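(* Let $m,m',n,n'\in\mathbb{Z}_{\ge 1}$ and let $\theta\in M_n(\mathbb{Q})$ and $\theta'\in M_{n'}(\mathbb{Q})$ be skew-symmetric. The following conditions are equivalent. (a) There is a $C^*$-algebra isomorphism $$C(\mathbb{T}^n_{\theta})\otimes M_m\;\cong\; C(\mathbb{T}^{n'}_{\theta'})\otimes M_{m'}.$$ (b) $n=n'$, $m=m'$ and $C(\mathbb{T}^n_{\theta})\cong C(\mathbb{T}^n_{\theta'})$ (as $C^*$-algebras). (c) $n=n'$, $m=m'$ and $$\theta'\in\left\{T\theta T^t\ :\ T\in GL(n,\mathbb{Z})\right\}+M_n(\mathbb{Z}).$$
   Context: $M_m=M_m(\mathbb{C})$. For a skew-symmetric real $n\times n$ matrix $\theta=(\theta_{jk})$, the non-commutative $n$-torus algebra $C(\mathbb{T}^n_{\theta})$ is the universal $C^*$-algebra generated by unitaries $u_1,\dots,u_n$ subject to the relations $u_ku_j=e^{2\pi i\theta_{jk}}u_ju_k$ for all $j,k$. $T^t$ denotes the transpose of $T$. *)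

theory Defs
  imports
    "HOL-Analysis.Analysis"
    "HOL-Library.Poly_Mapping"
    "HOL-Algebra.Module"
    "HOL-Algebra.QuotRing"
    "Jordan_Normal_Form.Schur_Decomposition"
begin

section \<open>Complex *-algebras\<close>

text \<open>Since the norm of a C*-algebra is determined by its *-algebra structure, the record
  carries no norm field.\<close>

record 'a star_algebra = "(complex, 'a) module" +
  star :: "'a \<Rightarrow> 'a"

text \<open>A bijective *-homomorphism between C*-algebras is automatically isometric, so this is
  the isomorphism relation for C*-algebras.\<close>

definition star_iso ::
    "('a, 'm) star_algebra_scheme \<Rightarrow> ('b, 'n) star_algebra_scheme \<Rightarrow> ('a \<Rightarrow> 'b) set" where
  "star_iso A B = {\<phi> \<in> ring_iso A B.
     (\<forall>c. \<forall>x\<in>carrier A. \<phi> (c \<odot>\<^bsub>A\<^esub> x) = c \<odot>\<^bsub>B\<^esub> \<phi> x) \<and>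
     (\<forall>x\<in>carrier A. \<phi> (star A x) = star B (\<phi> x))}"

definition cstar_isomorphic ::
    "('a, 'm) star_algebra_scheme \<Rightarrow> ('b, 'n) star_algebra_scheme \<Rightarrow> bool"
    (infix \<open>\<cong>\<^sub>*\<close> 50) where
  "A \<cong>\<^sub>* B \<longleftrightarrow> star_iso A B \<noteq> {}"

text \<open>The monoid *-algebra of a monoid \<open>M\<close> with an involutive anti-automorphism \<open>s\<close>: finitely
  supported functions on \<open>M\<close> with the convolution product, and with the conjugate-linear
  extension of \<open>s\<close> as involution.\<close>

definition monoid_star_algebra ::
    "('a, 'm) monoid_scheme \<Rightarrow> ('a \<Rightarrow> 'a) \<Rightarrow> ('a \<Rightarrow>\<^sub>0 complex) star_algebra" where
  "monoid_star_algebra M s =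
    \<lparr>carrier = {f. Poly_Mapping.keys f \<subseteq> carrier M},
     mult = (\<lambda>f g. \<Sum>a\<in>Poly_Mapping.keys f. \<Sum>b\<in>Poly_Mapping.keys g.
       Poly_Mapping.single (a \<otimes>\<^bsub>M\<^esub> b) (Poly_Mapping.lookup f a * Poly_Mapping.lookup g b)),
     one = Poly_Mapping.single \<one>\<^bsub>M\<^esub> 1,
     zero = 0,
     add = (+),
     smult = (\<lambda>c. Poly_Mapping.map ((*) c)),
     star = (\<lambda>f. \<Sum>a\<in>Poly_Mapping.keys f.
       Poly_Mapping.single (s a) (cnj (Poly_Mapping.lookup f a)))\<rparr>"

abbreviation basis_elem :: "'a \<Rightarrow> ('a \<Rightarrow>\<^sub>0 complex)" where
  "basis_elem a \<equiv> Poly_Mapping.single a 1"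


section \<open>Universal C*-algebras\<close>

definition cstar_seminorm :: "('a, 'm) star_algebra_scheme \<Rightarrow> ('a \<Rightarrow> real) \<Rightarrow> bool" where
  "cstar_seminorm S p \<longleftrightarrow>
     (\<forall>x\<in>carrier S. 0 \<le> p x) \<and>
     (\<forall>c. \<forall>x\<in>carrier S. p (c \<odot>\<^bsub>S\<^esub> x) = cmod c * p x) \<and>
     (\<forall>x\<in>carrier S. \<forall>y\<in>carrier S. p (x \<oplus>\<^bsub>S\<^esub> y) \<le> p x + p y) \<and>
     (\<forall>x\<in>carrier S. \<forall>y\<in>carrier S. p (x \<otimes>\<^bsub>S\<^esub> y) \<le> p x * p y) \<and>
     (\<forall>x\<in>carrier S. p (star S x \<otimes>\<^bsub>S\<^esub> x) = (p x)\<^sup>2)"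

text \<open>The largest C*-seminorm on \<open>S\<close> that vanishes on \<open>R\<close>.  It is meaningful only if these
  seminorms are pointwise bounded.\<close>

definition max_cstar_seminorm :: "('a, 'm) star_algebra_scheme \<Rightarrow> 'a set \<Rightarrow> 'a \<Rightarrow> real" where
  "max_cstar_seminorm S R x = Sup {p x |p. cstar_seminorm S p \<and> (\<forall>r\<in>R. p r = 0)}"

definition cauchy_seqs ::
    "('a, 'm) star_algebra_scheme \<Rightarrow> ('a \<Rightarrow> real) \<Rightarrow> (nat \<Rightarrow> 'a) set" where
  "cauchy_seqs S N = {x. range x \<subseteq> carrier S \<and>
     (\<forall>e>0. \<exists>k. \<forall>i\<ge>k. \<forall>j\<ge>k. N (x i \<ominus>\<^bsub>S\<^esub> x j) < e)}"

definition cauchy_rel ::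
    "('a, 'm) star_algebra_scheme \<Rightarrow> ('a \<Rightarrow> real) \<Rightarrow> (nat \<Rightarrow> 'a) rel" where
  "cauchy_rel S N = {(x, y). x \<in> cauchy_seqs S N \<and> y \<in> cauchy_seqs S N \<and>
     (\<lambda>i. N (x i \<ominus>\<^bsub>S\<^esub> y i)) \<longlonglongrightarrow> 0}"

text \<open>The Hausdorff completion of \<open>S\<close> with respect to the seminorm \<open>N\<close>, as Cauchy sequences
  modulo null sequences.\<close>

definition star_completion ::
    "('a, 'm) star_algebra_scheme \<Rightarrow> ('a \<Rightarrow> real) \<Rightarrow> (nat \<Rightarrow> 'a) set star_algebra" where
  "star_completion S N =
    \<lparr>carrier = cauchy_seqs S N // cauchy_rel S N,
     mult = (\<lambda>X Y. \<Union>x\<in>X. \<Union>y\<in>Y. cauchy_rel S N `` {\<lambda>i. x i \<otimes>\<^bsub>S\<^esub> y i}),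
     one = cauchy_rel S N `` {\<lambda>i. \<one>\<^bsub>S\<^esub>},
     zero = cauchy_rel S N `` {\<lambda>i. \<zero>\<^bsub>S\<^esub>},
     add = (\<lambda>X Y. \<Union>x\<in>X. \<Union>y\<in>Y. cauchy_rel S N `` {\<lambda>i. x i \<oplus>\<^bsub>S\<^esub> y i}),
     smult = (\<lambda>c X. \<Union>x\<in>X. cauchy_rel S N `` {\<lambda>i. c \<odot>\<^bsub>S\<^esub> x i}),
     star = (\<lambda>X. \<Union>x\<in>X. cauchy_rel S N `` {\<lambda>i. star S (x i)})\<rparr>"

text \<open>The free unital *-algebra on \<open>n\<close> generators, numbered \<open>0, \<dots>, n - 1\<close>.  The letter
  \<open>(j, False)\<close> stands for the \<open>j\<close>-th generator and \<open>(j, True)\<close> for its adjoint.\<close>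

definition free_star_algebra :: "nat \<Rightarrow> ((nat \<times> bool) list \<Rightarrow>\<^sub>0 complex) star_algebra" where
  "free_star_algebra n = monoid_star_algebra
     \<lparr>carrier = lists ({..<n} \<times> UNIV), mult = (@), one = []\<rparr>
     (\<lambda>w. rev (map (\<lambda>(j, b). (j, \<not> b)) w))"

abbreviation gen :: "nat \<Rightarrow> ((nat \<times> bool) list \<Rightarrow>\<^sub>0 complex)" where
  "gen j \<equiv> basis_elem [(j, False)]"

text \<open>The universal unital C*-algebra on generators \<open>0, \<dots>, n - 1\<close> and relations \<open>r = 0\<close> for
  \<open>r \<in> R\<close>.  The C*-seminorms killing \<open>R\<close> are exactly the pullbacks of the norm along the
  *-homomorphisms into C*-algebras that satisfy the relations.\<close>

definition universal_cstar_algebra ::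
    "nat \<Rightarrow> ((nat \<times> bool) list \<Rightarrow>\<^sub>0 complex) set \<Rightarrow>
     (nat \<Rightarrow> ((nat \<times> bool) list \<Rightarrow>\<^sub>0 complex)) set star_algebra" where
  "universal_cstar_algebra n R =
     star_completion (free_star_algebra n) (max_cstar_seminorm (free_star_algebra n) R)"


section \<open>Non-commutative tori\<close>

definition nc_torus_relations ::
    "nat \<Rightarrow> real mat \<Rightarrow> ((nat \<times> bool) list \<Rightarrow>\<^sub>0 complex) set" where
  "nc_torus_relations n \<theta> = (let F = free_star_algebra n in
     {star F (gen j) \<otimes>\<^bsub>F\<^esub> gen j \<ominus>\<^bsub>F\<^esub> \<one>\<^bsub>F\<^esub> |j. j < n} \<union>
     {gen j \<otimes>\<^bsub>F\<^esub> star F (gen j) \<ominus>\<^bsub>F\<^esub> \<one>\<^bsub>F\<^esub> |j. j < n} \<union>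
     {gen k \<otimes>\<^bsub>F\<^esub> gen j \<ominus>\<^bsub>F\<^esub>
        exp (2 * complex_of_real pi * \<i> * complex_of_real (\<theta> $$ (j, k))) \<odot>\<^bsub>F\<^esub> (gen j \<otimes>\<^bsub>F\<^esub> gen k)
      |j k. j < n \<and> k < n})"

definition nc_torus ::
    "nat \<Rightarrow> real mat \<Rightarrow> (nat \<Rightarrow> ((nat \<times> bool) list \<Rightarrow>\<^sub>0 complex)) set star_algebra" where
  "nc_torus n \<theta> = universal_cstar_algebra n (nc_torus_relations n \<theta>)"


section \<open>Tensor products\<close>

definition star_quotient ::
    "('a, 'm) star_algebra_scheme \<Rightarrow> 'a set \<Rightarrow> 'a set star_algebra" where
  "star_quotient S I =
    \<lparr>carrier = carrier (S Quot I),
     mult = mult (S Quot I),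
     one = \<one>\<^bsub>S Quot I\<^esub>,
     zero = \<zero>\<^bsub>S Quot I\<^esub>,
     add = add (S Quot I),
     smult = (\<lambda>c X. \<Union>x\<in>X. I +>\<^bsub>S\<^esub> (c \<odot>\<^bsub>S\<^esub> x)),
     star = (\<lambda>X. star S ` X)\<rparr>"

definition bilinear_relations ::
    "('a, 'm) star_algebra_scheme \<Rightarrow> ('b, 'n) star_algebra_scheme \<Rightarrow>
     ('a \<times> 'b \<Rightarrow>\<^sub>0 complex) set" where
  "bilinear_relations A B =
     {basis_elem (a \<oplus>\<^bsub>A\<^esub> a', b) - (basis_elem (a, b) + basis_elem (a', b)) |a a' b.
        a \<in> carrier A \<and> a' \<in> carrier A \<and> b \<in> carrier B} \<union>
     {basis_elem (a, b \<oplus>\<^bsub>B\<^esub> b') - (basis_elem (a, b) + basis_elem (a, b')) |a b b'.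
        a \<in> carrier A \<and> b \<in> carrier B \<and> b' \<in> carrier B} \<union>
     {basis_elem (c \<odot>\<^bsub>A\<^esub> a, b) - Poly_Mapping.single (a, b) c |a b c.
        a \<in> carrier A \<and> b \<in> carrier B} \<union>
     {basis_elem (a, c \<odot>\<^bsub>B\<^esub> b) - Poly_Mapping.single (a, b) c |a b c.
        a \<in> carrier A \<and> b \<in> carrier B}"

text \<open>The algebraic tensor product of unital *-algebras: the free vector space on
  \<open>carrier A \<times> carrier B\<close>, with componentwise product and
  involution on basis elements, modulo the bilinearity relations.  Their linear span is already a
  two-sided *-ideal, hence equal to the generated ideal.

  If \<open>A\<close> is a C*-algebra and \<open>B\<close> a finite-dimensional one, such as a full matrix algebra, the
  algebraic tensor product is complete in its unique C*-norm, so this is the C*-tensor product.\<close>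

definition star_tensor ::
    "('a, 'm) star_algebra_scheme \<Rightarrow> ('b, 'n) star_algebra_scheme \<Rightarrow>
     ('a \<times> 'b \<Rightarrow>\<^sub>0 complex) set star_algebra" (infixr \<open>\<otimes>\<^sub>*\<close> 70) where
  "A \<otimes>\<^sub>* B = (let F = monoid_star_algebra (A \<times>\<times> B) (map_prod (star A) (star B))
     in star_quotient F (Idl\<^bsub>F\<^esub> (bilinear_relations A B)))"

definition matrix_star_algebra :: "nat \<Rightarrow> complex mat star_algebra" where
  "matrix_star_algebra m =
    \<lparr>carrier = carrier_mat m m, mult = (*), one = 1\<^sub>m m, zero = 0\<^sub>m m m, add = (+),
     smult = (\<cdot>\<^sub>m), star = mat_adjoint\<rparr>"


section \<open>Integer matrices acting on rational skew-symmetric matrices\<close>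

definition GL_int :: "nat \<Rightarrow> int mat set" where
  "GL_int n = {T \<in> carrier_mat n n. invertible_mat T}"

definition skew_symmetric_mat :: "'a::ring mat \<Rightarrow> bool" where
  "skew_symmetric_mat M \<longleftrightarrow> transpose_mat M = - M"

abbreviation rat_mat_of_int :: "int mat \<Rightarrow> rat mat" where
  "rat_mat_of_int \<equiv> map_mat of_int"

abbreviation real_mat_of_rat :: "rat mat \<Rightarrow> real mat" where
  "real_mat_of_rat \<equiv> map_mat of_rat"

end

theory Submission
  imports Defs "Jordan_Normal_Form.Spectral_Radius"
begin

text \<open>Two of the implications are constructions.  If \<open>\<theta>' = T \<theta> T\<^sup>t + K\<close>, the monomials in the generators of the
  torus of \<open>\<theta>\<close> whose exponents are the rows of \<open>T\<close> satisfy the relations of \<open>\<theta>'\<close>, and the monomials of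
  \<open>T\<^sup>-\<^sup>1\<close> undo them up to phases (\<open>torus_iso_congruent\<close>); this gives (b) from (c).  An isomorphism of the
  tori extends to the tensor products (\<open>tensor_cong\<close>); this gives (a) from (b).

  For (c) from (a), the matrix \<open>\<theta>\<close> is recovered from the moduli space of the smallest representations of
  \<open>B = C(\<T>\<^sup>n\<^sub>\<theta>) \<otimes> M\<^sub>m\<close>.  As \<open>\<theta>\<close> is rational, \<open>B\<close> has representations on
  finite-dimensional spaces; let \<open>N\<close> be their least dimension.  Those of dimension \<open>N\<close> have scalar
  commutant (\<open>Schur\<close>).  A vector \<open>h \<in> \<real>\<^sup>n\<close> acts on them as a gauge transformation, which multiplies the generator
  \<open>u\<^sub>j\<close> by \<open>exp (2\<pi>i h\<^sub>j)\<close>.  The determinants of the \<open>\<pi>(u\<^sub>j)\<close> detect this action: over a convex compact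
  space, a continuous family of representations is unitarily equivalent to the gauge transforms of
  one of its members by the continuous logarithms of its determinants, divided by \<open>N\<close> (\<open>family_equivalence\<close>).
  A gauge transformation preserves the equivalence class of a representation if and only if \<open>h\<close>
  lies in the lattice \<open>\<Lambda> = \<theta> \<int>\<^sup>n + \<int>\<^sup>n\<close>, and then the equivalence is implemented by a monomial \<open>u\<^sup>z\<close> with
  \<open>h \<in> \<theta> z + \<int>\<^sup>n\<close> (\<open>gauge_inner\<close>, \<open>gauge_conjugate_Lat\<close>).  So the representations of dimension \<open>N\<close> form
  the torus \<open>\<real>\<^sup>n / \<Lambda>\<close>, and the monomials are the monodromy of a projective bundle over it.

  An isomorphism of \<open>B\<close> with the algebra \<open>B'\<close> of \<open>\<theta>'\<close>, \<open>m'\<close> identifies the two moduli spaces.  It lifts to a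
  map \<open>\<real>\<^sup>n' \<rightarrow> \<real>\<^sup>n\<close>: follow the segment from \<open>0\<close> to \<open>y\<close> by gauge transformations of \<open>B'\<close>, regard it as a family of
  representations of \<open>B\<close>, and take the end point of its lift (\<open>transport\<close>).  On \<open>\<Lambda>'\<close> this map is additive,
  takes values in \<open>\<Lambda>\<close>, and is inverted by the transport along the inverse isomorphism.  Both lattices
  span, so that \<open>n = n'\<close>.  Comparing the monodromies around a square shows that the transport
  preserves the commutators of monomials (\<open>pairing\<close>), that is, the \<open>\<real> / \<int>\<close>-valued bilinear form on the
  lattice which sends \<open>\<theta> z + w\<close> and \<open>y\<close> to \<open>\<langle>z, y\<rangle>\<close>.  Its radical is \<open>\<int>\<^sup>n\<close>; hence the matrix \<open>P\<close> of the transport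
  is in \<open>GL(n, \<int>)\<close>, and the invariance of the form says that \<open>\<theta> - P \<theta>' P\<^sup>t\<close> is integral (\<open>congruence\<close>).
  Finally, the tori are then isomorphic, so that their least representation dimensions agree.  As
  \<open>N\<close> is \<open>m\<close> times that of the torus (\<open>min_dim_product\<close>), also \<open>m = m'\<close>.

  The analytic input is confined to the universal property of the torus, for which completions and
  largest seminorms are constructed, and to the automatic contractivity of matrix representations
  (\<open>matrix_rep_contractive\<close>), by which they are determined by their values on generators.\<close>

abbreviation (input) "Mat \<equiv> matrix_star_algebra"

section \<open>Algebras with involution\<close>

locale star_alg = ring S for S :: "('a, 'm) star_algebra_scheme" (structure) +
  assumes smult_closed [simp, intro]: "x \<in> carrier S ==> c \<odot> x \<in> carrier S"
    and smult_l_distr: "x \<in> carrier S ==> (c + d) \<odot> x = c \<odot> x \<oplus> d \<odot> x"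
    and smult_r_distr: "x \<in> carrier S ==> y \<in> carrier S ==> c \<odot> (x \<oplus> y) = c \<odot> x \<oplus> c \<odot> y"
    and smult_smult: "x \<in> carrier S ==> c \<odot> (d \<odot> x) = (c * d) \<odot> x"
    and smult_one [simp]: "x \<in> carrier S ==> 1 \<odot> x = x"
    and smult_mult_l: "x \<in> carrier S ==> y \<in> carrier S ==> (c \<odot> x) \<otimes> y = c \<odot> (x \<otimes> y)"
    and smult_mult_r: "x \<in> carrier S ==> y \<in> carrier S ==> x \<otimes> (c \<odot> y) = c \<odot> (x \<otimes> y)"
    and star_closed [simp, intro]: "x \<in> carrier S ==> star S x \<in> carrier S"
    and star_star [simp]: "x \<in> carrier S ==> star S (star S x) = x"
    and star_add: "x \<in> carrier S ==> y \<in> carrier S ==> star S (x \<oplus> y) = star S x \<oplus> star S y"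
    and star_mult: "x \<in> carrier S ==> y \<in> carrier S ==> star S (x \<otimes> y) = star S y \<otimes> star S x"
    and star_smult: "x \<in> carrier S ==> star S (c \<odot> x) = cnj c \<odot> star S x"
begin

lemma smult_zero_left [simp]: assumes "x \<in> carrier S" shows "0 \<odot> x = \<zero>"
proof -
  have "0 \<odot> x \<oplus> 0 \<odot> x = 0 \<odot> x" using smult_l_distr[OF assms, of 0 0] by simp
  then show ?thesis using assms by (metis add.r_cancel_one' smult_closed)
qed

lemma smult_zero_right [simp]: "c \<odot> \<zero> = \<zero>"
proof -
  have "c \<odot> \<zero> \<oplus> c \<odot> \<zero> = c \<odot> \<zero>" using smult_r_distr[of \<zero> \<zero> c] by simp
  then show ?thesis by (metis add.r_cancel_one' smult_closed zero_closed)
qed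

lemma smult_minus_one: assumes "x \<in> carrier S" shows "(-1) \<odot> x = \<ominus> x"
proof -
  have "(-1) \<odot> x \<oplus> x = \<zero>" using smult_l_distr[OF assms, of "-1" 1] assms by simp
  then show ?thesis using assms by (simp add: minus_equality)
qed

lemma minus_as_smult: "x \<in> carrier S ==> y \<in> carrier S ==> x \<ominus> y = x \<oplus> (-1) \<odot> y"
  by (simp add: minus_eq smult_minus_one)

lemma star_one [simp]: "star S \<one> = \<one>"
  using star_mult[of "star S \<one>" \<one>] by simp

lemma star_zero [simp]: "star S \<zero> = \<zero>"
  using star_smult[of \<zero> 0] by (simp del: smult_zero_right)

lemma star_minus: "x \<in> carrier S ==> y \<in> carrier S ==> star S (x \<ominus> y) = star S x \<ominus> star S y"
  by (simp add: minus_as_smult star_add star_smult)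

lemma smult_minus_distr: "x \<in> carrier S ==> y \<in> carrier S ==> c \<odot> (x \<ominus> y) = c \<odot> x \<ominus> c \<odot> y"
  by (simp add: minus_as_smult smult_r_distr smult_smult)

lemma minus_cancel_mid: "x \<in> carrier S ==> y \<in> carrier S ==> z \<in> carrier S ==> (x \<ominus> y) \<oplus> (y \<ominus> z) = x \<ominus> z"
  by algebra

lemma minus_self [simp]: "x \<in> carrier S ==> x \<ominus> x = \<zero>"
  by (simp add: minus_eq r_neg)

lemma eq_if_minus_zero: "x \<in> carrier S ==> y \<in> carrier S ==> x \<ominus> y = \<zero> ==> x = y"
  by (metis add.inv_closed add.inv_equality add.inv_inv minus_eq)

end

definition star_hom ::
    "('a, 'm) star_algebra_scheme => ('b, 'n) star_algebra_scheme => ('a => 'b) set" where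
  "star_hom A B = {\<phi> \<in> Ring.ring_hom A B.
     (\<forall>c. \<forall>x\<in>carrier A. \<phi> (c \<odot>\<^bsub>A\<^esub> x) = c \<odot>\<^bsub>B\<^esub> \<phi> x) \<and>
     (\<forall>x\<in>carrier A. \<phi> (star A x) = star B (\<phi> x))}"

lemma star_homI:
  assumes "\<And>x. x \<in> carrier A ==> \<phi> x \<in> carrier B"
    and "\<And>x y. x \<in> carrier A ==> y \<in> carrier A ==> \<phi> (x \<otimes>\<^bsub>A\<^esub> y) = \<phi> x \<otimes>\<^bsub>B\<^esub> \<phi> y"
    and "\<And>x y. x \<in> carrier A ==> y \<in> carrier A ==> \<phi> (x \<oplus>\<^bsub>A\<^esub> y) = \<phi> x \<oplus>\<^bsub>B\<^esub> \<phi> y"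
    and "\<phi> \<one>\<^bsub>A\<^esub> = \<one>\<^bsub>B\<^esub>"
    and "\<And>c x. x \<in> carrier A ==> \<phi> (c \<odot>\<^bsub>A\<^esub> x) = c \<odot>\<^bsub>B\<^esub> \<phi> x"
    and "\<And>x. x \<in> carrier A ==> \<phi> (star A x) = star B (\<phi> x)"
  shows "\<phi> \<in> star_hom A B"
  using assms by (auto simp: star_hom_def intro!: ring_hom_memI)

lemma star_homD:
  assumes "\<phi> \<in> star_hom A B"
  shows "x \<in> carrier A ==> \<phi> x \<in> carrier B"
    and "x \<in> carrier A ==> y \<in> carrier A ==> \<phi> (x \<otimes>\<^bsub>A\<^esub> y) = \<phi> x \<otimes>\<^bsub>B\<^esub> \<phi> y"
    and "x \<in> carrier A ==> y \<in> carrier A ==> \<phi> (x \<oplus>\<^bsub>A\<^esub> y) = \<phi> x \<oplus>\<^bsub>B\<^esub> \<phi> y"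
    and "\<phi> \<one>\<^bsub>A\<^esub> = \<one>\<^bsub>B\<^esub>"
    and "x \<in> carrier A ==> \<phi> (c \<odot>\<^bsub>A\<^esub> x) = c \<odot>\<^bsub>B\<^esub> \<phi> x"
    and "x \<in> carrier A ==> \<phi> (star A x) = star B (\<phi> x)"
  using assms by (auto simp: star_hom_def Ring.ring_hom_def)

lemma star_hom_comp:
  assumes "\<phi> \<in> star_hom A B" "\<psi> \<in> star_hom B C" shows "(\<lambda>x. \<psi> (\<phi> x)) \<in> star_hom A C"
  by (rule star_homI) (simp_all add: star_homD[OF assms(1)] star_homD[OF assms(2)])

lemma star_hom_id: "(\<lambda>x. x) \<in> star_hom A A"
  by (rule star_homI) simp_all

lemma star_iso_iff: "\<phi> \<in> star_iso A B \<longleftrightarrow> \<phi> \<in> star_hom A B \<and> bij_betw \<phi> (carrier A) (carrier B)"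
  by (auto simp: star_iso_def star_hom_def ring_iso_def)

lemma star_hom_minus:
  assumes "star_alg A" "star_alg B" "\<phi> \<in> star_hom A B" "x \<in> carrier A" "y \<in> carrier A"
  shows "\<phi> (x \<ominus>\<^bsub>A\<^esub> y) = \<phi> x \<ominus>\<^bsub>B\<^esub> \<phi> y"
proof -
  interpret A: star_alg A by fact
  interpret B: star_alg B by fact
  show ?thesis using assms(4,5) by (simp add: A.minus_as_smult B.minus_as_smult star_homD[OF assms(3)])
qed

lemma star_hom_zero:
  assumes "star_alg A" "star_alg B" "\<phi> \<in> star_hom A B" shows "\<phi> \<zero>\<^bsub>A\<^esub> = \<zero>\<^bsub>B\<^esub>"
proof -
  interpret A: star_alg A by fact
  interpret B: star_alg B by fact
  show ?thesis using star_homD(5)[OF assms(3), of "\<zero>\<^bsub>A\<^esub>" 0] star_homD(1)[OF assms(3), of "\<zero>\<^bsub>A\<^esub>"] by simp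
qed

lemma cstar_isomorphicI:
  assumes "\<phi> \<in> star_hom A B" "\<psi> \<in> star_hom B A" "\<xi> \<in> star_hom B A"
    and "\<And>x. x \<in> carrier A ==> \<psi> (\<phi> x) = x" "\<And>y. y \<in> carrier B ==> \<phi> (\<xi> y) = y"
  shows "A \<cong>\<^sub>* B"
proof -
  have "inj_on \<phi> (carrier A)" by (metis assms(4) inj_onI)
  moreover have "\<phi> ` carrier A = carrier B"
    using star_homD(1)[OF assms(1)] star_homD(1)[OF assms(3)] assms(5) by (auto intro!: image_eqI)
  ultimately have "\<phi> \<in> star_iso A B" using assms(1) by (simp add: star_iso_iff bij_betw_def)
  then show ?thesis by (auto simp: cstar_isomorphic_def)
qed

lemma star_iso_inverse:
  assumes "star_alg A" "\<phi> \<in> star_iso A B"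
  obtains \<psi> where "\<psi> \<in> star_iso B A" "\<And>x. x \<in> carrier A ==> \<psi> (\<phi> x) = x" "\<And>y. y \<in> carrier B ==> \<phi> (\<psi> y) = y"
proof -
  interpret A: star_alg A by fact
  define \<psi> where "\<psi> = inv_into (carrier A) \<phi>"
  have h: "\<phi> \<in> star_hom A B" and b: "bij_betw \<phi> (carrier A) (carrier B)" using assms by (auto simp: star_iso_iff)
  have l: "\<psi> (\<phi> x) = x" if "x \<in> carrier A" for x using b that by (auto simp: \<psi>_def bij_betw_def)
  have r: "\<phi> (\<psi> y) = y" if "y \<in> carrier B" for y using b that by (auto simp: \<psi>_def bij_betw_def f_inv_into_f)
  have bi: "bij_betw \<psi> (carrier B) (carrier A)" unfolding \<psi>_def by (rule bij_betw_inv_into[OF b])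
  have cl: "\<psi> y \<in> carrier A" if "y \<in> carrier B" for y using bi that by (auto simp: bij_betw_def)
  have "\<psi> \<in> star_hom B A"
  proof (rule star_homI)
    fix x y assume *: "x \<in> carrier B" "y \<in> carrier B"
    show "\<psi> (x \<otimes>\<^bsub>B\<^esub> y) = \<psi> x \<otimes>\<^bsub>A\<^esub> \<psi> y"
      using l[of "\<psi> x \<otimes>\<^bsub>A\<^esub> \<psi> y"] * by (simp add: cl star_homD[OF h] r)
    show "\<psi> (x \<oplus>\<^bsub>B\<^esub> y) = \<psi> x \<oplus>\<^bsub>A\<^esub> \<psi> y"
      using l[of "\<psi> x \<oplus>\<^bsub>A\<^esub> \<psi> y"] * by (simp add: cl star_homD[OF h] r)
  next
    show "\<psi> \<one>\<^bsub>B\<^esub> = \<one>\<^bsub>A\<^esub>" using l[of "\<one>\<^bsub>A\<^esub>"] star_homD(4)[OF h] by simp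
  next
    fix c x assume *: "x \<in> carrier B"
    show "\<psi> (c \<odot>\<^bsub>B\<^esub> x) = c \<odot>\<^bsub>A\<^esub> \<psi> x"
      using l[of "c \<odot>\<^bsub>A\<^esub> \<psi> x"] * by (simp add: cl star_homD[OF h] r)
  next
    fix x assume *: "x \<in> carrier B"
    show "\<psi> (star B x) = star A (\<psi> x)"
      using l[of "star A (\<psi> x)"] * by (simp add: cl star_homD[OF h] r)
  qed (use cl in auto)
  then show ?thesis using that l r bi by (auto simp: star_iso_iff)
qed

abbreviation keys :: "('a \<Rightarrow>\<^sub>0 complex) => 'a set" where "keys \<equiv> Poly_Mapping.keys"

abbreviation lookup :: "('a \<Rightarrow>\<^sub>0 complex) => 'a => complex" where "lookup \<equiv> Poly_Mapping.lookup"

abbreviation single :: "'a => complex => ('a \<Rightarrow>\<^sub>0 complex)" where "single \<equiv> Poly_Mapping.single"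

abbreviation scale :: "complex => ('a \<Rightarrow>\<^sub>0 complex) => ('a \<Rightarrow>\<^sub>0 complex)" where "scale c \<equiv> Poly_Mapping.map ((*) c)"

section \<open>Monoid algebras and their universal property\<close>

locale star_monoid = monoid M for M :: "('a, 'm) monoid_scheme" (structure) +
  fixes s :: "'a => 'a"
  assumes s_closed [simp]: "x \<in> carrier M ==> s x \<in> carrier M"
    and s_s [simp]: "x \<in> carrier M ==> s (s x) = x"
    and s_mult: "x \<in> carrier M ==> y \<in> carrier M ==> s (x \<otimes> y) = s y \<otimes> s x"

lemma poly_mapping_keys_induct [consumes 1, case_names zero single add]:
  assumes "keys (f :: 'a \<Rightarrow>\<^sub>0 complex) \<subseteq> C" and "P 0"
    and sg: "\<And>a c. a \<in> C ==> P (single a c)"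
    and ad: "\<And>f g. keys f \<subseteq> C ==> keys g \<subseteq> C ==> P f ==> P g ==> P (f + g)"
  shows "P f"
proof -
  have "P (\<Sum>a\<in>A. single a (lookup f a)) \<and>
      keys (\<Sum>a\<in>A. single a (lookup f a)) \<subseteq> C" if "finite A" "A \<subseteq> keys f" for A
    using that
  proof (induction rule: finite_induct)
    case empty then show ?case using assms(2) by simp
  next
    case (insert a A)
    let ?S = "\<Sum>a\<in>A. single a (lookup f a)"
    have a: "a \<in> C" and S: "P ?S" "keys ?S \<subseteq> C" using insert assms(1) by auto
    have k: "keys (single a (lookup f a)) \<subseteq> C" using a by simp
    have "P (single a (lookup f a) + ?S)" using ad[OF k S(2) sg[OF a] S(1)] .
    moreover have "keys (single a (lookup f a) + ?S) \<subseteq> C"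
      using k S(2) Poly_Mapping.keys_add[of "single a (lookup f a)" ?S] by blast
    ultimately show ?case using insert by simp
  qed
  from this[of "keys f"] have "P (\<Sum>a\<in>keys f. single a (lookup f a))" by simp
  moreover have "(\<Sum>a\<in>keys f. single a (lookup f a)) = f"
    by (rule poly_mapping_eqI) (simp add: lookup_sum lookup_single when_def in_keys_iff)
  ultimately show ?thesis by simp
qed

lemma lookup_map_times: "lookup (scale c f) a = c * lookup f a"
  by (simp add: Poly_Mapping.map.rep_eq when_def)

lemma map_times_single: "scale c (single a d) = single a (c * d)"
  by (rule poly_mapping_eqI) (simp add: lookup_map_times lookup_single when_def)

lemma map_times_add: "scale c (f + g) = scale c f + scale c g"
  by (rule poly_mapping_eqI) (simp add: lookup_map_times lookup_add algebra_simps)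

lemma map_times_zero: "scale c 0 = 0"
  by (rule poly_mapping_eqI) (simp add: lookup_map_times)

lemma keys_map_times: "keys (scale c f) \<subseteq> keys f"
  by (auto simp: in_keys_iff lookup_map_times)

context star_monoid
begin

abbreviation "MA \<equiv> monoid_star_algebra M s"

lemma MA_simps:
  "carrier MA = {f. keys f \<subseteq> carrier M}" "\<one>\<^bsub>MA\<^esub> = basis_elem \<one>" "\<zero>\<^bsub>MA\<^esub> = 0"
  "f \<oplus>\<^bsub>MA\<^esub> g = f + g" "c \<odot>\<^bsub>MA\<^esub> f = scale c f"
  by (simp_all add: monoid_star_algebra_def)

lemma MA_mult_expand:
  assumes "finite A" "keys f \<subseteq> A" "finite B" "keys g \<subseteq> B"
  shows "f \<otimes>\<^bsub>MA\<^esub> g = (\<Sum>a\<in>A. \<Sum>b\<in>B. single (a \<otimes> b) (lookup f a * lookup g b))"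
proof -
  have "f \<otimes>\<^bsub>MA\<^esub> g = (\<Sum>a\<in>keys f. \<Sum>b\<in>keys g. single (a \<otimes> b) (lookup f a * lookup g b))"
    by (simp add: monoid_star_algebra_def)
  also have "\<dots> = (\<Sum>a\<in>keys f. \<Sum>b\<in>B. single (a \<otimes> b) (lookup f a * lookup g b))"
    by (intro sum.cong refl sum.mono_neutral_left) (use assms in "auto simp: in_keys_iff")
  also have "\<dots> = (\<Sum>a\<in>A. \<Sum>b\<in>B. single (a \<otimes> b) (lookup f a * lookup g b))"
    by (intro sum.mono_neutral_left) (use assms in "auto simp: in_keys_iff")
  finally show ?thesis .
qed

lemma MA_star_expand:
  assumes "finite A" "keys f \<subseteq> A"
  shows "star MA f = (\<Sum>a\<in>A. single (s a) (cnj (lookup f a)))"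
proof -
  have "star MA f = (\<Sum>a\<in>keys f. single (s a) (cnj (lookup f a)))"
    by (simp add: monoid_star_algebra_def)
  also have "\<dots> = (\<Sum>a\<in>A. single (s a) (cnj (lookup f a)))"
    by (intro sum.mono_neutral_left) (use assms in "auto simp: in_keys_iff")
  finally show ?thesis .
qed

lemma MA_mult_single:
  "single a c \<otimes>\<^bsub>MA\<^esub> single b d = single (a \<otimes> b) (c * d)"
  by (subst MA_mult_expand[of "{a}" _ "{b}"]) auto

lemma MA_mult_add_left: "(f + f') \<otimes>\<^bsub>MA\<^esub> g = f \<otimes>\<^bsub>MA\<^esub> g + f' \<otimes>\<^bsub>MA\<^esub> g"
proof -
  let ?A = "keys f \<union> keys f'"
  have e: "h \<otimes>\<^bsub>MA\<^esub> g = (\<Sum>a\<in>?A. \<Sum>b\<in>keys g. single (a \<otimes> b) (lookup h a * lookup g b))"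
    if "keys h \<subseteq> ?A" for h by (rule MA_mult_expand) (use that in auto)
  show ?thesis using Poly_Mapping.keys_add[of f f']
    by (simp add: e lookup_add single_add algebra_simps sum.distrib)
qed

lemma MA_mult_add_right: "g \<otimes>\<^bsub>MA\<^esub> (f + f') = g \<otimes>\<^bsub>MA\<^esub> f + g \<otimes>\<^bsub>MA\<^esub> f'"
proof -
  let ?A = "keys f \<union> keys f'"
  have e: "g \<otimes>\<^bsub>MA\<^esub> h = (\<Sum>b\<in>keys g. \<Sum>a\<in>?A. single (b \<otimes> a) (lookup g b * lookup h a))"
    if "keys h \<subseteq> ?A" for h by (rule MA_mult_expand) (use that in auto)
  show ?thesis using Poly_Mapping.keys_add[of f f']
    by (simp add: e lookup_add single_add algebra_simps sum.distrib)
qed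

lemma MA_star_add: "star MA (f + g) = star MA f + star MA g"
proof -
  let ?A = "keys f \<union> keys g"
  have e: "star MA h = (\<Sum>a\<in>?A. single (s a) (cnj (lookup h a)))"
    if "keys h \<subseteq> ?A" for h by (rule MA_star_expand) (use that in auto)
  show ?thesis using Poly_Mapping.keys_add[of f g]
    by (simp add: e lookup_add single_add sum.distrib)
qed

lemma MA_star_single: "star MA (single a c) = single (s a) (cnj c)"
  by (subst MA_star_expand[of "{a}"]) auto

lemma MA_mult_zero: "0 \<otimes>\<^bsub>MA\<^esub> f = 0" "f \<otimes>\<^bsub>MA\<^esub> 0 = 0" "star MA 0 = 0"
  by (simp_all add: monoid_star_algebra_def)

lemma MA_keys:
  assumes "keys f \<subseteq> carrier M" "keys g \<subseteq> carrier M"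
  shows "keys (f + g) \<subseteq> carrier M" "keys (f \<otimes>\<^bsub>MA\<^esub> g) \<subseteq> carrier M" "keys (star MA f) \<subseteq> carrier M"
    "keys (scale c f) \<subseteq> carrier M"
proof -
  have ka: "keys (f + g) \<subseteq> carrier M" if "keys f \<subseteq> carrier M" "keys g \<subseteq> carrier M"
    for f g :: "'a \<Rightarrow>\<^sub>0 complex"
    using that Poly_Mapping.keys_add[of f g] by blast
  show "keys (f + g) \<subseteq> carrier M" using ka assms by blast
  show "keys (f \<otimes>\<^bsub>MA\<^esub> g) \<subseteq> carrier M" using assms(1)
  proof (induction rule: poly_mapping_keys_induct)
    case (single a c)
    show ?case using assms(2)
      by (induction rule: poly_mapping_keys_induct) (use single in "simp_all add: MA_mult_zero MA_mult_single MA_mult_add_right ka")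
  qed (simp_all add: MA_mult_zero MA_mult_add_left ka)
  show "keys (star MA f) \<subseteq> carrier M" using assms(1)
  proof (induction rule: poly_mapping_keys_induct)
    case (add g h)
    show ?case unfolding MA_star_add by (rule ka) (use add in auto)
  qed (auto simp: MA_mult_zero MA_star_single)
  show "keys (scale c f) \<subseteq> carrier M" by (rule subset_trans[OF keys_map_times assms(1)])
qed

lemma MA_smult_mult:
  assumes "keys f \<subseteq> carrier M" "keys g \<subseteq> carrier M"
  shows "scale c f \<otimes>\<^bsub>MA\<^esub> g = scale c (f \<otimes>\<^bsub>MA\<^esub> g)"
    and "f \<otimes>\<^bsub>MA\<^esub> scale c g = scale c (f \<otimes>\<^bsub>MA\<^esub> g)"
proof -
  show "scale c f \<otimes>\<^bsub>MA\<^esub> g = scale c (f \<otimes>\<^bsub>MA\<^esub> g)" using assms(1)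
  proof (induction rule: poly_mapping_keys_induct)
    case (single a d)
    show ?case using assms(2) by (induction rule: poly_mapping_keys_induct)
      (simp_all add: MA_mult_zero map_times_zero map_times_single map_times_add MA_mult_single MA_mult_add_right mult.assoc)
  qed (simp_all add: MA_mult_zero map_times_zero map_times_add MA_mult_add_left)
  show "f \<otimes>\<^bsub>MA\<^esub> scale c g = scale c (f \<otimes>\<^bsub>MA\<^esub> g)" using assms(1)
  proof (induction rule: poly_mapping_keys_induct)
    case (single a d)
    show ?case using assms(2) by (induction rule: poly_mapping_keys_induct)
      (simp_all add: MA_mult_zero map_times_zero map_times_single map_times_add MA_mult_single MA_mult_add_right mult.left_commute)
  qed (simp_all add: MA_mult_zero map_times_zero map_times_add MA_mult_add_left)
qed

lemma MA_assoc:
  assumes "keys f \<subseteq> carrier M" "keys g \<subseteq> carrier M" "keys h \<subseteq> carrier M"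
  shows "(f \<otimes>\<^bsub>MA\<^esub> g) \<otimes>\<^bsub>MA\<^esub> h = f \<otimes>\<^bsub>MA\<^esub> (g \<otimes>\<^bsub>MA\<^esub> h)"
  using assms(1)
proof (induction rule: poly_mapping_keys_induct)
  case (single a c)
  show ?case using assms(2)
  proof (induction rule: poly_mapping_keys_induct)
    case b: (single b d)
    show ?case using assms(3) by (induction rule: poly_mapping_keys_induct)
      (use single b in "simp_all add: MA_mult_zero MA_mult_single MA_mult_add_right m_assoc mult.assoc")
  qed (simp_all add: MA_mult_zero MA_mult_add_left MA_mult_add_right)
qed (simp_all add: MA_mult_zero MA_mult_add_left)

lemma MA_star_mult:
  assumes "keys f \<subseteq> carrier M" "keys g \<subseteq> carrier M"
  shows "star MA (f \<otimes>\<^bsub>MA\<^esub> g) = star MA g \<otimes>\<^bsub>MA\<^esub> star MA f"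
  using assms(1)
proof (induction rule: poly_mapping_keys_induct)
  case (single a c)
  show ?case using assms(2) by (induction rule: poly_mapping_keys_induct)
    (use single in "simp_all add: MA_mult_zero MA_mult_single MA_mult_add_right MA_mult_add_left MA_star_add MA_star_single s_mult mult.commute")
qed (simp_all add: MA_mult_zero MA_mult_add_left MA_mult_add_right MA_star_add)

lemma star_alg_MA: "star_alg MA"
proof -
  have ag: "abelian_group MA"
  proof (rule abelian_groupI)
    fix f assume "f \<in> carrier MA"
    then show "\<exists>g\<in>carrier MA. g \<oplus>\<^bsub>MA\<^esub> f = \<zero>\<^bsub>MA\<^esub>"
      by (intro bexI[of _ "-f"]) (auto simp: MA_simps)
  qed (auto simp: MA_simps add_ac MA_keys)
  have one: "basis_elem \<one> \<otimes>\<^bsub>MA\<^esub> f = f" "f \<otimes>\<^bsub>MA\<^esub> basis_elem \<one> = f" if "keys f \<subseteq> carrier M" for f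
    using that by (induction rule: poly_mapping_keys_induct; simp add: MA_mult_zero MA_mult_single MA_mult_add_right MA_mult_add_left)+
  have mo: "monoid MA"
    by (rule monoidI) (auto simp: MA_simps MA_keys MA_assoc one)
  have r: "ring MA"
    by (rule ringI[OF ag mo]) (auto simp: MA_simps MA_mult_add_left MA_mult_add_right)
  have ss: "star MA (star MA f) = f" if "keys f \<subseteq> carrier M" for f
    using that by (induction rule: poly_mapping_keys_induct) (simp_all add: MA_mult_zero MA_star_single MA_star_add)
  have sm: "star MA (scale c f) = scale (cnj c) (star MA f)" if "keys f \<subseteq> carrier M" for f c
    using that by (induction rule: poly_mapping_keys_induct)
      (simp_all add: MA_mult_zero MA_star_single MA_star_add map_times_zero map_times_add map_times_single)
  interpret ring MA by fact
  show ?thesis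
    by unfold_locales (auto simp: MA_simps MA_keys MA_smult_mult MA_star_mult MA_star_add ss sm map_times_add
        intro!: poly_mapping_eqI simp: lookup_map_times lookup_add algebra_simps)
qed

end

text \<open>The linear extension of a map on a basis, which gives the monoid *-algebra its universal property.\<close>

definition (in star_alg) lin :: "('b => 'a) => ('b \<Rightarrow>\<^sub>0 complex) => 'a" where
  "lin f x = finsum S (\<lambda>a. lookup x a \<odot> f a) (keys x)"

context star_alg
begin

lemma lin_expand:
  assumes "finite A" "keys x \<subseteq> A" "f \<in> A \<rightarrow> carrier S"
  shows "lin f x = finsum S (\<lambda>a. lookup x a \<odot> f a) A"
  unfolding lin_def
  by (rule add.finprod_mono_neutral_cong_left) (use assms in "auto simp: in_keys_iff Pi_iff")

lemma lin_add:
  assumes "keys x \<subseteq> C" "keys y \<subseteq> C" "f \<in> C \<rightarrow> carrier S"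
  shows "lin f (x + y) = lin f x \<oplus> lin f y"
proof -
  let ?A = "keys x \<union> keys y"
  have f: "f \<in> ?A \<rightarrow> carrier S" using assms by auto
  have e: "lin f z = finsum S (\<lambda>a. lookup z a \<odot> f a) ?A" if "keys z \<subseteq> ?A" for z
    by (rule lin_expand) (use f that in auto)
  have "lin f (x + y) = finsum S (\<lambda>a. lookup x a \<odot> f a \<oplus> lookup y a \<odot> f a) ?A"
    unfolding e[OF Poly_Mapping.keys_add]
    by (rule finsum_cong') (use f in "auto simp: lookup_add smult_l_distr Pi_iff")
  also have "\<dots> = lin f x \<oplus> lin f y"
    using f by (subst finsum_addf) (auto simp: e Pi_iff)
  finally show ?thesis .
qed

lemma lin_single: assumes "f a \<in> carrier S" shows "lin f (single a c) = c \<odot> f a"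
  using assms by (subst lin_expand[of "{a}"]) auto

lemma lin_zero: "lin f 0 = \<zero>" by (simp add: lin_def)

lemma lin_closed: "keys x \<subseteq> C ==> f \<in> C \<rightarrow> carrier S ==> lin f x \<in> carrier S"
  unfolding lin_def by (rule finsum_closed) auto

lemma lin_star_hom:
  fixes M :: "('b, 'k) monoid_scheme"
  assumes "star_monoid M s" and f: "f \<in> carrier M \<rightarrow> carrier S" and f1: "f \<one>\<^bsub>M\<^esub> = \<one>"
    and fm: "\<And>x y. x \<in> carrier M ==> y \<in> carrier M ==> f (x \<otimes>\<^bsub>M\<^esub> y) = f x \<otimes> f y"
    and fs: "\<And>x. x \<in> carrier M ==> f (s x) = star S (f x)"
  shows "lin f \<in> star_hom (monoid_star_algebra M s) S"
    and "a \<in> carrier M ==> lin f (basis_elem a) = f a"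
proof -
  interpret M: star_monoid M s by fact
  have cl: "lin f x \<in> carrier S" if "keys x \<subseteq> carrier M" for x using lin_closed[OF that f] .
  have fc: "f a \<in> carrier S" if "a \<in> carrier M" for a using f that by auto
  have ad: "lin f (x + y) = lin f x \<oplus> lin f y" if "keys x \<subseteq> carrier M" "keys y \<subseteq> carrier M" for x y
    using lin_add[OF that f] .
  have mu: "lin f (x \<otimes>\<^bsub>M.MA\<^esub> y) = lin f x \<otimes> lin f y" if x: "keys x \<subseteq> carrier M" and y: "keys y \<subseteq> carrier M" for x y
    using x
  proof (induction rule: poly_mapping_keys_induct)
    case zero then show ?case using y by (simp add: M.MA_mult_zero lin_zero cl)
  next
    case (single a c)
    show ?case using y
    proof (induction rule: poly_mapping_keys_induct)
      case (single b d)
      then show ?case using \<open>a \<in> carrier M\<close>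
        by (simp add: M.MA_mult_single lin_single fc fm smult_mult_l smult_mult_r smult_smult mult.commute)
    next
      case (add g h)
      then show ?case using single
        by (simp add: M.MA_mult_add_right ad M.MA_keys r_distr cl)
    qed (use single in "simp add: M.MA_mult_zero lin_zero lin_single fc")
  next
    case (add g h)
    then show ?case using y by (simp add: M.MA_mult_add_left ad M.MA_keys l_distr cl)
  qed
  show "lin f \<in> star_hom M.MA S"
  proof (rule star_homI)
    fix c x assume "x \<in> carrier M.MA" then have x: "keys x \<subseteq> carrier M" by (simp add: M.MA_simps)
    show "lin f (c \<odot>\<^bsub>M.MA\<^esub> x) = c \<odot> lin f x" unfolding M.MA_simps using x
      by (induction rule: poly_mapping_keys_induct)
       (simp_all add: lin_zero map_times_zero map_times_single lin_single fc smult_smult map_times_add ad M.MA_keys smult_r_distr cl)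
    show "lin f (star M.MA x) = star S (lin f x)" using x
      by (induction rule: poly_mapping_keys_induct)
       (simp_all add: lin_zero M.MA_mult_zero M.MA_star_single lin_single fc fs star_smult M.MA_star_add ad M.MA_keys star_add cl)
  qed (auto simp: M.MA_simps cl mu ad lin_single f1)
  show "a \<in> carrier M ==> lin f (basis_elem a) = f a" by (simp add: lin_single fc)
qed

end

section \<open>C*-norms and completion\<close>

locale cstar_pre = star_alg S for S :: "('a, 'm) star_algebra_scheme" (structure) +
  fixes p :: "'a => real"
  assumes seminorm: "cstar_seminorm S p"
begin

lemma p_nonneg [simp]: "x \<in> carrier S ==> 0 \<le> p x"
  and p_smult: "x \<in> carrier S ==> p (c \<odot> x) = cmod c * p x"
  and p_add: "x \<in> carrier S ==> y \<in> carrier S ==> p (x \<oplus> y) \<le> p x + p y"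
  and p_mult: "x \<in> carrier S ==> y \<in> carrier S ==> p (x \<otimes> y) \<le> p x * p y"
  and p_cstar: "x \<in> carrier S ==> p (star S x \<otimes> x) = (p x)\<^sup>2"
  using seminorm by (auto simp: cstar_seminorm_def)

lemma p_zero [simp]: "p \<zero> = 0"
  using p_smult[of \<zero> 0] by simp

lemma p_uminus: "x \<in> carrier S ==> p (\<ominus> x) = p x"
  using p_smult[of x "-1"] by (simp add: smult_minus_one)

lemma p_minus_commute: "x \<in> carrier S ==> y \<in> carrier S ==> p (x \<ominus> y) = p (y \<ominus> x)"
proof -
  assume *: "x \<in> carrier S" "y \<in> carrier S"
  then have "\<ominus> (x \<ominus> y) = y \<ominus> x" by algebra
  then show ?thesis using p_uminus[of "x \<ominus> y"] * by simp
qed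

lemma p_triangle: "x \<in> carrier S ==> y \<in> carrier S ==> z \<in> carrier S ==> p (x \<ominus> z) \<le> p (x \<ominus> y) + p (y \<ominus> z)"
  using p_add[of "x \<ominus> y" "y \<ominus> z"] minus_cancel_mid[of x y z] by simp

lemma p_le_minus: "x \<in> carrier S ==> y \<in> carrier S ==> p x \<le> p (x \<ominus> y) + p y"
proof -
  assume *: "x \<in> carrier S" "y \<in> carrier S"
  then have "(x \<ominus> y) \<oplus> y = x" by algebra
  then show ?thesis using p_add[of "x \<ominus> y" y] * by simp
qed

lemma p_abs_diff: "x \<in> carrier S ==> y \<in> carrier S ==> \<bar>p x - p y\<bar> \<le> p (x \<ominus> y)"
  using p_le_minus[of x y] p_le_minus[of y x] p_minus_commute[of x y] by linarith

lemma p_star [simp]: "x \<in> carrier S ==> p (star S x) = p x"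
proof -
  have le: "p x \<le> p (star S x)" if "x \<in> carrier S" for x
  proof (cases "p x = 0")
    case False
    then have "p x > 0" using p_nonneg[OF that] by linarith
    moreover have "p x * p x \<le> p (star S x) * p x"
      using p_mult[of "star S x" x] p_cstar[OF that] that by (simp add: power2_eq_square)
    ultimately show ?thesis by simp
  qed (use that in simp)
  assume "x \<in> carrier S" then show ?thesis using le[of x] le[of "star S x"] by simp
qed

lemma p_one_le: "p \<one> \<le> 1"
proof -
  have "p \<one> * p \<one> = p \<one>" using p_cstar[of \<one>] by (simp add: power2_eq_square)
  then show ?thesis by (metis mult_cancel_right1 order_refl zero_le_one)
qed

lemma p_mult_diff:
  assumes "x \<in> carrier S" "y \<in> carrier S" "x' \<in> carrier S" "y' \<in> carrier S"
  shows "p (x \<otimes> y \<ominus> x' \<otimes> y') \<le> p (x \<ominus> x') * p y + p x' * p (y \<ominus> y')"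
proof -
  have "x \<otimes> y \<ominus> x' \<otimes> y' = (x \<ominus> x') \<otimes> y \<oplus> x' \<otimes> (y \<ominus> y')" using assms by algebra
  moreover have "p ((x \<ominus> x') \<otimes> y) \<le> p (x \<ominus> x') * p y" "p (x' \<otimes> (y \<ominus> y')) \<le> p x' * p (y \<ominus> y')"
    using assms by (auto intro: p_mult)
  ultimately show ?thesis using p_add[of "(x \<ominus> x') \<otimes> y" "x' \<otimes> (y \<ominus> y')"] assms by simp
qed

lemma p_add_diff:
  assumes "x \<in> carrier S" "y \<in> carrier S" "x' \<in> carrier S" "y' \<in> carrier S"
  shows "p ((x \<oplus> y) \<ominus> (x' \<oplus> y')) \<le> p (x \<ominus> x') + p (y \<ominus> y')"
proof -
  have "(x \<oplus> y) \<ominus> (x' \<oplus> y') = (x \<ominus> x') \<oplus> (y \<ominus> y')" using assms by algebra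
  then show ?thesis using p_add[of "x \<ominus> x'" "y \<ominus> y'"] assms by simp
qed

text \<open>Convergence in the seminorm; limits are unique only once it is definite.\<close>

definition conv :: "(nat => 'a) => 'a => bool" where
  "conv x a \<longleftrightarrow> (\<lambda>i. p (x i \<ominus> a)) \<longlonglongrightarrow> 0"

lemma conv_null:
  assumes "\<And>i. x i \<in> carrier S" "a \<in> carrier S" "\<And>i. p (x i \<ominus> a) \<le> f i" "f \<longlonglongrightarrow> 0"
  shows "conv x a"
  unfolding conv_def
  by (rule real_tendsto_sandwich[of "\<lambda>_. 0" _ _ f]) (use assms in auto)

lemma conv_norm:
  assumes "\<And>i. x i \<in> carrier S" "a \<in> carrier S" "conv x a" shows "(\<lambda>i. p (x i)) \<longlonglongrightarrow> p a"
proof -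
  have "(\<lambda>i. p (x i) - p a) \<longlonglongrightarrow> 0"
    by (rule Lim_null_comparison[of _ "\<lambda>i. p (x i \<ominus> a)"])
       (use assms p_abs_diff in "auto simp: conv_def")
  then show ?thesis by (simp add: LIM_zero_iff)
qed

lemma conv_const: "a \<in> carrier S ==> conv (\<lambda>_. a) a" by (simp add: conv_def)

lemma conv_add:
  assumes "\<And>i. x i \<in> carrier S" "\<And>i. y i \<in> carrier S" "a \<in> carrier S" "b \<in> carrier S" "conv x a" "conv y b"
  shows "conv (\<lambda>i. x i \<oplus> y i) (a \<oplus> b)"
  by (rule conv_null[where f = "\<lambda>i. p (x i \<ominus> a) + p (y i \<ominus> b)"])
     (use assms p_add_diff in "auto simp: conv_def intro: tendsto_add_zero")

lemma conv_smult:
  assumes "\<And>i. x i \<in> carrier S" "a \<in> carrier S" "conv x a"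
  shows "conv (\<lambda>i. c \<odot> x i) (c \<odot> a)"
  using assms tendsto_mult_right_zero[of "\<lambda>i. p (x i \<ominus> a)" sequentially "cmod c"]
  by (simp add: conv_def flip: smult_minus_distr) (simp add: p_smult)

lemma conv_star:
  assumes "\<And>i. x i \<in> carrier S" "a \<in> carrier S" "conv x a"
  shows "conv (\<lambda>i. star S (x i)) (star S a)"
  using assms by (simp add: conv_def flip: star_minus)

lemma conv_mult:
  assumes "\<And>i. x i \<in> carrier S" "\<And>i. y i \<in> carrier S" "a \<in> carrier S" "b \<in> carrier S" "conv x a" "conv y b"
  shows "conv (\<lambda>i. x i \<otimes> y i) (a \<otimes> b)"
proof (rule conv_null[where f = "\<lambda>i. p (x i \<ominus> a) * p (y i) + p a * p (y i \<ominus> b)"])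
  have "(\<lambda>i. p (y i)) \<longlonglongrightarrow> p b" using conv_norm assms by blast
  then have "(\<lambda>i. p (x i \<ominus> a) * p (y i) + p a * p (y i \<ominus> b)) \<longlonglongrightarrow> 0 * p b + p a * 0"
    by (intro tendsto_intros) (use assms in "auto simp: conv_def")
  then show "(\<lambda>i. p (x i \<ominus> a) * p (y i) + p a * p (y i \<ominus> b)) \<longlonglongrightarrow> 0" by simp
qed (use assms p_mult_diff in auto)

lemma conv_unique_norm:
  assumes "\<And>i. x i \<in> carrier S" "a \<in> carrier S" "b \<in> carrier S" "conv x a" "conv x b"
  shows "p (a \<ominus> b) = 0"
proof -
  have "(\<lambda>i. p (x i \<ominus> a) + p (x i \<ominus> b)) \<longlonglongrightarrow> 0"
    using assms by (auto simp: conv_def intro: tendsto_add_zero)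
  moreover have "p (a \<ominus> b) \<le> p (x i \<ominus> a) + p (x i \<ominus> b)" for i
    using p_triangle[of a "x i" b] assms p_minus_commute[of a "x i"] by simp
  ultimately have "p (a \<ominus> b) \<le> 0" by (intro LIMSEQ_le_const) auto
  moreover have "p (a \<ominus> b) \<ge> 0" using assms by simp
  ultimately show ?thesis by linarith
qed

abbreviation "CS \<equiv> cauchy_seqs S p"
abbreviation "cls x \<equiv> cauchy_rel S p `` {x}"
abbreviation "Compl \<equiv> star_completion S p"

lemma CS_carrier [simp]: "x \<in> CS ==> x i \<in> carrier S" by (auto simp: cauchy_seqs_def)

lemma CS_I:
  assumes "\<And>i. x i \<in> carrier S" "\<And>e. e > 0 ==> \<exists>k. \<forall>i\<ge>k. \<forall>j\<ge>k. p (x i \<ominus> x j) < e"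
  shows "x \<in> CS"
  using assms by (auto simp: cauchy_seqs_def)

lemma CS_D: "x \<in> CS ==> e > 0 ==> \<exists>k. \<forall>i\<ge>k. \<forall>j\<ge>k. p (x i \<ominus> x j) < e"
  by (auto simp: cauchy_seqs_def)

lemma equiv_cauchy: "equiv CS (cauchy_rel S p)"
proof (rule equivI)
  show "refl_on CS (cauchy_rel S p)" by (auto simp: refl_on_def cauchy_rel_def)
  show "cauchy_rel S p \<subseteq> CS \<times> CS" by (auto simp: cauchy_rel_def)
  show "sym (cauchy_rel S p)"
    by (rule symI) (auto simp: cauchy_rel_def p_minus_commute)
  show "trans (cauchy_rel S p)"
  proof (rule transI)
    fix x y z assume a: "(x, y) \<in> cauchy_rel S p" "(y, z) \<in> cauchy_rel S p"
    then have l: "(\<lambda>i. p (x i \<ominus> y i) + p (y i \<ominus> z i)) \<longlonglongrightarrow> 0"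
      by (intro tendsto_add_zero) (auto simp: cauchy_rel_def)
    have "(\<lambda>i. p (x i \<ominus> z i)) \<longlonglongrightarrow> 0"
      by (rule real_tendsto_sandwich[OF _ _ tendsto_const l])
         (use a in "auto simp: cauchy_rel_def intro!: p_triangle always_eventually")
    then show "(x, z) \<in> cauchy_rel S p" using a by (auto simp: cauchy_rel_def)
  qed
qed

lemma cls_eq: "x \<in> CS ==> y \<in> CS ==> cls x = cls y \<longleftrightarrow> (\<lambda>i. p (x i \<ominus> y i)) \<longlonglongrightarrow> 0"
  using eq_equiv_class_iff[OF equiv_cauchy, of x y] by (auto simp: cauchy_rel_def)

lemma CS_const [simp]: "a \<in> carrier S ==> (\<lambda>_. a) \<in> CS" by (rule CS_I) auto

lemma CS_norm_Cauchy: assumes "x \<in> CS" shows "convergent (\<lambda>i. p (x i))"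
proof -
  have "Cauchy (\<lambda>i. p (x i))"
  proof (rule metric_CauchyI)
    fix e :: real assume "e > 0"
    then obtain k where k: "\<forall>i\<ge>k. \<forall>j\<ge>k. p (x i \<ominus> x j) < e" using CS_D[OF assms] by blast
    have "dist (p (x i)) (p (x j)) < e" if "i \<ge> k" "j \<ge> k" for i j
      using p_abs_diff[of "x i" "x j"] k that assms by (auto simp: dist_real_def intro: le_less_trans)
    then show "\<exists>M. \<forall>m\<ge>M. \<forall>n\<ge>M. dist (p (x m)) (p (x n)) < e" by blast
  qed
  then show ?thesis by (simp add: Cauchy_convergent_iff)
qed

lemma CS_bounded: assumes "x \<in> CS" obtains B where "B > 0" "\<And>i. p (x i) \<le> B"
proof -
  have "Bseq (\<lambda>i. p (x i))" using CS_norm_Cauchy[OF assms] by (rule convergent_imp_Bseq)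
  then obtain B where "B > 0" "\<forall>i. norm (p (x i)) \<le> B" by (auto simp: Bseq_def)
  then show ?thesis using that assms by (metis CS_carrier abs_of_nonneg p_nonneg real_norm_def)
qed

lemma CS_add: assumes "x \<in> CS" "y \<in> CS" shows "(\<lambda>i. x i \<oplus> y i) \<in> CS"
proof (rule CS_I)
  fix e :: real assume "e > 0" then have "e / 2 > 0" by simp
  then obtain k l where k: "\<forall>i\<ge>k. \<forall>j\<ge>k. p (x i \<ominus> x j) < e / 2" and l: "\<forall>i\<ge>l. \<forall>j\<ge>l. p (y i \<ominus> y j) < e / 2"
    using CS_D assms by meson
  have "p ((x i \<oplus> y i) \<ominus> (x j \<oplus> y j)) < e" if "i \<ge> max k l" "j \<ge> max k l" for i j
  proof -
    have "p (x i \<ominus> x j) < e / 2" "p (y i \<ominus> y j) < e / 2" using k l that by auto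
    then show ?thesis using p_add_diff[of "x i" "y i" "x j" "y j"] assms by simp
  qed
  then show "\<exists>k. \<forall>i\<ge>k. \<forall>j\<ge>k. p ((x i \<oplus> y i) \<ominus> (x j \<oplus> y j)) < e" by blast
qed (use assms in auto)

lemma CS_smult: assumes "x \<in> CS" shows "(\<lambda>i. c \<odot> x i) \<in> CS"
proof (rule CS_I)
  fix e :: real assume "e > 0" then have "e / (cmod c + 1) > 0" by (simp add: add_nonneg_pos)
  then obtain k where k: "\<forall>i\<ge>k. \<forall>j\<ge>k. p (x i \<ominus> x j) < e / (cmod c + 1)"
    using CS_D assms by meson
  have "p (c \<odot> x i \<ominus> c \<odot> x j) < e" if "i \<ge> k" "j \<ge> k" for i j
  proof -
    have "p (c \<odot> x i \<ominus> c \<odot> x j) = cmod c * p (x i \<ominus> x j)"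
      using assms by (simp add: p_smult flip: smult_minus_distr)
    also have "\<dots> \<le> (cmod c + 1) * p (x i \<ominus> x j)" using assms by (intro mult_right_mono) auto
    also have "\<dots> < e" using k that by (simp add: pos_less_divide_eq add_nonneg_pos mult.commute)
    finally show ?thesis .
  qed
  then show "\<exists>k. \<forall>i\<ge>k. \<forall>j\<ge>k. p (c \<odot> x i \<ominus> c \<odot> x j) < e" by blast
qed (use assms in auto)

lemma CS_star: assumes "x \<in> CS" shows "(\<lambda>i. star S (x i)) \<in> CS"
  by (rule CS_I) (use assms CS_D[OF assms] in "auto simp flip: star_minus")

lemma CS_mult: assumes "x \<in> CS" "y \<in> CS" shows "(\<lambda>i. x i \<otimes> y i) \<in> CS"
proof (rule CS_I)
  fix e :: real assume e: "e > 0"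
  obtain B where B: "B > 0" "\<And>i. p (x i) \<le> B" using CS_bounded[OF assms(1)] by blast
  obtain C where C: "C > 0" "\<And>i. p (y i) \<le> C" using CS_bounded[OF assms(2)] by blast
  obtain k l where k: "\<forall>i\<ge>k. \<forall>j\<ge>k. p (x i \<ominus> x j) < e / (2 * C)" and l: "\<forall>i\<ge>l. \<forall>j\<ge>l. p (y i \<ominus> y j) < e / (2 * B)"
    using CS_D[OF assms(1), of "e / (2 * C)"] CS_D[OF assms(2), of "e / (2 * B)"] e B C by auto
  have "p (x i \<otimes> y i \<ominus> x j \<otimes> y j) < e" if ij: "i \<ge> max k l" "j \<ge> max k l" for i j
  proof -
    have "p (x i \<ominus> x j) * p (y i) \<le> p (x i \<ominus> x j) * C" using C assms by (intro mult_left_mono) auto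
    also have "\<dots> < e / (2 * C) * C" using k ij C by (intro mult_strict_right_mono) auto
    finally have 1: "p (x i \<ominus> x j) * p (y i) < e / 2" using C by simp
    have "p (x j) * p (y i \<ominus> y j) \<le> B * p (y i \<ominus> y j)" using B assms by (intro mult_right_mono) auto
    also have "\<dots> < B * (e / (2 * B))" using l ij B by (intro mult_strict_left_mono) auto
    finally have "p (x j) * p (y i \<ominus> y j) < e / 2" using B by simp
    then show ?thesis using p_mult_diff[of "x i" "y i" "x j" "y j"] 1 assms by simp
  qed
  then show "\<exists>k. \<forall>i\<ge>k. \<forall>j\<ge>k. p (x i \<otimes> y i \<ominus> x j \<otimes> y j) < e" by blast
qed (use assms in auto)

lemma rel_iff: "(x, y) \<in> cauchy_rel S p \<longleftrightarrow> x \<in> CS \<and> y \<in> CS \<and> (\<lambda>i. p (x i \<ominus> y i)) \<longlonglongrightarrow> 0"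
  by (auto simp: cauchy_rel_def)

lemma Compl_carrier: "carrier Compl = cls ` CS"
  by (auto simp: star_completion_def quotient_def)

lemma Compl_one: "\<one>\<^bsub>Compl\<^esub> = cls (\<lambda>_. \<one>)" and Compl_zero: "\<zero>\<^bsub>Compl\<^esub> = cls (\<lambda>_. \<zero>)"
  by (simp_all add: star_completion_def)

lemma Compl_add: assumes "x \<in> CS" "y \<in> CS" shows "cls x \<oplus>\<^bsub>Compl\<^esub> cls y = cls (\<lambda>i. x i \<oplus> y i)"
proof -
  have "congruent2 (cauchy_rel S p) (cauchy_rel S p) (\<lambda>x y. cls (\<lambda>i. x i \<oplus> y i))"
  proof (rule congruent2I')
    fix x x' y y' assume a: "(x, x') \<in> cauchy_rel S p" "(y, y') \<in> cauchy_rel S p"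
    then have l: "(\<lambda>i. p (x i \<ominus> x' i) + p (y i \<ominus> y' i)) \<longlonglongrightarrow> 0"
      by (intro tendsto_add_zero) (auto simp: rel_iff)
    have "(\<lambda>i. p ((x i \<oplus> y i) \<ominus> (x' i \<oplus> y' i))) \<longlonglongrightarrow> 0"
      by (rule real_tendsto_sandwich[OF _ _ tendsto_const l])
         (use a in "auto simp: rel_iff intro!: p_add_diff always_eventually")
    then show "cls (\<lambda>i. x i \<oplus> y i) = cls (\<lambda>i. x' i \<oplus> y' i)" using a by (simp add: rel_iff cls_eq CS_add)
  qed
  from UN_equiv_class2[OF equiv_cauchy equiv_cauchy this assms] show ?thesis by (simp add: star_completion_def)
qed

lemma Compl_mult: assumes "x \<in> CS" "y \<in> CS" shows "cls x \<otimes>\<^bsub>Compl\<^esub> cls y = cls (\<lambda>i. x i \<otimes> y i)"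
proof -
  have "congruent2 (cauchy_rel S p) (cauchy_rel S p) (\<lambda>x y. cls (\<lambda>i. x i \<otimes> y i))"
  proof (rule congruent2I')
    fix x x' y y' assume a: "(x, x') \<in> cauchy_rel S p" "(y, y') \<in> cauchy_rel S p"
    then have cs: "x \<in> CS" "x' \<in> CS" "y \<in> CS" "y' \<in> CS" by (auto simp: rel_iff)
    obtain B where B: "B > 0" "\<And>i. p (x' i) \<le> B" using CS_bounded[OF cs(2)] by blast
    obtain C where C: "C > 0" "\<And>i. p (y i) \<le> C" using CS_bounded[OF cs(3)] by blast
    have l: "(\<lambda>i. p (x i \<ominus> x' i) * C + B * p (y i \<ominus> y' i)) \<longlonglongrightarrow> 0"
      using a by (intro tendsto_add_zero tendsto_mult_left_zero tendsto_mult_right_zero) (auto simp: rel_iff)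
    have "p ((x i \<otimes> y i) \<ominus> (x' i \<otimes> y' i)) \<le> p (x i \<ominus> x' i) * C + B * p (y i \<ominus> y' i)" for i
      using p_mult_diff[of "x i" "y i" "x' i" "y' i"] cs B(2)[of i] C(2)[of i]
        mult_left_mono[of "p (y i)" C "p (x i \<ominus> x' i)"] mult_right_mono[of "p (x' i)" B "p (y i \<ominus> y' i)"] by simp
    then have "(\<lambda>i. p ((x i \<otimes> y i) \<ominus> (x' i \<otimes> y' i))) \<longlonglongrightarrow> 0"
      by (intro real_tendsto_sandwich[OF _ _ tendsto_const l] always_eventually) (use cs in auto)
    then show "cls (\<lambda>i. x i \<otimes> y i) = cls (\<lambda>i. x' i \<otimes> y' i)" using cs by (simp add: cls_eq CS_mult)
  qed
  from UN_equiv_class2[OF equiv_cauchy equiv_cauchy this assms] show ?thesis by (simp add: star_completion_def)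
qed

lemma Compl_smult: assumes "x \<in> CS" shows "c \<odot>\<^bsub>Compl\<^esub> cls x = cls (\<lambda>i. c \<odot> x i)"
proof -
  have "congruent (cauchy_rel S p) (\<lambda>x. cls (\<lambda>i. c \<odot> x i))"
  proof (rule congruentI)
    fix x x' assume a: "(x, x') \<in> cauchy_rel S p"
    then have cs: "x \<in> CS" "x' \<in> CS" by (auto simp: rel_iff)
    have "(\<lambda>i. p (c \<odot> x i \<ominus> c \<odot> x' i)) = (\<lambda>i. cmod c * p (x i \<ominus> x' i))"
      using cs by (auto simp: p_smult simp flip: smult_minus_distr)
    then have "(\<lambda>i. p (c \<odot> x i \<ominus> c \<odot> x' i)) \<longlonglongrightarrow> 0"
      using a by (auto simp: rel_iff intro: tendsto_mult_right_zero)
    then show "cls (\<lambda>i. c \<odot> x i) = cls (\<lambda>i. c \<odot> x' i)" using cs by (simp add: cls_eq CS_smult)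
  qed
  from UN_equiv_class[OF equiv_cauchy this assms] show ?thesis by (simp add: star_completion_def)
qed

lemma Compl_star: assumes "x \<in> CS" shows "star Compl (cls x) = cls (\<lambda>i. star S (x i))"
proof -
  have "congruent (cauchy_rel S p) (\<lambda>x. cls (\<lambda>i. star S (x i)))"
    by (rule congruentI) (auto simp: rel_iff cls_eq CS_star simp flip: star_minus)
  from UN_equiv_class[OF equiv_cauchy this assms] show ?thesis by (simp add: star_completion_def)
qed

lemmas Compl_ops = Compl_one Compl_zero Compl_add Compl_mult Compl_smult Compl_star
lemmas CS_ops = CS_const CS_add CS_mult CS_smult CS_star

lemma star_alg_Compl: "star_alg Compl"
proof -
  have ag: "abelian_group Compl"
  proof (rule abelian_groupI)
    fix X assume "X \<in> carrier Compl"
    then obtain x where x: "x \<in> CS" "X = cls x" by (auto simp: Compl_carrier)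
    have "(\<lambda>i. (-1) \<odot> x i \<oplus> x i) = (\<lambda>i. \<zero>)" using x by (auto simp: smult_minus_one l_neg)
    then show "\<exists>Y\<in>carrier Compl. Y \<oplus>\<^bsub>Compl\<^esub> X = \<zero>\<^bsub>Compl\<^esub>" using x
      by (intro bexI[of _ "cls (\<lambda>i. (-1) \<odot> x i)"]) (auto simp: Compl_carrier Compl_ops CS_ops)
  qed (auto simp: Compl_carrier Compl_ops CS_ops a_ac intro!: imageI)
  have mo: "monoid Compl"
    by (rule monoidI) (auto simp: Compl_carrier Compl_ops CS_ops m_assoc intro!: imageI)
  have "ring Compl"
    by (rule ringI[OF ag mo]) (auto simp: Compl_carrier Compl_ops CS_ops l_distr r_distr intro!: imageI)
  then interpret C: ring Compl .
  show ?thesis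
    by unfold_locales (auto simp: Compl_carrier Compl_ops CS_ops smult_l_distr smult_r_distr smult_smult
      smult_mult_l smult_mult_r star_add star_mult star_smult intro!: imageI)
qed

text \<open>The limit of the seminorms along a Cauchy sequence is the same for all representatives of its class.\<close>

definition cnorm :: "(nat => 'a) set => real" where
  "cnorm X = (THE r. \<exists>x\<in>CS. X = cls x \<and> (\<lambda>i. p (x i)) \<longlonglongrightarrow> r)"

lemma cnorm_cls: assumes "x \<in> CS" shows "(\<lambda>i. p (x i)) \<longlonglongrightarrow> cnorm (cls x)"
proof -
  obtain r where r: "(\<lambda>i. p (x i)) \<longlonglongrightarrow> r" using CS_norm_Cauchy[OF assms] by (auto simp: convergent_def)
  have "r' = r" if "y \<in> CS" "cls x = cls y" "(\<lambda>i. p (y i)) \<longlonglongrightarrow> r'" for r' y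
  proof -
    have z: "(\<lambda>i. p (x i \<ominus> y i)) \<longlonglongrightarrow> 0" using that assms cls_eq by blast
    have "(\<lambda>i. p (x i) - p (y i)) \<longlonglongrightarrow> 0"
      by (rule Lim_null_comparison[OF _ z]) (use assms that p_abs_diff in auto)
    moreover have "(\<lambda>i. p (x i) - p (y i)) \<longlonglongrightarrow> r - r'" using r that by (intro tendsto_diff)
    ultimately show "r' = r" using LIMSEQ_unique by fastforce
  qed
  then have "cnorm (cls x) = r" unfolding cnorm_def using assms r by (intro the_equality) blast+
  then show ?thesis using r by simp
qed

lemma cnorm_eqI: "x \<in> CS ==> (\<lambda>i. p (x i)) \<longlonglongrightarrow> r ==> cnorm (cls x) = r"
  using cnorm_cls LIMSEQ_unique by blast

lemma cnorm_le: "x \<in> CS ==> (\<And>j. j \<ge> k ==> p (x j) \<le> r) ==> cnorm (cls x) \<le> r"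
  by (rule LIMSEQ_le_const2[OF cnorm_cls]) auto

abbreviation emb :: "'a => (nat => 'a) set" where "emb a \<equiv> cls (\<lambda>_. a)"

lemma cnorm_emb [simp]: "a \<in> carrier S ==> cnorm (emb a) = p a"
  by (rule cnorm_eqI) auto

lemma emb_star_hom: "emb \<in> star_hom S Compl"
  by (rule star_homI) (auto simp: Compl_carrier Compl_ops CS_ops)

lemma cstar_pre_Compl: "cstar_pre Compl cnorm"
proof -
  interpret C: star_alg Compl by (rule star_alg_Compl)
  have "cstar_seminorm Compl cnorm"
    unfolding cstar_seminorm_def
  proof (intro conjI allI ballI)
    fix X assume "X \<in> carrier Compl"
    then obtain x where x: "x \<in> CS" "X = cls x" by (auto simp: Compl_carrier)
    show "0 \<le> cnorm X" using LIMSEQ_le_const[OF cnorm_cls[OF x(1)]] x by auto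
    show "cnorm (star Compl X \<otimes>\<^bsub>Compl\<^esub> X) = (cnorm X)\<^sup>2"
      unfolding x(2) using x(1) tendsto_power[OF cnorm_cls[OF x(1)], of 2]
      by (simp add: Compl_ops CS_ops) (rule cnorm_eqI, auto simp: CS_ops p_cstar)
    show "cnorm (c \<odot>\<^bsub>Compl\<^esub> X) = cmod c * cnorm X" for c
      unfolding x(2) using x(1) tendsto_mult_left[OF cnorm_cls[OF x(1)], of "cmod c"]
      by (simp add: Compl_ops CS_ops) (rule cnorm_eqI, auto simp: CS_ops p_smult)
    fix Y assume "Y \<in> carrier Compl"
    then obtain y where y: "y \<in> CS" "Y = cls y" by (auto simp: Compl_carrier)
    show "cnorm (X \<oplus>\<^bsub>Compl\<^esub> Y) \<le> cnorm X + cnorm Y"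
      unfolding x(2) y(2) Compl_add[OF x(1) y(1)]
      by (rule LIMSEQ_le[OF cnorm_cls tendsto_add[OF cnorm_cls cnorm_cls]]) (use x y in "auto simp: CS_ops p_add")
    show "cnorm (X \<otimes>\<^bsub>Compl\<^esub> Y) \<le> cnorm X * cnorm Y"
      unfolding x(2) y(2) Compl_mult[OF x(1) y(1)]
      by (rule LIMSEQ_le[OF cnorm_cls tendsto_mult[OF cnorm_cls cnorm_cls]]) (use x y in "auto simp: CS_ops p_mult")
  qed
  then show ?thesis by unfold_locales
qed

lemma Compl_minus:
  assumes "x \<in> CS" "y \<in> CS" shows "cls x \<ominus>\<^bsub>Compl\<^esub> cls y = cls (\<lambda>i. x i \<ominus> y i)"
proof -
  interpret C: star_alg Compl by (rule star_alg_Compl)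
  have "cls x \<in> carrier Compl" "cls y \<in> carrier Compl" using assms by (auto simp: Compl_carrier)
  then show ?thesis using assms by (simp add: C.minus_as_smult minus_as_smult Compl_ops CS_ops)
qed

lemma CS_minus: "x \<in> CS ==> y \<in> CS ==> (\<lambda>i. x i \<ominus> y i) \<in> CS"
  using CS_add[of x "\<lambda>i. (-1) \<odot> y i"] CS_smult[of y "-1"] by (simp add: minus_as_smult)

lemma Compl_dense:
  assumes "X \<in> carrier Compl" "e > 0"
  shows "\<exists>a\<in>carrier S. cnorm (X \<ominus>\<^bsub>Compl\<^esub> emb a) < e"
proof -
  obtain x where x: "x \<in> CS" "X = cls x" using assms by (auto simp: Compl_carrier)
  obtain k where k: "\<forall>i\<ge>k. \<forall>j\<ge>k. p (x i \<ominus> x j) < e / 2" using CS_D[OF x(1), of "e / 2"] assms by auto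
  have "cnorm (X \<ominus>\<^bsub>Compl\<^esub> emb (x k)) \<le> e / 2"
    unfolding x(2) Compl_minus[OF x(1) CS_const[OF CS_carrier[OF x(1)]]]
    by (rule cnorm_le[of _ k, OF CS_minus]) (use x k in "auto intro: less_imp_le")
  then show ?thesis using assms x by (intro bexI[of _ "x k"]) auto
qed

end

locale cstar_alg = cstar_pre +
  assumes definite: "x \<in> carrier S ==> p x = 0 ==> x = \<zero>"
    and complete: "xs \<in> cauchy_seqs S p ==> \<exists>a\<in>carrier S. conv xs a"
begin

lemma conv_unique:
  assumes "\<And>i. x i \<in> carrier S" "a \<in> carrier S" "b \<in> carrier S" "conv x a" "conv x b"
  shows "a = b"
  by (rule eq_if_minus_zero[OF assms(2,3) definite[OF _ conv_unique_norm[OF assms]]]) (use assms in simp)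

end

context cstar_pre
begin

text \<open>A Cauchy sequence of classes is approximated, with errors tending to zero, by a sequence of
  elements of the original algebra; that sequence is Cauchy, and its class is the limit.\<close>

lemma cstar_alg_Compl: "cstar_alg Compl cnorm"
proof -
  interpret C: cstar_pre Compl cnorm by (rule cstar_pre_Compl)
  show ?thesis
  proof unfold_locales
    fix X assume X: "X \<in> carrier Compl" "cnorm X = 0"
    then obtain x where x: "x \<in> CS" "X = cls x" by (auto simp: Compl_carrier)
    have "(\<lambda>i. p (x i \<ominus> \<zero>)) \<longlonglongrightarrow> 0" using cnorm_cls[OF x(1)] X x by (simp add: minus_eq)
    then show "X = \<zero>\<^bsub>Compl\<^esub>" using x by (simp add: Compl_zero cls_eq)
  next
    fix X assume X: "X \<in> cauchy_seqs Compl cnorm"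
    have "\<exists>a\<in>carrier S. cnorm (X i \<ominus>\<^bsub>Compl\<^esub> emb a) < 1 / real (Suc i)" for i
      by (rule Compl_dense) (use X in auto)
    then obtain a where a: "\<And>i. a i \<in> carrier S" "\<And>i. cnorm (X i \<ominus>\<^bsub>Compl\<^esub> emb (a i)) < 1 / real (Suc i)"
      by metis
    have Xc: "X i \<in> carrier Compl" for i using X by simp
    have ec: "emb (a i) \<in> carrier Compl" for i using a by (auto simp: Compl_carrier)
    have n: "p (a i \<ominus> a j) = cnorm (emb (a i) \<ominus>\<^bsub>Compl\<^esub> emb (a j))" for i j
      using a by (simp add: Compl_minus)
    have aCS: "a \<in> CS"
    proof (rule CS_I)
      fix e :: real assume e: "e > 0"
      obtain k where k: "\<forall>i\<ge>k. \<forall>j\<ge>k. cnorm (X i \<ominus>\<^bsub>Compl\<^esub> X j) < e / 3" using C.CS_D[OF X, of "e / 3"] e by auto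
      obtain l where l: "1 / real (Suc l) < e / 3" using nat_approx_posE[of "e / 3"] e by auto
      have sm: "1 / real (Suc i) < e / 3" if "i \<ge> l" for i
      proof -
        have "1 / real (Suc i) \<le> 1 / real (Suc l)" using that by (simp add: frac_le)
        then show ?thesis using l by linarith
      qed
      have "p (a i \<ominus> a j) < e" if ij: "i \<ge> max k l" "j \<ge> max k l" for i j
      proof -
        have "cnorm (X i \<ominus>\<^bsub>Compl\<^esub> X j) < e / 3" using k ij by simp
        moreover have "cnorm (emb (a i) \<ominus>\<^bsub>Compl\<^esub> X i) < e / 3" "cnorm (X j \<ominus>\<^bsub>Compl\<^esub> emb (a j)) < e / 3"
          using a(2)[of i] a(2)[of j] sm[of i] sm[of j] ij C.p_minus_commute[OF Xc[of i] ec[of i]] by auto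
        ultimately show ?thesis
          using C.p_triangle[OF ec[of i] Xc[of i] ec[of j]] C.p_triangle[OF Xc[of i] Xc[of j] ec[of j]]
          unfolding n by linarith
      qed
      then show "\<exists>k. \<forall>i\<ge>k. \<forall>j\<ge>k. p (a i \<ominus> a j) < e" by blast
    qed (rule a)
    have Ac: "cls a \<in> carrier Compl" using aCS by (auto simp: Compl_carrier)
    have "C.conv X (cls a)"
      unfolding C.conv_def
    proof (rule LIMSEQ_I)
      fix e :: real assume e: "e > 0"
      obtain k where k: "\<forall>i\<ge>k. \<forall>j\<ge>k. p (a i \<ominus> a j) < e / 3" using CS_D[OF aCS, of "e / 3"] e by auto
      obtain l where l: "1 / real (Suc l) < e / 3" using nat_approx_posE[of "e / 3"] e by auto
      have "norm (cnorm (X i \<ominus>\<^bsub>Compl\<^esub> cls a) - 0) < e" if i: "i \<ge> max k l" for i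
      proof -
        have "1 / real (Suc i) \<le> 1 / real (Suc l)" using i by (simp add: frac_le)
        then have 1: "cnorm (X i \<ominus>\<^bsub>Compl\<^esub> emb (a i)) < e / 3" using a(2)[of i] l by linarith
        have 2: "cnorm (emb (a i) \<ominus>\<^bsub>Compl\<^esub> cls a) \<le> e / 3"
          unfolding Compl_minus[OF CS_const[OF a(1)] aCS]
          by (rule cnorm_le[of _ k, OF CS_minus]) (use k i aCS a in "auto intro: less_imp_le")
        show ?thesis using C.p_triangle[OF Xc[of i] ec[of i] Ac] 1 2 C.p_nonneg[of "X i \<ominus>\<^bsub>Compl\<^esub> cls a"] Xc[of i] Ac e
          by (auto simp: C.minus_closed)
      qed
      then show "\<exists>no. \<forall>n\<ge>no. norm (cnorm (X n \<ominus>\<^bsub>Compl\<^esub> cls a) - 0) < e" by blast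
    qed
    then show "\<exists>A\<in>carrier Compl. C.conv X A" using Ac by blast
  qed
qed

lemma Compl_induct [consumes 1, case_names emb lim]:
  assumes X: "X \<in> carrier Compl" and e: "\<And>a. a \<in> carrier S ==> Q (emb a)"
    and l: "\<And>Y Z. [|\<And>i. Y i \<in> carrier Compl; \<And>i. Q (Y i); Z \<in> carrier Compl; cstar_pre.conv Compl cnorm Y Z|] ==> Q Z"
  shows "Q X"
proof -
  interpret C: cstar_pre Compl cnorm by (rule cstar_pre_Compl)
  have "\<exists>a\<in>carrier S. cnorm (X \<ominus>\<^bsub>Compl\<^esub> emb a) < 1 / real (Suc i)" for i
    by (rule Compl_dense) (use X in auto)
  then obtain a where a: "\<And>i. a i \<in> carrier S" "\<And>i. cnorm (X \<ominus>\<^bsub>Compl\<^esub> emb (a i)) < 1 / real (Suc i)"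
    by metis
  have ec: "emb (a i) \<in> carrier Compl" for i using a by (auto simp: Compl_carrier)
  have "C.conv (\<lambda>i. emb (a i)) X"
  proof (rule C.conv_null[where f = "\<lambda>i. 1 / real (Suc i)"])
    show "cnorm (emb (a i) \<ominus>\<^bsub>Compl\<^esub> X) \<le> 1 / real (Suc i)" for i
      using a(2)[of i] C.p_minus_commute[OF X ec[of i]] by simp
    show "(\<lambda>i. 1 / real (Suc i)) \<longlonglongrightarrow> 0" using LIMSEQ_inverse_real_of_nat by (simp add: inverse_eq_divide)
  qed (use ec X in auto)
  then show ?thesis using l[of "\<lambda>i. emb (a i)" X] ec e a X by blast
qed

text \<open>A contractive map sends Cauchy sequences to Cauchy sequences, and the value at a class is the
  limit of the images.\<close>

lemma extension_to_completion:
  assumes D: "cstar_alg D q" and f: "f \<in> star_hom S D" and le: "\<And>a. a \<in> carrier S ==> q (f a) \<le> p a"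
  obtains F where "F \<in> star_hom Compl D" "\<And>a. a \<in> carrier S ==> F (emb a) = f a"
    "\<And>X. X \<in> carrier Compl ==> q (F X) \<le> cnorm X"
proof -
  interpret D: cstar_alg D q by fact
  have fm: "f (a \<ominus> b) = f a \<ominus>\<^bsub>D\<^esub> f b" if "a \<in> carrier S" "b \<in> carrier S" for a b
    by (rule star_hom_minus[OF _ _ f that]) unfold_locales
  note fc = star_homD(1)[OF f]
  define F where "F X = (THE d. d \<in> carrier D \<and> (\<exists>x\<in>CS. X = cls x \<and> D.conv (\<lambda>i. f (x i)) d))" for X
  have F: "F (cls x) \<in> carrier D \<and> D.conv (\<lambda>i. f (x i)) (F (cls x))" if x: "x \<in> CS" for x
  proof -
    have le': "q (f (x i) \<ominus>\<^bsub>D\<^esub> f (x j)) \<le> p (x i \<ominus> x j)" for i j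
      using le[of "x i \<ominus> x j"] fm[of "x i" "x j"] x by simp
    have "(\<lambda>i. f (x i)) \<in> cauchy_seqs D q"
    proof (rule D.CS_I)
      fix e :: real assume "e > 0"
      then show "\<exists>k. \<forall>i\<ge>k. \<forall>j\<ge>k. q (f (x i) \<ominus>\<^bsub>D\<^esub> f (x j)) < e" using CS_D[OF x] le' le_less_trans by meson
    qed (use x fc in auto)
    then obtain d where d: "d \<in> carrier D" "D.conv (\<lambda>i. f (x i)) d" using D.complete by blast
    have "d' = d" if *: "d' \<in> carrier D" "y \<in> CS" "cls x = cls y" "D.conv (\<lambda>i. f (y i)) d'" for d' y
    proof (rule D.conv_unique[of "\<lambda>i. f (x i)"])
      have z: "(\<lambda>i. p (x i \<ominus> y i)) \<longlonglongrightarrow> 0" using that x cls_eq by blast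
      have s: "(\<lambda>i. p (x i \<ominus> y i) + q (f (y i) \<ominus>\<^bsub>D\<^esub> d')) \<longlonglongrightarrow> 0"
        by (rule tendsto_add_zero[OF z]) (use * in "simp add: D.conv_def")
      show "D.conv (\<lambda>i. f (x i)) d'"
      proof (rule D.conv_null[OF _ _ _ s])
        show "q (f (x i) \<ominus>\<^bsub>D\<^esub> d') \<le> p (x i \<ominus> y i) + q (f (y i) \<ominus>\<^bsub>D\<^esub> d')" for i
          using D.p_triangle[of "f (x i)" "f (y i)" d'] le[of "x i \<ominus> y i"] fm[of "x i" "y i"] x * fc by simp
      qed (use x * fc in auto)
    qed (use x d * fc in auto)
    then have "F (cls x) = d" unfolding F_def using d x by (intro the_equality) blast+
    then show ?thesis using d by simp
  qed
  have Feq: "F (cls x) = d" if "x \<in> CS" "d \<in> carrier D" "D.conv (\<lambda>i. f (x i)) d" for x d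
    using D.conv_unique[of "\<lambda>i. f (x i)" "F (cls x)" d] F that fc by auto
  have emb: "F (emb a) = f a" if "a \<in> carrier S" for a
    by (rule Feq) (use that fc in "auto simp: D.conv_const")
  have "F \<in> star_hom Compl D"
  proof (rule star_homI)
    fix X assume "X \<in> carrier Compl"
    then obtain x where x: "x \<in> CS" "X = cls x" by (auto simp: Compl_carrier)
    note Fx = F[OF x(1)]
    show "F X \<in> carrier D" using Fx x by simp
    show "F (c \<odot>\<^bsub>Compl\<^esub> X) = c \<odot>\<^bsub>D\<^esub> F X" for c
      unfolding x(2) Compl_smult[OF x(1)]
      by (rule Feq) (use Fx x D.conv_smult[of "\<lambda>i. f (x i)" "F (cls x)" c] fc in "auto simp: CS_ops star_homD[OF f]")
    show "F (star Compl X) = star D (F X)"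
      unfolding x(2) Compl_star[OF x(1)]
      by (rule Feq) (use Fx x D.conv_star[of "\<lambda>i. f (x i)" "F (cls x)"] fc in "auto simp: CS_ops star_homD[OF f]")
    fix Y assume "Y \<in> carrier Compl"
    then obtain y where y: "y \<in> CS" "Y = cls y" by (auto simp: Compl_carrier)
    note Fy = F[OF y(1)]
    show "F (X \<oplus>\<^bsub>Compl\<^esub> Y) = F X \<oplus>\<^bsub>D\<^esub> F Y"
      unfolding x(2) y(2) Compl_add[OF x(1) y(1)]
      by (rule Feq) (use Fx Fy x y D.conv_add[of "\<lambda>i. f (x i)" "\<lambda>i. f (y i)" "F (cls x)" "F (cls y)"] fc in "auto simp: CS_ops star_homD[OF f]")
    show "F (X \<otimes>\<^bsub>Compl\<^esub> Y) = F X \<otimes>\<^bsub>D\<^esub> F Y"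
      unfolding x(2) y(2) Compl_mult[OF x(1) y(1)]
      by (rule Feq) (use Fx Fy x y D.conv_mult[of "\<lambda>i. f (x i)" "\<lambda>i. f (y i)" "F (cls x)" "F (cls y)"] fc in "auto simp: CS_ops star_homD[OF f]")
  next
    show "F \<one>\<^bsub>Compl\<^esub> = \<one>\<^bsub>D\<^esub>" using emb[of \<one>] by (simp add: Compl_one star_homD(4)[OF f])
  qed
  moreover have "q (F X) \<le> cnorm X" if "X \<in> carrier Compl" for X
  proof -
    obtain x where x: "x \<in> CS" "X = cls x" using \<open>X \<in> carrier Compl\<close> by (auto simp: Compl_carrier)
    have "(\<lambda>i. q (f (x i))) \<longlonglongrightarrow> q (F X)" using D.conv_norm[of "\<lambda>i. f (x i)" "F X"] F[OF x(1)] x fc by auto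
    from LIMSEQ_le[OF this cnorm_cls[OF x(1)]] show ?thesis using le x by auto
  qed
  ultimately show ?thesis using that emb by blast
qed

end

section \<open>Matrix algebras as C*-algebras\<close>

lemma mat_adjoint_carrier [simp]: "A \<in> carrier_mat n m ==> mat_adjoint A \<in> carrier_mat m n"
  unfolding mat_adjoint_def by (metis carrier_matD cols_length length_map mat_of_rows_carrier(1))

lemma mat_adjoint_dim [simp]: "dim_row (mat_adjoint A) = dim_col A" "dim_col (mat_adjoint A) = dim_row A"
  by (simp_all add: mat_adjoint_def mat_of_rows_def)

lemma mat_adjoint_index [simp]:
  "i < dim_col A ==> j < dim_row A ==> mat_adjoint A $$ (i, j) = cnj (A $$ (j, i))"
  unfolding mat_adjoint_def by (subst mat_of_rows_index) auto

lemma mat_mult_index: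
  "A \<in> carrier_mat n k ==> B \<in> carrier_mat k m ==> i < n ==> j < m ==>
    (A * B) $$ (i, j) = (\<Sum>l<k. A $$ (i, l) * B $$ (l, j))"
  by (auto simp: scalar_prod_def atLeast0LessThan intro!: sum.cong)

lemma mat_adjoint_mult:
  assumes "A \<in> carrier_mat n k" "B \<in> carrier_mat k m"
  shows "mat_adjoint (A * B) = mat_adjoint B * (mat_adjoint A :: complex mat)"
proof (rule eq_matI)
  have c: "mat_adjoint (A * B) \<in> carrier_mat m n" "mat_adjoint B * mat_adjoint A \<in> carrier_mat m n"
    using assms by (auto intro!: mat_adjoint_carrier mult_carrier_mat)
  then show "dim_row (mat_adjoint (A * B)) = dim_row (mat_adjoint B * mat_adjoint A)"
    "dim_col (mat_adjoint (A * B)) = dim_col (mat_adjoint B * mat_adjoint A)" by auto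
  fix i j assume "i < dim_row (mat_adjoint B * mat_adjoint A)" "j < dim_col (mat_adjoint B * mat_adjoint A)"
  then have ij: "i < m" "j < n" using c by auto
  have "mat_adjoint (A * B) $$ (i, j) = cnj ((A * B) $$ (j, i))"
    using ij assms by (intro mat_adjoint_index) auto
  also have "\<dots> = (\<Sum>l<k. cnj (A $$ (j, l)) * cnj (B $$ (l, i)))" using ij assms by (simp add: mat_mult_index del: index_mult_mat)
  also have "\<dots> = (mat_adjoint B * mat_adjoint A) $$ (i, j)"
    using ij assms by (subst mat_mult_index[of _ m k _ n]) (auto intro!: sum.cong simp: mult.commute)
  finally show "mat_adjoint (A * B) $$ (i, j) = (mat_adjoint B * mat_adjoint A) $$ (i, j)" .
qed

lemma mat_adjoint_adjoint [simp]: "A \<in> carrier_mat n k ==> mat_adjoint (mat_adjoint (A :: complex mat)) = A"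
  by (intro eq_matI) auto

lemma mat_adjoint_one [simp]: "mat_adjoint (1\<^sub>m n :: complex mat) = 1\<^sub>m n"
  by (intro eq_matI) auto

lemma matrix_star_algebra_simps [simp]:
  "carrier (Mat n) = carrier_mat n n" "mult (Mat n) = (*)"
  "one (Mat n) = 1\<^sub>m n" "zero (Mat n) = 0\<^sub>m n n"
  "add (Mat n) = (+)" "smult (Mat n) = (\<cdot>\<^sub>m)"
  "star (Mat n) = mat_adjoint"
  by (simp_all add: matrix_star_algebra_def)

lemma star_alg_matrix: "star_alg (Mat n)"
proof -
  have ag: "abelian_group (Mat n)"
  proof (rule abelian_groupI)
    fix A assume "A \<in> carrier (Mat n)"
    then show "\<exists>B\<in>carrier (Mat n). B \<oplus>\<^bsub>Mat n\<^esub> A = \<zero>\<^bsub>Mat n\<^esub>"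
      by (intro bexI[of _ "-A"]) (auto simp: uminus_l_inv_mat)
  qed (auto simp: assoc_add_mat comm_add_mat)
  have mo: "monoid (Mat n)"
    by (rule monoidI) (auto simp: assoc_mult_mat)
  have "ring (Mat n)"
    by (rule ringI[OF ag mo]) (auto simp: add_mult_distrib_mat mult_add_distrib_mat)
  then interpret ring "Mat n" .
  show ?thesis
  proof
    fix A B :: "complex mat" and c :: complex
    assume "A \<in> carrier (Mat n)" "B \<in> carrier (Mat n)"
    then show "(c \<odot>\<^bsub>Mat n\<^esub> A) \<otimes>\<^bsub>Mat n\<^esub> B = c \<odot>\<^bsub>Mat n\<^esub> (A \<otimes>\<^bsub>Mat n\<^esub> B)"
      "A \<otimes>\<^bsub>Mat n\<^esub> (c \<odot>\<^bsub>Mat n\<^esub> B) = c \<odot>\<^bsub>Mat n\<^esub> (A \<otimes>\<^bsub>Mat n\<^esub> B)"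
      using mult_smult_assoc_mat[of A n n B n c] mult_smult_distrib[of A n n B n c] by auto
  qed (auto simp: mat_adjoint_mult add_smult_distrib_right_mat add_smult_distrib_left_mat algebra_simps
      carrier_matD[OF mat_adjoint_carrier] intro!: eq_matI)
qed

lemma mat_smult_smult: "a \<cdot>\<^sub>m (b \<cdot>\<^sub>m X) = (a * b :: complex) \<cdot>\<^sub>m X"
  by (intro eq_matI) (auto simp: mult.assoc)

lemma mat_smult_mult_smult:
  assumes "X \<in> carrier_mat N N" "Y \<in> carrier_mat N N"
  shows "(a \<cdot>\<^sub>m X) * (b \<cdot>\<^sub>m Y) = (a * b :: complex) \<cdot>\<^sub>m (X * Y)"
  using mult_smult_assoc_mat[OF assms(1) smult_carrier_mat[OF assms(2)], of a b] mult_smult_distrib[OF assms, of b]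
  by (simp add: mat_smult_smult)

text \<open>Vectors of length \<open>k\<close> are functions of which only the values below \<open>k\<close> count, which makes the
  library for \<open>L2_set\<close> applicable for varying \<open>k\<close>.\<close>

definition vnorm :: "nat => (nat => complex) => real" where
  "vnorm k v = L2_set (\<lambda>i. cmod (v i)) {..<k}"

definition mapply :: "nat => complex mat => (nat => complex) => nat => complex" where
  "mapply k A v = (\<lambda>i. \<Sum>j<k. A $$ (i, j) * v j)"

text \<open>The operator norm, as the least bound instead of as a supremum over the unit ball.\<close>

definition opnorm :: "nat => complex mat => real" where
  "opnorm k A = Inf {c. 0 \<le> c \<and> (\<forall>v. vnorm k (mapply k A v) \<le> c * vnorm k v)}"

lemma vnorm_nonneg [simp]: "0 \<le> vnorm k v" by (simp add: vnorm_def)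

lemma vnorm_cong: "(\<And>i. i < k ==> v i = w i) ==> vnorm k v = vnorm k w"
  by (auto simp: vnorm_def intro!: L2_set_cong)

lemma vnorm_component: "i < k ==> cmod (v i) \<le> vnorm k v"
  unfolding vnorm_def by (rule member_le_L2_set) auto

lemma vnorm_add: "vnorm k (\<lambda>i. v i + w i) \<le> vnorm k v + vnorm k w"
proof -
  have "vnorm k (\<lambda>i. v i + w i) \<le> L2_set (\<lambda>i. cmod (v i) + cmod (w i)) {..<k}"
    unfolding vnorm_def by (rule L2_set_mono) (auto intro: norm_triangle_ineq)
  also have "\<dots> \<le> vnorm k v + vnorm k w" unfolding vnorm_def by (rule L2_set_triangle_ineq)
  finally show ?thesis .
qed

lemma vnorm_scale: "vnorm k (\<lambda>i. c * v i) = cmod c * vnorm k v"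
  unfolding vnorm_def norm_mult by (rule L2_set_right_distrib[symmetric]) auto

lemma entry_bound:
  "vnorm k (mapply k A v) \<le> (\<Sum>i<k. \<Sum>j<k. cmod (A $$ (i, j))) * vnorm k v"
proof -
  have "vnorm k (mapply k A v) \<le> (\<Sum>i<k. cmod (mapply k A v i))"
    unfolding vnorm_def by (rule L2_set_le_sum) auto
  also have "\<dots> \<le> (\<Sum>i<k. \<Sum>j<k. cmod (A $$ (i, j)) * vnorm k v)"
    unfolding mapply_def by (intro sum_mono order_trans[OF norm_sum]) (auto simp: norm_mult intro!: mult_left_mono vnorm_component)
  finally show ?thesis by (simp add: sum_distrib_right)
qed

lemma opnorm_set_nonempty: "{c. 0 \<le> c \<and> (\<forall>v. vnorm k (mapply k A v) \<le> c * vnorm k v)} \<noteq> {}"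
  using entry_bound[of k A] by (auto intro!: exI[of _ "\<Sum>i<k. \<Sum>j<k. cmod (A $$ (i, j))"] sum_nonneg)

lemma opnorm_nonneg [simp]: "0 \<le> opnorm k A"
  unfolding opnorm_def by (rule cInf_greatest[OF opnorm_set_nonempty]) auto

lemma opnorm_le: "0 \<le> c ==> (\<And>v. vnorm k (mapply k A v) \<le> c * vnorm k v) ==> opnorm k A \<le> c"
  unfolding opnorm_def by (rule cInf_lower) (auto intro!: bdd_belowI[of _ 0])

lemma opnorm_bound: "vnorm k (mapply k A v) \<le> opnorm k A * vnorm k v"
proof (cases "vnorm k v = 0")
  case True then show ?thesis using entry_bound[of k A v] by simp
next
  case False
  then have pos: "vnorm k v > 0" using vnorm_nonneg[of k v] by linarith
  have "vnorm k (mapply k A v) / vnorm k v \<le> opnorm k A"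
    unfolding opnorm_def by (rule cInf_greatest[OF opnorm_set_nonempty]) (use pos in "auto simp: divide_simps")
  then show ?thesis using pos by (simp add: divide_simps)
qed

lemma opnorm_le_entries: "opnorm k A \<le> (\<Sum>i<k. \<Sum>j<k. cmod (A $$ (i, j)))"
  by (rule opnorm_le) (auto intro!: sum_nonneg entry_bound)

lemma entry_le_opnorm: assumes "i < k" "j < k" shows "cmod (A $$ (i, j)) \<le> opnorm k A"
proof -
  let ?e = "\<lambda>l. if l = j then 1 else 0 :: complex"
  have "vnorm k ?e = 1"
    using assms by (simp add: vnorm_def L2_set_def if_distrib[of norm] if_distrib[of "\<lambda>x. x ^ 2"] cong: if_cong)
  moreover have "mapply k A ?e i = A $$ (i, j)" using assms by (simp add: mapply_def if_distrib cong: if_cong)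
  ultimately show ?thesis using opnorm_bound[of k A ?e] vnorm_component[OF assms(1), of "mapply k A ?e"] by simp
qed

lemma mapply_mult:
  "A \<in> carrier_mat k k ==> B \<in> carrier_mat k k ==> i < k ==> mapply k (A * B) v i = mapply k A (mapply k B v) i"
  by (simp add: mapply_def mat_mult_index sum_distrib_left sum_distrib_right mult.assoc del: index_mult_mat)
     (rule sum.swap)

lemma mapply_inner:
  assumes "A \<in> carrier_mat k k"
  shows "(\<Sum>i<k. cnj (mapply k A u i) * w i) = (\<Sum>i<k. cnj (u i) * mapply k (mat_adjoint A) w i)"
  using assms by (simp add: mapply_def sum_distrib_left sum_distrib_right mult_ac) (rule sum.swap)

lemma vnorm_Cauchy_Schwarz: "cmod (\<Sum>i<k. cnj (u i) * w i) \<le> vnorm k u * vnorm k w"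
proof -
  have "cmod (\<Sum>i<k. cnj (u i) * w i) \<le> (\<Sum>i<k. \<bar>cmod (u i)\<bar> * \<bar>cmod (w i)\<bar>)"
    by (rule order_trans[OF norm_sum]) (simp add: norm_mult)
  also have "\<dots> \<le> vnorm k u * vnorm k w" unfolding vnorm_def by (rule L2_set_mult_ineq)
  finally show ?thesis .
qed

lemma vnorm_inner: "(\<Sum>i<k. cnj (u i) * u i) = complex_of_real ((vnorm k u)\<^sup>2)"
  by (simp add: vnorm_def L2_set_def sum_nonneg complex_norm_square mult.commute del: of_real_power)

lemma opnorm_add:
  assumes "A \<in> carrier_mat k k" "B \<in> carrier_mat k k" shows "opnorm k (A + B) \<le> opnorm k A + opnorm k B"
proof (rule opnorm_le)
  fix v
  have "vnorm k (mapply k (A + B) v) = vnorm k (\<lambda>i. mapply k A v i + mapply k B v i)"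
    using assms by (intro vnorm_cong) (simp add: mapply_def sum.distrib algebra_simps)
  also have "\<dots> \<le> opnorm k A * vnorm k v + opnorm k B * vnorm k v"
    using vnorm_add[of k "mapply k A v" "mapply k B v"] opnorm_bound[of k A v] opnorm_bound[of k B v] by linarith
  finally show "vnorm k (mapply k (A + B) v) \<le> (opnorm k A + opnorm k B) * vnorm k v" by (simp add: algebra_simps)
qed simp

lemma opnorm_mult:
  assumes "A \<in> carrier_mat k k" "B \<in> carrier_mat k k" shows "opnorm k (A * B) \<le> opnorm k A * opnorm k B"
proof (rule opnorm_le)
  fix v
  have "vnorm k (mapply k (A * B) v) = vnorm k (mapply k A (mapply k B v))"
    using assms by (intro vnorm_cong) (simp add: mapply_mult)
  also have "\<dots> \<le> opnorm k A * vnorm k (mapply k B v)" by (rule opnorm_bound)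
  also have "\<dots> \<le> opnorm k A * (opnorm k B * vnorm k v)" by (intro mult_left_mono opnorm_bound opnorm_nonneg)
  finally show "vnorm k (mapply k (A * B) v) \<le> (opnorm k A * opnorm k B) * vnorm k v" by (simp add: mult.assoc)
qed simp

lemma opnorm_smult:
  assumes "A \<in> carrier_mat k k" shows "opnorm k (c \<cdot>\<^sub>m A) = cmod c * opnorm k A"
proof -
  have le: "opnorm k (c \<cdot>\<^sub>m A) \<le> cmod c * opnorm k A" if "A \<in> carrier_mat k k" for A c
  proof (rule opnorm_le)
    fix v
    have "vnorm k (mapply k (c \<cdot>\<^sub>m A) v) = vnorm k (\<lambda>i. c * mapply k A v i)"
      using that by (intro vnorm_cong) (simp add: mapply_def sum_distrib_left mult.assoc)
    also have "\<dots> \<le> cmod c * (opnorm k A * vnorm k v)" unfolding vnorm_scale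
      by (intro mult_left_mono opnorm_bound) auto
    finally show "vnorm k (mapply k (c \<cdot>\<^sub>m A) v) \<le> cmod c * opnorm k A * vnorm k v" by (simp add: mult.assoc)
  qed simp
  show ?thesis
  proof (cases "c = 0")
    case True then show ?thesis using le[OF assms, of c] opnorm_nonneg[of k "c \<cdot>\<^sub>m A"] by (auto intro: antisym)
  next
    case False
    have "inverse c \<cdot>\<^sub>m (c \<cdot>\<^sub>m A) = A" using False by (intro eq_matI) auto
    then have "opnorm k A \<le> inverse (cmod c) * opnorm k (c \<cdot>\<^sub>m A)"
      using le[of "c \<cdot>\<^sub>m A" "inverse c"] assms by (simp add: norm_inverse)
    then have "cmod c * opnorm k A \<le> opnorm k (c \<cdot>\<^sub>m A)" using False by (simp add: field_simps)
    then show ?thesis using le[OF assms, of c] by simp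
  qed
qed

text \<open>By the Cauchy-Schwarz inequality, \<open>\<parallel>A v\<parallel>\<^sup>2 = \<langle>v, A\<^sup>* A v\<rangle> \<le> \<parallel>A\<^sup>* A\<parallel> \<parallel>v\<parallel>\<^sup>2\<close>.\<close>

lemma opnorm_square_le:
  assumes A: "A \<in> carrier_mat k k" shows "(opnorm k A)\<^sup>2 \<le> opnorm k (mat_adjoint A * A)"
proof -
  have "opnorm k A \<le> sqrt (opnorm k (mat_adjoint A * A))"
  proof (rule opnorm_le)
    fix v
    have "complex_of_real ((vnorm k (mapply k A v))\<^sup>2) = (\<Sum>i<k. cnj (v i) * mapply k (mat_adjoint A * A) v i)"
      unfolding vnorm_inner[symmetric] mapply_inner[OF A] using A by (simp add: mapply_mult)
    then have "(vnorm k (mapply k A v))\<^sup>2 \<le> vnorm k v * vnorm k (mapply k (mat_adjoint A * A) v)"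
      using vnorm_Cauchy_Schwarz[of v "mapply k (mat_adjoint A * A) v" k]
      by (metis norm_of_real abs_of_nonneg zero_le_power2)
    also have "\<dots> \<le> vnorm k v * (opnorm k (mat_adjoint A * A) * vnorm k v)"
      by (intro mult_left_mono opnorm_bound vnorm_nonneg)
    also have "\<dots> = (sqrt (opnorm k (mat_adjoint A * A)) * vnorm k v)\<^sup>2"
      by (simp add: power_mult_distrib) (simp add: power2_eq_square)
    finally show "vnorm k (mapply k A v) \<le> sqrt (opnorm k (mat_adjoint A * A)) * vnorm k v"
      by (rule power2_le_imp_le) simp
  qed simp
  from power_mono[OF this opnorm_nonneg, of 2] show ?thesis by simp
qed

lemma opnorm_cstar:
  assumes A: "A \<in> carrier_mat k k" shows "opnorm k (mat_adjoint A * A) = (opnorm k A)\<^sup>2"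
proof -
  have le: "opnorm k A \<le> opnorm k (mat_adjoint A)" if "A \<in> carrier_mat k k" for A
  proof (cases "opnorm k A = 0")
    case False
    then have "opnorm k A > 0" using opnorm_nonneg[of k A] by linarith
    moreover have "opnorm k A * opnorm k A \<le> opnorm k (mat_adjoint A) * opnorm k A"
      using opnorm_square_le[OF that] opnorm_mult[of "mat_adjoint A" k A] that by (simp add: power2_eq_square)
    ultimately show ?thesis by simp
  qed simp
  have "opnorm k (mat_adjoint A) = opnorm k A" using le[OF A] le[of "mat_adjoint A"] A by simp
  then show ?thesis using opnorm_square_le[OF A] opnorm_mult[of "mat_adjoint A" k A] A by (simp add: power2_eq_square)
qed

lemma cstar_pre_matrix: "cstar_pre (Mat k) (opnorm k)"
proof -
  interpret star_alg "Mat k" by (rule star_alg_matrix)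
  show ?thesis by unfold_locales (auto simp: cstar_seminorm_def opnorm_add opnorm_mult opnorm_smult opnorm_cstar)
qed

lemma matrix_minus:
  assumes "A \<in> carrier_mat k k" "B \<in> carrier_mat k k" shows "A \<ominus>\<^bsub>Mat k\<^esub> B = A - B"
proof -
  interpret star_alg "Mat k" by (rule star_alg_matrix)
  show ?thesis using assms minus_as_smult[of A B] by (auto intro!: eq_matI)
qed

lemma matrix_conv_iff:
  assumes "\<And>i. X i \<in> carrier_mat k k" "A \<in> carrier_mat k k"
  shows "cstar_pre.conv (Mat k) (opnorm k) X A \<longleftrightarrow>
    (\<forall>a<k. \<forall>b<k. (\<lambda>i. X i $$ (a, b)) \<longlonglongrightarrow> A $$ (a, b))" (is "?L \<longleftrightarrow> ?R")
proof -
  interpret M: cstar_pre "Mat k" "opnorm k" by (rule cstar_pre_matrix)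
  have e: "opnorm k (X i \<ominus>\<^bsub>Mat k\<^esub> A) = opnorm k (X i - A)" for i using matrix_minus assms by simp
  show ?thesis
  proof
    assume ?L
    then have l: "(\<lambda>i. opnorm k (X i - A)) \<longlonglongrightarrow> 0" by (simp add: M.conv_def e)
    show ?R
    proof (intro allI impI)
      fix a b assume ab: "a < k" "b < k"
      have "(\<lambda>i. X i $$ (a, b) - A $$ (a, b)) \<longlonglongrightarrow> 0"
        by (rule Lim_null_comparison[OF _ l]) (use entry_le_opnorm[OF ab] ab assms in \<open>auto intro!: always_eventually\<close>, metis assms(1,2) carrier_matD index_minus_mat(1))
      then show "(\<lambda>i. X i $$ (a, b)) \<longlonglongrightarrow> A $$ (a, b)" by (simp add: LIM_zero_iff)
    qed
  next
    assume R: ?R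
    have "(\<lambda>i. \<Sum>a<k. \<Sum>b<k. cmod (X i $$ (a, b) - A $$ (a, b))) \<longlonglongrightarrow> (\<Sum>a<k. \<Sum>b<k. 0)"
      by (intro tendsto_sum tendsto_norm_zero LIM_zero) (use R in auto)
    then have "(\<lambda>i. \<Sum>a<k. \<Sum>b<k. cmod ((X i - A) $$ (a, b))) \<longlonglongrightarrow> 0" using assms by simp
    then show ?L by (intro M.conv_null[where f = "\<lambda>i. \<Sum>a<k. \<Sum>b<k. cmod ((X i - A) $$ (a, b))"])
        (use assms in "simp_all add: e opnorm_le_entries del: index_minus_mat")
  qed
qed

lemma cstar_alg_matrix: "cstar_alg (Mat k) (opnorm k)"
proof -
  interpret M: cstar_pre "Mat k" "opnorm k" by (rule cstar_pre_matrix)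
  show ?thesis
  proof unfold_locales
    fix A assume A: "A \<in> carrier (Mat k)" "opnorm k A = 0"
    have "A $$ (i, j) = 0" if "i < k" "j < k" for i j using entry_le_opnorm[OF that, of A] A by simp
    then show "A = \<zero>\<^bsub>Mat k\<^esub>" using A by (auto intro!: eq_matI)
  next
    fix X assume X: "X \<in> cauchy_seqs (Mat k) (opnorm k)"
    have Xc: "X i \<in> carrier_mat k k" for i using M.CS_carrier[OF X] by simp
    have "convergent (\<lambda>i. X i $$ (a, b))" if ab: "a < k" "b < k" for a b
    proof -
      have "Cauchy (\<lambda>i. X i $$ (a, b))"
      proof (rule metric_CauchyI)
        fix e :: real assume "e > 0"
        then obtain n where n: "\<forall>i\<ge>n. \<forall>j\<ge>n. opnorm k (X i \<ominus>\<^bsub>Mat k\<^esub> X j) < e" using M.CS_D[OF X] by blast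
        have "dist (X i $$ (a, b)) (X j $$ (a, b)) < e" if "i \<ge> n" "j \<ge> n" for i j
        proof -
          have "(X i - X j) $$ (a, b) = X i $$ (a, b) - X j $$ (a, b)" using Xc[of i] Xc[of j] ab by auto
          moreover have "opnorm k (X i - X j) < e" using n that matrix_minus[OF Xc Xc, of i j] by metis
          ultimately show ?thesis using entry_le_opnorm[OF ab, of "X i - X j"] by (simp add: dist_norm)
        qed
        then show "\<exists>M. \<forall>m\<ge>M. \<forall>n\<ge>M. dist (X m $$ (a, b)) (X n $$ (a, b)) < e" by blast
      qed
      then show ?thesis by (simp add: Cauchy_convergent_iff)
    qed
    then have l: "(\<lambda>i. X i $$ (a, b)) \<longlonglongrightarrow> lim (\<lambda>i. X i $$ (a, b))" if "a < k" "b < k" for a b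
      using that by (simp add: convergent_LIMSEQ_iff)
    let ?A = "mat k k (\<lambda>(a, b). lim (\<lambda>i. X i $$ (a, b)))"
    have "M.conv X ?A" using l by (subst matrix_conv_iff) (auto simp: Xc)
    then show "\<exists>A\<in>carrier (Mat k). M.conv X A" by (intro bexI[of _ ?A]) auto
  qed
qed

section \<open>Automatic contractivity of matrix representations\<close>

context cstar_alg
begin

lemma Neumann_series:
  assumes c: "c \<in> carrier S" and lt: "p c < 1"
  obtains d where "d \<in> carrier S" "(\<one> \<ominus> c) \<otimes> d = \<one>"
proof -
  define r where "r = p c"
  have r: "0 \<le> r" "r < 1" using assms by (auto simp: r_def)
  define T where "T = rec_nat \<one> (\<lambda>_ x. \<one> \<oplus> c \<otimes> x)"
  have T0: "T 0 = \<one>" and TS: "T (Suc i) = \<one> \<oplus> c \<otimes> T i" for i by (simp_all add: T_def)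
  have Tc: "T i \<in> carrier S" for i by (induction i) (use c in "simp_all add: T0 TS")
  have bd: "p (T i) \<le> 1 / (1 - r)" for i
  proof (induction i)
    case 0
    have "1 \<le> 1 / (1 - r)" using r by (simp add: divide_simps)
    then show ?case using p_one_le by (simp add: T0)
  next
    case (Suc i)
    have "p (T (Suc i)) \<le> 1 + r * p (T i)"
      using p_add[of \<one> "c \<otimes> T i"] p_mult[OF c Tc, of i] p_one_le Tc c by (simp add: TS r_def)
    also have "\<dots> \<le> 1 + r * (1 / (1 - r))" using Suc r by (intro add_left_mono mult_left_mono) auto
    also have "\<dots> = 1 / (1 - r)" using r by (simp add: divide_simps)
    finally show ?case .
  qed
  define K where "K = 2 / (1 - r)"
  have K: "K > 0" using r by (simp add: K_def)
  have diff: "p (T (i + m) \<ominus> T i) \<le> r ^ i * K" for i m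
  proof (induction i)
    case 0
    have "p (T m \<ominus> T 0) \<le> p (T m) + p (T 0)"
      using p_add[of "T m" "\<ominus> T 0"] Tc by (simp add: minus_eq p_uminus)
    then show ?case using bd[of m] bd[of 0] by (simp add: K_def)
  next
    case (Suc i)
    have "T (Suc i + m) \<ominus> T (Suc i) = c \<otimes> (T (i + m) \<ominus> T i)"
      using Tc[of "i + m"] Tc[of i] c by (simp add: TS) algebra
    then have "p (T (Suc i + m) \<ominus> T (Suc i)) \<le> r * p (T (i + m) \<ominus> T i)"
      using p_mult[OF c, of "T (i + m) \<ominus> T i"] Tc by (simp add: r_def)
    also have "\<dots> \<le> r * (r ^ i * K)" using Suc r by (intro mult_left_mono) auto
    finally show ?case by simp
  qed
  have "T \<in> CS"
  proof (rule CS_I)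
    fix e :: real assume "e > 0"
    then obtain k where k: "r ^ k < e / K" using real_arch_pow_inv[of "e / K" r] r K by auto
    have le: "p (T i \<ominus> T j) < e" if "k \<le> i" "i \<le> j" for i j
    proof -
      have "p (T i \<ominus> T j) \<le> r ^ i * K" using diff[of i "j - i"] that Tc by (simp add: p_minus_commute)
      also have "\<dots> \<le> r ^ k * K" using r K that by (intro mult_right_mono power_decreasing) auto
      also have "\<dots> < e" using k K by (simp add: pos_less_divide_eq)
      finally show ?thesis .
    qed
    have "p (T i \<ominus> T j) < e" if "i \<ge> k" "j \<ge> k" for i j
      using le[of i j] le[of j i] that Tc p_minus_commute[of "T i" "T j"] by (cases "i \<le> j") auto
    then show "\<exists>k. \<forall>i\<ge>k. \<forall>j\<ge>k. p (T i \<ominus> T j) < e" by blast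
  qed (rule Tc)
  then obtain d where d: "d \<in> carrier S" "conv T d" using complete by blast
  have "conv (\<lambda>i. \<one> \<oplus> c \<otimes> T i) (\<one> \<oplus> c \<otimes> d)"
    using conv_add[OF _ _ _ _ conv_const conv_mult[OF _ _ _ _ conv_const d(2)]] c d Tc by auto
  moreover have "conv (\<lambda>i. T (Suc i)) d" using d(2) unfolding conv_def by (rule LIMSEQ_Suc)
  ultimately have "\<one> \<oplus> c \<otimes> d = d"
    using conv_unique[of "\<lambda>i. T (Suc i)"] Tc c d by (simp add: TS)
  then have "(\<one> \<ominus> c) \<otimes> d = \<one>"
  proof -
    have "(\<one> \<ominus> c) \<otimes> d = d \<ominus> c \<otimes> d" using c d by algebra
    also have "\<dots> = (\<one> \<oplus> c \<otimes> d) \<ominus> c \<otimes> d" using \<open>\<one> \<oplus> c \<otimes> d = d\<close> by simp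
    also have "\<dots> = \<one>" using c d by algebra
    finally show ?thesis .
  qed
  then show ?thesis using that d by blast
qed

text \<open>If \<open>\<pi>\<close> increased the norm of \<open>x\<close>, then for \<open>\<lambda> = \<parallel>\<pi> x\<parallel>\<^sup>2\<close> the element
  \<open>1 - x\<^sup>* x / \<lambda>\<close> would be invertible by the Neumann series, so that \<open>1 - \<pi>(x)\<^sup>* \<pi>(x) / \<lambda>\<close> would be
  bounded below. But a vector on which \<open>\<pi> x\<close> almost attains its norm is almost killed by it.\<close>

lemma matrix_rep_contractive:
  assumes h: "\<pi> \<in> star_hom S (Mat k)" and x: "x \<in> carrier S"
  shows "opnorm k (\<pi> x) \<le> p x"
proof (rule ccontr)
  assume "\<not> ?thesis"
  then have gt: "p x < opnorm k (\<pi> x)" by simp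
  define M where "M = \<pi> x"
  have M: "M \<in> carrier_mat k k" using star_homD(1)[OF h x] by (simp add: M_def)
  define l where "l = (opnorm k M)\<^sup>2"
  have l: "(p x)\<^sup>2 < l" unfolding l_def M_def using gt x by (intro power_strict_mono) auto
  then have l0: "l > 0" using zero_le_power2[of "p x"] by linarith
  define c where "c = complex_of_real (1 / l) \<odot> (star S x \<otimes> x)"
  have c: "c \<in> carrier S" using x by (simp add: c_def)
  have "p c = (p x)\<^sup>2 / l" unfolding c_def using x l0 by (subst p_smult) (auto simp: p_cstar norm_divide)
  then have "p c < 1" using l l0 by simp
  then obtain d where d: "d \<in> carrier S" "(\<one> \<ominus> c) \<otimes> d = \<one>" using Neumann_series[OF c] by blast
  define H where "H = mat_adjoint M * M"
  have H: "H \<in> carrier_mat k k" using M by (auto simp: H_def intro!: mult_carrier_mat)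
  define G where "G = 1\<^sub>m k - complex_of_real (1 / l) \<cdot>\<^sub>m H"
  have G: "G \<in> carrier_mat k k" using H by (auto simp: G_def)
  have pc: "\<pi> c = complex_of_real (1 / l) \<cdot>\<^sub>m H"
    using x by (simp add: c_def star_homD[OF h] H_def M_def)
  have "\<pi> (\<one> \<ominus> c) = G"
    using star_hom_minus[OF star_alg_axioms star_alg_matrix h, of \<one> c] c matrix_minus[of "1\<^sub>m k" k "\<pi> c"] star_homD[OF h] pc H
    by (simp add: G_def)
  then have inv: "G * \<pi> d = 1\<^sub>m k" using d c star_homD(2)[OF h, of "\<one> \<ominus> c" d] star_homD(4)[OF h] by simp
  have D: "\<pi> d \<in> carrier_mat k k" using star_homD(1)[OF h d(1)] by simp
  have inv': "\<pi> d * G = 1\<^sub>m k" using mat_mult_left_right_inverse[OF G D inv] .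
  define C where "C = opnorm k (\<pi> d) + 1"
  have C: "C \<ge> 1" by (simp add: C_def)
  have mv: "(vnorm k (mapply k M v))\<^sup>2 \<le> l * (1 - 1 / (2 * C\<^sup>2)) * (vnorm k v)\<^sup>2" for v
  proof -
    define a where "a = vnorm k v"
    define b where "b = vnorm k (mapply k M v)"
    define w where "w = mapply k H v"
    have "a = vnorm k (mapply k (\<pi> d * G) v)"
      unfolding a_def inv' by (rule vnorm_cong) (simp add: mapply_def if_distrib[of "\<lambda>x. x * _"] cong: if_cong)
    also have "\<dots> = vnorm k (mapply k (\<pi> d) (mapply k G v))" by (rule vnorm_cong) (rule mapply_mult[OF D G])
    also have "\<dots> \<le> C * vnorm k (mapply k G v)"
      unfolding C_def using opnorm_bound[of k "\<pi> d" "mapply k G v"] by (simp add: distrib_right add_increasing2)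
    finally have "a\<^sup>2 \<le> (C * vnorm k (mapply k G v))\<^sup>2" by (intro power_mono) (auto simp: a_def)
    then have 1: "a\<^sup>2 \<le> C\<^sup>2 * (vnorm k (mapply k G v))\<^sup>2" by (simp add: power_mult_distrib)
    have Gi: "mapply k G v i = v i - w i / l" if "i < k" for i
      using that H by (simp add: mapply_def G_def w_def left_diff_distrib sum_subtractf if_distrib[of "\<lambda>x. x * _"] sum_divide_distrib cong: if_cong)
    have vw: "(\<Sum>i<k. cnj (v i) * w i) = complex_of_real (b\<^sup>2)"
      unfolding b_def vnorm_inner[symmetric] mapply_inner[OF M] w_def H_def using M by (simp add: mapply_mult)
    then have "cnj (\<Sum>i<k. cnj (v i) * w i) = complex_of_real (b\<^sup>2)" by simp
    then have wv: "(\<Sum>i<k. cnj (w i) * v i) = complex_of_real (b\<^sup>2)" by (simp add: mult.commute)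
    have "complex_of_real ((vnorm k (mapply k G v))\<^sup>2) = (\<Sum>i<k. cnj (v i - w i / l) * (v i - w i / l))"
      unfolding vnorm_inner[symmetric] by (simp add: Gi)
    also have "\<dots> = (\<Sum>i<k. cnj (v i) * v i - (cnj (v i) * w i) / l - (cnj (w i) * v i) / l + (cnj (w i) * w i) / (l * l))"
      by (intro sum.cong refl) (simp add: algebra_simps diff_divide_distrib)
    also have "\<dots> = complex_of_real (a\<^sup>2) - complex_of_real (b\<^sup>2) / l - complex_of_real (b\<^sup>2) / l
        + complex_of_real ((vnorm k w)\<^sup>2) / (l * l)"
      by (simp only: sum.distrib sum_subtractf sum_divide_distrib[symmetric] vw wv vnorm_inner a_def)
    also have "\<dots> = complex_of_real (a\<^sup>2 - 2 * b\<^sup>2 / l + (vnorm k w)\<^sup>2 / (l * l))" by simp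
    finally have 2: "(vnorm k (mapply k G v))\<^sup>2 = a\<^sup>2 - 2 * b\<^sup>2 / l + (vnorm k w)\<^sup>2 / (l * l)"
      by (simp only: of_real_eq_iff)
    have "vnorm k w \<le> l * a"
      using opnorm_bound[of k H v] opnorm_cstar[OF M] by (simp add: w_def H_def a_def l_def)
    then have "(vnorm k w)\<^sup>2 \<le> (l * a)\<^sup>2" by (intro power_mono) auto
    then have "(vnorm k w)\<^sup>2 / (l * l) \<le> a\<^sup>2" using l0 by (simp add: divide_simps power2_eq_square algebra_simps)
    then have "(vnorm k (mapply k G v))\<^sup>2 \<le> 2 * a\<^sup>2 - 2 * b\<^sup>2 / l" using 2 by linarith
    then have "C\<^sup>2 * (vnorm k (mapply k G v))\<^sup>2 \<le> C\<^sup>2 * (2 * a\<^sup>2 - 2 * b\<^sup>2 / l)" by (intro mult_left_mono) auto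
    then have "a\<^sup>2 \<le> C\<^sup>2 * (2 * a\<^sup>2 - 2 * b\<^sup>2 / l)" using 1 by linarith
    then show ?thesis using l0 C unfolding a_def[symmetric] b_def[symmetric]
      by (simp add: divide_simps power2_eq_square) (simp add: algebra_simps)
  qed
  define z where "z = l * (1 - 1 / (2 * C\<^sup>2))"
  have "1 \<le> C\<^sup>2" using C by (rule one_le_power)
  then have "2 * C\<^sup>2 \<ge> 1" by linarith
  then have pos: "0 < 2 * C\<^sup>2" by linarith
  have "1 / (2 * C\<^sup>2) > 0" using pos by simp
  moreover have "1 / (2 * C\<^sup>2) \<le> 1" using divide_le_eq_1_pos[OF pos] \<open>2 * C\<^sup>2 \<ge> 1\<close> by blast
  ultimately have z: "0 \<le> z" "z < l" using l0 by (auto simp: z_def)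
  have "opnorm k M \<le> sqrt z"
  proof (rule opnorm_le)
    fix v
    have "(vnorm k (mapply k M v))\<^sup>2 \<le> (sqrt z * vnorm k v)\<^sup>2" using mv[of v] z by (simp add: z_def power_mult_distrib)
    then show "vnorm k (mapply k M v) \<le> sqrt z * vnorm k v" by (rule power2_le_imp_le) (use z in simp)
  qed (use z in simp)
  then have "l \<le> (sqrt z)\<^sup>2" unfolding l_def by (intro power_mono) auto
  then show False using z by simp
qed

end

section \<open>Universal C*-algebras\<close>

context star_alg
begin

abbreviation "admissible R q \<equiv> cstar_seminorm S q \<and> (\<forall>r\<in>R. q r = 0)"

lemma admissible_zero: "admissible R (\<lambda>_. 0)" by (simp add: cstar_seminorm_def)

context
  fixes R assumes bdd: "\<And>x. x \<in> carrier S ==> \<exists>B. \<forall>q. admissible R q \<longrightarrow> q x \<le> B"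
begin

lemma max_seminorm_ge: "x \<in> carrier S ==> admissible R q ==> q x \<le> max_cstar_seminorm S R x"
  unfolding max_cstar_seminorm_def
  by (rule cSup_upper) (use bdd[of x] in "auto simp: bdd_above_def")

lemma max_seminorm_le: "(\<And>q. admissible R q ==> q x \<le> b) ==> max_cstar_seminorm S R x \<le> b"
  unfolding max_cstar_seminorm_def
  by (rule cSup_least) (use admissible_zero in auto)

lemma max_seminorm_nonneg: "x \<in> carrier S ==> 0 \<le> max_cstar_seminorm S R x"
  using max_seminorm_ge[of x "\<lambda>_. 0"] admissible_zero by blast

lemma max_seminorm_relations: "r \<in> R ==> r \<in> carrier S ==> max_cstar_seminorm S R r = 0"
  by (intro antisym max_seminorm_le max_seminorm_nonneg) auto

text \<open>All clauses except the C*-identity pass to suprema; that one holds because the square of a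
  supremum of nonnegative numbers is the supremum of their squares.\<close>

lemma cstar_pre_max: "cstar_pre S (max_cstar_seminorm S R)"
proof -
  let ?N = "max_cstar_seminorm S R"
  have smle: "?N (c \<odot> x) \<le> cmod c * ?N x" if "x \<in> carrier S" for c x
    by (rule max_seminorm_le) (use that max_seminorm_ge in "auto simp: cstar_seminorm_def intro!: mult_left_mono")
  have "cstar_seminorm S ?N"
    unfolding cstar_seminorm_def
  proof (intro conjI allI ballI)
    fix x assume x: "x \<in> carrier S"
    show "0 \<le> ?N x" by (rule max_seminorm_nonneg[OF x])
    show "?N (c \<odot> x) = cmod c * ?N x" for c
    proof (cases "c = 0")
      case True
      then show ?thesis using smle[OF x, of c] max_seminorm_nonneg[of "c \<odot> x"] x by (auto intro: antisym)
    next
      case False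
      have "?N x \<le> inverse (cmod c) * ?N (c \<odot> x)"
        using smle[of "c \<odot> x" "inverse c"] x False by (simp add: smult_smult norm_inverse)
      then have "cmod c * ?N x \<le> ?N (c \<odot> x)" using False by (simp add: field_simps)
      then show ?thesis using smle[OF x, of c] by simp
    qed
    show "?N (star S x \<otimes> x) = (?N x)\<^sup>2"
    proof (rule antisym)
      show "?N (star S x \<otimes> x) \<le> (?N x)\<^sup>2"
        by (rule max_seminorm_le) (use x max_seminorm_ge in "auto simp: cstar_seminorm_def intro!: power_mono")
      have "?N x \<le> sqrt (?N (star S x \<otimes> x))"
      proof (rule max_seminorm_le)
        fix q assume q: "admissible R q"
        then have "(q x)\<^sup>2 = q (star S x \<otimes> x)" using x by (simp add: cstar_seminorm_def)
        also have "\<dots> \<le> ?N (star S x \<otimes> x)" using q x by (intro max_seminorm_ge) auto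
        finally show "q x \<le> sqrt (?N (star S x \<otimes> x))" by (rule real_le_rsqrt)
      qed
      from power_mono[OF this max_seminorm_nonneg[OF x], of 2]
      show "(?N x)\<^sup>2 \<le> ?N (star S x \<otimes> x)" using max_seminorm_nonneg[of "star S x \<otimes> x"] x by simp
    qed
    fix y assume y: "y \<in> carrier S"
    show "?N (x \<oplus> y) \<le> ?N x + ?N y"
    proof (rule max_seminorm_le)
      fix q assume q: "admissible R q"
      then have "q (x \<oplus> y) \<le> q x + q y" using x y by (simp add: cstar_seminorm_def)
      then show "q (x \<oplus> y) \<le> ?N x + ?N y" using max_seminorm_ge[OF x q] max_seminorm_ge[OF y q] by linarith
    qed
    show "?N (x \<otimes> y) \<le> ?N x * ?N y"
    proof (rule max_seminorm_le)
      fix q assume q: "admissible R q"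
      then have "q (x \<otimes> y) \<le> q x * q y" using x y by (simp add: cstar_seminorm_def)
      also have "\<dots> \<le> ?N x * ?N y"
        using q x y by (intro mult_mono max_seminorm_ge max_seminorm_nonneg) (auto simp: cstar_seminorm_def)
      finally show "q (x \<otimes> y) \<le> ?N x * ?N y" .
    qed
  qed
  then show ?thesis by unfold_locales
qed

end

end

section \<open>The universal property of the non-commutative torus\<close>

definition phase :: "real => complex" where "phase x = cis (2 * pi * x)"

lemma phase_exp: "exp (2 * complex_of_real pi * \<i> * complex_of_real x) = phase x"
  by (simp add: phase_def cis_conv_exp mult_ac)

lemma phase_add: "phase (x + y) = phase x * phase y"
  by (simp add: phase_def cis_mult algebra_simps)

lemma phase_0 [simp]: "phase 0 = 1" by (simp add: phase_def)

lemma phase_minus: "phase (- x) = cnj (phase x)" by (simp add: phase_def cis_cnj)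

lemma norm_phase [simp]: "cmod (phase x) = 1" by (simp add: phase_def)

lemma phase_nonzero [simp]: "phase x \<noteq> 0" by (metis norm_phase norm_zero zero_neq_one)

lemma unimodular_mult_cnj: "cmod c = 1 ==> c * cnj c = 1" "cmod c = 1 ==> cnj c * c = 1"
  by (simp_all add: complex_norm_square[symmetric] mult.commute)

lemma phase_eq_1_iff: "phase x = 1 \<longleftrightarrow> x \<in> \<int>"
proof
  assume "phase x = 1"
  then have "cos (2 * pi * x) = 1" by (simp add: phase_def complex_eq_iff)
  then obtain k :: int where "2 * pi * x = of_int k * 2 * pi" by (auto simp: cos_one_2pi_int)
  then have "x = of_int k" by simp
  then show "x \<in> \<int>" by simp
next
  assume "x \<in> \<int>"
  then show "phase x = 1" by (simp add: phase_def cis_multiple_2pi)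
qed

lemma phase_diff: "phase (x - y) = phase x * cnj (phase y)"
  using phase_add[of x "- y"] by (simp add: phase_minus)

lemma phase_cong_int: assumes "x - y \<in> \<int>" shows "phase x = phase y"
  using phase_add[of "x - y" y] assms phase_eq_1_iff[of "x - y"] by simp

lemma phase_power: "phase x ^ k = phase (real k * x)"
  by (induction k) (simp_all add: distrib_right phase_add)

lemma phase_sum: "finite A ==> phase (\<Sum>i\<in>A. f i) = (\<Prod>i\<in>A. phase (f i))"
  by (induction rule: finite_induct) (simp_all add: phase_add)

lemma phase_eq_diff: "phase a = phase b ==> a - b \<in> \<int>"
  by (subst phase_eq_1_iff[symmetric]) (simp add: phase_diff unimodular_mult_cnj)

text \<open>The defining relations of the torus, as a property of elements of an arbitrary *-algebra.\<close>

definition torus_tuple :: "('a, 'm) star_algebra_scheme => nat => real mat => (nat => 'a) => bool" where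
  "torus_tuple D n \<theta> u \<longleftrightarrow>
     (\<forall>j<n. u j \<in> carrier D \<and> star D (u j) \<otimes>\<^bsub>D\<^esub> u j = \<one>\<^bsub>D\<^esub> \<and> u j \<otimes>\<^bsub>D\<^esub> star D (u j) = \<one>\<^bsub>D\<^esub>) \<and>
     (\<forall>j<n. \<forall>k<n. u k \<otimes>\<^bsub>D\<^esub> u j = phase (\<theta> $$ (j, k)) \<odot>\<^bsub>D\<^esub> (u j \<otimes>\<^bsub>D\<^esub> u k))"

lemma torus_tupleD:
  assumes "torus_tuple D n \<theta> u" "j < n"
  shows "u j \<in> carrier D" "star D (u j) \<otimes>\<^bsub>D\<^esub> u j = \<one>\<^bsub>D\<^esub>" "u j \<otimes>\<^bsub>D\<^esub> star D (u j) = \<one>\<^bsub>D\<^esub>"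
    "k < n ==> u k \<otimes>\<^bsub>D\<^esub> u j = phase (\<theta> $$ (j, k)) \<odot>\<^bsub>D\<^esub> (u j \<otimes>\<^bsub>D\<^esub> u k)"
  using assms unfolding torus_tuple_def by blast+

lemma torus_tuple_hom:
  assumes "torus_tuple D n \<theta> u" "f \<in> star_hom D E" "star_alg D"
  shows "torus_tuple E n \<theta> (\<lambda>j. f (u j))"
proof -
  interpret D: star_alg D by fact
  show ?thesis unfolding torus_tuple_def
  proof (intro conjI allI impI)
    fix j assume j: "j < n"
    note uj = torus_tupleD(1-3)[OF assms(1) j]
    show "f (u j) \<in> carrier E" using uj star_homD(1)[OF assms(2)] by simp
    show "star E (f (u j)) \<otimes>\<^bsub>E\<^esub> f (u j) = \<one>\<^bsub>E\<^esub>" "f (u j) \<otimes>\<^bsub>E\<^esub> star E (f (u j)) = \<one>\<^bsub>E\<^esub>"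
      using uj star_homD(2)[OF assms(2), of "star D (u j)" "u j"] star_homD(2)[OF assms(2), of "u j" "star D (u j)"]
      by (simp_all add: star_homD(4,6)[OF assms(2)])
    fix k assume k: "k < n"
    note uk = torus_tupleD(1)[OF assms(1) k]
    show "f (u k) \<otimes>\<^bsub>E\<^esub> f (u j) = phase (\<theta> $$ (j, k)) \<odot>\<^bsub>E\<^esub> (f (u j) \<otimes>\<^bsub>E\<^esub> f (u k))"
      using star_homD(2)[OF assms(2), of "u k" "u j"] star_homD(2)[OF assms(2), of "u j" "u k"] uj uk
        torus_tupleD(4)[OF assms(1) j k] star_homD(5)[OF assms(2), of "u j \<otimes>\<^bsub>D\<^esub> u k"] by simp
  qed
qed

abbreviation word_monoid :: "nat => (nat \<times> bool) list monoid" where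
  "word_monoid n \<equiv> \<lparr>carrier = lists ({..<n} \<times> UNIV), mult = (@), one = []\<rparr>"

abbreviation word_star :: "(nat \<times> bool) list => (nat \<times> bool) list" where
  "word_star w \<equiv> rev (map (\<lambda>(j, b). (j, \<not> b)) w)"

lemma star_monoid_words: "star_monoid (word_monoid n) word_star"
proof -
  interpret monoid "word_monoid n" by (rule monoidI) auto
  show ?thesis by unfold_locales (auto simp: rev_map comp_def case_prod_unfold in_lists_conv_set)
qed

interpretation words: star_monoid "word_monoid n" word_star for n by (rule star_monoid_words)

lemma free_star_algebra_eq: "free_star_algebra n = words.MA n" by (simp add: free_star_algebra_def)

lemma star_alg_free: "star_alg (free_star_algebra n)"
  unfolding free_star_algebra_eq by (rule words.star_alg_MA)

lemma free_gen_carrier: "j < n ==> gen j \<in> carrier (free_star_algebra n)"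
  by (simp add: free_star_algebra_eq words.MA_simps)

lemma free_star_gen: "star (free_star_algebra n) (gen j) = basis_elem [(j, True)]"
  by (simp add: free_star_algebra_eq words.MA_star_single)

text \<open>A word is built from the empty word by putting letters in front of it.\<close>

lemma free_induct [consumes 1, case_names add smult one gen_mult star_gen_mult]:
  assumes x: "x \<in> carrier (free_star_algebra n)"
    and add: "\<And>x y. x \<in> carrier (free_star_algebra n) ==> y \<in> carrier (free_star_algebra n) ==> Q x ==> Q y ==> Q (x \<oplus>\<^bsub>free_star_algebra n\<^esub> y)"
    and smult: "\<And>c x. x \<in> carrier (free_star_algebra n) ==> Q x ==> Q (c \<odot>\<^bsub>free_star_algebra n\<^esub> x)"
    and one: "Q \<one>\<^bsub>free_star_algebra n\<^esub>"
    and g: "\<And>j x. j < n ==> x \<in> carrier (free_star_algebra n) ==> Q x ==> Q (gen j \<otimes>\<^bsub>free_star_algebra n\<^esub> x)"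
    and gs: "\<And>j x. j < n ==> x \<in> carrier (free_star_algebra n) ==> Q x ==> Q (star (free_star_algebra n) (gen j) \<otimes>\<^bsub>free_star_algebra n\<^esub> x)"
  shows "Q x"
proof -
  have w: "w \<in> lists ({..<n} \<times> UNIV) ==> Q (basis_elem w)" for w
  proof (induction w)
    case Nil
    then show ?case using one by (simp add: free_star_algebra_eq words.MA_simps)
  next
    case (Cons l w)
    obtain j b where l: "l = (j, b)" by (cases l)
    have c: "basis_elem w \<in> carrier (free_star_algebra n)" and j: "j < n" using Cons l
      by (auto simp: free_star_algebra_eq words.MA_simps)
    have e: "basis_elem (l # w) = basis_elem [l] \<otimes>\<^bsub>free_star_algebra n\<^esub> basis_elem w"
      by (simp add: free_star_algebra_eq words.MA_mult_single)
    have "Q (basis_elem [l] \<otimes>\<^bsub>free_star_algebra n\<^esub> basis_elem w)"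
      using g[OF j c] gs[OF j c] Cons unfolding free_star_gen l by (cases b) auto
    then show ?case by (simp only: e)
  qed
  interpret F: star_alg "free_star_algebra n" by (rule star_alg_free)
  have "keys x \<subseteq> lists ({..<n} \<times> UNIV)" using x by (simp add: free_star_algebra_eq words.MA_simps)
  then show ?thesis
  proof (induction rule: poly_mapping_keys_induct)
    case zero
    show ?case using smult[of "\<one>\<^bsub>free_star_algebra n\<^esub>" 0] one F.smult_zero_left[of "\<one>\<^bsub>free_star_algebra n\<^esub>"]
      by (simp add: free_star_algebra_eq words.MA_simps)
  next
    case (single a c)
    have "single a c = c \<odot>\<^bsub>free_star_algebra n\<^esub> basis_elem a"
      by (simp add: free_star_algebra_eq words.MA_simps map_times_single)
    then show ?case using smult[of "basis_elem a" c] w[OF single] single by (simp add: free_star_algebra_eq words.MA_simps)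
  next
    case (add f g)
    then show ?case using assms(2)[of f g] by (simp add: free_star_algebra_eq words.MA_simps)
  qed
qed

lemma torus_relations_iff:
  "(\<forall>r\<in>nc_torus_relations n \<theta>. P r) \<longleftrightarrow> (let F = free_star_algebra n in
     (\<forall>j<n. P (star F (gen j) \<otimes>\<^bsub>F\<^esub> gen j \<ominus>\<^bsub>F\<^esub> \<one>\<^bsub>F\<^esub>) \<and> P (gen j \<otimes>\<^bsub>F\<^esub> star F (gen j) \<ominus>\<^bsub>F\<^esub> \<one>\<^bsub>F\<^esub>)) \<and>
     (\<forall>j<n. \<forall>k<n. P (gen k \<otimes>\<^bsub>F\<^esub> gen j \<ominus>\<^bsub>F\<^esub> phase (\<theta> $$ (j, k)) \<odot>\<^bsub>F\<^esub> (gen j \<otimes>\<^bsub>F\<^esub> gen k))))"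
  unfolding nc_torus_relations_def Let_def phase_exp by blast

text \<open>A C*-seminorm that vanishes on the relations is at most \<open>1\<close> on the generators, as
  \<open>q(u)\<^sup>2 = q(u\<^sup>* u) = q(1) \<le> 1\<close>.\<close>

lemma torus_bounded:
  assumes "x \<in> carrier (free_star_algebra n)"
  shows "\<exists>B. \<forall>q. cstar_seminorm (free_star_algebra n) q \<and> (\<forall>r\<in>nc_torus_relations n \<theta>. q r = 0) \<longrightarrow> q x \<le> B"
proof -
  interpret F: star_alg "free_star_algebra n" by (rule star_alg_free)
  let ?F = "free_star_algebra n"
  let ?adm = "\<lambda>q. cstar_seminorm (free_star_algebra n) q \<and> (\<forall>r\<in>nc_torus_relations n \<theta>. q r = 0)"
  have pre: "cstar_pre ?F q" if "?adm q" for q using that by unfold_locales simp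
  have gb: "q (gen j) \<le> 1" "q (star ?F (gen j)) \<le> 1" if q: "?adm q" and j: "j < n" for q j
  proof -
    interpret q: cstar_pre ?F q by (rule pre[OF q])
    have g: "gen j \<in> carrier ?F" using free_gen_carrier[OF j] .
    have "q (star ?F (gen j) \<otimes>\<^bsub>?F\<^esub> gen j) \<le> q (star ?F (gen j) \<otimes>\<^bsub>?F\<^esub> gen j \<ominus>\<^bsub>?F\<^esub> \<one>\<^bsub>?F\<^esub>) + q \<one>\<^bsub>?F\<^esub>"
      using g by (intro q.p_le_minus) auto
    also have "q (star ?F (gen j) \<otimes>\<^bsub>?F\<^esub> gen j \<ominus>\<^bsub>?F\<^esub> \<one>\<^bsub>?F\<^esub>) = 0"
      using conjunct2[OF q] j unfolding torus_relations_iff Let_def by blast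
    finally have "(q (gen j))\<^sup>2 \<le> 1" using q.p_cstar[OF g] q.p_one_le by simp
    then show "q (gen j) \<le> 1" using power2_le_imp_le[of "q (gen j)" 1] by simp
    then show "q (star ?F (gen j)) \<le> 1" using q.p_star[OF g] by simp
  qed
  show ?thesis using assms
  proof (induction rule: free_induct)
    case (add x y)
    then obtain B C where "\<forall>q. ?adm q \<longrightarrow> q x \<le> B" "\<forall>q. ?adm q \<longrightarrow> q y \<le> C" by meson
    then have "\<forall>q. ?adm q \<longrightarrow> q (x \<oplus>\<^bsub>?F\<^esub> y) \<le> B + C"
      using cstar_pre.p_add[OF pre add(1,2)] by (meson add_mono order_trans)
    then show ?case by blast
  next
    case (smult c x)
    then obtain B where "\<forall>q. ?adm q \<longrightarrow> q x \<le> B" by meson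
    then have "\<forall>q. ?adm q \<longrightarrow> q (c \<odot>\<^bsub>?F\<^esub> x) \<le> cmod c * B"
      using cstar_pre.p_smult[OF pre smult(1)] by (metis mult_left_mono norm_ge_zero)
    then show ?case by blast
  next
    case one
    then show ?case using cstar_pre.p_one_le[OF pre] by blast
  next
    case (gen_mult j x)
    then obtain B where "\<forall>q. ?adm q \<longrightarrow> q x \<le> B" by meson
    moreover have "q (gen j \<otimes>\<^bsub>?F\<^esub> x) \<le> q x" if "?adm q" for q
      using cstar_pre.p_mult[OF pre[OF that] free_gen_carrier[OF gen_mult(1)] gen_mult(2)] gb(1)[OF that gen_mult(1)]
        mult_right_mono[of "q (gen j)" 1 "q x"] cstar_pre.p_nonneg[OF pre[OF that] gen_mult(2)] by simp
    ultimately show ?case by (meson order_trans)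
  next
    case (star_gen_mult j x)
    then obtain B where "\<forall>q. ?adm q \<longrightarrow> q x \<le> B" by meson
    moreover have "q (star ?F (gen j) \<otimes>\<^bsub>?F\<^esub> x) \<le> q x" if "?adm q" for q
      using cstar_pre.p_mult[OF pre[OF that] F.star_closed[OF free_gen_carrier[OF star_gen_mult(1)]] star_gen_mult(2)] gb(2)[OF that star_gen_mult(1)]
        mult_right_mono[of "q (star ?F (gen j))" 1 "q x"] cstar_pre.p_nonneg[OF pre[OF that] star_gen_mult(2)] by simp
    ultimately show ?case by (meson order_trans)
  qed
qed

abbreviation torus_seminorm :: "nat => real mat => ((nat \<times> bool) list \<Rightarrow>\<^sub>0 complex) => real" where
  "torus_seminorm n \<theta> \<equiv> max_cstar_seminorm (free_star_algebra n) (nc_torus_relations n \<theta>)"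

lemma cstar_pre_torus: "cstar_pre (free_star_algebra n) (torus_seminorm n \<theta>)"
  by (rule star_alg.cstar_pre_max[OF star_alg_free torus_bounded])

interpretation tor: cstar_pre "free_star_algebra n" "torus_seminorm n \<theta>" for n \<theta> by (rule cstar_pre_torus)

lemma nc_torus_eq: "nc_torus n \<theta> = tor.Compl n \<theta>"
  by (simp add: nc_torus_def universal_cstar_algebra_def)

definition torus_norm :: "nat => real mat => _ => real" where "torus_norm n \<theta> = tor.cnorm n \<theta>"

definition tgen :: "nat => real mat => nat => (nat => ((nat \<times> bool) list \<Rightarrow>\<^sub>0 complex)) set" where
  "tgen n \<theta> j = tor.emb n \<theta> (gen j)"

lemma cstar_alg_torus: "cstar_alg (nc_torus n \<theta>) (torus_norm n \<theta>)"
  unfolding nc_torus_eq torus_norm_def by (rule tor.cstar_alg_Compl)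

lemma star_alg_torus: "star_alg (nc_torus n \<theta>)"
  unfolding nc_torus_eq by (rule tor.star_alg_Compl)

lemma torus_tuple_tgen: "torus_tuple (nc_torus n \<theta>) n \<theta> (tgen n \<theta>)"
proof -
  interpret F: star_alg "free_star_algebra n" by (rule star_alg_free)
  let ?F = "free_star_algebra n"
  note h = tor.emb_star_hom[of n \<theta>, folded nc_torus_eq]
  have eq: "tor.emb n \<theta> x = tor.emb n \<theta> y"
    if "x \<ominus>\<^bsub>?F\<^esub> y \<in> nc_torus_relations n \<theta>" "x \<in> carrier ?F" "y \<in> carrier ?F" for x y
    using star_alg.max_seminorm_relations[OF star_alg_free torus_bounded that(1)] that by (simp add: tor.cls_eq)
  have rel: "\<forall>r\<in>nc_torus_relations n \<theta>. r \<in> nc_torus_relations n \<theta>" by blast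
  note rel = rel[unfolded torus_relations_iff Let_def]
  show ?thesis unfolding torus_tuple_def tgen_def
  proof (intro conjI allI impI)
    fix j assume j: "j < n"
    note gj = free_gen_carrier[OF j]
    show "tor.emb n \<theta> (gen j) \<in> carrier (nc_torus n \<theta>)" using star_homD(1)[OF h gj] .
    have "tor.emb n \<theta> (star ?F (gen j) \<otimes>\<^bsub>?F\<^esub> gen j) = tor.emb n \<theta> \<one>\<^bsub>?F\<^esub>"
      by (rule eq) (use rel j gj in auto)
    then show "star (nc_torus n \<theta>) (tor.emb n \<theta> (gen j)) \<otimes>\<^bsub>nc_torus n \<theta>\<^esub> tor.emb n \<theta> (gen j) = \<one>\<^bsub>nc_torus n \<theta>\<^esub>"
      using gj by (simp add: star_homD[OF h])
    have "tor.emb n \<theta> (gen j \<otimes>\<^bsub>?F\<^esub> star ?F (gen j)) = tor.emb n \<theta> \<one>\<^bsub>?F\<^esub>"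
      by (rule eq) (use rel j gj in auto)
    then show "tor.emb n \<theta> (gen j) \<otimes>\<^bsub>nc_torus n \<theta>\<^esub> star (nc_torus n \<theta>) (tor.emb n \<theta> (gen j)) = \<one>\<^bsub>nc_torus n \<theta>\<^esub>"
      using gj by (simp add: star_homD[OF h])
    fix k assume k: "k < n"
    note gk = free_gen_carrier[OF k]
    have "tor.emb n \<theta> (gen k \<otimes>\<^bsub>?F\<^esub> gen j) = tor.emb n \<theta> (phase (\<theta> $$ (j, k)) \<odot>\<^bsub>?F\<^esub> (gen j \<otimes>\<^bsub>?F\<^esub> gen k))"
      by (rule eq) (use rel j k gj gk in auto)
    then show "tor.emb n \<theta> (gen k) \<otimes>\<^bsub>nc_torus n \<theta>\<^esub> tor.emb n \<theta> (gen j) =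
        phase (\<theta> $$ (j, k)) \<odot>\<^bsub>nc_torus n \<theta>\<^esub> (tor.emb n \<theta> (gen j) \<otimes>\<^bsub>nc_torus n \<theta>\<^esub> tor.emb n \<theta> (gen k))"
      using gj gk by (simp add: star_homD[OF h])
  qed
qed

text \<open>The map from the free algebra induced by \<open>u\<close> pulls the norm of \<open>D\<close> back to a C*-seminorm that
  vanishes on the relations.  It is therefore contractive for the largest one, and extends.\<close>

lemma torus_universal:
  assumes D: "cstar_alg D q" and u: "torus_tuple D n \<theta> u"
  obtains f where "f \<in> star_hom (nc_torus n \<theta>) D" "\<And>j. j < n ==> f (tgen n \<theta> j) = u j"
    "\<And>x. x \<in> carrier (nc_torus n \<theta>) ==> q (f x) \<le> torus_norm n \<theta> x"
proof -
  interpret D: cstar_alg D q by fact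
  interpret F: star_alg "free_star_algebra n" by (rule star_alg_free)
  let ?F = "free_star_algebra n"
  define l where "l = (\<lambda>(j, b). if b then star D (u j) else u j)"
  define W where "W w = foldr (\<lambda>a x. l a \<otimes>\<^bsub>D\<^esub> x) w \<one>\<^bsub>D\<^esub>" for w
  note uc = torus_tupleD(1)[OF u]
  have lc: "l a \<in> carrier D" if "a \<in> {..<n} \<times> UNIV" for a using that uc by (auto simp: l_def)
  have Wc: "w \<in> lists ({..<n} \<times> UNIV) ==> W w \<in> carrier D" for w
    by (induction w) (auto simp: W_def lc)
  have Wm: "W (v @ w) = W v \<otimes>\<^bsub>D\<^esub> W w" if "v \<in> lists ({..<n} \<times> UNIV)" "w \<in> lists ({..<n} \<times> UNIV)" for v w
    using that(1) that(2)[THEN Wc] by (induction v) (auto simp: W_def lc Wc[unfolded W_def] D.m_assoc)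
  have Ws: "W (word_star w) = star D (W w)" if "w \<in> lists ({..<n} \<times> UNIV)" for w
    using that
  proof (induction w)
    case Nil then show ?case by (simp add: W_def)
  next
    case (Cons a w)
    obtain j b where a: "a = (j, b)" by (cases a)
    have ws: "word_star w \<in> lists ({..<n} \<times> UNIV)" using Cons by (auto simp: in_lists_conv_set)
    have "W (word_star (a # w)) = W (word_star w) \<otimes>\<^bsub>D\<^esub> W [(j, \<not> b)]"
      using ws Cons by (simp add: a Wm)
    also have "\<dots> = star D (W w) \<otimes>\<^bsub>D\<^esub> star D (l a)" using Cons uc by (simp add: W_def l_def a)
    also have "\<dots> = star D (W (a # w))" using Cons Wc[of w] lc[of a] by (simp add: W_def D.star_mult)
    finally show ?case .
  qed
  define f where "f = D.lin W"
  have f: "f \<in> star_hom ?F D" and fw: "\<And>w. w \<in> lists ({..<n} \<times> UNIV) ==> f (basis_elem w) = W w"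
    unfolding f_def free_star_algebra_def
    using D.lin_star_hom[OF star_monoid_words, of W n] Wc Wm Ws by (auto simp: W_def)
  have fg: "f (gen j) = u j" if "j < n" for j using fw[of "[(j, False)]"] that uc by (simp add: W_def l_def)
  note fc = star_homD[OF f]
  have fm: "f (a \<ominus>\<^bsub>?F\<^esub> b) = f a \<ominus>\<^bsub>D\<^esub> f b" if "a \<in> carrier ?F" "b \<in> carrier ?F" for a b
    by (rule star_hom_minus[OF star_alg_free D.star_alg_axioms f that])
  have "cstar_seminorm ?F (\<lambda>x. q (f x))"
    unfolding cstar_seminorm_def
    using fc D.p_smult D.p_add D.p_mult D.p_cstar by auto
  moreover have "\<forall>r\<in>nc_torus_relations n \<theta>. q (f r) = 0"
    unfolding torus_relations_iff Let_def
  proof (intro conjI allI impI)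
    fix j assume j: "j < n"
    note g = free_gen_carrier[OF j] and uj = torus_tupleD(1-3)[OF u j]
    have gs: "star ?F (gen j) \<in> carrier ?F" using g by simp
    have "f (star ?F (gen j) \<otimes>\<^bsub>?F\<^esub> gen j) = \<one>\<^bsub>D\<^esub>" "f (gen j \<otimes>\<^bsub>?F\<^esub> star ?F (gen j)) = \<one>\<^bsub>D\<^esub>"
      unfolding fc(2)[OF g gs] fc(2)[OF gs g] fc(6)[OF g] fg[OF j] using uj by simp_all
    then show "q (f (star ?F (gen j) \<otimes>\<^bsub>?F\<^esub> gen j \<ominus>\<^bsub>?F\<^esub> \<one>\<^bsub>?F\<^esub>)) = 0"
      "q (f (gen j \<otimes>\<^bsub>?F\<^esub> star ?F (gen j) \<ominus>\<^bsub>?F\<^esub> \<one>\<^bsub>?F\<^esub>)) = 0"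
      using g gs by (simp_all add: fm fc(4))
    fix k assume k: "k < n"
    note gk = free_gen_carrier[OF k]
    have c: "u j \<otimes>\<^bsub>D\<^esub> u k \<in> carrier D" using uj torus_tupleD(1)[OF u k] by simp
    have "f (gen k \<otimes>\<^bsub>?F\<^esub> gen j) = f (phase (\<theta> $$ (j, k)) \<odot>\<^bsub>?F\<^esub> (gen j \<otimes>\<^bsub>?F\<^esub> gen k))"
      using torus_tupleD(4)[OF u j k] g gk by (simp add: fc(2,5) fg j k)
    moreover have "f (gen k \<otimes>\<^bsub>?F\<^esub> gen j) \<in> carrier D" using g gk by (intro fc(1)) simp
    ultimately show "q (f (gen k \<otimes>\<^bsub>?F\<^esub> gen j \<ominus>\<^bsub>?F\<^esub> phase (\<theta> $$ (j, k)) \<odot>\<^bsub>?F\<^esub> (gen j \<otimes>\<^bsub>?F\<^esub> gen k))) = 0"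
      using g gk by (simp add: fm)
  qed
  ultimately have le: "q (f x) \<le> torus_seminorm n \<theta> x" if "x \<in> carrier ?F" for x
    using star_alg.max_seminorm_ge[OF star_alg_free torus_bounded that, where q = "\<lambda>x. q (f x)"] by simp
  obtain G where G: "G \<in> star_hom (tor.Compl n \<theta>) D" "\<And>a. a \<in> carrier ?F ==> G (tor.emb n \<theta> a) = f a"
    "\<And>X. X \<in> carrier (tor.Compl n \<theta>) ==> q (G X) \<le> tor.cnorm n \<theta> X"
    using tor.extension_to_completion[OF D f le] by blast
  show ?thesis
    by (rule that[of G]) (use G in "auto simp: nc_torus_eq torus_norm_def tgen_def free_gen_carrier fg")
qed

text \<open>The polynomials in the generators and their adjoints are dense.\<close>

lemma torus_induct [consumes 1, case_names gen star_gen one add smult mult lim]: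
  assumes x: "x \<in> carrier (nc_torus n \<theta>)"
    and "\<And>j. j < n ==> Q (tgen n \<theta> j)" "\<And>j. j < n ==> Q (star (nc_torus n \<theta>) (tgen n \<theta> j))"
    and "Q \<one>\<^bsub>nc_torus n \<theta>\<^esub>"
    and "\<And>x y. x \<in> carrier (nc_torus n \<theta>) ==> y \<in> carrier (nc_torus n \<theta>) ==> Q x ==> Q y ==> Q (x \<oplus>\<^bsub>nc_torus n \<theta>\<^esub> y)"
    and "\<And>c x. x \<in> carrier (nc_torus n \<theta>) ==> Q x ==> Q (c \<odot>\<^bsub>nc_torus n \<theta>\<^esub> x)"
    and "\<And>x y. x \<in> carrier (nc_torus n \<theta>) ==> y \<in> carrier (nc_torus n \<theta>) ==> Q x ==> Q y ==> Q (x \<otimes>\<^bsub>nc_torus n \<theta>\<^esub> y)"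
    and lim: "\<And>Y Z. [|\<And>i. Y i \<in> carrier (nc_torus n \<theta>); \<And>i. Q (Y i); Z \<in> carrier (nc_torus n \<theta>);
      cstar_pre.conv (nc_torus n \<theta>) (torus_norm n \<theta>) Y Z|] ==> Q Z"
  shows "Q x"
proof -
  interpret F: star_alg "free_star_algebra n" by (rule star_alg_free)
  note h = tor.emb_star_hom[of n \<theta>, folded nc_torus_eq]
  note hD = star_homD[OF h]
  have e: "Q (tor.emb n \<theta> a)" if "a \<in> carrier (free_star_algebra n)" for a
    using that
  proof (induction rule: free_induct)
    case (gen_mult j x)
    have gj: "gen j \<in> carrier (free_star_algebra n)" by (rule free_gen_carrier[OF gen_mult(1)])
    have "Q (tgen n \<theta> j \<otimes>\<^bsub>nc_torus n \<theta>\<^esub> tor.emb n \<theta> x)"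
      by (rule assms(7)) (use gen_mult gj assms(2) hD(1) in "auto simp: tgen_def")
    then show ?case unfolding hD(2)[OF gj gen_mult(2)] tgen_def .
  next
    case (star_gen_mult j x)
    have gj: "gen j \<in> carrier (free_star_algebra n)" by (rule free_gen_carrier[OF star_gen_mult(1)])
    have "Q (star (nc_torus n \<theta>) (tgen n \<theta> j) \<otimes>\<^bsub>nc_torus n \<theta>\<^esub> tor.emb n \<theta> x)"
      by (rule assms(7)) (use star_gen_mult gj assms(3) hD(1) star_alg.star_closed[OF star_alg_torus] in "auto simp: tgen_def")
    then show ?case unfolding hD(2)[OF star_alg.star_closed[OF star_alg_free gj] star_gen_mult(2)] hD(6)[OF gj] tgen_def .
  next
    case (add x y)
    show ?case unfolding hD(3)[OF add(1,2)] by (rule assms(5)) (use add hD(1) in auto)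
  next
    case (smult c x)
    show ?case unfolding hD(5)[OF smult(1)] by (rule assms(6)) (use smult hD(1) in auto)
  next
    case one
    show ?case unfolding hD(4) by (rule assms(4))
  qed
  show ?thesis using x unfolding nc_torus_eq
  proof (induction rule: tor.Compl_induct)
    case (lim Y Z) then show ?case using assms(8)[of Y Z] by (simp add: nc_torus_eq torus_norm_def)
  qed (rule e)
qed

text \<open>The elements on which two contractive *-homomorphisms agree form a closed *-subalgebra.\<close>

lemma torus_hom_unique:
  assumes D: "cstar_alg D q" and f: "f \<in> star_hom (nc_torus n \<theta>) D" and g: "g \<in> star_hom (nc_torus n \<theta>) D"
    and fq: "\<And>x. x \<in> carrier (nc_torus n \<theta>) ==> q (f x) \<le> torus_norm n \<theta> x"
    and gq: "\<And>x. x \<in> carrier (nc_torus n \<theta>) ==> q (g x) \<le> torus_norm n \<theta> x"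
    and eq: "\<And>j. j < n ==> f (tgen n \<theta> j) = g (tgen n \<theta> j)" and x: "x \<in> carrier (nc_torus n \<theta>)"
  shows "f x = g x"
proof -
  interpret D: cstar_alg D q by fact
  interpret A: cstar_alg "nc_torus n \<theta>" "torus_norm n \<theta>" by (rule cstar_alg_torus)
  note fD = star_homD[OF f] and gD = star_homD[OF g] and tg = torus_tupleD(1)[OF torus_tuple_tgen]
  have cv: "D.conv (\<lambda>i. h (Y i)) (h Z)" if "h \<in> star_hom (nc_torus n \<theta>) D"
    "\<And>x. x \<in> carrier (nc_torus n \<theta>) ==> q (h x) \<le> torus_norm n \<theta> x"
    "\<And>i. Y i \<in> carrier (nc_torus n \<theta>)" "Z \<in> carrier (nc_torus n \<theta>)" "A.conv Y Z" for h Y Z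
  proof (rule D.conv_null[where f = "\<lambda>i. torus_norm n \<theta> (Y i \<ominus>\<^bsub>nc_torus n \<theta>\<^esub> Z)"])
    show "q (h (Y i) \<ominus>\<^bsub>D\<^esub> h Z) \<le> torus_norm n \<theta> (Y i \<ominus>\<^bsub>nc_torus n \<theta>\<^esub> Z)" for i
      using star_hom_minus[OF A.star_alg_axioms D.star_alg_axioms that(1) that(3,4)] that(2)[of "Y i \<ominus>\<^bsub>nc_torus n \<theta>\<^esub> Z"] that(3,4) by simp
  qed (use that star_homD(1)[OF that(1)] in "auto simp: A.conv_def")
  show ?thesis using x
  proof (induction rule: torus_induct)
    case (lim Y Z)
    have "D.conv (\<lambda>i. f (Y i)) (f Z)" "D.conv (\<lambda>i. g (Y i)) (g Z)" using cv[OF f fq lim(1-3)] cv[OF g gq lim(1-3)] by blast+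
    moreover have "(\<lambda>i. g (Y i)) = (\<lambda>i. f (Y i))" using lim(4) by simp
    ultimately show ?case using D.conv_unique[of "\<lambda>i. f (Y i)" "f Z" "g Z"] lim(1,2) fD(1) gD(1) by simp
  next
    case (gen j) then show ?case by (rule eq)
  next
    case (star_gen j)
    have t: "tgen n \<theta> j \<in> carrier (nc_torus n \<theta>)" by (rule tg[OF star_gen])
    show ?case unfolding fD(6)[OF t] gD(6)[OF t] eq[OF star_gen] ..
  next
    case one show ?case by (simp only: fD(4) gD(4))
  next
    case (add x y) then show ?case by (simp only: fD(3) gD(3))
  next
    case (smult c x) then show ?case by (simp only: fD(5) gD(5))
  next
    case (mult x y) then show ?case by (simp only: fD(2) gD(2))
  qed
qed

section \<open>The universal property of the tensor product\<close>

text \<open>The axioms are equations, up to the existence of additive inverses, and pass to surjective images.\<close>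

lemma star_alg_surj_image:
  assumes "star_alg S" and im: "carrier T = f ` carrier S"
    and f: "\<And>x y. x \<in> carrier S ==> y \<in> carrier S ==> f x \<otimes>\<^bsub>T\<^esub> f y = f (x \<otimes>\<^bsub>S\<^esub> y)"
      "\<And>x y. x \<in> carrier S ==> y \<in> carrier S ==> f x \<oplus>\<^bsub>T\<^esub> f y = f (x \<oplus>\<^bsub>S\<^esub> y)"
      "\<one>\<^bsub>T\<^esub> = f \<one>\<^bsub>S\<^esub>" "\<zero>\<^bsub>T\<^esub> = f \<zero>\<^bsub>S\<^esub>"
      "\<And>c x. x \<in> carrier S ==> c \<odot>\<^bsub>T\<^esub> f x = f (c \<odot>\<^bsub>S\<^esub> x)"
      "\<And>x. x \<in> carrier S ==> star T (f x) = f (star S x)"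
  shows "star_alg T"
proof -
  interpret S: star_alg S by fact
  have ag: "abelian_group T"
  proof (rule abelian_groupI)
    fix X assume "X \<in> carrier T"
    then obtain x where x: "x \<in> carrier S" "X = f x" by (auto simp: im)
    then show "\<exists>Y\<in>carrier T. Y \<oplus>\<^bsub>T\<^esub> X = \<zero>\<^bsub>T\<^esub>"
      by (intro bexI[of _ "f (\<ominus>\<^bsub>S\<^esub> x)"]) (auto simp: im f S.l_neg)
  qed (auto simp: im f S.a_ac)
  have mo: "monoid T" by (rule monoidI) (auto simp: im f S.m_assoc)
  have "ring T" by (rule ringI[OF ag mo]) (auto simp: im f S.l_distr S.r_distr)
  then interpret T: ring T .
  show ?thesis
    by unfold_locales (auto simp: im f S.smult_l_distr S.smult_r_distr S.smult_smult
      S.smult_mult_l S.smult_mult_r S.star_add S.star_mult S.star_smult)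
qed

locale tensor = A: star_alg A + B: star_alg B
  for A :: "('a, 'm) star_algebra_scheme" and B :: "('b, 'n) star_algebra_scheme"
begin

lemma star_monoid_pairs: "star_monoid (A \<times>\<times> B) (map_prod (star A) (star B))"
proof -
  interpret monoid "A \<times>\<times> B" by (rule DirProd_monoid) unfold_locales
  show ?thesis by unfold_locales (auto simp: A.star_mult B.star_mult)
qed

sublocale P: star_monoid "A \<times>\<times> B" "map_prod (star A) (star B)" by (rule star_monoid_pairs)

abbreviation "F \<equiv> P.MA"
abbreviation "R \<equiv> bilinear_relations A B"
abbreviation "I \<equiv> Idl\<^bsub>F\<^esub> R"
abbreviation "T \<equiv> A \<otimes>\<^sub>* B"

lemma star_alg_F: "star_alg F" by (rule P.star_alg_MA)

sublocale F: star_alg F by (rule star_alg_F)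

lemma F_carrier: "x \<in> carrier F \<longleftrightarrow> keys x \<subseteq> carrier A \<times> carrier B"
  by (simp add: P.MA_simps)

lemma single_F [simp]: "a \<in> carrier A ==> b \<in> carrier B ==> single (a, b) c \<in> carrier F"
  by (simp add: F_carrier)

lemma F_minus: assumes "x \<in> carrier F" "y \<in> carrier F" shows "x \<ominus>\<^bsub>F\<^esub> y = x - y"
proof -
  have "(-1) \<odot>\<^bsub>F\<^esub> y = - y"
    by (rule poly_mapping_eqI) (simp add: P.MA_simps lookup_map_times)
  then show ?thesis using F.minus_as_smult[OF assms] by (simp add: P.MA_simps)
qed

lemma F_add_closed: "x \<in> carrier F ==> y \<in> carrier F ==> x + y \<in> carrier F"
  using F.add.m_closed[of x y] by (simp add: P.MA_simps)

lemma R_cases [consumes 1, case_names 1 2 3 4]: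
  assumes "r \<in> R"
  obtains (1) a a' b where "a \<in> carrier A" "a' \<in> carrier A" "b \<in> carrier B"
        "r = basis_elem (a \<oplus>\<^bsub>A\<^esub> a', b) - (basis_elem (a, b) + basis_elem (a', b))"
    | (2) a b b' where "a \<in> carrier A" "b \<in> carrier B" "b' \<in> carrier B"
        "r = basis_elem (a, b \<oplus>\<^bsub>B\<^esub> b') - (basis_elem (a, b) + basis_elem (a, b'))"
    | (3) a b c where "a \<in> carrier A" "b \<in> carrier B" "r = basis_elem (c \<odot>\<^bsub>A\<^esub> a, b) - single (a, b) c"
    | (4) a b c where "a \<in> carrier A" "b \<in> carrier B" "r = basis_elem (a, c \<odot>\<^bsub>B\<^esub> b) - single (a, b) c"
  using assms unfolding bilinear_relations_def
  by (elim UnE CollectE exE conjE)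
     ((rule that(1); assumption) | (rule that(2); assumption) | (rule that(3); assumption) | (rule that(4); assumption))+

lemma R_intros:
  "a \<in> carrier A ==> a' \<in> carrier A ==> b \<in> carrier B ==>
    basis_elem (a \<oplus>\<^bsub>A\<^esub> a', b) - (basis_elem (a, b) + basis_elem (a', b)) \<in> R"
  "a \<in> carrier A ==> b \<in> carrier B ==> b' \<in> carrier B ==>
    basis_elem (a, b \<oplus>\<^bsub>B\<^esub> b') - (basis_elem (a, b) + basis_elem (a, b')) \<in> R"
  "a \<in> carrier A ==> b \<in> carrier B ==> basis_elem (c \<odot>\<^bsub>A\<^esub> a, b) - single (a, b) c \<in> R"
  "a \<in> carrier A ==> b \<in> carrier B ==> basis_elem (a, c \<odot>\<^bsub>B\<^esub> b) - single (a, b) c \<in> R"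
  unfolding bilinear_relations_def Un_iff mem_Collect_eq by metis+

lemma R_subset: "R \<subseteq> carrier F"
proof -
  have m: "x - y \<in> carrier F" if "x \<in> carrier F" "y \<in> carrier F" for x y
    using F_minus[OF that] F.minus_closed[OF that] by simp
  show ?thesis by (auto elim!: R_cases intro!: m F_add_closed single_F A.a_closed B.a_closed A.smult_closed B.smult_closed simp del: partial_object.simps)
qed

lemma ideal_I: "ideal I F" by (rule F.genideal_ideal[OF R_subset])

lemma I_subset: "x \<in> I ==> x \<in> carrier F"
  using ideal.Icarr[OF ideal_I] .

lemma R_I: "R \<subseteq> I" by (rule F.genideal_self[OF R_subset])

lemma I_smult: "x \<in> I ==> c \<odot>\<^bsub>F\<^esub> x \<in> I"
  using ideal.I_l_closed[OF ideal_I, of x "c \<odot>\<^bsub>F\<^esub> \<one>\<^bsub>F\<^esub>"] I_subset[of x] by (simp add: F.smult_mult_l)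

lemma kernel_I:
  assumes "star_alg D" "f \<in> star_hom F D" "\<And>r. r \<in> R ==> f r = \<zero>\<^bsub>D\<^esub>" "x \<in> I" shows "f x = \<zero>\<^bsub>D\<^esub>"
proof -
  interpret D: star_alg D by fact
  have "f \<in> Ring.ring_hom F D" using assms(2) by (simp add: star_hom_def)
  then have "ring_hom_ring F D f" by (intro ring_hom_ringI2) unfold_locales
  then have "ideal (a_kernel F D f) F" by (rule ring_hom_ring.kernel_is_ideal)
  moreover have "R \<subseteq> a_kernel F D f" using assms(3) R_subset by (auto simp: a_kernel_def')
  ultimately have "I \<subseteq> a_kernel F D f" by (rule F.genideal_minimal)
  then show ?thesis using assms(4) by (auto simp: a_kernel_def')
qed

lemma star_R: assumes "r \<in> R" shows "star F r \<in> R"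
proof -
  have sm: "star F (x - y) = star F x - star F y" if "x \<in> carrier F" "y \<in> carrier F" for x y
    using F.star_minus[OF that] F_minus[OF that] F_minus[of "star F x" "star F y"] that by simp
  note s = P.MA_star_add P.MA_star_single map_prod_simp complex_cnj_one
  from assms show ?thesis
  proof (cases rule: R_cases)
    case (1 a a' b)
    then have "star F r = basis_elem (star A a \<oplus>\<^bsub>A\<^esub> star A a', star B b) - (basis_elem (star A a, star B b) + basis_elem (star A a', star B b))"
      unfolding 1(4) sm[OF single_F[OF A.a_closed[OF 1(1,2)] 1(3)] F_add_closed[OF single_F[OF 1(1,3)] single_F[OF 1(2,3)]]]
      by (simp only: s A.star_add[OF 1(1,2)])
    then show ?thesis using 1(1-3) by (simp only: R_intros A.star_closed B.star_closed)
  next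
    case (2 a b b')
    then have "star F r = basis_elem (star A a, star B b \<oplus>\<^bsub>B\<^esub> star B b') - (basis_elem (star A a, star B b) + basis_elem (star A a, star B b'))"
      unfolding 2(4) sm[OF single_F[OF 2(1) B.a_closed[OF 2(2,3)]] F_add_closed[OF single_F[OF 2(1,2)] single_F[OF 2(1,3)]]]
      by (simp only: s B.star_add[OF 2(2,3)])
    then show ?thesis using 2(1-3) by (simp only: R_intros A.star_closed B.star_closed)
  next
    case (3 a b c)
    then have "star F r = basis_elem (cnj c \<odot>\<^bsub>A\<^esub> star A a, star B b) - single (star A a, star B b) (cnj c)"
      unfolding 3(3) sm[OF single_F[OF A.smult_closed[OF 3(1)] 3(2)] single_F[OF 3(1,2)]]
      by (simp only: s A.star_smult[OF 3(1)])
    then show ?thesis using 3(1-2) by (simp only: R_intros A.star_closed B.star_closed)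
  next
    case (4 a b c)
    then have "star F r = basis_elem (star A a, cnj c \<odot>\<^bsub>B\<^esub> star B b) - single (star A a, star B b) (cnj c)"
      unfolding 4(3) sm[OF single_F[OF 4(1) B.smult_closed[OF 4(2)]] single_F[OF 4(1,2)]]
      by (simp only: s B.star_smult[OF 4(2)])
    then show ?thesis using 4(1-2) by (simp only: R_intros A.star_closed B.star_closed)
  qed
qed

text \<open>The elements whose adjoint lies in \<open>I\<close> form an ideal, which contains the relations.\<close>

lemma star_I: assumes "x \<in> I" shows "star F x \<in> I"
proof -
  interpret I: ideal I F by (rule ideal_I)
  let ?J = "{x \<in> carrier F. star F x \<in> I}"
  have neg: "star F (\<ominus>\<^bsub>F\<^esub> x) = \<ominus>\<^bsub>F\<^esub> star F x" if "x \<in> carrier F" for x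
    using that F.star_smult[of x "-1"] by (simp add: F.smult_minus_one)
  have "ideal ?J F"
  proof (rule idealI)
    show "ring F" by unfold_locales
    show "subgroup ?J (add_monoid F)"
      by (rule F.add.subgroupI)
         (auto simp: F.star_add neg I.a_closed I.a_inv_closed simp flip: a_inv_def intro: exI[of _ "\<zero>\<^bsub>F\<^esub>"] I.zero_closed)
  qed (auto simp: F.star_mult I.I_l_closed I.I_r_closed)
  moreover have "R \<subseteq> ?J" using star_R R_I R_subset by blast
  ultimately have "I \<subseteq> ?J" by (rule F.genideal_minimal)
  then show ?thesis using assms by blast
qed

abbreviation cl where "cl x \<equiv> I +>\<^bsub>F\<^esub> x"

lemma cl_eq_iff: "x \<in> carrier F ==> y \<in> carrier F ==> cl x = cl y \<longleftrightarrow> x \<ominus>\<^bsub>F\<^esub> y \<in> I"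
  using F.quotient_eq_iff_same_a_r_cos[OF ideal_I] by blast

lemma in_cl: "x \<in> carrier F ==> y \<in> cl x \<longleftrightarrow> y \<in> carrier F \<and> y \<ominus>\<^bsub>F\<^esub> x \<in> I"
proof
  interpret I: ideal I F by (rule ideal_I)
  assume x: "x \<in> carrier F"
  { assume "y \<in> cl x"
    then obtain i where i: "i \<in> I" "y = i \<oplus>\<^bsub>F\<^esub> x" by (auto simp: a_r_coset_def')
    then have "y \<ominus>\<^bsub>F\<^esub> x = i" using I_subset x by (simp add: F.minus_eq F.a_assoc F.r_neg)
    then show "y \<in> carrier F \<and> y \<ominus>\<^bsub>F\<^esub> x \<in> I" using i I_subset x by auto }
  { assume y: "y \<in> carrier F \<and> y \<ominus>\<^bsub>F\<^esub> x \<in> I"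
    have "y = (y \<ominus>\<^bsub>F\<^esub> x) \<oplus>\<^bsub>F\<^esub> x" using y x by (simp add: F.minus_eq F.a_assoc F.l_neg)
    then show "y \<in> cl x" using y unfolding a_r_coset_def' by blast }
qed

lemma T_eq: "T = star_quotient F I" by (simp add: star_tensor_def Let_def)

lemma T_carrier: "carrier T = cl ` carrier F"
  by (auto simp: T_eq star_quotient_def FactRing_def A_RCOSETS_def')

lemma T_smult: assumes x: "x \<in> carrier F" shows "c \<odot>\<^bsub>T\<^esub> cl x = cl (c \<odot>\<^bsub>F\<^esub> x)"
proof -
  have "cl (c \<odot>\<^bsub>F\<^esub> y) = cl (c \<odot>\<^bsub>F\<^esub> x)" if "y \<in> cl x" for y
    using that x I_smult[of "y \<ominus>\<^bsub>F\<^esub> x" c] by (simp add: in_cl cl_eq_iff F.smult_minus_distr)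
  moreover have "x \<in> cl x" using x ideal.Icarr[OF ideal_I] additive_subgroup.zero_closed[OF ideal.axioms(1)[OF ideal_I]]
    by (simp add: in_cl)
  moreover have "c \<odot>\<^bsub>T\<^esub> cl x = (\<Union>y\<in>cl x. cl (c \<odot>\<^bsub>F\<^esub> y))" by (simp add: T_eq star_quotient_def)
  ultimately show ?thesis by (metis (no_types, lifting) SUP_eq_const empty_iff)
qed

lemma T_star: assumes x: "x \<in> carrier F" shows "star T (cl x) = cl (star F x)"
proof -
  have "star F ` cl x = cl (star F x)"
  proof (intro equalityI subsetI)
    fix z assume "z \<in> star F ` cl x"
    then obtain y where "y \<in> cl x" "z = star F y" by blast
    then show "z \<in> cl (star F x)" using x star_I[of "y \<ominus>\<^bsub>F\<^esub> x"] by (simp add: in_cl F.star_minus)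
  next
    fix z assume "z \<in> cl (star F x)"
    then have "star F z \<in> cl x" "z = star F (star F z)"
      using x star_I[of "z \<ominus>\<^bsub>F\<^esub> star F x"] by (simp_all add: in_cl F.star_minus)
    then show "z \<in> star F ` cl x" by blast
  qed
  then show ?thesis by (simp add: T_eq star_quotient_def)
qed

lemma T_ops:
  shows "x \<in> carrier F ==> y \<in> carrier F ==> cl x \<otimes>\<^bsub>T\<^esub> cl y = cl (x \<otimes>\<^bsub>F\<^esub> y)"
    and "x \<in> carrier F ==> y \<in> carrier F ==> cl x \<oplus>\<^bsub>T\<^esub> cl y = cl (x \<oplus>\<^bsub>F\<^esub> y)"
    and "\<one>\<^bsub>T\<^esub> = cl \<one>\<^bsub>F\<^esub>" "\<zero>\<^bsub>T\<^esub> = cl \<zero>\<^bsub>F\<^esub>"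
proof -
  note h = ideal.rcos_ring_hom[OF ideal_I]
  show "x \<in> carrier F ==> y \<in> carrier F ==> cl x \<otimes>\<^bsub>T\<^esub> cl y = cl (x \<otimes>\<^bsub>F\<^esub> y)"
    and "x \<in> carrier F ==> y \<in> carrier F ==> cl x \<oplus>\<^bsub>T\<^esub> cl y = cl (x \<oplus>\<^bsub>F\<^esub> y)"
    and "\<one>\<^bsub>T\<^esub> = cl \<one>\<^bsub>F\<^esub>"
    using ring_hom_mult[OF h, of x y] ring_hom_add[OF h, of x y] by (simp_all add: T_eq star_quotient_def FactRing_def)
  have "I = cl \<zero>\<^bsub>F\<^esub>"
    using in_cl[OF F.zero_closed] I_subset by (auto simp: F.minus_eq)
  then show "\<zero>\<^bsub>T\<^esub> = cl \<zero>\<^bsub>F\<^esub>" by (simp add: T_eq star_quotient_def FactRing_def)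
qed

lemma star_alg_T: "star_alg T"
  by (rule star_alg_surj_image[OF star_alg_F T_carrier T_ops T_smult T_star])

definition inA :: "'a => ('a \<times> 'b \<Rightarrow>\<^sub>0 complex) set" where "inA a = cl (basis_elem (a, \<one>\<^bsub>B\<^esub>))"
definition inB :: "'b => ('a \<times> 'b \<Rightarrow>\<^sub>0 complex) set" where "inB b = cl (basis_elem (\<one>\<^bsub>A\<^esub>, b))"

lemma cl_R:
  assumes "x - y \<in> R" "x \<in> carrier F" "y \<in> carrier F" shows "cl x = cl y"
  using assms R_I F_minus cl_eq_iff by auto

lemma F_simps:
  "basis_elem (a, b) \<otimes>\<^bsub>F\<^esub> basis_elem (a', b') = basis_elem (a \<otimes>\<^bsub>A\<^esub> a', b \<otimes>\<^bsub>B\<^esub> b')"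
  "star F (basis_elem (a, b)) = basis_elem (star A a, star B b)"
  "\<one>\<^bsub>F\<^esub> = basis_elem (\<one>\<^bsub>A\<^esub>, \<one>\<^bsub>B\<^esub>)"
  "c \<odot>\<^bsub>F\<^esub> basis_elem (a, b) = single (a, b) c"
  by (simp_all add: P.MA_mult_single P.MA_star_single P.MA_simps map_times_single)

lemma inA_hom: "inA \<in> star_hom A T"
proof (rule star_homI)
  fix a a' assume a: "a \<in> carrier A" "a' \<in> carrier A"
  show "inA (a \<otimes>\<^bsub>A\<^esub> a') = inA a \<otimes>\<^bsub>T\<^esub> inA a'" using a by (simp add: inA_def T_ops F_simps)
  have "inA (a \<oplus>\<^bsub>A\<^esub> a') = cl (basis_elem (a, \<one>\<^bsub>B\<^esub>) + basis_elem (a', \<one>\<^bsub>B\<^esub>))"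
    unfolding inA_def by (rule cl_R) (use a in "simp_all only: R_intros F_add_closed single_F B.one_closed A.a_closed")
  then show "inA (a \<oplus>\<^bsub>A\<^esub> a') = inA a \<oplus>\<^bsub>T\<^esub> inA a'" using a by (simp add: inA_def T_ops P.MA_simps(4))
next
  fix a c assume a: "a \<in> carrier A"
  have "inA (c \<odot>\<^bsub>A\<^esub> a) = cl (single (a, \<one>\<^bsub>B\<^esub>) c)"
    unfolding inA_def by (rule cl_R) (use a in "simp_all only: R_intros single_F B.one_closed A.smult_closed")
  then show "inA (c \<odot>\<^bsub>A\<^esub> a) = c \<odot>\<^bsub>T\<^esub> inA a" using a by (simp add: inA_def T_smult F_simps)
next
  fix a assume a: "a \<in> carrier A"
  show "inA (star A a) = star T (inA a)" using a by (simp add: inA_def T_star F_simps)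
  show "inA a \<in> carrier T" using a by (simp add: inA_def T_carrier)
qed (simp add: inA_def T_ops F_simps)

lemma inB_hom: "inB \<in> star_hom B T"
proof (rule star_homI)
  fix b b' assume b: "b \<in> carrier B" "b' \<in> carrier B"
  show "inB (b \<otimes>\<^bsub>B\<^esub> b') = inB b \<otimes>\<^bsub>T\<^esub> inB b'" using b by (simp add: inB_def T_ops F_simps)
  have "inB (b \<oplus>\<^bsub>B\<^esub> b') = cl (basis_elem (\<one>\<^bsub>A\<^esub>, b) + basis_elem (\<one>\<^bsub>A\<^esub>, b'))"
    unfolding inB_def by (rule cl_R) (use b in "simp_all only: R_intros F_add_closed single_F A.one_closed B.a_closed")
  then show "inB (b \<oplus>\<^bsub>B\<^esub> b') = inB b \<oplus>\<^bsub>T\<^esub> inB b'" using b by (simp add: inB_def T_ops P.MA_simps(4))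
next
  fix b c assume b: "b \<in> carrier B"
  have "inB (c \<odot>\<^bsub>B\<^esub> b) = cl (single (\<one>\<^bsub>A\<^esub>, b) c)"
    unfolding inB_def by (rule cl_R) (use b in "simp_all only: R_intros single_F A.one_closed B.smult_closed")
  then show "inB (c \<odot>\<^bsub>B\<^esub> b) = c \<odot>\<^bsub>T\<^esub> inB b" using b by (simp add: inB_def T_smult F_simps)
next
  fix b assume b: "b \<in> carrier B"
  show "inB (star B b) = star T (inB b)" using b by (simp add: inB_def T_star F_simps)
  show "inB b \<in> carrier T" using b by (simp add: inB_def T_carrier)
qed (simp add: inB_def T_ops F_simps)

lemma in_commute: "a \<in> carrier A ==> b \<in> carrier B ==> inA a \<otimes>\<^bsub>T\<^esub> inB b = inB b \<otimes>\<^bsub>T\<^esub> inA a"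
  by (simp add: inA_def inB_def T_ops F_simps)

lemma inA_inB: "a \<in> carrier A ==> b \<in> carrier B ==> inA a \<otimes>\<^bsub>T\<^esub> inB b = cl (basis_elem (a, b))"
  by (simp add: inA_def inB_def T_ops F_simps)

lemma tensor_induct [consumes 1, case_names inA inB add mult]:
  assumes "x \<in> carrier T"
    and "\<And>a. a \<in> carrier A ==> Q (inA a)" "\<And>b. b \<in> carrier B ==> Q (inB b)"
    and "\<And>x y. x \<in> carrier T ==> y \<in> carrier T ==> Q x ==> Q y ==> Q (x \<oplus>\<^bsub>T\<^esub> y)"
    and "\<And>x y. x \<in> carrier T ==> y \<in> carrier T ==> Q x ==> Q y ==> Q (x \<otimes>\<^bsub>T\<^esub> y)"
  shows "Q x"
proof -
  obtain f where f: "f \<in> carrier F" "x = cl f" using assms(1) by (auto simp: T_carrier)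
  have "keys f \<subseteq> carrier A \<times> carrier B" using f F_carrier by blast
  then have "Q (cl f)"
  proof (induction rule: poly_mapping_keys_induct)
    case zero
    have "cl 0 = inA \<zero>\<^bsub>A\<^esub>" using star_hom_zero[OF A.star_alg_axioms star_alg_T inA_hom] T_ops(4) by (simp add: P.MA_simps)
    then show ?case using assms(2)[of "\<zero>\<^bsub>A\<^esub>"] by simp
  next
    case (single p c)
    obtain a b where p: "p = (a, b)" "a \<in> carrier A" "b \<in> carrier B" using single by (cases p) auto
    have "cl (single p c) = inA (c \<odot>\<^bsub>A\<^esub> a) \<otimes>\<^bsub>T\<^esub> inB b"
      unfolding inA_inB[OF A.smult_closed[OF p(2)] p(3)] p(1)
      by (rule cl_R[symmetric]) (use p in "simp_all only: R_intros single_F A.smult_closed")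
    then show ?case using assms(2)[of "c \<odot>\<^bsub>A\<^esub> a"] assms(3)[OF p(3)] assms(5)[of "inA (c \<odot>\<^bsub>A\<^esub> a)" "inB b"]
        star_homD(1)[OF inA_hom, of "c \<odot>\<^bsub>A\<^esub> a"] star_homD(1)[OF inB_hom p(3)] p by simp
  next
    case (add f g)
    have c: "f \<in> carrier F" "g \<in> carrier F" using add by (auto simp: F_carrier)
    have "cl (f + g) = cl f \<oplus>\<^bsub>T\<^esub> cl g" using T_ops(2)[OF c] by (simp add: P.MA_simps)
    then show ?case using assms(4)[of "cl f" "cl g"] add c by (auto simp: T_carrier)
  qed
  then show ?thesis using f by simp
qed

text \<open>Commuting \<open>f\<close> and \<open>g\<close> make \<open>(a, b) \<mapsto> f a * g b\<close> multiplicative.  Its linear extension kills the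
  bilinearity relations, hence the ideal that they generate.\<close>

lemma tensor_universal:
  assumes D: "star_alg D" and f: "f \<in> star_hom A D" and g: "g \<in> star_hom B D"
    and comm: "\<And>a b. a \<in> carrier A ==> b \<in> carrier B ==> f a \<otimes>\<^bsub>D\<^esub> g b = g b \<otimes>\<^bsub>D\<^esub> f a"
  obtains h where "h \<in> star_hom T D" "\<And>a. a \<in> carrier A ==> h (inA a) = f a" "\<And>b. b \<in> carrier B ==> h (inB b) = g b"
proof -
  interpret D: star_alg D by fact
  note fD = star_homD[OF f] and gD = star_homD[OF g]
  define w where "w = (\<lambda>(a, b). f a \<otimes>\<^bsub>D\<^esub> g b)"
  define L where "L = D.lin w"
  have wm: "w (x \<otimes>\<^bsub>A \<times>\<times> B\<^esub> y) = w x \<otimes>\<^bsub>D\<^esub> w y" if "x \<in> carrier (A \<times>\<times> B)" "y \<in> carrier (A \<times>\<times> B)" for x y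
  proof -
    obtain a b a' b' where xy: "x = (a, b)" "y = (a', b')" by (cases x; cases y)
    then have c: "a \<in> carrier A" "b \<in> carrier B" "a' \<in> carrier A" "b' \<in> carrier B" using that by auto
    have "f a \<otimes>\<^bsub>D\<^esub> f a' \<otimes>\<^bsub>D\<^esub> (g b \<otimes>\<^bsub>D\<^esub> g b') = f a \<otimes>\<^bsub>D\<^esub> (f a' \<otimes>\<^bsub>D\<^esub> g b) \<otimes>\<^bsub>D\<^esub> g b'"
      using c fD(1) gD(1) by (simp add: D.m_assoc)
    also have "\<dots> = f a \<otimes>\<^bsub>D\<^esub> g b \<otimes>\<^bsub>D\<^esub> (f a' \<otimes>\<^bsub>D\<^esub> g b')"
      unfolding comm[OF c(3,2)] using c fD(1) gD(1) by (simp add: D.m_assoc)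
    finally show ?thesis using c by (simp add: w_def xy fD(2) gD(2))
  qed
  have ws: "w (map_prod (star A) (star B) x) = star D (w x)" if "x \<in> carrier (A \<times>\<times> B)" for x
  proof -
    obtain a b where x: "x = (a, b)" by (cases x)
    then have c: "a \<in> carrier A" "b \<in> carrier B" using that by auto
    have "star D (f a \<otimes>\<^bsub>D\<^esub> g b) = g (star B b) \<otimes>\<^bsub>D\<^esub> f (star A a)"
      using c fD(1) gD(1) by (simp add: D.star_mult fD(6) gD(6))
    then show ?thesis using c comm[of "star A a" "star B b"] by (simp add: w_def x)
  qed
  have wc: "w \<in> carrier (A \<times>\<times> B) \<rightarrow> carrier D" and w1: "w \<one>\<^bsub>A \<times>\<times> B\<^esub> = \<one>\<^bsub>D\<^esub>"
    using fD(1,4) gD(1,4) by (auto simp: w_def)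
  have L: "L \<in> star_hom F D" and Lb: "\<And>x. x \<in> carrier (A \<times>\<times> B) ==> L (basis_elem x) = w x"
    unfolding L_def
    using D.lin_star_hom[OF star_monoid_pairs wc w1 wm ws] by blast+
  note LD = star_homD[OF L]
  have Lm: "L (x - y) = L x \<ominus>\<^bsub>D\<^esub> L y" if "x \<in> carrier F" "y \<in> carrier F" for x y
    using star_hom_minus[OF star_alg_F D L that] F_minus[OF that] by simp
  have La: "L (x + y) = L x \<oplus>\<^bsub>D\<^esub> L y" if "x \<in> carrier F" "y \<in> carrier F" for x y
    using LD(3)[OF that] by (simp add: P.MA_simps)
  have Ls: "L (single (a, b) c) = c \<odot>\<^bsub>D\<^esub> (f a \<otimes>\<^bsub>D\<^esub> g b)" if "a \<in> carrier A" "b \<in> carrier B" for a b c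
    using LD(5)[of "basis_elem (a, b)" c] Lb[of "(a, b)"] that by (simp add: F_simps w_def)
  have LR: "L r = \<zero>\<^bsub>D\<^esub>" if "r \<in> R" for r
  proof -
    have z: "L (x - y) = \<zero>\<^bsub>D\<^esub>" if "x \<in> carrier F" "y \<in> carrier F" "L x = L y" for x y
      using Lm[OF that(1,2)] LD(1)[OF that(2)] that(3) by simp
    note cc = F_add_closed single_F A.a_closed B.a_closed A.smult_closed B.smult_closed fD(1) gD(1)
    from \<open>r \<in> R\<close> show ?thesis
    proof (cases rule: R_cases)
      case 1
      show ?thesis unfolding 1(4) by (rule z) (use 1(1-3) in "simp_all only: cc La Ls fD gD D.l_distr D.smult_one D.m_closed D.a_closed")
    next
      case 2
      show ?thesis unfolding 2(4) by (rule z) (use 2(1-3) in "simp_all only: cc La Ls fD gD D.r_distr D.smult_one D.m_closed D.a_closed")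
    next
      case 3
      show ?thesis unfolding 3(3) by (rule z) (use 3(1-2) in "simp_all only: cc Ls fD gD D.smult_mult_l D.smult_one D.m_closed D.smult_closed")
    next
      case 4
      show ?thesis unfolding 4(3) by (rule z) (use 4(1-2) in "simp_all only: cc Ls fD gD D.smult_mult_r D.smult_one D.m_closed D.smult_closed")
    qed
  qed
  define h where "h X = (THE d. \<exists>x\<in>carrier F. X = cl x \<and> d = L x)" for X
  have h: "h (cl x) = L x" if x: "x \<in> carrier F" for x
  proof -
    have "L y = L x" if "y \<in> carrier F" "cl x = cl y" for y
    proof -
      have "y \<ominus>\<^bsub>F\<^esub> x \<in> I" using cl_eq_iff[OF that(1) x] that(2) by metis
      then have "L (y \<ominus>\<^bsub>F\<^esub> x) = \<zero>\<^bsub>D\<^esub>" using kernel_I[OF D L LR] by blast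
      then have "L y \<ominus>\<^bsub>D\<^esub> L x = \<zero>\<^bsub>D\<^esub>" using Lm[OF that(1) x] F_minus[OF that(1) x] by simp
      then show ?thesis by (rule D.eq_if_minus_zero[OF LD(1)[OF that(1)] LD(1)[OF x]])
    qed
    then show ?thesis unfolding h_def using x by (intro the_equality) blast+
  qed
  have "h \<in> star_hom T D"
  proof (rule star_homI)
    fix X assume "X \<in> carrier T"
    then obtain x where x: "x \<in> carrier F" and X: "X = cl x" unfolding T_carrier by blast
    show "h X \<in> carrier D" unfolding X h[OF x] by (rule LD(1)[OF x])
    show "h (c \<odot>\<^bsub>T\<^esub> X) = c \<odot>\<^bsub>D\<^esub> h X" for c
      unfolding X T_smult[OF x] h[OF x] h[OF F.smult_closed[OF x]] by (rule LD(5)[OF x])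
    show "h (star T X) = star D (h X)"
      unfolding X T_star[OF x] h[OF x] h[OF F.star_closed[OF x]] by (rule LD(6)[OF x])
    fix Y assume "Y \<in> carrier T"
    then obtain y where y: "y \<in> carrier F" and Y: "Y = cl y" unfolding T_carrier by blast
    show "h (X \<otimes>\<^bsub>T\<^esub> Y) = h X \<otimes>\<^bsub>D\<^esub> h Y"
      unfolding X Y T_ops(1)[OF x y] h[OF x] h[OF y] h[OF F.m_closed[OF x y]] by (rule LD(2)[OF x y])
    show "h (X \<oplus>\<^bsub>T\<^esub> Y) = h X \<oplus>\<^bsub>D\<^esub> h Y"
      unfolding X Y T_ops(2)[OF x y] h[OF x] h[OF y] h[OF F.a_closed[OF x y]] by (rule LD(3)[OF x y])
  next
    show "h \<one>\<^bsub>T\<^esub> = \<one>\<^bsub>D\<^esub>" unfolding T_ops(3) h[OF F.one_closed] by (rule LD(4))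
  qed
  moreover have "h (inA a) = f a" if "a \<in> carrier A" for a
    using that fD(1) gD(4) by (simp add: inA_def h Lb w_def)
  moreover have "h (inB b) = g b" if "b \<in> carrier B" for b
    using that gD(1) fD(4) by (simp add: inB_def h Lb w_def)
  ultimately show ?thesis using that by blast
qed

end

lemma tensor_cong:
  assumes A: "star_alg A" and A': "star_alg A'" and B: "star_alg B" and iso: "A \<cong>\<^sub>* A'"
  shows "A \<otimes>\<^sub>* B \<cong>\<^sub>* A' \<otimes>\<^sub>* B"
proof -
  interpret t: tensor A B using A B by (simp add: tensor_def)
  interpret t': tensor A' B using A' B by (simp add: tensor_def)
  obtain \<phi> where \<phi>: "\<phi> \<in> star_iso A A'" using iso by (auto simp: cstar_isomorphic_def)
  obtain \<psi> where \<psi>: "\<psi> \<in> star_iso A' A" "\<And>x. x \<in> carrier A ==> \<psi> (\<phi> x) = x" "\<And>y. y \<in> carrier A' ==> \<phi> (\<psi> y) = y"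
    using star_iso_inverse[OF A \<phi>] by blast
  have hom: "\<phi> \<in> star_hom A A'" "\<psi> \<in> star_hom A' A" using \<phi> \<psi> by (auto simp: star_iso_iff)
  obtain h where h: "h \<in> star_hom t.T t'.T" "\<And>a. a \<in> carrier A ==> h (t.inA a) = t'.inA (\<phi> a)" "\<And>b. b \<in> carrier B ==> h (t.inB b) = t'.inB b"
    using t.tensor_universal[OF t'.star_alg_T star_hom_comp[OF hom(1) t'.inA_hom] t'.inB_hom]
      t'.in_commute star_homD(1)[OF hom(1)] by metis
  obtain k where k: "k \<in> star_hom t'.T t.T" "\<And>a. a \<in> carrier A' ==> k (t'.inA a) = t.inA (\<psi> a)" "\<And>b. b \<in> carrier B ==> k (t'.inB b) = t.inB b"
    using t'.tensor_universal[OF t.star_alg_T star_hom_comp[OF hom(2) t.inA_hom] t.inB_hom]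
      t.in_commute star_homD(1)[OF hom(2)] by metis
  note hD = star_homD[OF h(1)] and kD = star_homD[OF k(1)]
  have "k (h x) = x" if "x \<in> carrier t.T" for x using that
  proof (induction rule: t.tensor_induct)
    case (inA a) then show ?case using star_homD(1)[OF hom(1)] by (simp add: h k \<psi>)
  next
    case (inB b) then show ?case by (simp add: h k)
  next
    case (add x y) then show ?case by (simp add: hD(1,3) kD(3))
  next
    case (mult x y) then show ?case by (simp add: hD(1,2) kD(2))
  qed
  moreover have "h (k x) = x" if "x \<in> carrier t'.T" for x using that
  proof (induction rule: t'.tensor_induct)
    case (inA a) then show ?case using star_homD(1)[OF hom(2)] by (simp add: h k \<psi>)
  next
    case (inB b) then show ?case by (simp add: h k)
  next
    case (add x y) then show ?case by (simp add: kD(1,3) hD(3))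
  next
    case (mult x y) then show ?case by (simp add: kD(1,2) hD(2))
  qed
  ultimately show ?thesis using cstar_isomorphicI[OF h(1) k(1) k(1)] by blast
qed

section \<open>Monomials in commuting-up-to-phase unitaries\<close>

text \<open>In the uses below \<open>c\<close> has modulus one; all relations of the torus have this form.\<close>

definition comm_phase :: "('a, 'm) star_algebra_scheme => 'a => 'a => complex => bool" where
  "comm_phase D a b c \<longleftrightarrow> a \<otimes>\<^bsub>D\<^esub> b = c \<odot>\<^bsub>D\<^esub> (b \<otimes>\<^bsub>D\<^esub> a)"

definition unitaries :: "('a, 'm) star_algebra_scheme => 'a set" where
  "unitaries D = {a \<in> carrier D. star D a \<otimes>\<^bsub>D\<^esub> a = \<one>\<^bsub>D\<^esub> \<and> a \<otimes>\<^bsub>D\<^esub> star D a = \<one>\<^bsub>D\<^esub>}"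

definition zpow :: "('a, 'm) star_algebra_scheme => 'a => int => 'a" where
  "zpow D a k = a [^]\<^bsub>units_of D\<^esub> k"

primrec monomial :: "('a, 'm) star_algebra_scheme => nat => (nat => 'a) => (nat => int) => 'a" where
  "monomial D 0 u x = \<one>\<^bsub>D\<^esub>"
| "monomial D (Suc n) u x = monomial D n u x \<otimes>\<^bsub>D\<^esub> zpow D (u n) (x n)"

lemma monomial_cong_gen: "(\<And>j. j < n ==> u j = v j) ==> monomial D n u x = monomial D n v x"
  by (induction n) simp_all

context star_alg
begin

lemma unitariesD: "a \<in> unitaries S ==> a \<in> carrier S" "a \<in> unitaries S ==> star S a \<otimes> a = \<one>"
    "a \<in> unitaries S ==> a \<otimes> star S a = \<one>"
  by (auto simp: unitaries_def)

lemma unitaries_one [simp]: "\<one> \<in> unitaries S" by (simp add: unitaries_def)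

lemma unitaries_mult: assumes "a \<in> unitaries S" "b \<in> unitaries S" shows "a \<otimes> b \<in> unitaries S"
proof -
  note a = unitariesD[OF assms(1)] and b = unitariesD[OF assms(2)]
  have "star S (a \<otimes> b) \<otimes> (a \<otimes> b) = star S b \<otimes> (star S a \<otimes> a) \<otimes> b" using a(1) b(1) by (simp add: star_mult m_assoc)
  moreover have "(a \<otimes> b) \<otimes> star S (a \<otimes> b) = a \<otimes> (b \<otimes> star S b) \<otimes> star S a" using a(1) b(1) by (simp add: star_mult m_assoc)
  ultimately show ?thesis using a b by (simp add: unitaries_def)
qed

lemma unitaries_star: "a \<in> unitaries S ==> star S a \<in> unitaries S"
  by (auto simp: unitaries_def)

lemma unitaries_smult: "a \<in> unitaries S ==> cmod c = 1 ==> c \<odot> a \<in> unitaries S"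
  by (simp add: unitaries_def star_smult smult_mult_l smult_mult_r smult_smult unimodular_mult_cnj)

lemma unitary_Units: assumes "a \<in> unitaries S" shows "a \<in> Units S" "inv a = star S a"
proof -
  note a = unitariesD[OF assms]
  show "a \<in> Units S" using a by (auto simp: Units_def)
  show "inv a = star S a" by (rule inv_unique'[OF a(1) star_closed[OF a(1)] a(3,2), symmetric])
qed

lemma zpow_0 [simp]: "zpow S a 0 = \<one>" by (simp add: zpow_def units_of_one)

lemma zpow_Suc: assumes "a \<in> unitaries S" shows "zpow S a (k + 1) = zpow S a k \<otimes> a"
proof -
  interpret G: group "units_of S" by (rule units_group)
  have "a \<in> carrier (units_of S)" using unitary_Units[OF assms] by (simp add: units_of_carrier)
  then show ?thesis using G.int_pow_mult[of a k 1] by (simp add: zpow_def units_of_mult)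
qed

lemma zpow_pred: assumes "a \<in> unitaries S" shows "zpow S a (k - 1) = zpow S a k \<otimes> star S a"
proof -
  interpret G: group "units_of S" by (rule units_group)
  have "a \<in> carrier (units_of S)" using unitary_Units[OF assms] by (simp add: units_of_carrier)
  then have "zpow S a (k - 1) = zpow S a k \<otimes> inv\<^bsub>units_of S\<^esub> a"
    using G.int_pow_mult[of a k "-1"] by (simp add: zpow_def units_of_mult G.int_pow_neg)
  then show ?thesis using units_of_inv[OF unitary_Units(1)[OF assms]] unitary_Units(2)[OF assms] by simp
qed

lemma zpow_1 [simp]: "a \<in> unitaries S ==> zpow S a 1 = a"
  using zpow_Suc[of a 0] unitariesD(1)[of a] by simp

lemma zpow_unitary [simp]: assumes "a \<in> unitaries S" shows "zpow S a k \<in> unitaries S"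
proof (induction k rule: int_induct[where k = 0])
  case (step1 i) then show ?case using assms by (simp add: zpow_Suc unitaries_mult)
next
  case (step2 i) then show ?case using assms by (simp add: zpow_pred unitaries_mult unitaries_star)
qed simp

lemma zpow_add: assumes "a \<in> unitaries S" shows "zpow S a (k + l) = zpow S a k \<otimes> zpow S a l"
proof -
  interpret G: group "units_of S" by (rule units_group)
  have "a \<in> carrier (units_of S)" using unitary_Units[OF assms] by (simp add: units_of_carrier)
  then show ?thesis using G.int_pow_mult[of a k l] by (simp add: zpow_def units_of_mult)
qed

lemma monomial_unitary: "(\<And>j. j < n ==> u j \<in> unitaries S) ==> monomial S n u x \<in> unitaries S"
  by (induction n) (auto intro!: unitaries_mult)

lemma comm_phase_mult:
  assumes "a \<in> carrier S" "b \<in> carrier S" "b' \<in> carrier S" "comm_phase S a b c" "comm_phase S a b' c'"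
  shows "comm_phase S a (b \<otimes> b') (c * c')"
proof -
  have "a \<otimes> (b \<otimes> b') = (a \<otimes> b) \<otimes> b'" using assms by (simp add: m_assoc)
  also have "\<dots> = c \<odot> (b \<otimes> (a \<otimes> b'))" using assms by (simp add: comm_phase_def smult_mult_l m_assoc)
  also have "\<dots> = (c * c') \<odot> (b \<otimes> b' \<otimes> a)"
    using assms(1-3) assms(5)[unfolded comm_phase_def] by (simp add: smult_mult_r smult_smult m_assoc)
  finally show ?thesis by (simp add: comm_phase_def)
qed

lemma comm_phase_sym:
  assumes "a \<in> carrier S" "b \<in> carrier S" "comm_phase S a b c" "cmod c = 1"
  shows "comm_phase S b a (cnj c)"
  using assms by (simp add: comm_phase_def smult_smult unimodular_mult_cnj)

lemma comm_phase_star: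
  assumes "a \<in> carrier S" "b \<in> unitaries S" "comm_phase S a b c" "cmod c = 1"
  shows "comm_phase S a (star S b) (cnj c)"
proof -
  note b = unitariesD[OF assms(2)]
  have "star S b \<otimes> a = star S b \<otimes> (a \<otimes> b) \<otimes> star S b"
    using b assms(1) by (simp add: m_assoc)
  also have "\<dots> = c \<odot> ((star S b \<otimes> b) \<otimes> a \<otimes> star S b)"
    using b(1) assms(1,3) by (simp add: comm_phase_def smult_mult_l smult_mult_r m_assoc)
  also have "\<dots> = c \<odot> (a \<otimes> star S b)" using b assms(1) by simp
  finally have "comm_phase S (star S b) a c" by (simp add: comm_phase_def)
  then show ?thesis using comm_phase_sym[of "star S b" a c] assms b by simp
qed

lemma comm_phase_one: "a \<in> carrier S ==> comm_phase S a \<one> 1" by (simp add: comm_phase_def)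

lemma comm_phase_zpow:
  assumes a: "a \<in> carrier S" and b: "b \<in> unitaries S" and c: "comm_phase S a b (phase t)"
  shows "comm_phase S a (zpow S b k) (phase (of_int k * t))"
proof (induction k rule: int_induct[where k = 0])
  case base then show ?case using a by (simp add: comm_phase_one)
next
  case (step1 i)
  then show ?case using comm_phase_mult[OF a _ _ step1(2) c] zpow_unitary[OF b, of i] b
    by (simp add: zpow_Suc unitariesD phase_add distrib_right)
next
  case (step2 i)
  have "phase (of_int (i - 1) * t) = phase (of_int i * t) * cnj (phase t)"
    by (simp add: left_diff_distrib phase_diff)
  then show ?case using comm_phase_mult[OF a _ _ step2(2) comm_phase_star[OF a b c]] zpow_unitary[OF b, of i] b
    by (simp add: zpow_pred unitariesD)
qed

lemma comm_phase_monomial: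
  assumes a: "a \<in> carrier S" and u: "\<And>j. j < n ==> u j \<in> unitaries S" and c: "\<And>j. j < n ==> comm_phase S a (u j) (phase (t j))"
  shows "comm_phase S a (monomial S n u x) (phase (\<Sum>j<n. of_int (x j) * t j))"
  using u c
proof (induction n)
  case 0 then show ?case using a by (simp add: comm_phase_one)
next
  case (Suc n)
  have m: "monomial S n u x \<in> carrier S" using Suc.prems by (intro unitariesD(1) monomial_unitary) auto
  have z: "zpow S (u n) (x n) \<in> carrier S" using Suc.prems by (intro unitariesD(1) zpow_unitary) auto
  show ?case using comm_phase_mult[OF a m z Suc.IH comm_phase_zpow[OF a]] Suc.prems
    by (simp add: phase_add)
qed

text \<open>Equality up to a phase.  Products of monomials are monomials only in this sense, and keeping track of
  the phases would be pointless, since they are removed by a gauge automorphism in the end.\<close>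

definition phase_eq (infix "\<doteq>" 50) where "a \<doteq> b \<longleftrightarrow> (\<exists>c. cmod c = 1 \<and> a = c \<odot> b)"

lemma phase_eq_refl: "a \<in> carrier S ==> a \<doteq> a" unfolding phase_eq_def by (metis norm_one smult_one)

lemma phase_eq_trans: "a \<doteq> b ==> b \<doteq> d ==> d \<in> carrier S ==> a \<doteq> d"
  unfolding phase_eq_def by (metis mult_1 norm_mult smult_smult)

lemma phase_eq_mult: assumes "a \<doteq> a'" "b \<doteq> b'" "a' \<in> carrier S" "b' \<in> carrier S" shows "a \<otimes> b \<doteq> a' \<otimes> b'"
proof -
  obtain c d where "cmod c = 1" "a = c \<odot> a'" "cmod d = 1" "b = d \<odot> b'" using assms by (auto simp: phase_eq_def)
  then show ?thesis unfolding phase_eq_def using assms(3,4)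
    by (intro exI[of _ "c * d"]) (simp add: smult_mult_l smult_mult_r smult_smult norm_mult mult.commute)
qed

lemma comm_phase_eq: "comm_phase S a b (phase t) ==> a \<otimes> b \<doteq> b \<otimes> a"
  unfolding comm_phase_def phase_eq_def using norm_phase by blast

lemma phase_eq_star:
  assumes "a \<doteq> b" "b \<in> carrier S" shows "star S a \<doteq> star S b"
proof -
  obtain c where "cmod c = 1" "a = c \<odot> b" using assms by (auto simp: phase_eq_def)
  then show ?thesis unfolding phase_eq_def using assms(2) by (intro exI[of _ "cnj c"]) (simp add: star_smult)
qed

lemma torus_tuple_unitary: "torus_tuple S n \<theta> u ==> j < n ==> u j \<in> unitaries S"
  by (simp add: unitaries_def torus_tupleD)

lemma torus_tuple_comm: "torus_tuple S n \<theta> u ==> j < n ==> k < n ==> comm_phase S (u k) (u j) (phase (\<theta> $$ (j, k)))"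
  unfolding comm_phase_def by (rule torus_tupleD(4))

context
  fixes n \<theta> u assumes u: "torus_tuple S n \<theta> u"
begin

lemma gen_monomial_comm:
  assumes "k < n" "m \<le> n"
  shows "comm_phase S (u k) (monomial S m u x) (phase (\<Sum>j<m. of_int (x j) * \<theta> $$ (j, k)))"
  by (rule comm_phase_monomial) (use assms torus_tupleD(1)[OF u] torus_tuple_unitary[OF u] torus_tuple_comm[OF u] in auto)

lemma monomial_closed: "m \<le> n ==> monomial S m u x \<in> carrier S"
  by (intro unitariesD(1) monomial_unitary) (use torus_tuple_unitary[OF u] in auto)

lemma monomial_gen_comm:
  assumes "k < n" "m \<le> n"
  shows "comm_phase S (monomial S m u x) (u k) (phase (- (\<Sum>j<m. of_int (x j) * \<theta> $$ (j, k))))"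
  using comm_phase_sym[OF _ _ gen_monomial_comm[OF assms]] torus_tupleD(1)[OF u assms(1)] monomial_closed[OF assms(2)]
  by (simp add: phase_minus)

lemma monomial_comm:
  "comm_phase S (monomial S n u y) (monomial S n u x) (phase (\<Sum>k<n. of_int (x k) * - (\<Sum>j<n. of_int (y j) * \<theta> $$ (j, k))))"
  by (rule comm_phase_monomial) (use monomial_closed torus_tuple_unitary[OF u] monomial_gen_comm in auto)

lemma monomial_add:
  assumes "m \<le> n" shows "monomial S m u x \<otimes> monomial S m u y \<doteq> monomial S m u (\<lambda>i. x i + y i)"
  using assms
proof (induction m)
  case 0 then show ?case by (simp add: phase_eq_refl)
next
  case (Suc m)
  have um: "u m \<in> unitaries S" using Suc torus_tuple_unitary[OF u] by simp
  note c = monomial_closed[of m] unitariesD(1)[OF zpow_unitary[OF um]]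
  define p q where "p = zpow S (u m) (x m)" and "q = zpow S (u m) (y m)"
  have pq: "p \<in> carrier S" "q \<in> carrier S" using c by (auto simp: p_def q_def)
  have mc: "monomial S m u z \<in> carrier S" for z using c(1) Suc by simp
  have "comm_phase S (monomial S m u y) p (phase (of_int (x m) * - (\<Sum>j<m. of_int (y j) * \<theta> $$ (j, m))))"
    unfolding p_def using monomial_gen_comm[of m m y] Suc by (intro comm_phase_zpow mc um) auto
  then have "comm_phase S p (monomial S m u y) (phase (- (of_int (x m) * - (\<Sum>j<m. of_int (y j) * \<theta> $$ (j, m)))))"
    using comm_phase_sym[of "monomial S m u y" p] mc pq unfolding phase_minus by simp
  then have 1: "p \<otimes> monomial S m u y \<doteq> monomial S m u y \<otimes> p" by (rule comm_phase_eq)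
  have "monomial S m u x \<otimes> p \<otimes> (monomial S m u y \<otimes> q) = monomial S m u x \<otimes> (p \<otimes> monomial S m u y) \<otimes> q"
    using mc pq by (simp add: m_assoc)
  moreover have "\<dots> \<doteq> monomial S m u x \<otimes> (monomial S m u y \<otimes> p) \<otimes> q"
    by (intro phase_eq_mult 1 phase_eq_refl) (use mc pq in auto)
  moreover have "monomial S m u x \<otimes> (monomial S m u y \<otimes> p) \<otimes> q = (monomial S m u x \<otimes> monomial S m u y) \<otimes> (p \<otimes> q)"
    using mc pq by (simp add: m_assoc)
  moreover have "\<dots> \<doteq> monomial S m u (\<lambda>i. x i + y i) \<otimes> (p \<otimes> q)"
    by (intro phase_eq_mult Suc.IH phase_eq_refl) (use mc pq Suc in auto)
  moreover have "p \<otimes> q = zpow S (u m) (x m + y m)" by (simp add: p_def q_def zpow_add[OF um])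
  ultimately have "monomial S m u x \<otimes> p \<otimes> (monomial S m u y \<otimes> q) \<doteq>
      monomial S m u (\<lambda>i. x i + y i) \<otimes> zpow S (u m) (x m + y m)"
    using phase_eq_trans mc c(2) by simp
  then show ?case by (simp add: p_def q_def)
qed

lemma monomial_zero: "monomial S m v (\<lambda>_. 0) = \<one>"
  by (induction m) simp_all

lemma monomial_cong: "(\<And>i. i < m ==> x i = y i) ==> monomial S m v x = monomial S m v y"
  by (induction m) simp_all

lemma monomial_unit: "k < m ==> m \<le> n ==> monomial S m u (\<lambda>i. if i = k then 1 else 0) = u k"
proof (induction m)
  case (Suc m)
  show ?case
  proof (cases "k = m")
    case True
    have "monomial S m u (\<lambda>i. if i = k then 1 else 0) = \<one>"
      using True by (subst monomial_cong[of m _ "\<lambda>_. 0"]) (auto simp: monomial_zero)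
    then show ?thesis using True Suc torus_tuple_unitary[OF u, of m] by (simp add: unitariesD)
  qed (use Suc torus_tupleD(1)[OF u, of k] in auto)
qed simp

lemma monomial_inv: "star S (monomial S n u x) \<doteq> monomial S n u (\<lambda>i. - x i)"
proof -
  let ?a = "monomial S n u x" and ?b = "monomial S n u (\<lambda>i. - x i)"
  have un: "?a \<in> unitaries S" "?b \<in> unitaries S" using torus_tuple_unitary[OF u] by (auto intro!: monomial_unitary)
  note a = unitariesD[OF un(1)] and b = unitariesD[OF un(2)]
  have "?a \<otimes> ?b \<doteq> \<one>" using monomial_add[of n x "\<lambda>i. - x i"] by (simp add: monomial_zero)
  then obtain c where c: "cmod c = 1" "?a \<otimes> ?b = c \<odot> \<one>" by (auto simp: phase_eq_def)
  have "?b = star S ?a \<otimes> (?a \<otimes> ?b)" using a b(1) m_assoc[of "star S ?a" ?a ?b] by simp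
  also have "\<dots> = c \<odot> star S ?a" using a c by (simp add: smult_mult_r)
  finally have "cnj c \<odot> ?b = star S ?a" using a(1) c(1) by (simp add: smult_smult unimodular_mult_cnj)
  then show ?thesis unfolding phase_eq_def using c(1) by (intro exI[of _ "cnj c"]) auto
qed

lemma zpow_monomial: "zpow S (monomial S n u x) k \<doteq> monomial S n u (\<lambda>i. k * x i)"
proof (induction k rule: int_induct[where k = 0])
  case base show ?case by (simp add: monomial_zero phase_eq_refl)
next
  case (step1 i)
  have un: "monomial S n u x \<in> unitaries S" using torus_tuple_unitary[OF u] by (auto intro!: monomial_unitary)
  have "zpow S (monomial S n u x) i \<otimes> monomial S n u x \<doteq> monomial S n u (\<lambda>j. i * x j) \<otimes> monomial S n u x"
    by (intro phase_eq_mult step1 phase_eq_refl monomial_closed) auto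
  from phase_eq_trans[OF this monomial_add] show ?case
    by (simp add: zpow_Suc[OF un] distrib_right monomial_closed)
next
  case (step2 i)
  have un: "monomial S n u x \<in> unitaries S" using torus_tuple_unitary[OF u] by (auto intro!: monomial_unitary)
  have "zpow S (monomial S n u x) i \<otimes> star S (monomial S n u x) \<doteq> monomial S n u (\<lambda>j. i * x j) \<otimes> monomial S n u (\<lambda>j. - x j)"
    by (intro phase_eq_mult step2 monomial_inv monomial_closed) auto
  from phase_eq_trans[OF this monomial_add] show ?case
    by (simp add: zpow_pred[OF un] left_diff_distrib monomial_closed)
qed

lemma monomial_monomial:
  assumes "\<And>j. j < m ==> v j \<doteq> monomial S n u (t j)" "\<And>j. j < m ==> v j \<in> unitaries S"
  shows "monomial S m v y \<doteq> monomial S n u (\<lambda>i. \<Sum>j<m. y j * t j i)"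
  using assms
proof (induction m)
  case 0 show ?case by (simp add: monomial_zero phase_eq_refl)
next
  case (Suc m)
  have un: "monomial S n u x \<in> unitaries S" for x using torus_tuple_unitary[OF u] by (auto intro!: monomial_unitary)
  obtain c where c: "cmod c = 1" "v m = c \<odot> monomial S n u (t m)" using Suc.prems(1)[of m] by (auto simp: phase_eq_def)
  have zz: "zpow S (v m) k \<doteq> zpow S (monomial S n u (t m)) k" for k
  proof (induction k rule: int_induct[where k = 0])
    case (step1 i)
    then show ?case using Suc.prems un
      by (auto simp: zpow_Suc intro!: phase_eq_mult unitariesD(1))
  next
    case (step2 i)
    then show ?case using Suc.prems un
      by (auto simp: zpow_pred intro!: phase_eq_mult phase_eq_star unitariesD(1) unitaries_star)
  qed (simp add: phase_eq_refl)
  have "zpow S (v m) (y m) \<doteq> monomial S n u (\<lambda>i. y m * t m i)"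
    by (rule phase_eq_trans[OF zz zpow_monomial]) (simp add: monomial_closed)
  then have "monomial S (Suc m) v y \<doteq> monomial S n u (\<lambda>i. \<Sum>j<m. y j * t j i) \<otimes> monomial S n u (\<lambda>i. y m * t m i)"
    using Suc by (auto intro!: phase_eq_mult monomial_closed)
  from phase_eq_trans[OF this monomial_add] show ?case by (simp add: monomial_closed)
qed

text \<open>The commutation phase of two monomials is bilinear in their exponents.\<close>

lemma torus_tuple_monomials:
  assumes "\<And>j k. j < m ==> k < m ==> \<theta>' $$ (j, k) = (\<Sum>a<n. \<Sum>b<n. of_int (t j a) * \<theta> $$ (a, b) * of_int (t k b))"
    and skew: "\<And>a b. a < n ==> b < n ==> \<theta> $$ (a, b) = - \<theta> $$ (b, a)"
  shows "torus_tuple S m \<theta>' (\<lambda>j. monomial S n u (t j))"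
proof -
  have un: "monomial S n u x \<in> unitaries S" for x using torus_tuple_unitary[OF u] by (auto intro!: monomial_unitary)
  have "monomial S n u (t k) \<otimes> monomial S n u (t j) = phase (\<theta>' $$ (j, k)) \<odot> (monomial S n u (t j) \<otimes> monomial S n u (t k))"
    if "j < m" "k < m" for j k
  proof -
    have "(\<Sum>a<n. of_int (t j a) * - (\<Sum>b<n. of_int (t k b) * \<theta> $$ (b, a))) = \<theta>' $$ (j, k)"
      unfolding assms(1)[OF that] sum_distrib_left sum_negf[symmetric]
    proof (intro sum.cong refl)
      fix a b assume "a \<in> {..<n}" "b \<in> {..<n}"
      then show "of_int (t j a) * - (of_int (t k b) * \<theta> $$ (b, a)) = of_int (t j a) * \<theta> $$ (a, b) * of_int (t k b)"
        using skew[of a b] by simp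
    qed
    then show ?thesis using monomial_comm[of "t k" "t j"] by (simp only: comm_phase_def)
  qed
  then show ?thesis unfolding torus_tuple_def using unitariesD[OF un] by blast
qed

end

lemma zpow_scale:
  assumes "a \<in> unitaries S" shows "zpow S (phase h \<odot> a) k = phase (of_int k * h) \<odot> zpow S a k"
proof -
  have un: "phase h \<odot> a \<in> unitaries S" using assms by (simp add: unitaries_smult)
  note ac = unitariesD(1)[OF assms]
  have zc: "zpow S a i \<in> carrier S" for i using unitariesD(1)[OF zpow_unitary[OF assms]] .
  show ?thesis
  proof (induction k rule: int_induct[where k = 0])
    case (step1 i)
    have "phase (of_int (i + 1) * h) = phase (of_int i * h) * phase h" by (simp only: of_int_add distrib_right of_int_1 mult_1 phase_add)
    then show ?case using zc[of i] ac
      by (simp add: zpow_Suc un assms step1 smult_mult_l smult_mult_r smult_smult mult.commute)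
  next
    case (step2 i)
    have "phase (of_int (i - 1) * h) = phase (of_int i * h) * cnj (phase h)"
      by (simp add: left_diff_distrib phase_diff)
    then show ?case using zc[of i] ac
      by (simp add: zpow_pred un assms step2 star_smult smult_mult_l smult_mult_r smult_smult mult.commute)
  qed simp
qed

lemma monomial_scale:
  "(\<And>j. j < n ==> u j \<in> unitaries S) ==>
    monomial S n (\<lambda>j. phase (h j) \<odot> u j) x = phase (\<Sum>j<n. of_int (x j) * h j) \<odot> monomial S n u x"
proof (induction n)
  case (Suc n)
  have "monomial S n u x \<in> carrier S" "zpow S (u n) (x n) \<in> carrier S"
    using Suc.prems by (auto intro!: unitariesD(1) monomial_unitary)
  then show ?case using Suc by (simp add: zpow_scale smult_mult_l smult_mult_r smult_smult phase_add mult.commute)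
qed simp

end

lemma zpow_hom:
  assumes "star_alg A" "star_alg B" and f: "f \<in> star_hom A B" and a: "a \<in> unitaries A"
  shows "f a \<in> unitaries B" "f (zpow A a k) = zpow B (f a) k"
proof -
  interpret A: star_alg A by fact
  interpret B: star_alg B by fact
  note fD = star_homD[OF f] and aD = A.unitariesD[OF a]
  show un: "f a \<in> unitaries B"
    using fD(1)[OF aD(1)] fD(2)[of "star A a" a] fD(2)[of a "star A a"] fD(4,6) aD by (simp add: unitaries_def)
  have zc: "zpow A a i \<in> carrier A" for i using A.unitariesD(1)[OF A.zpow_unitary[OF a]] .
  show "f (zpow A a k) = zpow B (f a) k"
  proof (induction k rule: int_induct[where k = 0])
    case base show ?case using fD(4) by simp
  next
    case (step1 i) then show ?case by (simp only: A.zpow_Suc[OF a] B.zpow_Suc[OF un] fD(2)[OF zc aD(1)])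
  next
    case (step2 i) then show ?case
      by (simp only: A.zpow_pred[OF a] B.zpow_pred[OF un] fD(2)[OF zc A.star_closed[OF aD(1)]] fD(6)[OF aD(1)])
  qed
qed

lemma monomial_hom:
  assumes "star_alg A" "star_alg B" and f: "f \<in> star_hom A B" and u: "\<And>j. j < n ==> u j \<in> unitaries A"
  shows "f (monomial A n u x) = monomial B n (\<lambda>j. f (u j)) x"
  using u
proof (induction n)
  case 0 show ?case using star_homD(4)[OF f] by simp
next
  case (Suc n)
  interpret A: star_alg A by fact
  have "monomial A n u x \<in> carrier A" "zpow A (u n) (x n) \<in> carrier A"
    using Suc.prems by (auto intro!: A.unitariesD(1) A.monomial_unitary)
  then show ?case using Suc zpow_hom(2)[OF assms(1,2) f] by (simp add: star_homD(2)[OF f])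
qed

section \<open>Congruent matrices give isomorphic tori\<close>

lemma cstar_isomorphic_sym:
  assumes A: "star_alg A" and iso: "A \<cong>\<^sub>* B" shows "B \<cong>\<^sub>* A"
proof -
  obtain \<phi> where \<phi>: "\<phi> \<in> star_iso A B" using iso unfolding cstar_isomorphic_def by blast
  obtain \<psi> where \<psi>: "\<psi> \<in> star_iso B A" "\<And>x. x \<in> carrier A ==> \<psi> (\<phi> x) = x" "\<And>y. y \<in> carrier B ==> \<phi> (\<psi> y) = y"
    using star_iso_inverse[OF A \<phi>] by blast
  show ?thesis unfolding cstar_isomorphic_def using \<psi>(1) by blast
qed

lemma torus_tuple_mod_int:
  assumes "\<And>j k. j < n ==> k < n ==> \<theta> $$ (j, k) - \<theta>' $$ (j, k) \<in> \<int>" "torus_tuple D n \<theta> u"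
  shows "torus_tuple D n \<theta>' u"
  using assms(2) phase_cong_int[OF assms(1)] unfolding torus_tuple_def by metis

lemma torus_tuple_scale:
  assumes "star_alg D" and t: "torus_tuple D n \<theta> u" and c: "\<And>j. j < n ==> cmod (c j) = 1"
  shows "torus_tuple D n \<theta> (\<lambda>j. c j \<odot>\<^bsub>D\<^esub> u j)"
proof -
  interpret D: star_alg D by fact
  show ?thesis unfolding torus_tuple_def
  proof (intro conjI allI impI)
    fix j assume j: "j < n"
    have un: "c j \<odot>\<^bsub>D\<^esub> u j \<in> unitaries D"
      by (rule D.unitaries_smult[OF D.torus_tuple_unitary[OF t j] c[OF j]])
    show "c j \<odot>\<^bsub>D\<^esub> u j \<in> carrier D" "star D (c j \<odot>\<^bsub>D\<^esub> u j) \<otimes>\<^bsub>D\<^esub> (c j \<odot>\<^bsub>D\<^esub> u j) = \<one>\<^bsub>D\<^esub>"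
      "c j \<odot>\<^bsub>D\<^esub> u j \<otimes>\<^bsub>D\<^esub> star D (c j \<odot>\<^bsub>D\<^esub> u j) = \<one>\<^bsub>D\<^esub>"
      using D.unitariesD[OF un] by blast+
    fix k assume k: "k < n"
    show "c k \<odot>\<^bsub>D\<^esub> u k \<otimes>\<^bsub>D\<^esub> (c j \<odot>\<^bsub>D\<^esub> u j) = phase (\<theta> $$ (j, k)) \<odot>\<^bsub>D\<^esub> (c j \<odot>\<^bsub>D\<^esub> u j \<otimes>\<^bsub>D\<^esub> (c k \<odot>\<^bsub>D\<^esub> u k))"
      using torus_tupleD(1)[OF t j] torus_tupleD(1)[OF t k] torus_tupleD(4)[OF t j k]
      by (simp add: D.smult_mult_l D.smult_mult_r D.smult_smult mult_ac)
  qed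
qed

lemma torus_gauge:
  assumes c: "\<And>j. j < n ==> cmod (c j) = 1"
  obtains g where "g \<in> star_hom (nc_torus n \<theta>) (nc_torus n \<theta>)" "\<And>j. j < n ==> g (tgen n \<theta> j) = c j \<odot>\<^bsub>nc_torus n \<theta>\<^esub> tgen n \<theta> j"
    "\<And>x. x \<in> carrier (nc_torus n \<theta>) ==> torus_norm n \<theta> (g x) \<le> torus_norm n \<theta> x"
proof -
  have "torus_tuple (nc_torus n \<theta>) n \<theta> (\<lambda>j. c j \<odot>\<^bsub>nc_torus n \<theta>\<^esub> tgen n \<theta> j)"
    by (rule torus_tuple_scale[OF star_alg_torus torus_tuple_tgen c])
  from torus_universal[OF cstar_alg_torus this] show ?thesis using that by blast
qed

text \<open>The monomials for \<open>T\<close> and for \<open>U\<close> define homomorphisms in both directions.  As \<open>T\<close> and \<open>U\<close> are inverse to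
  each other, both composites fix the generators up to phases, hence are gauge automorphisms.\<close>

lemma torus_iso_of_monomials:
  fixes T U :: "nat => nat => int"
  assumes skew: "\<And>a b. a < n ==> b < n ==> \<theta> $$ (a, b) = - \<theta> $$ (b, a)"
    and skew': "\<And>a b. a < n ==> b < n ==> \<theta>' $$ (a, b) = - \<theta>' $$ (b, a)"
    and r: "\<And>j k. j < n ==> k < n ==> (\<Sum>a<n. \<Sum>b<n. of_int (T j a) * \<theta> $$ (a, b) * of_int (T k b)) - \<theta>' $$ (j, k) \<in> \<int>"
    and r': "\<And>j k. j < n ==> k < n ==> (\<Sum>a<n. \<Sum>b<n. of_int (U j a) * \<theta>' $$ (a, b) * of_int (U k b)) - \<theta> $$ (j, k) \<in> \<int>"
    and TU: "\<And>i k. i < n ==> k < n ==> (\<Sum>j<n. T i j * U j k) = (if k = i then 1 else 0)"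
    and UT: "\<And>i k. i < n ==> k < n ==> (\<Sum>j<n. U i j * T j k) = (if k = i then 1 else 0)"
  shows "nc_torus n \<theta>' \<cong>\<^sub>* nc_torus n \<theta>"
proof -
  have key: "\<exists>f. f \<in> star_hom (nc_torus n \<beta>) (nc_torus n \<alpha>) \<and>
      (\<forall>j<n. f (tgen n \<beta> j) = monomial (nc_torus n \<alpha>) n (tgen n \<alpha>) (V j)) \<and>
      (\<forall>x\<in>carrier (nc_torus n \<beta>). torus_norm n \<alpha> (f x) \<le> torus_norm n \<beta> x)"
    if "\<And>a b. a < n ==> b < n ==> \<alpha> $$ (a, b) = - \<alpha> $$ (b, a)"
      "\<And>j k. j < n ==> k < n ==> (\<Sum>a<n. \<Sum>b<n. of_int (V j a) * \<alpha> $$ (a, b) * of_int (V k b)) - \<beta> $$ (j, k) \<in> \<int>"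
    for \<alpha> \<beta> V
  proof -
    interpret A: cstar_alg "nc_torus n \<alpha>" "torus_norm n \<alpha>" by (rule cstar_alg_torus)
    let ?\<beta> = "mat n n (\<lambda>(j, k). \<Sum>a<n. \<Sum>b<n. of_int (V j a) * \<alpha> $$ (a, b) * of_int (V k b))"
    have "torus_tuple (nc_torus n \<alpha>) n ?\<beta> (\<lambda>j. monomial (nc_torus n \<alpha>) n (tgen n \<alpha>) (V j))"
      by (rule A.torus_tuple_monomials[OF torus_tuple_tgen _ that(1)]) simp_all
    then have "torus_tuple (nc_torus n \<alpha>) n \<beta> (\<lambda>j. monomial (nc_torus n \<alpha>) n (tgen n \<alpha>) (V j))"
      by (rule torus_tuple_mod_int[rotated]) (use that(2) in simp)
    from torus_universal[OF cstar_alg_torus this] show ?thesis by metis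
  qed
  have comp: "\<exists>c. (\<forall>j<n. cmod (c j) = 1 \<and> f (g (tgen n \<beta> j)) = c j \<odot>\<^bsub>nc_torus n \<beta>\<^esub> tgen n \<beta> j)"
    if f: "f \<in> star_hom (nc_torus n \<alpha>) (nc_torus n \<beta>)" "\<forall>j<n. f (tgen n \<alpha> j) = monomial (nc_torus n \<beta>) n (tgen n \<beta>) (V j)"
      and g: "\<forall>j<n. g (tgen n \<beta> j) = monomial (nc_torus n \<alpha>) n (tgen n \<alpha>) (W j)"
      and WV: "\<And>i k. i < n ==> k < n ==> (\<Sum>j<n. W i j * V j k) = (if k = i then 1 else 0)"
    for \<alpha> \<beta> f g V W
  proof -
    interpret A: cstar_alg "nc_torus n \<alpha>" "torus_norm n \<alpha>" by (rule cstar_alg_torus)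
    interpret B: cstar_alg "nc_torus n \<beta>" "torus_norm n \<beta>" by (rule cstar_alg_torus)
    note tA = torus_tuple_tgen[of n \<alpha>] and tB = torus_tuple_tgen[of n \<beta>]
    have "\<exists>c. cmod c = 1 \<and> f (g (tgen n \<beta> j)) = c \<odot>\<^bsub>nc_torus n \<beta>\<^esub> tgen n \<beta> j" if j: "j < n" for j
    proof -
      have un: "f (tgen n \<alpha> i) \<in> unitaries (nc_torus n \<beta>)" if "i < n" for i
        by (rule zpow_hom(1)[OF A.star_alg_axioms B.star_alg_axioms f(1) A.torus_tuple_unitary[OF tA that]])
      have "f (g (tgen n \<beta> j)) = monomial (nc_torus n \<beta>) n (\<lambda>i. f (tgen n \<alpha> i)) (W j)"
        using g j monomial_hom[OF A.star_alg_axioms B.star_alg_axioms f(1), of n "tgen n \<alpha>"] A.torus_tuple_unitary[OF tA] by simp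
      moreover have "B.phase_eq (monomial (nc_torus n \<beta>) n (\<lambda>i. f (tgen n \<alpha> i)) (W j))
          (monomial (nc_torus n \<beta>) n (tgen n \<beta>) (\<lambda>i. \<Sum>k<n. W j k * V k i))"
        by (rule B.monomial_monomial[OF tB]) (use f(2) un in "auto intro!: B.phase_eq_refl B.monomial_closed[OF tB]")
      moreover have "monomial (nc_torus n \<beta>) n (tgen n \<beta>) (\<lambda>i. \<Sum>k<n. W j k * V k i) =
          monomial (nc_torus n \<beta>) n (tgen n \<beta>) (\<lambda>i. if i = j then 1 else 0)"
        by (rule B.monomial_cong[OF tB]) (use WV j in auto)
      ultimately show ?thesis using B.monomial_unit[OF tB j] by (simp add: B.phase_eq_def)
    qed
    then show ?thesis by metis
  qed
  let ?A = "nc_torus n \<theta>" and ?p = "torus_norm n \<theta>" and ?B = "nc_torus n \<theta>'" and ?q = "torus_norm n \<theta>'"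
  obtain f where f: "f \<in> star_hom ?B ?A"
    "\<forall>j<n. f (tgen n \<theta>' j) = monomial ?A n (tgen n \<theta>) (T j)"
    "\<And>x. x \<in> carrier ?B ==> ?p (f x) \<le> ?q x"
    using key[OF skew r] by blast
  obtain g where g: "g \<in> star_hom ?A ?B"
    "\<forall>j<n. g (tgen n \<theta> j) = monomial ?B n (tgen n \<theta>') (U j)"
    "\<And>x. x \<in> carrier ?A ==> ?q (g x) \<le> ?p x"
    using key[OF skew' r'] by blast
  obtain c where c: "\<And>j. j < n ==> cmod (c j) = 1" "\<And>j. j < n ==> f (g (tgen n \<theta> j)) = c j \<odot>\<^bsub>?A\<^esub> tgen n \<theta> j"
    using comp[OF f(1,2) g(2) UT] by metis
  obtain d where d: "\<And>j. j < n ==> cmod (d j) = 1" "\<And>j. j < n ==> g (f (tgen n \<theta>' j)) = d j \<odot>\<^bsub>?B\<^esub> tgen n \<theta>' j"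
    using comp[OF g(1,2) f(2) TU] by metis
  obtain \<gamma> where \<gamma>: "\<gamma> \<in> star_hom ?A ?A" "\<And>j. j < n ==> \<gamma> (tgen n \<theta> j) = cnj (c j) \<odot>\<^bsub>?A\<^esub> tgen n \<theta> j"
    "\<And>x. x \<in> carrier ?A ==> ?p (\<gamma> x) \<le> ?p x"
    using torus_gauge[of n "\<lambda>j. cnj (c j)" \<theta>] c(1) by (metis complex_mod_cnj)
  obtain \<delta> where \<delta>: "\<delta> \<in> star_hom ?B ?B" "\<And>j. j < n ==> \<delta> (tgen n \<theta>' j) = cnj (d j) \<odot>\<^bsub>?B\<^esub> tgen n \<theta>' j"
    "\<And>x. x \<in> carrier ?B ==> ?q (\<delta> x) \<le> ?q x"
    using torus_gauge[of n "\<lambda>j. cnj (d j)" \<theta>'] d(1) by (metis complex_mod_cnj)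
  interpret A: cstar_alg "nc_torus n \<theta>" "torus_norm n \<theta>" by (rule cstar_alg_torus)
  interpret B: cstar_alg "nc_torus n \<theta>'" "torus_norm n \<theta>'" by (rule cstar_alg_torus)
  note tA = torus_tupleD(1)[OF torus_tuple_tgen[of n \<theta>]] and tB = torus_tupleD(1)[OF torus_tuple_tgen[of n \<theta>']]
  note fD = star_homD[OF f(1)] and gD = star_homD[OF g(1)] and cD = star_homD[OF \<gamma>(1)] and dD = star_homD[OF \<delta>(1)]
  have "f (g (\<gamma> x)) = x" if "x \<in> carrier ?A" for x
  proof (rule torus_hom_unique[OF cstar_alg_torus star_hom_comp[OF star_hom_comp[OF \<gamma>(1) g(1)] f(1)] star_hom_id _ _ _ that])
    fix x assume x: "x \<in> carrier ?A"
    show "?p (f (g (\<gamma> x))) \<le> ?p x"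
      using f(3)[OF gD(1)[OF cD(1)[OF x]]] g(3)[OF cD(1)[OF x]] \<gamma>(3)[OF x] by linarith
  next
    fix j assume j: "j < n"
    show "f (g (\<gamma> (tgen n \<theta> j))) = tgen n \<theta> j"
      using tA[OF j] c[OF j] by (simp add: \<gamma>(2)[OF j] gD(1,5) fD(5) A.smult_smult unimodular_mult_cnj)
  qed simp
  moreover have "\<delta> (g (f x)) = x" if "x \<in> carrier ?B" for x
  proof (rule torus_hom_unique[OF cstar_alg_torus star_hom_comp[OF star_hom_comp[OF f(1) g(1)] \<delta>(1)] star_hom_id _ _ _ that])
    fix x assume x: "x \<in> carrier ?B"
    show "?q (\<delta> (g (f x))) \<le> ?q x"
      using \<delta>(3)[OF gD(1)[OF fD(1)[OF x]]] g(3)[OF fD(1)[OF x]] f(3)[OF x] by linarith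
  next
    fix j assume j: "j < n"
    show "\<delta> (g (f (tgen n \<theta>' j))) = tgen n \<theta>' j"
      using tB[OF j] d[OF j] by (simp add: \<delta>(2)[OF j] dD(5) B.smult_smult unimodular_mult_cnj)
  qed simp
  ultimately show ?thesis
    using cstar_isomorphicI[OF f(1) star_hom_comp[OF g(1) \<delta>(1)] star_hom_comp[OF \<gamma>(1) g(1)]] by blast
qed

lemma skew_symmetric_index:
  "skew_symmetric_mat (M :: rat mat) ==> M \<in> carrier_mat n n ==> a < n ==> b < n ==> M $$ (a, b) = - M $$ (b, a)"
  unfolding skew_symmetric_mat_def
  by (metis carrier_matD index_transpose_mat(1) index_uminus_mat(1) minus_minus)

lemma triple_product_index:
  assumes "A \<in> carrier_mat n n" "B \<in> carrier_mat n n" "j < n" "k < n"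
  shows "(A * B * transpose_mat A) $$ (j, k) = (\<Sum>a<n. \<Sum>b<n. A $$ (j, a) * B $$ (a, b) * (A $$ (k, b) :: 'a :: comm_semiring_0))"
proof -
  have "(A * B * transpose_mat A) $$ (j, k) = (\<Sum>b<n. (\<Sum>a<n. A $$ (j, a) * B $$ (a, b)) * A $$ (k, b))"
    using assms by (subst mat_mult_index[of _ n n _ n]) (auto simp: mat_mult_index[of _ n n _ n] simp del: index_mult_mat)
  also have "\<dots> = (\<Sum>a<n. \<Sum>b<n. A $$ (j, a) * B $$ (a, b) * A $$ (k, b))"
    by (simp add: sum_distrib_right) (rule sum.swap)
  finally show ?thesis .
qed

lemma GL_int_inverse:
  assumes "T \<in> GL_int n" obtains U where "U \<in> GL_int n" "T * U = 1\<^sub>m n" "U * T = 1\<^sub>m n"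
proof -
  have T: "T \<in> carrier_mat n n" "invertible_mat T" using assms by (auto simp: GL_int_def)
  obtain U where U: "inverts_mat T U" "inverts_mat U T" using T by (auto simp: invertible_mat_def)
  have TU: "T * U = 1\<^sub>m n" "U * T = 1\<^sub>m (dim_row U)" using U T by (auto simp: inverts_mat_def)
  have "dim_col U = n" using arg_cong[OF TU(1), of dim_col] by simp
  moreover have "dim_row U = n" using arg_cong[OF TU(2), of dim_col] T by simp
  ultimately have Uc: "U \<in> carrier_mat n n" by auto
  then have "U \<in> GL_int n" using U by (auto simp: GL_int_def invertible_mat_def)
  then show ?thesis using that TU \<open>dim_row U = n\<close> by simp
qed

lemma torus_iso_congruent:
  fixes \<theta> \<theta>' :: "rat mat"
  assumes \<theta>: "\<theta> \<in> carrier_mat n n" "skew_symmetric_mat \<theta>" and \<theta>': "\<theta>' \<in> carrier_mat n n" "skew_symmetric_mat \<theta>'"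
    and T: "T \<in> GL_int n" and K: "K \<in> carrier_mat n n"
    and eq: "\<theta>' = rat_mat_of_int T * \<theta> * transpose_mat (rat_mat_of_int T) + rat_mat_of_int K"
  shows "nc_torus n (real_mat_of_rat \<theta>) \<cong>\<^sub>* nc_torus n (real_mat_of_rat \<theta>')"
proof -
  obtain U where U: "U \<in> GL_int n" "T * U = 1\<^sub>m n" "U * T = 1\<^sub>m n" using GL_int_inverse[OF T] by blast
  have Tc: "T \<in> carrier_mat n n" and Uc: "U \<in> carrier_mat n n" using T U by (auto simp: GL_int_def)
  let ?T = "rat_mat_of_int T" and ?U = "rat_mat_of_int U" and ?K = "rat_mat_of_int K"
  have c: "?T \<in> carrier_mat n n" "?U \<in> carrier_mat n n" "?K \<in> carrier_mat n n" using Tc Uc K by auto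
  have TU: "(\<Sum>j<n. T $$ (i, j) * U $$ (j, k)) = (if k = i then 1 else 0)" if "i < n" "k < n" for i k
    unfolding mat_mult_index[OF Tc Uc that, symmetric] U(2) using that by auto
  have UT: "(\<Sum>j<n. U $$ (i, j) * T $$ (j, k)) = (if k = i then 1 else 0)" if "i < n" "k < n" for i k
    unfolding mat_mult_index[OF Uc Tc that, symmetric] U(3) using that by auto
  have conv: "(\<Sum>a<n. \<Sum>b<n. of_int (V $$ (j, a)) * real_mat_of_rat \<alpha> $$ (a, b) * of_int (V $$ (k, b))) =
      (of_rat ((rat_mat_of_int V * \<alpha> * transpose_mat (rat_mat_of_int V)) $$ (j, k)) :: real)"
    if "V \<in> carrier_mat n n" "\<alpha> \<in> carrier_mat n n" "j < n" "k < n" for V \<alpha> j k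
    using that triple_product_index[of "rat_mat_of_int V" n \<alpha> j k] by (simp add: of_rat_sum of_rat_mult)
  have e1: "(?T * \<theta> * transpose_mat ?T) $$ (j, k) = \<theta>' $$ (j, k) - of_int (K $$ (j, k))" if "j < n" "k < n" for j k
    unfolding eq using that c \<theta> K by (simp add: carrier_matD[OF Tc])
  have UTm: "?U * ?T = 1\<^sub>m n"
    using of_int_hom.mat_hom_mult[OF Uc Tc, where ?'a = rat] U(3) of_int_hom.mat_hom_one[of n, where ?'a = rat] by simp
  have "?U * \<theta>' * transpose_mat ?U = \<theta> + ?U * ?K * transpose_mat ?U"
  proof -
    have tU: "transpose_mat ?T * transpose_mat ?U = 1\<^sub>m n"
      using transpose_mult[OF c(2,1)] UTm by simp
    have "?U * (?T * \<theta> * transpose_mat ?T) * transpose_mat ?U = (?U * ?T) * \<theta> * (transpose_mat ?T * transpose_mat ?U)"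
      using c \<theta>(1) by (simp add: assoc_mult_mat[of _ n n _ n _ n])
    also have "\<dots> = \<theta>" unfolding UTm tU using \<theta>(1) by simp
    finally have *: "?U * (?T * \<theta> * transpose_mat ?T) * transpose_mat ?U = \<theta>" .
    have "?U * \<theta>' * transpose_mat ?U = ?U * (?T * \<theta> * transpose_mat ?T) * transpose_mat ?U + ?U * ?K * transpose_mat ?U"
      unfolding eq using c \<theta>(1)
      by (simp add: mult_add_distrib_mat[of _ n n _ n] add_mult_distrib_mat[of _ n n _ _ n])
    then show ?thesis using * by simp
  qed
  then have e2: "(?U * \<theta>' * transpose_mat ?U) $$ (j, k) = \<theta> $$ (j, k) + (?U * ?K * transpose_mat ?U) $$ (j, k)"
    if "j < n" "k < n" for j k using that c \<theta> carrier_matD[OF Uc] by simp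
  have e3: "(?U * ?K * transpose_mat ?U) $$ (j, k) = of_int (\<Sum>a<n. \<Sum>b<n. U $$ (j, a) * K $$ (a, b) * U $$ (k, b))"
    if "j < n" "k < n" for j k
    unfolding triple_product_index[OF c(2,3) that] using that carrier_matD[OF Uc] carrier_matD[OF K] by simp
  have e4: "\<exists>z. (?U * \<theta>' * transpose_mat ?U) $$ (j, k) = \<theta> $$ (j, k) + of_int z" if "j < n" "k < n" for j k
    unfolding e2[OF that] e3[OF that] by blast
  have "nc_torus n (real_mat_of_rat \<theta>') \<cong>\<^sub>* nc_torus n (real_mat_of_rat \<theta>)"
  proof (rule torus_iso_of_monomials[where T = "\<lambda>j a. T $$ (j, a)" and U = "\<lambda>j a. U $$ (j, a)"])
    fix j k assume jk: "j < n" "k < n"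
    show "real_mat_of_rat \<theta> $$ (j, k) = - real_mat_of_rat \<theta> $$ (k, j)"
      using skew_symmetric_index[OF \<theta>(2,1) jk] jk \<theta>(1) by (simp add: of_rat_minus)
    show "real_mat_of_rat \<theta>' $$ (j, k) = - real_mat_of_rat \<theta>' $$ (k, j)"
      using skew_symmetric_index[OF \<theta>'(2,1) jk] jk \<theta>'(1) by (simp add: of_rat_minus)
    show "(\<Sum>a<n. \<Sum>b<n. of_int (T $$ (j, a)) * real_mat_of_rat \<theta> $$ (a, b) * of_int (T $$ (k, b))) - real_mat_of_rat \<theta>' $$ (j, k) \<in> \<int>"
      unfolding conv[OF Tc \<theta>(1) jk] e1[OF jk] using jk \<theta>'(1) by (simp add: of_rat_diff)
    obtain z where z: "(?U * \<theta>' * transpose_mat ?U) $$ (j, k) = \<theta> $$ (j, k) + of_int z" using e4[OF jk] by blast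
    show "(\<Sum>a<n. \<Sum>b<n. of_int (U $$ (j, a)) * real_mat_of_rat \<theta>' $$ (a, b) * of_int (U $$ (k, b))) - real_mat_of_rat \<theta> $$ (j, k) \<in> \<int>"
      unfolding conv[OF Uc \<theta>'(1) jk] z using jk \<theta>(1) by (simp add: of_rat_add)
  next
    fix i k assume "i < n" "k < n"
    then show "(\<Sum>j<n. T $$ (i, j) * U $$ (j, k)) = (if k = i then 1 else 0)"
      "(\<Sum>j<n. U $$ (i, j) * T $$ (j, k)) = (if k = i then 1 else 0)" by (rule TU, rule UT)
  qed
  then show ?thesis by (rule cstar_isomorphic_sym[OF star_alg_torus])
qed

section \<open>Schur's lemma and compression\<close>

lemma cnj_mult_self: "cnj y * y = complex_of_real ((cmod y)\<^sup>2)"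
  by (metis complex_norm_square mult.commute)

lemma ne_emptyI: "x \<in> A ==> A \<noteq> {}" by blast

lemma mat_eqI_index:
  assumes "A \<in> carrier_mat n k" "B \<in> carrier_mat n k" "\<And>i j. i < n ==> j < k ==> A $$ (i, j) = B $$ (i, j)"
  shows "A = B"
  using assms by (intro eq_matI) auto

text \<open>Otherwise \<open>J\<close>, padded with zero rows, would be a square isometry that is not surjective.\<close>

lemma isometry_dim_le:
  fixes J :: "complex mat"
  assumes J: "J \<in> carrier_mat N r" "mat_adjoint J * J = 1\<^sub>m r" shows "r \<le> N"
proof (rule ccontr)
  assume "\<not> r \<le> N"
  then have Nr: "N < r" by simp
  define J0 where "J0 = mat r r (\<lambda>(i, j). if i < N then J $$ (i, j) else 0)"
  have J0: "J0 \<in> carrier_mat r r" "mat_adjoint J0 \<in> carrier_mat r r" by (auto simp: J0_def intro: mat_adjoint_carrier)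
  have aJ: "mat_adjoint J \<in> carrier_mat r N" using J by simp
  have "mat_adjoint J0 * J0 = mat_adjoint J * J"
  proof (rule mat_eqI_index[of _ r r])
    fix i j assume ij: "i < r" "j < r"
    have "(mat_adjoint J0 * J0) $$ (i, j) = (\<Sum>l<r. if l < N then cnj (J $$ (l, i)) * J $$ (l, j) else 0)"
      unfolding mat_mult_index[OF J0(2,1) ij] using ij J0(1) by (intro sum.cong) (auto simp: J0_def)
    also have "\<dots> = (\<Sum>l<N. cnj (J $$ (l, i)) * J $$ (l, j))"
      using Nr by (intro sum.mono_neutral_cong_right) auto
    also have "\<dots> = (mat_adjoint J * J) $$ (i, j)"
      unfolding mat_mult_index[OF aJ J(1) ij] using ij J(1) by (intro sum.cong) auto
    finally show "(mat_adjoint J0 * J0) $$ (i, j) = (mat_adjoint J * J) $$ (i, j)" .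
  qed (use J0 J aJ in "auto intro: mult_carrier_mat")
  then have "J0 * mat_adjoint J0 = 1\<^sub>m r" using J(2) by (intro mat_mult_left_right_inverse[OF J0(2,1)]) simp
  moreover have "(J0 * mat_adjoint J0) $$ (N, N) = 0"
    unfolding mat_mult_index[OF J0 Nr Nr] using Nr by (intro sum.neutral) (auto simp: J0_def)
  ultimately show False using Nr by simp
qed

text \<open>The columns of \<open>J\<close> are an orthonormal basis of the kernel of \<open>D\<close>.  It is found as an isometry into the
  kernel with as many columns as possible: if it missed a column of \<open>X\<close>, the component of that column
  orthogonal to its range could be normalised and appended.\<close>

lemma kernel_isometry:
  fixes D :: "complex mat"
  assumes D: "D \<in> carrier_mat N N"
  obtains r J where "J \<in> carrier_mat N r" "r \<le> N" "mat_adjoint J * J = 1\<^sub>m r" "D * J = 0\<^sub>m N r"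
    "\<And>k X. X \<in> carrier_mat N k ==> D * X = 0\<^sub>m N k ==> J * (mat_adjoint J * X) = X"
proof -
  define P where "P r \<longleftrightarrow> (\<exists>J\<in>carrier_mat N r. mat_adjoint J * J = 1\<^sub>m r \<and> D * J = 0\<^sub>m N r)" for r
  have P0: "P 0" unfolding P_def by (rule bexI[of _ "0\<^sub>m N 0"]) (use D in "auto intro!: eq_matI")
  have bd: "\<forall>r. P r \<longrightarrow> r \<le> N" using isometry_dim_le by (auto simp: P_def)
  define r where "r = (GREATEST r. P r)"
  have Pr: "P r" unfolding r_def by (rule GreatestI_nat[of P 0 N, OF P0]) (use bd in auto)
  have mx: "\<not> P (Suc r)" using Greatest_le_nat[of P "Suc r" N] bd unfolding r_def[symmetric] by auto
  obtain J where J: "J \<in> carrier_mat N r" and JJ: "mat_adjoint J * J = 1\<^sub>m r" and DJ: "D * J = 0\<^sub>m N r" using Pr by (auto simp: P_def)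
  have aJ: "mat_adjoint J \<in> carrier_mat r N" using J by simp
  have "J * (mat_adjoint J * X) = X" if X: "X \<in> carrier_mat N k" and DX: "D * X = 0\<^sub>m N k" for k X
  proof (rule ccontr)
    assume ne: "J * (mat_adjoint J * X) \<noteq> X"
    define Q where "Q = mat_adjoint J * X"
    have Q: "Q \<in> carrier_mat r k" using aJ X by (simp add: Q_def)
    define Y where "Y = X - J * Q"
    have Y: "Y \<in> carrier_mat N k" unfolding Y_def by (rule minus_carrier_mat[OF mult_carrier_mat[OF J Q]])
    obtain i0 c where i0: "i0 < N" "c < k" "Y $$ (i0, c) \<noteq> 0"
    proof -
      have "\<not> (\<forall>i<N. \<forall>c<k. Y $$ (i, c) = 0)"
      proof
        assume z: "\<forall>i<N. \<forall>c<k. Y $$ (i, c) = 0"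
        have "J * Q = X"
        proof (rule mat_eqI_index[of _ N k])
          show JQ: "J * Q \<in> carrier_mat N k" using J Q by simp
          fix i j assume "i < N" "j < k"
          then show "(J * Q) $$ (i, j) = X $$ (i, j)" using z JQ X unfolding Y_def
            by (metis carrier_matD eq_iff_diff_eq_0 index_minus_mat(1))
        qed (rule X)
        then show False using ne by (simp add: Q_def)
      qed
      then show ?thesis using that by blast
    qed
    have DY: "D * Y = 0\<^sub>m N k"
    proof -
      have "D * Y = D * X - (D * J) * Q" unfolding Y_def using D X J Q
        by (simp add: mult_minus_distrib_mat[of _ N N _ k] assoc_mult_mat[of _ N N _ r _ k])
      then show ?thesis using DX DJ Q by simp
    qed
    have aJY: "mat_adjoint J * Y = 0\<^sub>m r k"
    proof -
      have "mat_adjoint J * Y = Q - (mat_adjoint J * J) * Q" unfolding Y_def using aJ X J Q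
        by (simp add: mult_minus_distrib_mat[of _ r N _ k] assoc_mult_mat[of _ r N _ r _ k] Q_def)
      then show ?thesis using JJ Q by simp
    qed
    define s where "s = sqrt (\<Sum>l<N. (cmod (Y $$ (l, c)))\<^sup>2)"
    have "(\<Sum>l<N. (cmod (Y $$ (l, c)))\<^sup>2) \<ge> (cmod (Y $$ (i0, c)))\<^sup>2"
      using i0 by (intro member_le_sum) auto
    moreover have "(cmod (Y $$ (i0, c)))\<^sup>2 > 0" using i0 by simp
    ultimately have s2: "(\<Sum>l<N. (cmod (Y $$ (l, c)))\<^sup>2) > 0" by linarith
    then have s: "s > 0" "s\<^sup>2 = (\<Sum>l<N. (cmod (Y $$ (l, c)))\<^sup>2)" by (auto simp: s_def)
    \<comment> \<open>The component of a missed column orthogonal to the range, normalised, becomes the last column.\<close>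
    define J' where "J' = mat N (Suc r) (\<lambda>(i, j). if j < r then J $$ (i, j) else Y $$ (i, c) / complex_of_real s)"
    have J': "J' \<in> carrier_mat N (Suc r)" "mat_adjoint J' \<in> carrier_mat (Suc r) N"
      by (auto simp: J'_def intro: mat_adjoint_carrier)
    have J'i: "J' $$ (l, j) = (if j < r then J $$ (l, j) else Y $$ (l, c) / s)" if "l < N" "j < Suc r" for l j
      using that by (simp add: J'_def)
    have orth: "(\<Sum>l<N. cnj (J $$ (l, i)) * Y $$ (l, c)) = 0" if "i < r" for i
      using mat_mult_index[OF aJ Y that i0(2)] aJY that i0 J by simp
    have orth': "(\<Sum>l<N. cnj (Y $$ (l, c)) * J $$ (l, i)) = 0" if "i < r" for i
      using arg_cong[OF orth[OF that], of cnj] by (simp add: mult.commute)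
    have "mat_adjoint J' * J' = 1\<^sub>m (Suc r)"
    proof (rule mat_eqI_index[of _ "Suc r" "Suc r"])
      fix i j assume ij: "i < Suc r" "j < Suc r"
      have e: "(mat_adjoint J' * J') $$ (i, j) = (\<Sum>l<N. cnj (J' $$ (l, i)) * J' $$ (l, j))"
        unfolding mat_mult_index[OF J'(2,1) ij] using ij J'(1) by (intro sum.cong) auto
      consider "i < r" "j < r" | "i < r" "j = r" | "i = r" "j < r" | "i = r" "j = r" using ij by linarith
      then show "(mat_adjoint J' * J') $$ (i, j) = 1\<^sub>m (Suc r) $$ (i, j)"
      proof cases
        case 1
        have "(mat_adjoint J' * J') $$ (i, j) = (mat_adjoint J * J) $$ (i, j)"
          unfolding e mat_mult_index[OF aJ J 1] using 1 ij J by (intro sum.cong) (auto simp: J'i)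
        then show ?thesis unfolding JJ using 1 by simp
      next
        case 2
        have "(mat_adjoint J' * J') $$ (i, j) = (\<Sum>l<N. cnj (J $$ (l, i)) * Y $$ (l, c)) / s"
          unfolding e sum_divide_distrib using 2 by (intro sum.cong) (auto simp: J'i)
        then show ?thesis using orth 2 by simp
      next
        case 3
        have "(mat_adjoint J' * J') $$ (i, j) = (\<Sum>l<N. cnj (Y $$ (l, c)) * J $$ (l, j)) / s"
          unfolding e sum_divide_distrib using 3 by (intro sum.cong) (auto simp: J'i)
        then show ?thesis using orth' 3 by simp
      next
        case 4
        have "(mat_adjoint J' * J') $$ (i, j) = (\<Sum>l<N. complex_of_real ((cmod (Y $$ (l, c)))\<^sup>2)) / complex_of_real (s\<^sup>2)"
          unfolding e sum_divide_distrib
        proof (rule sum.cong[OF refl])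
          fix l assume "l \<in> {..<N}"
          then have "cnj (J' $$ (l, i)) * J' $$ (l, j) = (cnj (Y $$ (l, c)) * Y $$ (l, c)) / complex_of_real (s\<^sup>2)"
            using 4 by (simp add: J'i power2_eq_square)
          then show "cnj (J' $$ (l, i)) * J' $$ (l, j) = complex_of_real ((cmod (Y $$ (l, c)))\<^sup>2) / complex_of_real (s\<^sup>2)"
            by (simp only: cnj_mult_self)
        qed
        also have "\<dots> = 1" unfolding s(2) of_real_sum using s2
          by (simp add: less_imp_neq[symmetric] flip: of_real_sum of_real_power)
        finally show ?thesis using 4 by simp
      qed
    qed (use J' in "auto intro: mult_carrier_mat")
    moreover have "D * J' = 0\<^sub>m N (Suc r)"
    proof (rule mat_eqI_index[of _ N "Suc r"])
      fix i j assume ij: "i < N" "j < Suc r"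
      show "(D * J') $$ (i, j) = 0\<^sub>m N (Suc r) $$ (i, j)"
      proof (cases "j < r")
        case True
        have "(D * J') $$ (i, j) = (D * J) $$ (i, j)"
          unfolding mat_mult_index[OF D J'(1) ij] mat_mult_index[OF D J ij(1) True] using True ij by (intro sum.cong) (auto simp: J'i)
        then show ?thesis unfolding DJ using True ij by simp
      next
        case False
        have "(D * J') $$ (i, j) = (D * Y) $$ (i, c) / s"
          unfolding mat_mult_index[OF D J'(1) ij] mat_mult_index[OF D Y ij(1) i0(2)] sum_divide_distrib using False ij by (intro sum.cong) (auto simp: J'i)
        then show ?thesis unfolding DY using i0 ij by simp
      qed
    qed (use D J' in "auto intro: mult_carrier_mat")
    ultimately show False using mx J' by (auto simp: P_def)
  qed
  moreover have "r \<le> N" using bd Pr by blast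
  ultimately show ?thesis using that[OF J _ JJ DJ] by blast
qed

text \<open>The kernel of \<open>D\<close> is invariant under the representation, so that \<open>J J\<^sup>*\<close> may be cancelled from
  \<open>J\<^sup>* \<pi>(a) J J\<^sup>* \<pi>(b) J\<close>.\<close>

lemma compression_hom:
  fixes \<pi> :: "'a => complex mat"
  assumes S: "star_alg S" and \<pi>: "\<pi> \<in> star_hom S (Mat N)" and D: "D \<in> carrier_mat N N"
    and comm: "\<And>b. b \<in> carrier S ==> D * \<pi> b = \<pi> b * D"
    and J: "J \<in> carrier_mat N r" "mat_adjoint J * J = 1\<^sub>m r" "D * J = 0\<^sub>m N r"
      "\<And>k X. X \<in> carrier_mat N k ==> D * X = 0\<^sub>m N k ==> J * (mat_adjoint J * X) = X"
  shows "(\<lambda>b. mat_adjoint J * \<pi> b * J) \<in> star_hom S (Mat r)"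
proof -
  interpret S: star_alg S by fact
  note h = star_homD[OF \<pi>, simplified]
  have aJ: "mat_adjoint J \<in> carrier_mat r N" using J by simp
  have inv: "J * (mat_adjoint J * (\<pi> b * J)) = \<pi> b * J" if "b \<in> carrier S" for b
  proof (rule J(4))
    show "\<pi> b * J \<in> carrier_mat N r" using h(1)[OF that] J by simp
    have "D * (\<pi> b * J) = \<pi> b * (D * J)"
      using assoc_mult_mat[OF D h(1)[OF that] J(1)] assoc_mult_mat[OF h(1)[OF that] D J(1)] comm[OF that] by simp
    then show "D * (\<pi> b * J) = 0\<^sub>m N r" using J(3) h(1)[OF that] by simp
  qed
  show ?thesis
  proof (rule star_homI; simp only: matrix_star_algebra_simps)
    fix a assume a: "a \<in> carrier S"
    note pa = h(1)[OF a]
    show "mat_adjoint J * \<pi> a * J \<in> carrier_mat r r" by (rule mult_carrier_mat[OF mult_carrier_mat[OF aJ pa] J(1)])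
    show "mat_adjoint J * \<pi> (star S a) * J = mat_adjoint (mat_adjoint J * \<pi> a * J)"
      unfolding mat_adjoint_mult[OF mult_carrier_mat[OF aJ pa] J(1)] mat_adjoint_mult[OF aJ pa] mat_adjoint_adjoint[OF J(1)] h(6)[OF a]
      by (rule assoc_mult_mat[OF aJ mat_adjoint_carrier[OF pa] J(1)])
    show "mat_adjoint J * \<pi> (c \<odot>\<^bsub>S\<^esub> a) * J = c \<cdot>\<^sub>m (mat_adjoint J * \<pi> a * J)" for c
      using aJ pa J h(5)[OF a, of c] mult_smult_distrib[OF aJ pa, of c] mult_smult_assoc_mat[OF mult_carrier_mat[OF aJ pa] J(1), of c]
      by simp
    fix b assume b: "b \<in> carrier S"
    note pb = h(1)[OF b]
    show "mat_adjoint J * \<pi> (a \<oplus>\<^bsub>S\<^esub> b) * J = mat_adjoint J * \<pi> a * J + mat_adjoint J * \<pi> b * J"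
      using aJ pa pb J h(3)[OF a b]
      by (simp add: mult_add_distrib_mat[of _ r N _ N] add_mult_distrib_mat[OF mult_carrier_mat[OF aJ pa] mult_carrier_mat[OF aJ pb] J(1)])
    have "mat_adjoint J * \<pi> a * J * (mat_adjoint J * \<pi> b * J) = mat_adjoint J * \<pi> a * (J * (mat_adjoint J * (\<pi> b * J)))"
    proof -
      have "mat_adjoint J * \<pi> b * J = mat_adjoint J * (\<pi> b * J)" using aJ pb J by (simp add: assoc_mult_mat[of _ r N _ N _ r])
      then show ?thesis
        by (simp only: assoc_mult_mat[OF mult_carrier_mat[OF aJ pa] J(1) mult_carrier_mat[OF aJ mult_carrier_mat[OF pb J(1)]]])
    qed
    also have "\<dots> = mat_adjoint J * \<pi> a * (\<pi> b * J)" by (simp only: inv[OF b])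
    also have "\<dots> = mat_adjoint J * (\<pi> a * \<pi> b) * J"
      by (simp only: assoc_mult_mat[OF mult_carrier_mat[OF aJ pa] pb J(1), symmetric] assoc_mult_mat[OF aJ pa pb])
    finally show "mat_adjoint J * \<pi> (a \<otimes>\<^bsub>S\<^esub> b) * J = mat_adjoint J * \<pi> a * J * (mat_adjoint J * \<pi> b * J)"
      using h(2)[OF a b] by simp
  next
    show "mat_adjoint J * \<pi> \<one>\<^bsub>S\<^esub> * J = 1\<^sub>m r" using h(4) aJ J by simp
  qed
qed

text \<open>Dimension zero is excluded, as every algebra has the unital representation on the zero space.\<close>

definition min_rep_dim :: "('a, 'm) star_algebra_scheme => nat => bool" where
  "min_rep_dim S N \<longleftrightarrow> 1 \<le> N \<and> star_hom S (Mat N) \<noteq> {} \<and>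
     (\<forall>k. 1 \<le> k \<longrightarrow> k < N \<longrightarrow> star_hom S (Mat k) = {})"

lemma min_rep_dim_exists:
  assumes "1 \<le> k" "\<pi> \<in> star_hom S (Mat k)" obtains N where "min_rep_dim S N"
proof -
  let ?P = "\<lambda>k. 1 \<le> k \<and> star_hom S (Mat k) \<noteq> {}"
  have "?P k" using assms by blast
  then have "?P (LEAST k. ?P k)" by (rule LeastI)
  moreover have "\<not> ?P k" if "k < (LEAST k. ?P k)" for k using that by (rule not_less_Least)
  ultimately have "min_rep_dim S (LEAST k. ?P k)" unfolding min_rep_dim_def by blast
  then show ?thesis using that by blast
qed

lemma min_rep_dim_unique: "min_rep_dim S N ==> min_rep_dim S N' ==> N = N'"
  unfolding min_rep_dim_def by (metis linorder_neqE_nat)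

lemma min_rep_dim_iso:
  assumes "star_alg S" "S \<cong>\<^sub>* S'" "min_rep_dim S N" shows "min_rep_dim S' N"
proof -
  obtain \<phi> where \<phi>: "\<phi> \<in> star_iso S S'" using assms(2) unfolding cstar_isomorphic_def by blast
  obtain \<psi> where \<psi>: "\<psi> \<in> star_iso S' S" "\<And>x. x \<in> carrier S ==> \<psi> (\<phi> x) = x" "\<And>y. y \<in> carrier S' ==> \<phi> (\<psi> y) = y"
    using star_iso_inverse[OF assms(1) \<phi>] by blast
  have "star_hom S (Mat k) = {} \<longleftrightarrow> star_hom S' (Mat k) = {}" for k
    using star_hom_comp[of \<phi> S S' _ "Mat k"] star_hom_comp[of \<psi> S' S _ "Mat k"] \<phi> \<psi>(1)
    unfolding star_iso_iff by blast
  then show ?thesis using assms(3) unfolding min_rep_dim_def by blast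
qed

text \<open>A proper eigenspace of \<open>C\<close> would carry a representation of smaller dimension.\<close>

lemma Schur:
  fixes \<pi> :: "'a => complex mat"
  assumes S: "star_alg S" and N: "min_rep_dim S N" and \<pi>: "\<pi> \<in> star_hom S (Mat N)"
    and C: "C \<in> carrier_mat N N" and comm: "\<And>b. b \<in> carrier S ==> C * \<pi> b = \<pi> b * C"
  obtains c where "C = c \<cdot>\<^sub>m 1\<^sub>m N"
proof -
  have N1: "N \<ge> 1" using N by (simp add: min_rep_dim_def)
  obtain c where "c \<in> spectrum C" using spectrum_non_empty[OF C] N1 by auto
  then obtain v where v: "v \<in> carrier_vec N" "v \<noteq> 0\<^sub>v N" "C *\<^sub>v v = c \<cdot>\<^sub>v v"
    using C by (auto simp: spectrum_def eigenvalue_def eigenvector_def)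
  define D where "D = C - c \<cdot>\<^sub>m 1\<^sub>m N"
  have D: "D \<in> carrier_mat N N" unfolding D_def by (rule minus_carrier_mat) simp
  obtain r J where J: "J \<in> carrier_mat N r" "r \<le> N" "mat_adjoint J * J = 1\<^sub>m r" "D * J = 0\<^sub>m N r"
    "\<And>k X. X \<in> carrier_mat N k ==> D * X = 0\<^sub>m N k ==> J * (mat_adjoint J * X) = X"
    using kernel_isometry[OF D] by metis
  have "D * \<pi> b = \<pi> b * D" if "b \<in> carrier S" for b
  proof -
    have pb: "\<pi> b \<in> carrier_mat N N" using star_homD(1)[OF \<pi> that] by simp
    have "D * \<pi> b = C * \<pi> b - c \<cdot>\<^sub>m \<pi> b"
      unfolding D_def using C pb mult_smult_assoc_mat[of "1\<^sub>m N" N N "\<pi> b" N c]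
      by (simp add: minus_mult_distrib_mat[of _ N N _ _ N])
    also have "\<dots> = \<pi> b * D"
      unfolding D_def comm[OF that] using C pb by (simp add: mult_minus_distrib_mat[of _ N N _ N] mult_smult_distrib[of _ N N _ N])
    finally show ?thesis .
  qed
  then have "(\<lambda>b. mat_adjoint J * \<pi> b * J) \<in> star_hom S (Mat r)"
    by (rule compression_hom[OF S \<pi> D _ J(1,3,4,5)])
  then have "star_hom S (Mat r) \<noteq> {}" by (rule ne_emptyI)
  moreover have "r \<ge> 1"
  proof (rule ccontr)
    assume "\<not> r \<ge> 1"
    then have r0: "r = 0" by simp
    define X where "X = mat N 1 (\<lambda>(i, j). v $ i)"
    have X: "X \<in> carrier_mat N 1" by (simp add: X_def)
    have "D * X = 0\<^sub>m N 1"
    proof (rule mat_eqI_index[of _ N 1])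
      fix i j assume ij: "i < N" "j < (1::nat)"
      have "(\<Sum>l<N. C $$ (i, l) * v $ l) = (C *\<^sub>v v) $ i"
        using ij C v(1) by (auto simp: scalar_prod_def atLeast0LessThan intro!: sum.cong)
      then have "(\<Sum>l<N. C $$ (i, l) * v $ l) = c * v $ i" unfolding v(3) using v(1) ij by simp
      moreover have "(D * X) $$ (i, j) = (\<Sum>l<N. C $$ (i, l) * v $ l - (if i = l then c * v $ l else 0))"
        unfolding mat_mult_index[OF D X ij] using ij C by (intro sum.cong) (auto simp: D_def X_def algebra_simps)
      ultimately show "(D * X) $$ (i, j) = 0\<^sub>m N 1 $$ (i, j)" using ij by (simp add: sum_subtractf)
    qed (use D X in auto)
    then have "X = J * (mat_adjoint J * X)" using J(5)[OF X] by simp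
    also have "\<dots> = 0\<^sub>m N 1"
      using J(1) X by (intro eq_matI) (auto simp: r0 scalar_prod_def)
    finally have "X = 0\<^sub>m N 1" .
    have "v = 0\<^sub>v N"
    proof (rule eq_vecI)
      fix i assume "i < dim_vec (0\<^sub>v N)"
      then show "v $ i = 0\<^sub>v N $ i" using arg_cong[OF \<open>X = 0\<^sub>m N 1\<close>, of "\<lambda>Y. Y $$ (i, 0)"] by (simp add: X_def)
    qed (use v in simp)
    then show False using v by simp
  qed
  ultimately have "r = N" using N J(2) unfolding min_rep_dim_def by (metis le_neq_implies_less)
  then have Jc: "J \<in> carrier_mat N N" "mat_adjoint J \<in> carrier_mat N N" using J(1) by auto
  have "J * mat_adjoint J = 1\<^sub>m N" using mat_mult_left_right_inverse[OF Jc(2,1)] J(3) \<open>r = N\<close> by simp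
  then have "D = D * (J * mat_adjoint J)" using D by simp
  also have "\<dots> = (D * J) * mat_adjoint J" using D Jc by (simp add: assoc_mult_mat[of _ N N _ N _ N])
  also have "\<dots> = 0\<^sub>m N N" using J(4) \<open>r = N\<close> Jc by simp
  finally have "D = 0\<^sub>m N N" .
  have "C = c \<cdot>\<^sub>m 1\<^sub>m N"
  proof (rule mat_eqI_index[of _ N N])
    fix i j assume "i < N" "j < N"
    then show "C $$ (i, j) = (c \<cdot>\<^sub>m 1\<^sub>m N) $$ (i, j)"
      using arg_cong[OF \<open>D = 0\<^sub>m N N\<close>, of "\<lambda>Y. Y $$ (i, j)"] C by (simp add: D_def)
  qed (use C in auto)
  then show ?thesis using that by blast
qed

section \<open>Matrix representations of a torus tensored with a matrix algebra\<close>

lemma (in cstar_alg) matrix_rep_conv: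
  assumes \<pi>: "\<pi> \<in> star_hom S (Mat k)" and Y: "\<And>i. Y i \<in> carrier S" "Z \<in> carrier S" "conv Y Z"
    and ab: "a < k" "b < k"
  shows "(\<lambda>i. \<pi> (Y i) $$ (a, b)) \<longlonglongrightarrow> \<pi> Z $$ (a, b)"
proof -
  interpret M: cstar_pre "Mat k" "opnorm k" by (rule cstar_pre_matrix)
  note h = star_homD(1)[OF \<pi>, simplified]
  have "M.conv (\<lambda>i. \<pi> (Y i)) (\<pi> Z)"
  proof (rule M.conv_null[where f = "\<lambda>i. p (Y i \<ominus> Z)"])
    show "opnorm k (\<pi> (Y i) \<ominus>\<^bsub>Mat k\<^esub> \<pi> Z) \<le> p (Y i \<ominus> Z)" for i
      using matrix_rep_contractive[OF \<pi>, of "Y i \<ominus> Z"] star_hom_minus[OF star_alg_axioms star_alg_matrix \<pi> Y(1,2), of i] Y by simp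
    show "(\<lambda>i. p (Y i \<ominus> Z)) \<longlonglongrightarrow> 0" using Y(3) by (simp add: conv_def)
  qed (use Y h in auto)
  then show ?thesis using matrix_conv_iff[of "\<lambda>i. \<pi> (Y i)" k "\<pi> Z"] h Y ab by simp
qed

text \<open>The elements that are intertwined form a closed *-subalgebra: closed because matrix representations are
  contractive, and closed under adjoints on the generators because these are unitary.\<close>

lemma torus_intertwiner:
  assumes f: "f \<in> star_hom (nc_torus n \<theta>) (Mat k)" and g: "g \<in> star_hom (nc_torus n \<theta>) (Mat l)"
    and W: "W \<in> carrier_mat k l" and eq: "\<And>j. j < n ==> f (tgen n \<theta> j) * W = W * g (tgen n \<theta> j)"
    and a: "a \<in> carrier (nc_torus n \<theta>)"
  shows "f a * W = W * g a"
proof -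
  interpret A: cstar_alg "nc_torus n \<theta>" "torus_norm n \<theta>" by (rule cstar_alg_torus)
  note fD = star_homD[OF f, simplified] and gD = star_homD[OF g, simplified]
  note t = torus_tupleD(1-3)[OF torus_tuple_tgen[of n \<theta>]]
  show ?thesis using a
  proof (induction rule: torus_induct)
    case (gen j) then show ?case by (rule eq)
  next
    case (star_gen j)
    let ?u = "f (tgen n \<theta> j)" and ?v = "g (tgen n \<theta> j)"
    have c: "?u \<in> carrier_mat k k" "?v \<in> carrier_mat l l" using fD(1) gD(1) t(1)[OF star_gen] by auto
    have ac: "mat_adjoint ?u \<in> carrier_mat k k" "mat_adjoint ?v \<in> carrier_mat l l" using c by auto
    have uu: "mat_adjoint ?u * ?u = 1\<^sub>m k"
      using fD(2)[OF A.star_closed[OF t(1)[OF star_gen]] t(1)[OF star_gen]] fD(6)[OF t(1)[OF star_gen]] fD(4) t(2)[OF star_gen] by simp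
    have vv: "?v * mat_adjoint ?v = 1\<^sub>m l"
      using gD(2)[OF t(1)[OF star_gen] A.star_closed[OF t(1)[OF star_gen]]] gD(6)[OF t(1)[OF star_gen]] gD(4) t(3)[OF star_gen] by simp
    have "mat_adjoint ?u * W = mat_adjoint ?u * (W * (?v * mat_adjoint ?v))" using W vv by simp
    also have "\<dots> = mat_adjoint ?u * ((W * ?v) * mat_adjoint ?v)" using assoc_mult_mat[OF W c(2) ac(2)] by simp
    also have "\<dots> = mat_adjoint ?u * (?u * (W * mat_adjoint ?v))"
      using assoc_mult_mat[OF c(1) W ac(2)] eq[OF star_gen] by simp
    also have "\<dots> = W * mat_adjoint ?v"
      using assoc_mult_mat[OF ac(1) c(1) mult_carrier_mat[OF W ac(2)]] uu W ac by (simp add: mult_carrier_mat[OF W ac(2)])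
    finally show ?case using fD(6)[OF t(1)[OF star_gen]] gD(6)[OF t(1)[OF star_gen]] by simp
  next
    case one show ?case using fD(4) gD(4) W by simp
  next
    case (add x y)
    then show ?case using fD(1,3) gD(1,3) W
      by (simp add: add_mult_distrib_mat[of _ k k _ _ l] mult_add_distrib_mat[of _ k l _ l])
  next
    case (smult c x)
    then show ?case using fD(1,5) gD(1,5) W mult_smult_assoc_mat[of "f x" k k W l c] mult_smult_distrib[of W k l "g x" l c] by simp
  next
    case (mult x y)
    have c: "f x \<in> carrier_mat k k" "f y \<in> carrier_mat k k" "g x \<in> carrier_mat l l" "g y \<in> carrier_mat l l"
      using mult fD(1) gD(1) by auto
    show ?case unfolding fD(2)[OF mult(1,2)] gD(2)[OF mult(1,2)]
      using assoc_mult_mat[OF c(1,2) W] assoc_mult_mat[OF c(1) W c(4)] assoc_mult_mat[OF W c(3,4)] mult(3,4) by simp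
  next
    case (lim Y Z)
    note fl = A.matrix_rep_conv[OF f lim(1-3)] and gl = A.matrix_rep_conv[OF g lim(1-3)]
    show ?case
    proof (rule mat_eqI_index[of _ k l])
      fix i j assume ij: "i < k" "j < l"
      have "(\<lambda>h. \<Sum>c<k. f (Y h) $$ (i, c) * W $$ (c, j)) \<longlonglongrightarrow> (\<Sum>c<k. f Z $$ (i, c) * W $$ (c, j))"
        by (intro tendsto_intros fl) (use ij in auto)
      moreover have "(\<lambda>h. \<Sum>c<l. W $$ (i, c) * g (Y h) $$ (c, j)) \<longlonglongrightarrow> (\<Sum>c<l. W $$ (i, c) * g Z $$ (c, j))"
        by (intro tendsto_intros gl) (use ij in auto)
      moreover have "(\<Sum>c<k. f (Y h) $$ (i, c) * W $$ (c, j)) = (\<Sum>c<l. W $$ (i, c) * g (Y h) $$ (c, j))" for h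
        using lim(4)[of h] mat_mult_index[OF fD(1)[OF lim(1)] W ij, of h] mat_mult_index[OF W gD(1)[OF lim(1)] ij, of h] by simp
      ultimately have "(\<Sum>c<k. f Z $$ (i, c) * W $$ (c, j)) = (\<Sum>c<l. W $$ (i, c) * g Z $$ (c, j))"
        using LIMSEQ_unique by simp
      then show "(f Z * W) $$ (i, j) = (W * g Z) $$ (i, j)"
        unfolding mat_mult_index[OF fD(1)[OF lim(2)] W ij] mat_mult_index[OF W gD(1)[OF lim(2)] ij] .
    qed (use fD(1)[OF lim(2)] gD(1)[OF lim(2)] W in auto)
  qed
qed

text \<open>Entrywise continuity; matrices of all sizes share one type, which carries no topology.\<close>

definition cont_mat :: "'t::topological_space set => nat => nat => ('t => complex mat) => bool" where
  "cont_mat X k l F \<longleftrightarrow> (\<forall>t\<in>X. F t \<in> carrier_mat k l) \<and> (\<forall>i<k. \<forall>j<l. continuous_on X (\<lambda>t. F t $$ (i, j)))"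

lemma cont_matI: "(\<And>t. t \<in> X ==> F t \<in> carrier_mat k l) ==> (\<And>i j. i < k ==> j < l ==> continuous_on X (\<lambda>t. F t $$ (i, j))) ==> cont_mat X k l F"
  by (simp add: cont_mat_def)

lemma cont_matD: "cont_mat X k l F ==> t \<in> X ==> F t \<in> carrier_mat k l"
    "cont_mat X k l F ==> i < k ==> j < l ==> continuous_on X (\<lambda>t. F t $$ (i, j))"
  by (simp_all add: cont_mat_def)

lemma cont_mat_const: "C \<in> carrier_mat k l ==> cont_mat X k l (\<lambda>_. C)"
  by (simp add: cont_mat_def)

lemma cont_mat_cong: "(\<And>t. t \<in> X ==> F t = G t) ==> cont_mat X k l F ==> cont_mat X k l G"
  unfolding cont_mat_def by (auto cong: continuous_on_cong)

lemma cont_mat_mult: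
  assumes "cont_mat X k l F" "cont_mat X l r G" shows "cont_mat X k r (\<lambda>t. F t * G t)"
proof (rule cont_matI)
  fix i j assume ij: "i < k" "j < r"
  have "continuous_on X (\<lambda>t. \<Sum>c<l. F t $$ (i, c) * G t $$ (c, j))"
    by (intro continuous_intros cont_matD(2)[OF assms(1)] cont_matD(2)[OF assms(2)]) (use ij in auto)
  then show "continuous_on X (\<lambda>t. (F t * G t) $$ (i, j))"
    by (rule continuous_on_cong[THEN iffD1, rotated 2]) (use mat_mult_index[OF cont_matD(1)[OF assms(1)] cont_matD(1)[OF assms(2)] ij] in auto)
qed (use cont_matD(1)[OF assms(1)] cont_matD(1)[OF assms(2)] in "auto intro: mult_carrier_mat")

lemma cont_mat_add:
  assumes "cont_mat X k l F" "cont_mat X k l G" shows "cont_mat X k l (\<lambda>t. F t + G t)"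
proof (rule cont_matI)
  fix i j assume ij: "i < k" "j < l"
  have "continuous_on X (\<lambda>t. F t $$ (i, j) + G t $$ (i, j))"
    by (intro continuous_intros cont_matD(2)[OF assms(1)] cont_matD(2)[OF assms(2)]) (use ij in auto)
  then show "continuous_on X (\<lambda>t. (F t + G t) $$ (i, j))"
    by (rule continuous_on_cong[THEN iffD1, rotated 2]) (use ij in "simp_all add: carrier_matD[OF cont_matD(1)[OF assms(2)]]")
qed (use cont_matD(1)[OF assms(1)] cont_matD(1)[OF assms(2)] in auto)

lemma cont_mat_smult:
  assumes "continuous_on X c" "cont_mat X k l F" shows "cont_mat X k l (\<lambda>t. c t \<cdot>\<^sub>m F t)"
proof (rule cont_matI)
  fix i j assume ij: "i < k" "j < l"
  have "continuous_on X (\<lambda>t. c t * F t $$ (i, j))"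
    by (intro continuous_intros assms(1) cont_matD(2)[OF assms(2)]) (use ij in auto)
  then show "continuous_on X (\<lambda>t. (c t \<cdot>\<^sub>m F t) $$ (i, j))"
    by (rule continuous_on_cong[THEN iffD1, rotated 2]) (use ij in "simp_all add: carrier_matD[OF cont_matD(1)[OF assms(2)]]")
qed (use cont_matD(1)[OF assms(2)] in auto)

lemma cont_mat_adjoint:
  assumes "cont_mat X k l F" shows "cont_mat X l k (\<lambda>t. mat_adjoint (F t))"
proof (rule cont_matI)
  fix i j assume ij: "i < l" "j < k"
  have "continuous_on X (\<lambda>t. cnj (F t $$ (j, i)))"
    by (intro continuous_intros cont_matD(2)[OF assms(1)]) (use ij in auto)
  then show "continuous_on X (\<lambda>t. mat_adjoint (F t) $$ (i, j))"
    by (rule continuous_on_cong[THEN iffD1, rotated 2]) (use ij in "simp_all add: carrier_matD[OF cont_matD(1)[OF assms(1)]]")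
qed (use cont_matD(1)[OF assms(1)] in auto)

lemma continuous_on_det:
  assumes "cont_mat X k k F" shows "continuous_on X (\<lambda>t. det (F t))"
proof -
  have "continuous_on X (\<lambda>t. \<Sum>p | p permutes {0..<k}. signof p * (\<Prod>i = 0..<k. F t $$ (i, p i)))"
  proof (intro continuous_intros)
    fix p i assume "p \<in> {p. p permutes {0..<k}}" "i \<in> {0..<k}"
    then show "continuous_on X (\<lambda>t. F t $$ (i, p i))"
      using permutes_in_image[of p "{0..<k}" i] by (intro cont_matD(2)[OF assms]) auto
  qed
  then show ?thesis
    by (rule continuous_on_cong[THEN iffD1, rotated 2]) (auto simp: det_def'[OF cont_matD(1)[OF assms]])
qed

text \<open>Contractivity with the same constant for all \<open>t\<close> makes the convergence uniform in \<open>t\<close> when a limit is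
  taken in the torus.\<close>

lemma torus_rep_continuous:
  fixes q :: "'t::topological_space => _"
  assumes q: "\<And>t. t \<in> X ==> q t \<in> star_hom (nc_torus n \<theta>) (Mat k)"
    and g: "\<And>j. j < n ==> cont_mat X k k (\<lambda>t. q t (tgen n \<theta> j))" and a: "a \<in> carrier (nc_torus n \<theta>)"
  shows "cont_mat X k k (\<lambda>t. q t a)"
proof -
  interpret A: cstar_alg "nc_torus n \<theta>" "torus_norm n \<theta>" by (rule cstar_alg_torus)
  note t = torus_tupleD(1)[OF torus_tuple_tgen[of n \<theta>]]
  show ?thesis using a
  proof (induction rule: torus_induct)
    case (gen j) then show ?case by (rule g)
  next
    case (star_gen j)
    show ?case by (rule cont_mat_cong[OF _ cont_mat_adjoint[OF g[OF star_gen]]]) (simp add: star_homD(6)[OF q t[OF star_gen]])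
  next
    case one
    show ?case by (rule cont_mat_cong[OF _ cont_mat_const[of "1\<^sub>m k"]]) (simp_all add: star_homD(4)[OF q])
  next
    case (add x y)
    show ?case by (rule cont_mat_cong[OF _ cont_mat_add[OF add(3,4)]]) (simp add: star_homD(3)[OF q add(1,2)])
  next
    case (smult c x)
    show ?case by (rule cont_mat_cong[OF _ cont_mat_smult[OF continuous_on_const[of _ c] smult(2)]]) (simp add: star_homD(5)[OF q smult(1)])
  next
    case (mult x y)
    show ?case by (rule cont_mat_cong[OF _ cont_mat_mult[OF mult(3,4)]]) (simp add: star_homD(2)[OF q mult(1,2)])
  next
    case (lim Y Z)
    show ?case
    proof (rule cont_matI)
      fix s assume "s \<in> X" then show "q s Z \<in> carrier_mat k k" using star_homD(1)[OF q lim(2)] by simp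
    next
      fix i j assume ij: "i < k" "j < k"
      show "continuous_on X (\<lambda>t. q t Z $$ (i, j))"
      proof (rule uniform_limit_theorem[where f = "\<lambda>h t. q t (Y h) $$ (i, j)" and F = sequentially])
        show "\<forall>\<^sub>F h in sequentially. continuous_on X (\<lambda>t. q t (Y h) $$ (i, j))"
          using cont_matD(2)[OF lim(4) ij] by simp
        show "uniform_limit X (\<lambda>h t. q t (Y h) $$ (i, j)) (\<lambda>t. q t Z $$ (i, j)) sequentially"
        proof (rule uniform_limitI)
          fix e :: real assume "e > 0"
          then have ev: "\<forall>\<^sub>F h in sequentially. torus_norm n \<theta> (Y h \<ominus>\<^bsub>nc_torus n \<theta>\<^esub> Z) < e"
            using lim(3) unfolding A.conv_def by (rule order_tendstoD(2)[rotated])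
          have "dist (q s (Y h) $$ (i, j)) (q s Z $$ (i, j)) \<le> torus_norm n \<theta> (Y h \<ominus>\<^bsub>nc_torus n \<theta>\<^esub> Z)" if s: "s \<in> X" for h s
          proof -
            have c: "q s (Y h) \<in> carrier_mat k k" "q s Z \<in> carrier_mat k k" using star_homD(1)[OF q[OF s]] lim(1,2) by auto
            have "(q s (Y h) - q s Z) $$ (i, j) = q s (Y h) $$ (i, j) - q s Z $$ (i, j)" using c ij by (auto dest: carrier_matD)
            moreover have "opnorm k (q s (Y h) - q s Z) \<le> torus_norm n \<theta> (Y h \<ominus>\<^bsub>nc_torus n \<theta>\<^esub> Z)"
              using A.matrix_rep_contractive[OF q[OF s] A.minus_closed[OF lim(1,2)], of h]
              unfolding star_hom_minus[OF A.star_alg_axioms star_alg_matrix q[OF s] lim(1,2)] matrix_minus[OF c] .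
            ultimately show ?thesis using entry_le_opnorm[OF ij, of "q s (Y h) - q s Z"] by (simp add: dist_norm)
          qed
          then show "\<forall>\<^sub>F h in sequentially. \<forall>t\<in>X. dist (q t (Y h) $$ (i, j)) (q t Z $$ (i, j)) < e"
            using ev by (auto elim!: eventually_mono intro: le_less_trans)
        qed
      qed simp
    qed
  qed
qed

locale torus_matrix =
  fixes n :: nat and \<theta> :: "real mat" and m :: nat
begin

abbreviation "A \<equiv> nc_torus n \<theta>"
abbreviation "M \<equiv> Mat m"
abbreviation "B \<equiv> A \<otimes>\<^sub>* M"

sublocale ts: tensor A M
  using star_alg_torus[of n \<theta>] star_alg_matrix[of m] by (simp add: tensor_def)

text \<open>The generators of the torus, and the matrices, as elements of the tensor product.\<close>

definition ug where "ug j = ts.inA (tgen n \<theta> j)"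
definition em where "em x = ts.inB x"

lemma star_alg_B: "star_alg B" by (rule ts.star_alg_T)

lemma ug_carrier: "j < n ==> ug j \<in> carrier B"
  unfolding ug_def by (rule star_homD(1)[OF ts.inA_hom torus_tupleD(1)[OF torus_tuple_tgen]])

lemma em_carrier: "x \<in> carrier_mat m m ==> em x \<in> carrier B"
  unfolding em_def using star_homD(1)[OF ts.inB_hom] by simp

lemma ug_tuple: "torus_tuple B n \<theta> ug"
  unfolding ug_def by (rule torus_tuple_hom[OF torus_tuple_tgen ts.inA_hom star_alg_torus])

lemma rep_tuple: "\<pi> \<in> star_hom B D ==> torus_tuple D n \<theta> (\<lambda>j. \<pi> (ug j))"
  by (rule torus_tuple_hom[OF ug_tuple _ star_alg_B])

lemma rep_em: "\<pi> \<in> star_hom B D ==> (\<lambda>x. \<pi> (em x)) \<in> star_hom M D"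
  unfolding em_def by (rule star_hom_comp[OF ts.inB_hom])

lemma rep_comm:
  assumes \<pi>: "\<pi> \<in> star_hom B (Mat k)" and "j < n" "x \<in> carrier_mat m m"
  shows "\<pi> (ug j) * \<pi> (em x) = \<pi> (em x) * \<pi> (ug j)"
proof -
  have t: "tgen n \<theta> j \<in> carrier A" using torus_tupleD(1)[OF torus_tuple_tgen] assms by blast
  have "\<pi> (ug j \<otimes>\<^bsub>B\<^esub> em x) = \<pi> (em x \<otimes>\<^bsub>B\<^esub> ug j)"
    using ts.in_commute[OF t, of x] assms by (simp add: ug_def em_def)
  then show ?thesis
    unfolding star_homD(2)[OF \<pi> ug_carrier[OF assms(2)] em_carrier[OF assms(3)]]
      star_homD(2)[OF \<pi> em_carrier[OF assms(3)] ug_carrier[OF assms(2)]] matrix_star_algebra_simps .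
qed

lemma rep_intertwiner:
  assumes \<pi>: "\<pi> \<in> star_hom B (Mat k)" and \<rho>: "\<rho> \<in> star_hom B (Mat l)"
    and W: "W \<in> carrier_mat k l" and u: "\<And>j. j < n ==> \<pi> (ug j) * W = W * \<rho> (ug j)"
    and e: "\<And>x. x \<in> carrier_mat m m ==> \<pi> (em x) * W = W * \<rho> (em x)" and b: "b \<in> carrier B"
  shows "\<pi> b * W = W * \<rho> b"
proof -
  note pD = star_homD[OF \<pi>, simplified] and rD = star_homD[OF \<rho>, simplified]
  show ?thesis using b
  proof (induction rule: ts.tensor_induct)
    case (inA a)
    show ?case
      by (rule torus_intertwiner[OF star_hom_comp[OF ts.inA_hom \<pi>] star_hom_comp[OF ts.inA_hom \<rho>] W _ inA])
         (use u in "simp add: ug_def")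
  next
    case (inB x) then show ?case using e by (simp add: em_def)
  next
    case (add x y)
    then show ?case using pD(1,3) rD(1,3) W
      by (simp add: add_mult_distrib_mat[of _ k k _ _ l] mult_add_distrib_mat[of _ k l _ l])
  next
    case (mult x y)
    have c: "\<pi> x \<in> carrier_mat k k" "\<pi> y \<in> carrier_mat k k" "\<rho> x \<in> carrier_mat l l" "\<rho> y \<in> carrier_mat l l"
      using mult pD(1) rD(1) by auto
    show ?case unfolding pD(2)[OF mult(1,2)] rD(2)[OF mult(1,2)]
      using assoc_mult_mat[OF c(1,2) W] assoc_mult_mat[OF c(1) W c(4)] assoc_mult_mat[OF W c(3,4)] mult(3,4) by simp
  qed
qed

lemma rep_unique:
  assumes \<pi>: "\<pi> \<in> star_hom B (Mat k)" and \<rho>: "\<rho> \<in> star_hom B (Mat k)"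
    and "\<And>j. j < n ==> \<pi> (ug j) = \<rho> (ug j)" "\<And>x. x \<in> carrier_mat m m ==> \<pi> (em x) = \<rho> (em x)" and b: "b \<in> carrier B"
  shows "\<pi> b = \<rho> b"
proof -
  have c: "\<pi> b' \<in> carrier_mat k k" "\<rho> b' \<in> carrier_mat k k" if "b' \<in> carrier B" for b'
    using star_homD(1)[OF \<pi> that] star_homD(1)[OF \<rho> that] by auto
  have "\<pi> b * 1\<^sub>m k = 1\<^sub>m k * \<rho> b"
    by (rule rep_intertwiner[OF \<pi> \<rho> _ _ _ b]) (simp_all add: assms(3,4) right_mult_one_mat[OF c(2)[OF ug_carrier]] left_mult_one_mat[OF c(2)[OF ug_carrier]]
        right_mult_one_mat[OF c(2)[OF em_carrier]] left_mult_one_mat[OF c(2)[OF em_carrier]])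
  then show ?thesis using c[OF b] by simp
qed

lemma rep_exists:
  assumes U: "torus_tuple (Mat k) n \<theta> U" and E: "E \<in> star_hom M (Mat k)"
    and comm: "\<And>j x. j < n ==> x \<in> carrier_mat m m ==> U j * E x = E x * U j"
  obtains \<pi> where "\<pi> \<in> star_hom B (Mat k)" "\<And>j. j < n ==> \<pi> (ug j) = U j"
    "\<And>x. x \<in> carrier_mat m m ==> \<pi> (em x) = E x"
proof -
  obtain f where f: "f \<in> star_hom A (Mat k)" "\<And>j. j < n ==> f (tgen n \<theta> j) = U j"
    "\<And>x. x \<in> carrier A ==> opnorm k (f x) \<le> torus_norm n \<theta> x"
    using torus_universal[OF cstar_alg_matrix U] by metis
  have "f a * E x = E x * f a" if "a \<in> carrier A" "x \<in> carrier_mat m m" for a x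
    by (rule torus_intertwiner[OF f(1) f(1) _ _ that(1)]) (use star_homD(1)[OF E] that comm f(2) in auto)
  then have c: "f a \<otimes>\<^bsub>Mat k\<^esub> E x = E x \<otimes>\<^bsub>Mat k\<^esub> f a" if "a \<in> carrier A" "x \<in> carrier M" for a x
    using that by simp
  obtain \<pi> where \<pi>: "\<pi> \<in> star_hom B (Mat k)" "\<And>a. a \<in> carrier A ==> \<pi> (ts.inA a) = f a"
    "\<And>b. b \<in> carrier M ==> \<pi> (ts.inB b) = E b"
    using ts.tensor_universal[OF star_alg_matrix f(1) E c] by metis
  show ?thesis
  proof (rule that[OF \<pi>(1)])
    fix j assume "j < n"
    then show "\<pi> (ug j) = U j" unfolding ug_def using \<pi>(2)[OF torus_tupleD(1)[OF torus_tuple_tgen]] f(2) by simp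
  next
    fix x :: "complex mat" assume "x \<in> carrier_mat m m"
    then show "\<pi> (em x) = E x" unfolding em_def by (intro \<pi>(3)) simp
  qed
qed

lemma rep_continuous:
  fixes q :: "'t::topological_space => _"
  assumes q: "\<And>t. t \<in> X ==> q t \<in> star_hom B (Mat k)"
    and g: "\<And>j. j < n ==> cont_mat X k k (\<lambda>t. q t (ug j))"
    and e: "\<And>x. x \<in> carrier_mat m m ==> cont_mat X k k (\<lambda>t. q t (em x))" and b: "b \<in> carrier B"
  shows "cont_mat X k k (\<lambda>t. q t b)"
  using b
proof (induction rule: ts.tensor_induct)
  case (inA a)
  show ?case by (rule torus_rep_continuous[OF star_hom_comp[OF ts.inA_hom q] _ inA]) (use g in "auto simp: ug_def")
next
  case (inB x) then show ?case using e by (simp add: em_def)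
next
  case (add x y)
  show ?case by (rule cont_mat_cong[OF _ cont_mat_add[OF add(3,4)]]) (simp add: star_homD(3)[OF q add(1,2)])
next
  case (mult x y)
  show ?case by (rule cont_mat_cong[OF _ cont_mat_mult[OF mult(3,4)]]) (simp add: star_homD(2)[OF q mult(1,2)])
qed

end

section \<open>Kronecker products and existence of representations\<close>

definition kron :: "nat => nat => complex mat => complex mat => complex mat" where
  "kron k l U T = mat (k * l) (k * l) (\<lambda>(i, j). U $$ (i div l, j div l) * T $$ (i mod l, j mod l))"

lemma kron_carrier [simp]: "kron k l U T \<in> carrier_mat (k * l) (k * l)" by (simp add: kron_def)

lemma div_mod_less: "i < k * l ==> i div l < k" "i < k * l ==> i mod l < (l::nat)"
  by (simp add: less_mult_imp_div_less) (metis mod_less_divisor mult_0_right neq0_conv not_less0)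

lemma kron_index: "i < k * l ==> j < k * l ==> kron k l U T $$ (i, j) = U $$ (i div l, j div l) * T $$ (i mod l, j mod l)"
  by (simp add: kron_def)

lemma sum_div_mod:
  fixes f :: "nat => nat => 'a :: comm_monoid_add"
  shows "(\<Sum>c<k * l. f (c div l) (c mod l)) = (\<Sum>a<k. \<Sum>b<l. f a b)"
proof -
  have "(\<Sum>a<k. \<Sum>b<l. f a b) = (\<Sum>(a, b)\<in>{..<k} \<times> {..<l}. f a b)" by (simp add: sum.cartesian_product)
  also have "\<dots> = (\<Sum>c<k * l. f (c div l) (c mod l))"
  proof (rule sum.reindex_bij_witness[of _ "\<lambda>c. (c div l, c mod l)" "\<lambda>(a, b). a * l + b"]; clarsimp simp: div_mod_less)
    fix a b assume "a < k" "b < l"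
    then have "a * l + b < a * l + l" by simp
    also have "\<dots> = Suc a * l" by simp
    also have "\<dots> \<le> k * l" using \<open>a < k\<close> by (intro mult_right_mono) auto
    finally show "a * l + b < k * l" .
  qed
  finally show ?thesis by simp
qed

lemma kron_mult:
  assumes "U \<in> carrier_mat k k" "U' \<in> carrier_mat k k" "T \<in> carrier_mat l l" "T' \<in> carrier_mat l l"
  shows "kron k l U T * kron k l U' T' = kron k l (U * U') (T * T')"
proof (rule mat_eqI_index[of _ "k * l" "k * l"])
  fix i j assume ij: "i < k * l" "j < k * l"
  note dm = div_mod_less[OF ij(1)] div_mod_less[OF ij(2)]
  have "(kron k l U T * kron k l U' T') $$ (i, j) =
      (\<Sum>c<k * l. (U $$ (i div l, c div l) * U' $$ (c div l, j div l)) * (T $$ (i mod l, c mod l) * T' $$ (c mod l, j mod l)))"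
    unfolding mat_mult_index[OF kron_carrier kron_carrier ij] using ij by (intro sum.cong) (auto simp: kron_index)
  also have "\<dots> = (\<Sum>a<k. \<Sum>b<l. (U $$ (i div l, a) * U' $$ (a, j div l)) * (T $$ (i mod l, b) * T' $$ (b, j mod l)))"
    by (rule sum_div_mod)
  also have "\<dots> = kron k l (U * U') (T * T') $$ (i, j)"
    unfolding kron_index[OF ij] mat_mult_index[OF assms(1,2) dm(1,3)] mat_mult_index[OF assms(3,4) dm(2,4)] by (simp add: sum_product)
  finally show "(kron k l U T * kron k l U' T') $$ (i, j) = kron k l (U * U') (T * T') $$ (i, j)" .
qed (auto intro: mult_carrier_mat[OF kron_carrier kron_carrier])

lemma kron_adjoint:
  assumes "U \<in> carrier_mat k k" "T \<in> carrier_mat l l"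
  shows "mat_adjoint (kron k l U T) = kron k l (mat_adjoint U) (mat_adjoint T)"
  using assms div_mod_less
  by (intro mat_eqI_index[of _ "k * l" "k * l"] mat_adjoint_carrier) (auto simp: kron_index carrier_matD[OF kron_carrier])

lemma kron_one: "kron k l (1\<^sub>m k) (1\<^sub>m l) = 1\<^sub>m (k * l)"
proof (rule mat_eqI_index[of _ "k * l" "k * l"])
  fix i j assume ij: "i < k * l" "j < k * l"
  note dm = div_mod_less[OF ij(1)] div_mod_less[OF ij(2)]
  show "kron k l (1\<^sub>m k) (1\<^sub>m l) $$ (i, j) = 1\<^sub>m (k * l) $$ (i, j)"
    unfolding kron_index[OF ij] using ij dm by auto (metis div_mult_mod_eq)
qed auto

lemma kron_smult:
  assumes "U \<in> carrier_mat k k" "T \<in> carrier_mat l l"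
  shows "kron k l (c \<cdot>\<^sub>m U) T = c \<cdot>\<^sub>m kron k l U T" "kron k l U (c \<cdot>\<^sub>m T) = c \<cdot>\<^sub>m kron k l U T"
  by (rule mat_eqI_index[of _ "k * l" "k * l"]; use assms div_mod_less in "simp add: kron_index carrier_matD[OF kron_carrier]")+

lemma kron_add:
  assumes "U \<in> carrier_mat k k" "T \<in> carrier_mat l l" "T' \<in> carrier_mat l l"
  shows "kron k l U (T + T') = kron k l U T + kron k l U T'"
  by (rule mat_eqI_index[of _ "k * l" "k * l"]) (use assms div_mod_less in "simp_all add: kron_index carrier_matD[OF kron_carrier] distrib_left")

definition perm_mat :: "nat => (nat => nat) => (nat => complex) => complex mat" where
  "perm_mat d \<sigma> f = mat d d (\<lambda>(a, b). if a = \<sigma> b then f b else 0)"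

lemma perm_mat_carrier [simp]: "perm_mat d \<sigma> f \<in> carrier_mat d d" by (simp add: perm_mat_def)

lemma perm_mat_mult:
  assumes "\<And>b. b < d ==> \<tau> b < d"
  shows "perm_mat d \<sigma> f * perm_mat d \<tau> g = perm_mat d (\<lambda>b. \<sigma> (\<tau> b)) (\<lambda>b. f (\<tau> b) * g b)"
proof (rule mat_eqI_index[of _ d d])
  fix i j assume ij: "i < d" "j < d"
  have "(perm_mat d \<sigma> f * perm_mat d \<tau> g) $$ (i, j) = (\<Sum>c<d. if c = \<tau> j then (if i = \<sigma> c then f c * g j else 0) else 0)"
    unfolding mat_mult_index[OF perm_mat_carrier perm_mat_carrier ij] using ij by (intro sum.cong) (auto simp: perm_mat_def)
  then show "(perm_mat d \<sigma> f * perm_mat d \<tau> g) $$ (i, j) = perm_mat d (\<lambda>b. \<sigma> (\<tau> b)) (\<lambda>b. f (\<tau> b) * g b) $$ (i, j)"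
    using ij assms by (simp add: perm_mat_def)
qed (auto intro: mult_carrier_mat[OF perm_mat_carrier perm_mat_carrier])

lemma perm_mat_unitary:
  assumes "\<And>b. b < d ==> \<sigma> b < d" "inj_on \<sigma> {..<d}" "\<And>b. b < d ==> cmod (f b) = 1"
  shows "perm_mat d \<sigma> f \<in> unitaries (Mat d)"
proof -
  let ?U = "perm_mat d \<sigma> f"
  have a: "mat_adjoint ?U \<in> carrier_mat d d" by (rule mat_adjoint_carrier) simp
  have "mat_adjoint ?U * ?U = 1\<^sub>m d"
  proof (rule mat_eqI_index[of _ d d])
    fix i j assume ij: "i < d" "j < d"
    have "(mat_adjoint ?U * ?U) $$ (i, j) = (\<Sum>c<d. if c = \<sigma> j then (if c = \<sigma> i then cnj (f i) * f j else 0) else 0)"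
      unfolding mat_mult_index[OF a perm_mat_carrier ij] using ij by (intro sum.cong) (auto simp: perm_mat_def)
    also have "\<dots> = (if \<sigma> j = \<sigma> i then cnj (f i) * f j else 0)" using ij assms(1) by simp
    also have "\<dots> = 1\<^sub>m d $$ (i, j)"
      using ij assms(2) unimodular_mult_cnj(2)[OF assms(3)[OF ij(1)]] by (auto simp: inj_on_def)
    finally show "(mat_adjoint ?U * ?U) $$ (i, j) = 1\<^sub>m d $$ (i, j)" .
  qed (auto intro: mult_carrier_mat[OF a perm_mat_carrier])
  moreover from this have "?U * mat_adjoint ?U = 1\<^sub>m d" by (rule mat_mult_left_right_inverse[OF a perm_mat_carrier])
  ultimately show ?thesis by (simp add: unitaries_def)
qed

text \<open>The common denominator \<open>d\<close> is used as an exponent: the powers \<open>u\<^sub>j\<^sup>d\<close> are central.\<close>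

definition rat_skew :: "nat => nat => real mat => bool" where
  "rat_skew n d \<theta> \<longleftrightarrow> 1 \<le> d \<and> (\<forall>j<n. \<forall>k<n. real d * \<theta> $$ (j, k) \<in> \<int> \<and> \<theta> $$ (j, k) = - \<theta> $$ (k, j))"

lemma rat_skewD: "rat_skew n d \<theta> ==> 1 \<le> d" "rat_skew n d \<theta> ==> j < n ==> k < n ==> real d * \<theta> $$ (j, k) \<in> \<int>"
    "rat_skew n d \<theta> ==> j < n ==> k < n ==> \<theta> $$ (j, k) = - \<theta> $$ (k, j)"
  unfolding rat_skew_def by blast+

text \<open>Clock and shift matrices: the new generator acts as the shift on a new tensor factor, and each
  old generator is twisted by a power of the clock.\<close>

lemma torus_tuple_matrix_exists:
  assumes "rat_skew n d \<theta>" shows "\<exists>K U. 1 \<le> K \<and> torus_tuple (Mat K) n \<theta> U"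
  using assms
proof (induction n)
  case 0
  show ?case by (intro exI[of _ 1] exI[of _ undefined]) (simp add: torus_tuple_def)
next
  case (Suc n)
  have d: "1 \<le> d" using Suc.prems by (rule rat_skewD)
  have "rat_skew n d \<theta>" using Suc.prems unfolding rat_skew_def by (meson less_SucI)
  then obtain K U where K: "1 \<le> K" and U: "torus_tuple (Mat K) n \<theta> U" using Suc.IH by blast
  define sh where "sh b = (if Suc b < d then Suc b else 0)" for b
  define C where "C t = perm_mat d (\<lambda>b. b) (\<lambda>b. phase (t * real b))" for t
  define S where "S = perm_mat d sh (\<lambda>_. 1)"
  have shl: "sh b < d" for b using d by (simp add: sh_def)
  have "inj_on sh {..<d}" by (rule inj_onI) (auto simp: sh_def split: if_splits)
  then have Su: "S \<in> unitaries (Mat d)" unfolding S_def using shl by (intro perm_mat_unitary) auto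
  have Cu: "C t \<in> unitaries (Mat d)" for t unfolding C_def by (intro perm_mat_unitary) auto
  have Cc: "C t \<in> carrier_mat d d" and Sc: "S \<in> carrier_mat d d" for t by (auto simp: C_def S_def)
  have CC: "C t * C t' = C t' * C t" for t t' unfolding C_def by (subst (1 2) perm_mat_mult) (simp_all add: mult.commute)
  have CS: "C t * S = phase t \<cdot>\<^sub>m (S * C t)" if "real d * t \<in> \<int>" for t
  proof -
    have "phase (t * real (sh b)) = phase (t * real b) * phase t" if "b < d" for b
    proof (cases "Suc b = d")
      case True
      then have "sh b = 0" by (simp add: sh_def)
      moreover have "t * real b + t = real d * t" using True by (simp add: algebra_simps flip: True)
      then have "phase (t * real b) * phase t = 1" using \<open>real d * t \<in> \<int>\<close> phase_eq_1_iff by (metis phase_add)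
      ultimately show ?thesis by simp
    next
      case False
      then have "sh b = Suc b" using that by (simp add: sh_def)
      then show ?thesis by (simp add: distrib_left phase_add mult.commute)
    qed
    note ph = this
    have "C t * S = perm_mat d sh (\<lambda>b. phase (t * real (sh b)))" unfolding C_def S_def using shl by (subst perm_mat_mult) auto
    moreover have "S * C t = perm_mat d sh (\<lambda>b. phase (t * real b))" unfolding C_def S_def by (subst perm_mat_mult) auto
    ultimately show ?thesis using ph by (intro mat_eqI_index[of _ d d]) (auto simp: perm_mat_def)
  qed
  interpret K: star_alg "Mat K" by (rule star_alg_matrix)
  have un: "kron K d X Y \<in> unitaries (Mat (K * d))"
    if "X \<in> unitaries (Mat K)" "Y \<in> unitaries (Mat d)" for X Y
    using that by (simp add: unitaries_def kron_adjoint kron_mult kron_one)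
  define V where "V j = (if j = n then kron K d (1\<^sub>m K) S else kron K d (U j) (C (\<theta> $$ (n, j))))" for j
  note Uc = torus_tupleD(1)[OF U, simplified]
  have "torus_tuple (Mat (K * d)) (Suc n) \<theta> V"
    unfolding torus_tuple_def
  proof (intro conjI allI impI)
    fix j assume j: "j < Suc n"
    have Vu: "V j \<in> unitaries (Mat (K * d))"
    proof (cases "j = n")
      case True
      show ?thesis unfolding V_def using un[OF _ Su] K.unitaries_one True by simp
    next
      case False
      then show ?thesis unfolding V_def using un[OF K.torus_tuple_unitary[OF U] Cu] j by simp
    qed
    then show "V j \<in> carrier (Mat (K * d))"
      "star (Mat (K * d)) (V j) \<otimes>\<^bsub>Mat (K * d)\<^esub> V j = \<one>\<^bsub>Mat (K * d)\<^esub>"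
      "V j \<otimes>\<^bsub>Mat (K * d)\<^esub> star (Mat (K * d)) (V j) = \<one>\<^bsub>Mat (K * d)\<^esub>"
      unfolding unitaries_def by blast+
    fix k assume k: "k < Suc n"
    have zero: "phase (\<theta> $$ (n, n)) = 1" using rat_skewD(3)[OF Suc.prems, of n n] by simp
    have int: "real d * \<theta> $$ (n, i) \<in> \<int>" if "i < n" for i using rat_skewD(2)[OF Suc.prems, of n i] that by simp
    have "V k * V j = phase (\<theta> $$ (j, k)) \<cdot>\<^sub>m (V j * V k)"
    proof -
      consider "j = n" "k = n" | "j < n" "k = n" | "j = n" "k < n" | "j < n" "k < n" using j k by linarith
      then show ?thesis
      proof cases
        case 1
        have "1 \<cdot>\<^sub>m (V n * V n) = V n * V n" by (intro eq_matI) auto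
        then show ?thesis using 1 zero by simp
      next
        case 2
        have "kron K d (U j) (C (\<theta> $$ (n, j)) * S) = phase (\<theta> $$ (n, j)) \<cdot>\<^sub>m kron K d (U j) (S * C (\<theta> $$ (n, j)))"
          unfolding CS[OF int[OF 2(1)]] using Uc[OF 2(1)] by (intro kron_smult(2)) (auto intro: mult_carrier_mat[OF Sc Cc])
        then have "phase (\<theta> $$ (j, n)) \<cdot>\<^sub>m kron K d (U j) (C (\<theta> $$ (n, j)) * S) = kron K d (U j) (S * C (\<theta> $$ (n, j)))"
          using rat_skewD(3)[OF Suc.prems, of j n] 2
          by (intro mat_eqI_index[of _ "K * d" "K * d"]) (auto simp: phase_minus unimodular_mult_cnj carrier_matD[OF kron_carrier])
        then show ?thesis using 2 Uc[OF 2(1)] Cc Sc by (simp add: V_def kron_mult)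
      next
        case 3
        have "kron K d (U k) (C (\<theta> $$ (n, k)) * S) = phase (\<theta> $$ (n, k)) \<cdot>\<^sub>m kron K d (U k) (S * C (\<theta> $$ (n, k)))"
          unfolding CS[OF int[OF 3(2)]] using Uc[OF 3(2)] by (intro kron_smult(2)) (auto intro: mult_carrier_mat[OF Sc Cc])
        then show ?thesis using 3 Uc[OF 3(2)] Cc Sc by (simp add: V_def kron_mult)
      next
        case 4
        have "U k * U j = phase (\<theta> $$ (j, k)) \<cdot>\<^sub>m (U j * U k)" using torus_tupleD(4)[OF U 4] by simp
        then show ?thesis using 4 Uc[OF 4(1)] Uc[OF 4(2)] Cc CC[of "\<theta> $$ (n, k)" "\<theta> $$ (n, j)"]
          by (simp add: V_def kron_mult kron_smult mult_carrier_mat[OF Uc Uc] mult_carrier_mat[OF Cc Cc])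
      qed
    qed
    then show "V k \<otimes>\<^bsub>Mat (K * d)\<^esub> V j = phase (\<theta> $$ (j, k)) \<odot>\<^bsub>Mat (K * d)\<^esub> (V j \<otimes>\<^bsub>Mat (K * d)\<^esub> V k)"
      by simp
  qed
  moreover have "1 \<le> K * d" using K d by simp
  ultimately show ?case by blast
qed

section \<open>Matrix units and the dimension of minimal representations\<close>

definition munit :: "nat => nat => nat => complex mat" where
  "munit m a b = mat m m (\<lambda>(i, j). if i = a \<and> j = b then 1 else 0)"

lemma munit_carrier [simp]: "munit m a b \<in> carrier_mat m m" by (simp add: munit_def)

lemma munit_mult:
  assumes "b < m" shows "munit m a b * munit m c e = (if b = c then munit m a e else 0\<^sub>m m m)"
proof (rule mat_eqI_index[of _ m m])
  fix i j assume ij: "i < m" "j < m"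
  have "(munit m a b * munit m c e) $$ (i, j) = (\<Sum>l<m. if l = b then (if i = a \<and> b = c \<and> j = e then 1 else 0) else 0)"
    unfolding mat_mult_index[OF munit_carrier munit_carrier ij] using ij by (intro sum.cong) (auto simp: munit_def)
  then show "(munit m a b * munit m c e) $$ (i, j) = (if b = c then munit m a e else 0\<^sub>m m m) $$ (i, j)"
    using ij assms by (auto simp: munit_def)
qed (auto intro: mult_carrier_mat[OF munit_carrier munit_carrier])

lemma munit_adjoint: "mat_adjoint (munit m a b) = munit m b a"
  by (rule mat_eqI_index[of _ m m]) (auto simp: munit_def intro!: mat_adjoint_carrier)

lemma munit_induct [consumes 1, case_names zero munit add]:
  assumes x: "x \<in> carrier_mat m m" and z: "Q (0\<^sub>m m m)"
    and u: "\<And>a b c. a < m ==> b < m ==> Q (c \<cdot>\<^sub>m munit m a b)"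
    and add: "\<And>x y. x \<in> carrier_mat m m ==> y \<in> carrier_mat m m ==> Q x ==> Q y ==> Q (x + y)"
  shows "Q x"
proof -
  define R where "R A = mat m m (\<lambda>ij. if ij \<in> A then x $$ ij else 0)" for A
  have "Q (R A)" if "finite A" "A \<subseteq> {..<m} \<times> {..<m}" for A
    using that
  proof (induction rule: finite_induct)
    case empty
    have "R {} = 0\<^sub>m m m" unfolding R_def by (intro eq_matI) auto
    then show ?case using z by simp
  next
    case (insert p A)
    obtain a b where p: "p = (a, b)" "a < m" "b < m" using insert by auto
    have "R (insert p A) = x $$ p \<cdot>\<^sub>m munit m a b + R A"
      unfolding R_def p(1) using insert(2) p by (intro eq_matI) (auto simp: munit_def)
    then show ?case using add[of "x $$ p \<cdot>\<^sub>m munit m a b" "R A"] u[OF p(2,3)] insert by (simp add: R_def)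
  qed
  moreover have "R ({..<m} \<times> {..<m}) = x" unfolding R_def using x by (intro eq_matI) auto
  ultimately show ?thesis by (metis finite_SigmaI finite_lessThan order_refl)
qed

definition mtrace :: "nat => complex mat => complex" where "mtrace k A = (\<Sum>i<k. A $$ (i, i))"

lemma mtrace_comm:
  assumes "X \<in> carrier_mat N r" "Y \<in> carrier_mat r N" shows "mtrace N (X * Y) = mtrace r (Y * X)"
proof -
  have "mtrace N (X * Y) = (\<Sum>i<N. \<Sum>j<r. X $$ (i, j) * Y $$ (j, i))"
    unfolding mtrace_def using mat_mult_index[OF assms] by (intro sum.cong) auto
  also have "\<dots> = (\<Sum>j<r. \<Sum>i<N. Y $$ (j, i) * X $$ (i, j))" by (subst sum.swap) (simp add: mult.commute)
  also have "\<dots> = mtrace r (Y * X)" unfolding mtrace_def using mat_mult_index[OF assms(2,1)] by (intro sum.cong) auto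
  finally show ?thesis .
qed

context torus_matrix
begin

lemma rep_amplification:
  assumes m: "1 \<le> m" and U: "torus_tuple (Mat r) n \<theta> U"
  shows "star_hom B (Mat (r * m)) \<noteq> {}"
proof -
  note Uc = torus_tupleD(1)[OF U, simplified]
  have o: "1\<^sub>m m \<in> carrier_mat m m" "1\<^sub>m r \<in> carrier_mat r r" by auto
  have t: "torus_tuple (Mat (r * m)) n \<theta> (\<lambda>j. kron r m (U j) (1\<^sub>m m))"
    unfolding torus_tuple_def
  proof (intro conjI allI impI)
    fix j assume j: "j < n"
    note uj = torus_tupleD(1-3)[OF U j, simplified]
    show "kron r m (U j) (1\<^sub>m m) \<in> carrier (Mat (r * m))" by simp
    show "star (Mat (r * m)) (kron r m (U j) (1\<^sub>m m)) \<otimes>\<^bsub>Mat (r * m)\<^esub> kron r m (U j) (1\<^sub>m m) = \<one>\<^bsub>Mat (r * m)\<^esub>"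
      "kron r m (U j) (1\<^sub>m m) \<otimes>\<^bsub>Mat (r * m)\<^esub> star (Mat (r * m)) (kron r m (U j) (1\<^sub>m m)) = \<one>\<^bsub>Mat (r * m)\<^esub>"
      using uj by (simp_all add: kron_adjoint kron_mult kron_one)
    fix k assume k: "k < n"
    show "kron r m (U k) (1\<^sub>m m) \<otimes>\<^bsub>Mat (r * m)\<^esub> kron r m (U j) (1\<^sub>m m) =
      phase (\<theta> $$ (j, k)) \<odot>\<^bsub>Mat (r * m)\<^esub> (kron r m (U j) (1\<^sub>m m) \<otimes>\<^bsub>Mat (r * m)\<^esub> kron r m (U k) (1\<^sub>m m))"
      using torus_tupleD(4)[OF U j k] Uc[OF j] Uc[OF k] kron_smult(1)[OF mult_carrier_mat[OF Uc[OF j] Uc[OF k]] o(1)]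
      by (simp add: kron_mult)
  qed
  have e: "(\<lambda>x. kron r m (1\<^sub>m r) x) \<in> star_hom M (Mat (r * m))"
    by (rule star_homI) (simp_all add: kron_adjoint kron_mult kron_one kron_add kron_smult)
  have c: "kron r m (U j) (1\<^sub>m m) * kron r m (1\<^sub>m r) x = kron r m (1\<^sub>m r) x * kron r m (U j) (1\<^sub>m m)"
    if "j < n" "x \<in> carrier_mat m m" for j x using Uc[OF that(1)] that(2) by (simp add: kron_mult)
  obtain \<pi> where \<pi>: "\<pi> \<in> star_hom B (Mat (r * m))"
    using rep_exists[OF t e c] by metis
  show ?thesis by (rule ne_emptyI[OF \<pi>])
qed

text \<open>The diagonal matrix units act as \<open>m\<close> projections of the same trace \<open>r\<close> with sum \<open>1\<close>, and the torus
  acts on the range of each of them.\<close>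

lemma rep_divisible:
  assumes m: "1 \<le> m" and \<pi>: "\<pi> \<in> star_hom B (Mat N)"
  obtains r where "N = m * r" "star_hom A (Mat r) \<noteq> {}"
proof -
  have m0: "0 < m" using m by simp
  note pD = star_homD[OF rep_em[OF \<pi>], simplified]
  define E where "E a b = \<pi> (em (munit m a b))" for a b
  have Ec: "E a b \<in> carrier_mat N N" for a b using pD(1)[OF munit_carrier] by (simp add: E_def)
  have z: "\<pi> (em (0\<^sub>m m m)) = 0\<^sub>m N N"
    using star_hom_zero[OF star_alg_matrix star_alg_matrix rep_em[OF \<pi>]] by simp
  have Em: "E a b * E b c = E a c" if "b < m" for a b c
    using pD(2)[OF munit_carrier munit_carrier, of a b b c] munit_mult[OF that, of a b c] by (simp add: E_def)
  have tr: "mtrace N (E a a) = mtrace N (E 0 0)" if "a < m" for a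
    using mtrace_comm[OF Ec Ec, of a 0 0 a] Em[OF m0, of a a] Em[OF that, of 0 0] by simp
  define P where "P = E 0 0"
  have P: "P \<in> carrier_mat N N" "P * P = P" "mat_adjoint P = P"
    using Ec Em[OF m0, of 0 0] pD(6)[OF munit_carrier, of 0 0] by (auto simp: P_def E_def munit_adjoint)
  define D where "D = 1\<^sub>m N - P"
  have D: "D \<in> carrier_mat N N" unfolding D_def by (rule minus_carrier_mat[OF P(1)])
  obtain r J where J: "J \<in> carrier_mat N r" "r \<le> N" "mat_adjoint J * J = 1\<^sub>m r" "D * J = 0\<^sub>m N r"
    "\<And>k X. X \<in> carrier_mat N k ==> D * X = 0\<^sub>m N k ==> J * (mat_adjoint J * X) = X"
    using kernel_isometry[OF D] by metis
  have aJ: "mat_adjoint J \<in> carrier_mat r N" using J by simp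
  have f: "(\<lambda>a. \<pi> (ts.inA a)) \<in> star_hom A (Mat N)" by (rule star_hom_comp[OF ts.inA_hom \<pi>])
  have "D * \<pi> (ts.inA a) = \<pi> (ts.inA a) * D" if a: "a \<in> carrier A" for a
  proof -
    have fa: "\<pi> (ts.inA a) \<in> carrier_mat N N" using star_homD(1)[OF f a] by simp
    have "\<pi> (ts.inA a) * P = P * \<pi> (ts.inA a)"
      unfolding P_def E_def
    proof (rule torus_intertwiner[OF f f Ec[unfolded E_def] _ a])
      fix j assume "j < n"
      then show "\<pi> (ts.inA (tgen n \<theta> j)) * \<pi> (em (munit m 0 0)) = \<pi> (em (munit m 0 0)) * \<pi> (ts.inA (tgen n \<theta> j))"
        using rep_comm[OF \<pi> _ munit_carrier] by (simp add: ug_def)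
    qed
    then show ?thesis unfolding D_def using fa P
      by (simp add: minus_mult_distrib_mat[of _ N N _ _ N] mult_minus_distrib_mat[of _ N N _ N])
  qed
  then have "(\<lambda>a. mat_adjoint J * \<pi> (ts.inA a) * J) \<in> star_hom A (Mat r)"
    by (rule compression_hom[OF star_alg_torus f D _ J(1,3,4,5)])
  then have ne: "star_hom A (Mat r) \<noteq> {}" by (rule ne_emptyI)
  have PJ: "P * J = J"
  proof -
    have "J - P * J = 0\<^sub>m N r" using J(4) J(1) P by (simp add: D_def minus_mult_distrib_mat[of _ N N _ _ r])
    note z = this
    show ?thesis
    proof (rule mat_eqI_index[of _ N r])
      fix i j assume "i < N" "j < r"
      then show "(P * J) $$ (i, j) = J $$ (i, j)"
        using arg_cong[OF z, of "\<lambda>X. X $$ (i, j)"] J(1) P(1) by (simp del: index_mult_mat(1))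
    qed (use mult_carrier_mat[OF P(1) J(1)] J in auto)
  qed
  have "D * P = 0\<^sub>m N N" using P by (simp add: D_def minus_mult_distrib_mat[of _ N N _ _ N])
  then have "J * (mat_adjoint J * P) = P" using J(5)[OF P(1)] by simp
  moreover have "mat_adjoint J * P = mat_adjoint J"
    using mat_adjoint_mult[OF P(1) J(1)] P(3) PJ by simp
  ultimately have JJ: "J * mat_adjoint J = P" by simp
  have "mtrace N P = of_nat r"
    using mtrace_comm[OF J(1) aJ] JJ J(3) by (simp add: mtrace_def)
  define Q where "Q k = mat m m (\<lambda>(i, j). if i = j \<and> i < k then 1 else (0::complex))" for k
  have Qc: "Q k \<in> carrier_mat m m" for k by (simp add: Q_def)
  have "mtrace N (\<pi> (em (Q k))) = of_nat k * of_nat r" if "k \<le> m" for k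
    using that
  proof (induction k)
    case 0
    have "Q 0 = 0\<^sub>m m m" unfolding Q_def by (intro eq_matI) auto
    then show ?case using z by (simp add: mtrace_def)
  next
    case (Suc k)
    have "Q (Suc k) = Q k + munit m k k" unfolding Q_def munit_def by (intro eq_matI) auto
    then have "\<pi> (em (Q (Suc k))) = \<pi> (em (Q k)) + E k k" using pD(3)[OF Qc munit_carrier] by (simp add: E_def)
    then have "mtrace N (\<pi> (em (Q (Suc k)))) = mtrace N (\<pi> (em (Q k))) + mtrace N (E k k)"
      using Ec[of k k] by (simp add: mtrace_def sum.distrib carrier_matD[OF Ec])
    then show ?case using Suc tr[of k] \<open>mtrace N P = of_nat r\<close> by (simp add: P_def distrib_right)
  qed
  from this[of m] have "mtrace N (\<pi> (em (1\<^sub>m m))) = of_nat (m * r)"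
  proof -
    assume *: "m \<le> m ==> mtrace N (\<pi> (em (Q m))) = of_nat m * of_nat r"
    have "Q m = 1\<^sub>m m" unfolding Q_def by (intro eq_matI) auto
    then show ?thesis using * by simp
  qed
  then have "of_nat N = (of_nat (m * r) :: complex)" unfolding pD(4) by (simp add: mtrace_def del: of_nat_mult)
  then have "N = m * r" by (simp only: of_nat_eq_iff)
  then show ?thesis using that ne by blast
qed

lemma min_dim_product:
  assumes m: "1 \<le> m" and q: "min_rep_dim A q" and N: "min_rep_dim B N"
  shows "N = m * q"
proof -
  obtain f where f: "f \<in> star_hom A (Mat q)" using q unfolding min_rep_dim_def by blast
  have "star_hom B (Mat (q * m)) \<noteq> {}"
    by (rule rep_amplification[OF m torus_tuple_hom[OF torus_tuple_tgen f star_alg_torus]])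
  then have le: "N \<le> q * m" using N q m unfolding min_rep_dim_def by (metis le_neq_implies_less mult_le_mono nat_le_linear nat_mult_1)
  obtain \<pi> where \<pi>: "\<pi> \<in> star_hom B (Mat N)" using N unfolding min_rep_dim_def by blast
  obtain r where r: "N = m * r" "star_hom A (Mat r) \<noteq> {}" using rep_divisible[OF m \<pi>] by metis
  have "r \<ge> 1" using r N unfolding min_rep_dim_def by (metis Suc_leI One_nat_def mult_0_right neq0_conv not_one_le_zero)
  then have "q \<le> r" using q r(2) unfolding min_rep_dim_def by (metis not_le_imp_less)
  then have "m * q \<le> N" using r(1) by simp
  then show ?thesis using le by (simp add: mult.commute)
qed

lemma min_dims_exist:
  assumes m: "1 \<le> m" and rs: "rat_skew n d \<theta>"
  obtains q N where "min_rep_dim A q" "min_rep_dim B N"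
proof -
  obtain K U where K: "1 \<le> K" and U: "torus_tuple (Mat K) n \<theta> U" using torus_tuple_matrix_exists[OF rs] by blast
  obtain f where f: "f \<in> star_hom A (Mat K)" "\<And>j. j < n ==> f (tgen n \<theta> j) = U j"
    "\<And>x. x \<in> carrier A ==> opnorm K (f x) \<le> torus_norm n \<theta> x"
    using torus_universal[OF cstar_alg_matrix U] by metis
  obtain \<pi> where \<pi>: "\<pi> \<in> star_hom B (Mat (K * m))" using rep_amplification[OF m U] by blast
  have "1 \<le> K * m" using K m by simp
  then show ?thesis using that min_rep_dim_exists[OF K f(1)] min_rep_dim_exists[OF _ \<pi>] by metis
qed

end

section \<open>Averaged intertwiners\<close>

context star_alg
begin

text \<open>Averages of \<open>X \<mapsto> u X v\<^sup>*\<close> turn a matrix into an intertwiner from \<open>v\<close> to \<open>u\<close> as soon as the \<open>d\<close>-th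
  power of this map is the identity.\<close>

definition avg :: "nat => 'a => 'a => 'a => 'a" where
  "avg d u v T = finsum S (\<lambda>a. zpow S u (int a) \<otimes> T \<otimes> star S (zpow S v (int a))) {..<d}"

lemma avg_term_closed:
  assumes "u \<in> unitaries S" "v \<in> unitaries S" "T \<in> carrier S"
  shows "zpow S u k \<otimes> T \<otimes> star S (zpow S v l) \<in> carrier S"
  using unitariesD(1)[OF zpow_unitary[OF assms(1)]] unitariesD(1)[OF zpow_unitary[OF assms(2)]] assms(3) by simp

lemma avg_closed:
  assumes "u \<in> unitaries S" "v \<in> unitaries S" "T \<in> carrier S" shows "avg d u v T \<in> carrier S"
  unfolding avg_def by (rule finsum_closed) (use avg_term_closed[OF assms] in auto)

lemma avg_intertwine:
  assumes u: "u \<in> unitaries S" and v: "v \<in> unitaries S" and T: "T \<in> carrier S" and x: "x \<in> carrier S" and y: "y \<in> carrier S"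
    and xu: "comm_phase S x u (phase t)" and yv: "comm_phase S y v (phase t)" and xT: "x \<otimes> T = T \<otimes> y"
  shows "x \<otimes> avg d u v T = avg d u v T \<otimes> y"
proof -
  have "x \<otimes> (zpow S u k \<otimes> T \<otimes> star S (zpow S v k)) = zpow S u k \<otimes> T \<otimes> star S (zpow S v k) \<otimes> y" for k
  proof -
    define z w where "z = zpow S u k" and "w = star S (zpow S v k)"
    have c: "z \<in> carrier S" "w \<in> carrier S"
      using unitariesD(1)[OF zpow_unitary[OF u]] unitariesD(1)[OF zpow_unitary[OF v]] by (auto simp: z_def w_def)
    define c where "c = phase (of_int k * t)"
    have cc: "c * cnj c = 1" by (simp add: c_def unimodular_mult_cnj)
    have xz: "x \<otimes> z = c \<odot> (z \<otimes> x)" using comm_phase_zpow[OF x u xu] by (simp add: comm_phase_def z_def c_def)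
    have "comm_phase S y w (cnj c)"
      unfolding w_def c_def by (rule comm_phase_star[OF y zpow_unitary[OF v] comm_phase_zpow[OF y v yv]]) simp
    then have yw: "y \<otimes> w = cnj c \<odot> (w \<otimes> y)" by (simp add: comm_phase_def)
    have "x \<otimes> (z \<otimes> T \<otimes> w) = (x \<otimes> z) \<otimes> T \<otimes> w" using x c T by (simp add: m_assoc)
    also have "\<dots> = c \<odot> (z \<otimes> (x \<otimes> T) \<otimes> w)" unfolding xz using x c T by (simp add: m_assoc smult_mult_l)
    also have "\<dots> = c \<odot> (z \<otimes> T \<otimes> (y \<otimes> w))" unfolding xT using y c T by (simp add: m_assoc)
    also have "\<dots> = (c * cnj c) \<odot> (z \<otimes> T \<otimes> w \<otimes> y)" unfolding yw using y c T by (simp add: m_assoc smult_mult_r smult_smult)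
    also have "\<dots> = z \<otimes> T \<otimes> w \<otimes> y" unfolding cc using y c T by simp
    finally show ?thesis by (simp only: z_def w_def)
  qed
  then show ?thesis
    unfolding avg_def using avg_term_closed[OF u v T] x y
    by (subst finsum_rdistr, simp, simp, fastforce, subst finsum_ldistr, simp, simp, fastforce) simp
qed

text \<open>Conjugation by \<open>u\<close> and \<open>v\<close> shifts the terms of the average cyclically, thanks to \<open>per\<close>.\<close>

lemma avg_self:
  assumes u: "u \<in> unitaries S" and v: "v \<in> unitaries S" and T: "T \<in> carrier S" and d: "1 \<le> d"
    and per: "zpow S u (int d) \<otimes> T \<otimes> star S (zpow S v (int d)) = T"
  shows "u \<otimes> avg d u v T = avg d u v T \<otimes> v"
proof -
  define g where "g a = zpow S u (int a) \<otimes> T \<otimes> star S (zpow S v (int a))" for a :: nat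
  have gc: "g a \<in> carrier S" for a unfolding g_def by (rule avg_term_closed[OF u v T])
  obtain d' where d': "d = Suc d'" using d by (cases d) auto
  have g0: "g 0 = T" using T by (simp add: g_def)
  have gd: "g (Suc d') = T" using per by (simp add: g_def d')
  note uc = unitariesD[OF u] and vc = unitariesD[OF v]
  have gs: "u \<otimes> g a \<otimes> star S v = g (Suc a)" for a
  proof -
    have z: "zpow S u (int (Suc a)) = u \<otimes> zpow S u (int a)" using zpow_add[OF u, of 1 "int a"] u by simp
    have w: "zpow S v (int (Suc a)) = v \<otimes> zpow S v (int a)" using zpow_add[OF v, of 1 "int a"] v by simp
    show ?thesis unfolding g_def z w
      using uc(1) vc(1) T unitariesD(1)[OF zpow_unitary[OF u]] unitariesD(1)[OF zpow_unitary[OF v]] by (simp add: star_mult m_assoc)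
  qed
  have av: "avg d u v T = finsum S g {..d'}" unfolding avg_def g_def d' lessThan_Suc_atMost ..
  have "u \<otimes> avg d u v T \<otimes> star S v = finsum S (\<lambda>a. g (Suc a)) {..d'}"
    unfolding av using gc uc(1) vc(1)
    by (subst finsum_rdistr, simp, simp, fastforce, subst finsum_ldistr, simp, simp, fastforce) (simp add: gs)
  moreover have "finsum S (\<lambda>a. g (Suc a)) {..d'} \<oplus> g 0 = finsum S g {..Suc d'}"
    by (rule finsum_Suc2[symmetric]) (use gc in auto)
  moreover have "finsum S g {..Suc d'} = g (Suc d') \<oplus> finsum S g {..d'}"
    by (rule finsum_Suc) (use gc in auto)
  ultimately have "u \<otimes> avg d u v T \<otimes> star S v \<oplus> T = avg d u v T \<oplus> T"
    using g0 gd av a_comm[OF T avg_closed[OF u v T, of d]] by simp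
  then have e: "u \<otimes> avg d u v T \<otimes> star S v = avg d u v T"
    using add.right_cancel[of T "u \<otimes> avg d u v T \<otimes> star S v" "avg d u v T"] avg_closed[OF u v T, of d] uc(1) vc(1) T by simp
  have "u \<otimes> avg d u v T = u \<otimes> avg d u v T \<otimes> (star S v \<otimes> v)" using vc uc(1) avg_closed[OF u v T, of d] by simp
  also have "\<dots> = (u \<otimes> avg d u v T \<otimes> star S v) \<otimes> v" using vc(1) uc(1) avg_closed[OF u v T, of d] by (simp add: m_assoc)
  finally show ?thesis unfolding e .
qed

lemma avg_diag:
  assumes u: "u \<in> unitaries S" shows "avg d u u (c \<odot> \<one>) = (of_nat d * c) \<odot> \<one>"
proof (induction d)
  case 0 show ?case by (simp add: avg_def)
next
  case (Suc d)
  have z: "zpow S u (int a) \<otimes> (c \<odot> \<one>) \<otimes> star S (zpow S u (int a)) = c \<odot> \<one>" for a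
    using unitariesD[OF zpow_unitary[OF u]] by (simp add: smult_mult_r smult_mult_l)
  have "avg (Suc d) u u (c \<odot> \<one>) = c \<odot> \<one> \<oplus> avg d u u (c \<odot> \<one>)"
    unfolding avg_def lessThan_Suc by (subst finsum_insert) (auto simp: z)
  then show ?case using Suc smult_l_distr[of \<one> c "of_nat d * c"] by (simp add: distrib_right)
qed

text \<open>Averaging over one generator after the other.  Since generators commute up to phases, averaging
  over a later one does not destroy the intertwining property for the earlier ones.\<close>

primrec itw :: "nat => (nat => 'a) => (nat => 'a) => 'a => nat => 'a" where
  "itw d u v T 0 = T"
| "itw d u v T (Suc i) = avg d (u i) (v i) (itw d u v T i)"

context
  fixes n d :: nat and \<theta> u v T
  assumes u: "torus_tuple S n \<theta> u" and v: "torus_tuple S n \<theta> v" and T: "T \<in> carrier S" and d: "1 \<le> d"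
begin

lemma itw_closed: "i \<le> n ==> itw d u v T i \<in> carrier S"
  by (induction i) (use T avg_closed torus_tuple_unitary[OF u] torus_tuple_unitary[OF v] in auto)

lemma itw_intertwine_commuting:
  assumes x: "x \<in> carrier S" "y \<in> carrier S" "x \<otimes> T = T \<otimes> y"
    and "\<And>j. j < n ==> x \<otimes> u j = u j \<otimes> x" "\<And>j. j < n ==> y \<otimes> v j = v j \<otimes> y"
  shows "i \<le> n ==> x \<otimes> itw d u v T i = itw d u v T i \<otimes> y"
proof (induction i)
  case (Suc i)
  have cp: "comm_phase S x (u i) (phase 0)" "comm_phase S y (v i) (phase 0)"
    using assms(4,5)[of i] Suc x torus_tupleD(1)[OF u, of i] torus_tupleD(1)[OF v, of i] by (auto simp: comm_phase_def)
  have un: "u i \<in> unitaries S" "v i \<in> unitaries S" using Suc torus_tuple_unitary[OF u] torus_tuple_unitary[OF v] by auto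
  show ?case using avg_intertwine[OF un itw_closed x(1,2) cp] Suc by simp
qed (use x in simp)

lemma itw_intertwine_gen:
  assumes per: "\<And>j X. j < n ==> X \<in> carrier S ==> zpow S (u j) (int d) \<otimes> X \<otimes> star S (zpow S (v j) (int d)) = X"
  shows "i \<le> n ==> j < i ==> u j \<otimes> itw d u v T i = itw d u v T i \<otimes> v j"
proof (induction i)
  case (Suc i)
  have un: "u i \<in> unitaries S" "v i \<in> unitaries S" using Suc torus_tuple_unitary[OF u] torus_tuple_unitary[OF v] by auto
  show ?case
  proof (cases "j = i")
    case True
    then show ?thesis using avg_self[OF un itw_closed d per] Suc itw_closed[of i] by simp
  next
    case False
    then have j: "j < i" "j < n" using Suc by auto
    have cp: "comm_phase S (u j) (u i) (phase (\<theta> $$ (i, j)))" "comm_phase S (v j) (v i) (phase (\<theta> $$ (i, j)))"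
      using torus_tuple_comm[OF u, of i j] torus_tuple_comm[OF v, of i j] Suc j by auto
    show ?thesis
      using avg_intertwine[OF un itw_closed torus_tupleD(1)[OF u j(2)] torus_tupleD(1)[OF v j(2)] cp] Suc j by simp
  qed
qed simp

end

lemma itw_diag:
  assumes "torus_tuple S n \<theta> u" shows "i \<le> n ==> itw d u u \<one> i = (of_nat d ^ i) \<odot> \<one>"
  by (induction i) (use torus_tuple_unitary[OF assms] avg_diag in auto)

end

lemma finsum_matrix:
  assumes "finite A" "\<And>a. a \<in> A ==> f a \<in> carrier_mat k k"
  shows "finsum (Mat k) f A \<in> carrier_mat k k"
    "i < k ==> j < k ==> finsum (Mat k) f A $$ (i, j) = (\<Sum>a\<in>A. f a $$ (i, j))"
proof -
  interpret K: star_alg "Mat k" by (rule star_alg_matrix)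
  show c: "finsum (Mat k) f A \<in> carrier_mat k k"
    using K.finsum_closed[of f A] assms(2) by (simp add: Pi_iff)
  show "i < k ==> j < k ==> finsum (Mat k) f A $$ (i, j) = (\<Sum>a\<in>A. f a $$ (i, j))"
    using assms
  proof (induction rule: finite_induct)
    case empty then show ?case by simp
  next
    case (insert a A)
    have fc: "finsum (Mat k) f A \<in> carrier_mat k k"
      using K.finsum_closed[of f A] insert by (simp add: Pi_iff)
    have "finsum (Mat k) f (insert a A) = f a + finsum (Mat k) f A"
      using K.finsum_insert[of A a f] insert by (simp add: Pi_iff)
    then show ?case using insert fc by (simp add: carrier_matD[OF fc])
  qed
qed

lemma cont_mat_compose:
  assumes "cont_mat X k l F" "continuous_on Y f" "f ` Y \<subseteq> X" shows "cont_mat Y k l (\<lambda>y. F (f y))"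
proof (rule cont_matI)
  fix i j assume "i < k" "j < l"
  from continuous_on_compose2[OF cont_matD(2)[OF assms(1) this] assms(2,3)]
  show "continuous_on Y (\<lambda>y. F (f y) $$ (i, j))" .
qed (use assms(3) cont_matD(1)[OF assms(1)] in auto)

lemma cont_mat_finsum:
  assumes "finite A" "\<And>a. a \<in> A ==> cont_mat X k k (\<lambda>t. F t a)"
  shows "cont_mat X k k (\<lambda>t. finsum (Mat k) (F t) A)"
proof (rule cont_matI)
  fix t assume "t \<in> X" then show "finsum (Mat k) (F t) A \<in> carrier_mat k k"
    using finsum_matrix(1)[OF assms(1), of "F t" k] cont_matD(1)[OF assms(2)] by simp
next
  fix i j assume ij: "i < k" "j < k"
  have "continuous_on X (\<lambda>t. \<Sum>c\<in>A. F t c $$ (i, j))" by (intro continuous_intros cont_matD(2)[OF assms(2) ij])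
  then show "continuous_on X (\<lambda>t. finsum (Mat k) (F t) A $$ (i, j))"
    by (rule continuous_on_cong[THEN iffD1, rotated 2])
       (use assms(1) ij cont_matD(1)[OF assms(2)] in "simp_all add: finsum_matrix(2)")
qed

lemma cont_mat_zpow:
  assumes "cont_mat X k k F" "\<And>t. t \<in> X ==> F t \<in> unitaries (Mat k)"
  shows "cont_mat X k k (\<lambda>t. zpow (Mat k) (F t) (int a))"
proof -
  interpret K: star_alg "Mat k" by (rule star_alg_matrix)
  show ?thesis
  proof (induction a)
    case 0
    show ?case using cont_mat_const[of "1\<^sub>m k" k k X] by simp
  next
    case (Suc a)
    have "zpow (Mat k) (F t) (int (Suc a)) = zpow (Mat k) (F t) (int a) * F t" if "t \<in> X" for t
      using K.zpow_Suc[OF assms(2)[OF that], of "int a"] by (simp add: add.commute)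
    then show ?case using cont_mat_cong[OF _ cont_mat_mult[OF Suc assms(1)]] by metis
  qed
qed

lemma cont_mat_itw:
  assumes "\<And>t. t \<in> X ==> torus_tuple (Mat k) n \<theta> (u t)" "\<And>t. t \<in> X ==> torus_tuple (Mat k) n \<theta> (v t)"
    and "\<And>j. j < n ==> cont_mat X k k (\<lambda>t. u t j)" "\<And>j. j < n ==> cont_mat X k k (\<lambda>t. v t j)" and T: "cont_mat X k k T"
  shows "i \<le> n ==> cont_mat X k k (\<lambda>t. star_alg.itw (Mat k) d (u t) (v t) (T t) i)"
proof (induction i)
  interpret K: star_alg "Mat k" by (rule star_alg_matrix)
  case 0 then show ?case using T by simp
next
  interpret K: star_alg "Mat k" by (rule star_alg_matrix)
  case (Suc i)
  have un: "u t i \<in> unitaries (Mat k)" "v t i \<in> unitaries (Mat k)" if "t \<in> X" for t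
    using K.torus_tuple_unitary[OF assms(1)[OF that]] K.torus_tuple_unitary[OF assms(2)[OF that]] Suc by auto
  define F where "F t a = zpow (Mat k) (u t i) (int a) * K.itw d (u t) (v t) (T t) i * mat_adjoint (zpow (Mat k) (v t i) (int a))" for t a
  have Fc: "cont_mat X k k (\<lambda>t. F t a)" for a
    unfolding F_def
    by (intro cont_mat_mult[where l = k] cont_mat_adjoint cont_mat_zpow) (use assms Suc un in auto)
  have e: "K.itw d (u t) (v t) (T t) (Suc i) = finsum (Mat k) (F t) {..<d}" for t
    by (simp add: K.avg_def F_def[abs_def])
  show ?case unfolding e by (rule cont_mat_finsum) (use Fc in auto)
qed

section \<open>Families of minimal representations\<close>

lemma det_mat_adjoint: assumes "A \<in> carrier_mat k k" shows "det (mat_adjoint A) = cnj (det A)"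
proof -
  interpret c: comm_ring_hom cnj by unfold_locales auto
  have "mat_adjoint A = map_mat cnj (transpose_mat A)" by (rule eq_matI) auto
  then show ?thesis using det_transpose[OF assms] by (simp add: c.hom_det)
qed

lemma cmod_det_unitary: assumes "U \<in> unitaries (Mat k)" shows "cmod (det U) = 1"
proof -
  have U: "U \<in> carrier_mat k k" "mat_adjoint U * U = 1\<^sub>m k" using assms by (auto simp: unitaries_def)
  have "cnj (det U) * det U = 1"
    using det_mult[OF mat_adjoint_carrier[OF U(1)] U(1)] U by (simp add: det_mat_adjoint)
  then have "(cmod (det U))\<^sup>2 = 1" unfolding cnj_mult_self by (metis of_real_eq_1_iff)
  then show ?thesis using norm_ge_zero[of "det U"] by (auto simp: power2_eq_1_iff)
qed

lemma det_smult_one: "det (c \<cdot>\<^sub>m 1\<^sub>m k) = (c :: complex) ^ k"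
  by (simp add: det_smult)

lemma constant_of_roots:
  fixes f :: "'t::topological_space => complex"
  assumes "connected X" "continuous_on X f" "0 < N" "\<And>t. t \<in> X ==> f t ^ N = c" "s \<in> X" "t \<in> X"
  shows "f s = f t"
proof -
  have "f ` X \<subseteq> {z. z ^ N = c}" using assms by auto
  then have "finite (f ` X)" using finite_nth_roots[OF assms(3), of c] finite_subset by blast
  then have "f constant_on X" using continuous_finite_range_constant[OF assms(1,2)] by blast
  then show ?thesis using assms by (metis constant_on_def)
qed

lemma constant_of_Ints:
  fixes f :: "'t::topological_space => real"
  assumes "connected X" "continuous_on X f" "\<And>t. t \<in> X ==> f t \<in> \<int>" "s \<in> X" "t \<in> X"
  shows "f s = f t"
proof -
  have "f constant_on X"
  proof (rule continuous_discrete_range_constant[OF assms(1,2)])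
    fix x assume x: "x \<in> X"
    show "\<exists>e>0. \<forall>y. y \<in> X \<and> f y \<noteq> f x \<longrightarrow> e \<le> norm (f y - f x)"
    proof (intro exI[of _ "1::real"] conjI allI impI)
      fix y assume y: "y \<in> X \<and> f y \<noteq> f x"
      then have "f y - f x \<in> \<int>" using assms(3) x by (intro Ints_diff) auto
      then show "1 \<le> norm (f y - f x)" using Ints_nonzero_abs_ge1[of "f y - f x"] y by simp
    qed simp
  qed
  then show ?thesis using assms by (metis constant_on_def)
qed

text \<open>Representations of the least dimension \<open>N\<close>; for these the commutant is scalar.\<close>

locale torus_rep = torus_matrix +
  fixes d N :: nat
  assumes rs: "rat_skew n d \<theta>" and m1: "1 \<le> m" and N: "min_rep_dim B N"
begin

abbreviation "Rep \<equiv> star_hom B (Mat N)"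

lemma N1: "1 \<le> N" using N by (simp add: min_rep_dim_def)

lemma d1: "1 \<le> d" using rs by (rule rat_skewD)

lemma rep_carrier: "\<pi> \<in> Rep ==> b \<in> carrier B ==> \<pi> b \<in> carrier_mat N N"
  using star_homD(1)[of \<pi> B "Mat N" b] by simp

lemma rep_unitary: "\<pi> \<in> Rep ==> j < n ==> \<pi> (ug j) \<in> unitaries (Mat N)"
  using star_alg.torus_tuple_unitary[OF star_alg_matrix rep_tuple] by blast

lemma rep_commutant:
  assumes \<pi>: "\<pi> \<in> Rep" and C: "C \<in> carrier_mat N N"
    and "\<And>j. j < n ==> \<pi> (ug j) * C = C * \<pi> (ug j)" "\<And>x. x \<in> carrier_mat m m ==> \<pi> (em x) * C = C * \<pi> (em x)"
  obtains c where "C = c \<cdot>\<^sub>m 1\<^sub>m N"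
  using Schur[OF star_alg_B N \<pi> C] rep_intertwiner[OF \<pi> \<pi> C assms(3,4)] by metis

text \<open>The universal properties of the torus and of the tensor product provide such a representation, and its values on \<open>B\<close>
  are unique.\<close>

definition gauge :: "_ => (nat => real) => _" where
  "gauge \<sigma> h = (SOME \<pi>. \<pi> \<in> Rep \<and> (\<forall>j<n. \<pi> (ug j) = phase (h j) \<cdot>\<^sub>m \<sigma> (ug j)) \<and> (\<forall>x\<in>carrier_mat m m. \<pi> (em x) = \<sigma> (em x)))"

lemma gauge:
  assumes \<sigma>: "\<sigma> \<in> Rep"
  shows "gauge \<sigma> h \<in> Rep" "j < n ==> gauge \<sigma> h (ug j) = phase (h j) \<cdot>\<^sub>m \<sigma> (ug j)"
    "x \<in> carrier_mat m m ==> gauge \<sigma> h (em x) = \<sigma> (em x)"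
proof -
  have t: "torus_tuple (Mat N) n \<theta> (\<lambda>j. phase (h j) \<cdot>\<^sub>m \<sigma> (ug j))"
    using torus_tuple_scale[OF star_alg_matrix rep_tuple[OF \<sigma>], of "\<lambda>j. phase (h j)"] by simp
  have c: "(phase (h j) \<cdot>\<^sub>m \<sigma> (ug j)) * \<sigma> (em x) = \<sigma> (em x) * (phase (h j) \<cdot>\<^sub>m \<sigma> (ug j))" if "j < n" "x \<in> carrier_mat m m" for j x
    using rep_comm[OF \<sigma> that] mult_smult_assoc_mat[OF rep_carrier[OF \<sigma> ug_carrier[OF that(1)]] rep_carrier[OF \<sigma> em_carrier[OF that(2)]]]
      mult_smult_distrib[OF rep_carrier[OF \<sigma> em_carrier[OF that(2)]] rep_carrier[OF \<sigma> ug_carrier[OF that(1)]]] by simp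
  obtain \<pi> where \<pi>: "\<pi> \<in> Rep" "\<And>j. j < n ==> \<pi> (ug j) = phase (h j) \<cdot>\<^sub>m \<sigma> (ug j)" "\<And>x. x \<in> carrier_mat m m ==> \<pi> (em x) = \<sigma> (em x)"
    using rep_exists[OF t rep_em[OF \<sigma>] c] by metis
  have "gauge \<sigma> h \<in> Rep \<and> (\<forall>j<n. gauge \<sigma> h (ug j) = phase (h j) \<cdot>\<^sub>m \<sigma> (ug j)) \<and> (\<forall>x\<in>carrier_mat m m. gauge \<sigma> h (em x) = \<sigma> (em x))"
    unfolding gauge_def by (rule someI[of _ \<pi>]) (use \<pi> in blast)
  then show "gauge \<sigma> h \<in> Rep" "j < n ==> gauge \<sigma> h (ug j) = phase (h j) \<cdot>\<^sub>m \<sigma> (ug j)"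
    "x \<in> carrier_mat m m ==> gauge \<sigma> h (em x) = \<sigma> (em x)" by blast+
qed

lemma gauge_zero:
  assumes \<sigma>: "\<sigma> \<in> Rep" "b \<in> carrier B" "\<And>j. j < n ==> h j = 0" shows "gauge \<sigma> h b = \<sigma> b"
proof (rule rep_unique[OF gauge(1)[OF \<sigma>(1)] \<sigma>(1) _ gauge(3)[OF \<sigma>(1)] \<sigma>(2)])
  fix j assume "j < n"
  then show "gauge \<sigma> h (ug j) = \<sigma> (ug j)"
    using gauge(2)[OF \<sigma>(1), of j h] assms(3) by (auto intro!: eq_matI)
qed

lemma gauge_continuous:
  fixes h :: "'t::topological_space => nat => real"
  assumes \<sigma>: "\<sigma> \<in> Rep" and h: "\<And>j. j < n ==> continuous_on X (\<lambda>t. h t j)" and b: "b \<in> carrier B"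
  shows "cont_mat X N N (\<lambda>t. gauge \<sigma> (h t) b)"
proof (rule rep_continuous[OF gauge(1)[OF \<sigma>] _ _ b])
  fix j assume j: "j < n"
  have "continuous_on X (\<lambda>t. phase (h t j))"
    unfolding phase_def by (intro continuous_intros h[OF j])
  then show "cont_mat X N N (\<lambda>t. gauge \<sigma> (h t) (ug j))"
    unfolding gauge(2)[OF \<sigma> j] by (rule cont_mat_smult[OF _ cont_mat_const[OF rep_carrier[OF \<sigma> ug_carrier[OF j]]]])
next
  fix x :: "complex mat" assume x: "x \<in> carrier_mat m m"
  show "cont_mat X N N (\<lambda>t. gauge \<sigma> (h t) (em x))"
    unfolding gauge(3)[OF \<sigma> x] by (rule cont_mat_const[OF rep_carrier[OF \<sigma> em_carrier[OF x]]])
qed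

lemma det_gauge:
  assumes "\<sigma> \<in> Rep" "j < n" shows "det (gauge \<sigma> h (ug j)) = phase (real N * h j) * det (\<sigma> (ug j))"
proof -
  have "phase (h j) ^ N = phase (real N * h j)" by (rule phase_power)
  then show ?thesis using gauge(2)[OF assms, of h] rep_carrier[OF assms(1) ug_carrier[OF assms(2)]] by (simp add: det_smult)
qed

text \<open>As \<open>d \<theta>\<close> is integral, \<open>u\<^sub>j\<^sup>d\<close> commutes with everything and acts as a scalar.  The determinant
  determines this scalar up to an \<open>N\<close>-th root of unity, which is constant in continuous families.\<close>

lemma central_power:
  assumes j: "j < n" shows "zpow B (ug j) (int d) \<in> carrier B"
    "\<pi> \<in> Rep ==> \<exists>c. \<pi> (zpow B (ug j) (int d)) = c \<cdot>\<^sub>m 1\<^sub>m N \<and> c * cnj c = 1 \<and> c ^ N = det (\<pi> (ug j)) ^ d"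
proof -
  interpret B: star_alg B by (rule star_alg_B)
  interpret K: star_alg "Mat N" by (rule star_alg_matrix)
  let ?w = "zpow B (ug j) (int d)"
  have uj: "ug j \<in> unitaries B" by (rule B.torus_tuple_unitary[OF ug_tuple j])
  show w: "?w \<in> carrier B" by (rule B.unitariesD(1)[OF B.zpow_unitary[OF uj]])
  assume \<pi>: "\<pi> \<in> Rep"
  note pw = rep_carrier[OF \<pi> w]
  have uk: "\<pi> (ug k) * \<pi> ?w = \<pi> ?w * \<pi> (ug k)" if k: "k < n" for k
  proof -
    have "comm_phase B (ug k) ?w (phase (of_int (int d) * \<theta> $$ (j, k)))"
      by (rule B.comm_phase_zpow[OF ug_carrier[OF k] uj B.torus_tuple_comm[OF ug_tuple j k]])
    moreover have "phase (of_int (int d) * \<theta> $$ (j, k)) = 1" using rat_skewD(2)[OF rs j k] by (simp add: phase_eq_1_iff)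
    ultimately have "ug k \<otimes>\<^bsub>B\<^esub> ?w = ?w \<otimes>\<^bsub>B\<^esub> ug k"
      unfolding comm_phase_def using B.smult_one[OF B.m_closed[OF w ug_carrier[OF k]]] by simp
    then show ?thesis using star_homD(2)[OF \<pi> ug_carrier[OF k] w] star_homD(2)[OF \<pi> w ug_carrier[OF k]] by simp
  qed
  have pz: "\<pi> ?w = zpow (Mat N) (\<pi> (ug j)) (int d)"
    by (rule zpow_hom(2)[OF star_alg_B star_alg_matrix \<pi> uj])
  have un: "\<pi> (ug j) \<in> unitaries (Mat N)" by (rule rep_unitary[OF \<pi> j])
  have ue: "\<pi> (em x) * \<pi> ?w = \<pi> ?w * \<pi> (em x)" if x: "x \<in> carrier_mat m m" for x
  proof -
    have "comm_phase (Mat N) (\<pi> (em x)) (\<pi> (ug j)) (phase 0)"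
      using rep_comm[OF \<pi> j x] rep_carrier[OF \<pi> ug_carrier[OF j]] rep_carrier[OF \<pi> em_carrier[OF x]]
      unfolding comm_phase_def by (auto intro!: eq_matI simp del: index_mult_mat(1))
    then have "comm_phase (Mat N) (\<pi> (em x)) (\<pi> ?w) (phase (of_int (int d) * 0))"
      unfolding pz using rep_carrier[OF \<pi> em_carrier[OF x]] by (intro K.comm_phase_zpow un) auto
    then have "\<pi> (em x) * \<pi> ?w = 1 \<cdot>\<^sub>m (\<pi> ?w * \<pi> (em x))" by (simp add: comm_phase_def)
    then show ?thesis by (auto intro!: eq_matI simp del: index_mult_mat(1))
  qed
  obtain c where c: "\<pi> ?w = c \<cdot>\<^sub>m 1\<^sub>m N" using rep_commutant[OF \<pi> pw uk ue] by metis
  have "\<pi> ?w \<in> unitaries (Mat N)" unfolding pz by (rule K.zpow_unitary[OF un])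
  then have "(c \<cdot>\<^sub>m 1\<^sub>m N) * mat_adjoint (c \<cdot>\<^sub>m 1\<^sub>m N) = 1\<^sub>m N" unfolding c by (simp add: unitaries_def)
  moreover have "mat_adjoint (c \<cdot>\<^sub>m 1\<^sub>m N) = cnj c \<cdot>\<^sub>m 1\<^sub>m N" by (intro eq_matI) auto
  ultimately have "((c * cnj c) \<cdot>\<^sub>m 1\<^sub>m N) $$ (0, 0) = 1\<^sub>m N $$ (0, 0)"
    using K.smult_mult_l[of "1\<^sub>m N" "cnj c \<cdot>\<^sub>m 1\<^sub>m N" c] K.smult_smult[of "1\<^sub>m N" c "cnj c"] by simp
  then have cc: "c * cnj c = 1" using N1 by simp
  have "det (zpow (Mat N) (\<pi> (ug j)) (int a)) = det (\<pi> (ug j)) ^ a" for a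
  proof (induction a)
    case (Suc a)
    have "zpow (Mat N) (\<pi> (ug j)) (int (Suc a)) = zpow (Mat N) (\<pi> (ug j)) (int a) * \<pi> (ug j)"
      using K.zpow_Suc[OF un, of "int a"] by (simp add: add.commute)
    then show ?case using Suc det_mult[of "zpow (Mat N) (\<pi> (ug j)) (int a)" N "\<pi> (ug j)"]
        K.unitariesD(1)[OF K.zpow_unitary[OF un]] K.unitariesD(1)[OF un] by simp
  qed simp
  then have "c ^ N = det (\<pi> (ug j)) ^ d" using pz c det_smult_one[of c N] by simp
  then show "\<exists>c. \<pi> ?w = c \<cdot>\<^sub>m 1\<^sub>m N \<and> c * cnj c = 1 \<and> c ^ N = det (\<pi> (ug j)) ^ d" using c cc by blast
qed

end

context torus_rep
begin

definition family :: "'t::real_normed_vector set => ('t => _) => bool" where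
  "family X p \<longleftrightarrow> (\<forall>t\<in>X. p t \<in> Rep) \<and> (\<forall>b\<in>carrier B. cont_mat X N N (\<lambda>t. p t b))"

text \<open>The lift measures the determinants relative to the base point \<open>0\<close>, in such a way that the lift of
  \<open>t \<mapsto> gauge \<sigma> (h t)\<close> is \<open>h\<close> if \<open>h\<close> is continuous and vanishes at \<open>0\<close>.\<close>

definition is_lift :: "'t::real_normed_vector set => ('t => _) => ('t => nat => real) => bool" where
  "is_lift X p h \<longleftrightarrow> (\<forall>j<n. continuous_on X (\<lambda>t. h t j) \<and> h 0 j = 0 \<and>
     (\<forall>t\<in>X. det (p t (ug j)) = phase (real N * h t j) * det (p 0 (ug j))))"

lemma familyD: "family X p ==> t \<in> X ==> p t \<in> Rep" "family X p ==> b \<in> carrier B ==> cont_mat X N N (\<lambda>t. p t b)"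
  by (auto simp: family_def)

lemma is_liftD: "is_lift X p h ==> j < n ==> continuous_on X (\<lambda>t. h t j)" "is_lift X p h ==> j < n ==> h 0 j = 0"
    "is_lift X p h ==> j < n ==> t \<in> X ==> det (p t (ug j)) = phase (real N * h t j) * det (p 0 (ug j))"
  unfolding is_lift_def by blast+

lemma det_rep_nonzero: "\<pi> \<in> Rep ==> j < n ==> det (\<pi> (ug j)) \<noteq> 0"
  using cmod_det_unitary[OF rep_unitary] by fastforce

lemma lift_exists:
  assumes X: "convex X" "0 \<in> X" and p: "family X p" obtains h where "is_lift X p h"
proof -
  have "\<exists>f. j < n \<longrightarrow> continuous_on X f \<and> f 0 = 0 \<and> (\<forall>t\<in>X. det (p t (ug j)) = phase (real N * f t) * det (p 0 (ug j)))" for j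
  proof (cases "j < n")
    case True
    have "continuous_on X (\<lambda>t. det (p t (ug j)))" by (rule continuous_on_det[OF familyD(2)[OF p ug_carrier[OF True]]])
    then obtain g where g: "continuous_on X g" "\<And>t. t \<in> X ==> det (p t (ug j)) = exp (g t)"
      using continuous_logarithm_on_contractible[of X "\<lambda>t. det (p t (ug j))"] convex_imp_contractible[OF X(1)]
        det_rep_nonzero[OF familyD(1)[OF p] True] by metis
    have Re0: "Re (g t) = 0" if "t \<in> X" for t
    proof -
      have "exp (Re (g t)) = 1"
        using cmod_det_unitary[OF rep_unitary[OF familyD(1)[OF p that] True]] g(2)[OF that] by (simp add: norm_exp_eq_Re)
      then show ?thesis by simp
    qed
    define f where "f t = Im (g t - g 0) / (2 * pi * real N)" for t
    have "continuous_on X f" unfolding f_def by (intro continuous_intros g(1)) (use N1 in auto)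
    moreover have "det (p t (ug j)) = phase (real N * f t) * det (p 0 (ug j))" if t: "t \<in> X" for t
    proof -
      have "phase (real N * f t) = cis (Im (g t - g 0))" using N1 by (simp add: phase_def f_def)
      also have "\<dots> = exp (g t - g 0)" using Re0[OF t] Re0[OF X(2)] by (simp add: exp_eq_polar)
      finally show ?thesis using g(2)[OF t] g(2)[OF X(2)] by (simp add: exp_diff)
    qed
    ultimately show ?thesis by (intro exI[of _ f]) (simp add: f_def)
  qed simp
  then obtain F where F: "\<And>j. j < n ==> continuous_on X (F j) \<and> F j 0 = 0 \<and> (\<forall>t\<in>X. det (p t (ug j)) = phase (real N * F j t) * det (p 0 (ug j)))"
    by metis
  show ?thesis by (rule that[of "\<lambda>t j. F j t"]) (use F in "simp add: is_lift_def")
qed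

lemma lift_unique_gen:
  assumes X: "connected X" and p: "family X p" and j: "j < n" and f: "continuous_on X f" and g: "continuous_on X g"
    and "\<And>t. t \<in> X ==> det (p t (ug j)) = phase (real N * f t) * c" "\<And>t. t \<in> X ==> det (p t (ug j)) = phase (real N * g t) * c"
    and st: "s \<in> X" "t \<in> X"
  shows "f s - g s = f t - g t"
proof -
  have "real N * (f t - g t) \<in> \<int>" if "t \<in> X" for t
  proof -
    have "c \<noteq> 0" using assms(6)[OF that] det_rep_nonzero[OF familyD(1)[OF p that] j] by auto
    then have "phase (real N * f t) = phase (real N * g t)" using assms(6,7)[OF that] by simp
    then have "phase (real N * f t - real N * g t) = 1" by (simp add: phase_diff unimodular_mult_cnj)
    then show ?thesis by (simp add: phase_eq_1_iff right_diff_distrib)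
  qed
  then have "real N * (f s - g s) = real N * (f t - g t)"
    by (intro constant_of_Ints[OF X _ _ st]) (auto intro!: continuous_intros f g)
  then show ?thesis using N1 by simp
qed

text \<open>Without averaging, the sum over \<open>k\<close> of \<open>\<pi>(e\<^sub>k\<^sub>0) \<rho>(e\<^sub>0\<^sub>k)\<close> intertwines the two actions of \<open>M\<^sub>m\<close>, and it is \<open>1\<close> for
  \<open>\<pi> = \<rho>\<close>.\<close>

definition base_itw where
  "base_itw \<pi> \<rho> = finsum (Mat N) (\<lambda>k. \<pi> (em (munit m k 0)) * \<rho> (em (munit m 0 k))) {..<m}"

text \<open>Averaging over the generators gives an intertwiner of \<open>B\<close> if the scalars by which the central
  powers act agree.\<close>

definition full_itw where
  "full_itw \<pi> \<rho> = star_alg.itw (Mat N) d (\<lambda>j. \<pi> (ug j)) (\<lambda>j. \<rho> (ug j)) (base_itw \<pi> \<rho>) n"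

lemma munit_rep:
  assumes "\<pi> \<in> Rep" "b < m"
  shows "\<pi> (em (munit m a b)) * \<pi> (em (munit m c e)) = (if b = c then \<pi> (em (munit m a e)) else 0\<^sub>m N N)"
proof -
  note h = rep_em[OF assms(1)]
  have z: "\<pi> (em (0\<^sub>m m m)) = 0\<^sub>m N N" using star_hom_zero[OF star_alg_matrix star_alg_matrix h] by simp
  show ?thesis using star_homD(2)[OF h, of "munit m a b" "munit m c e"] munit_mult[OF assms(2), of a c e] z by (simp split: if_splits)
qed

lemma base_itw_closed: "\<pi> \<in> Rep ==> \<rho> \<in> Rep ==> base_itw \<pi> \<rho> \<in> carrier_mat N N"
  unfolding base_itw_def
  by (rule finsum_matrix(1))
     (auto intro!: mult_carrier_mat[OF rep_carrier[OF _ em_carrier[OF munit_carrier]] rep_carrier[OF _ em_carrier[OF munit_carrier]]])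

lemma base_itw_intertwines:
  assumes \<pi>: "\<pi> \<in> Rep" and \<rho>: "\<rho> \<in> Rep" and x: "x \<in> carrier_mat m m"
  shows "\<pi> (em x) * base_itw \<pi> \<rho> = base_itw \<pi> \<rho> * \<rho> (em x)"
  using x
proof (induction rule: munit_induct)
  interpret K: star_alg "Mat N" by (rule star_alg_matrix)
  note hp = star_homD[OF rep_em[OF \<pi>], simplified] and hr = star_homD[OF rep_em[OF \<rho>], simplified]
  note T = base_itw_closed[OF \<pi> \<rho>]
  case zero
  have "\<pi> (em (0\<^sub>m m m)) = 0\<^sub>m N N" "\<rho> (em (0\<^sub>m m m)) = 0\<^sub>m N N"
    using star_hom_zero[OF star_alg_matrix star_alg_matrix rep_em[OF \<pi>]] star_hom_zero[OF star_alg_matrix star_alg_matrix rep_em[OF \<rho>]] by simp_all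
  then show ?case using T by simp
next
  interpret K: star_alg "Mat N" by (rule star_alg_matrix)
  note hp = star_homD[OF rep_em[OF \<pi>], simplified] and hr = star_homD[OF rep_em[OF \<rho>], simplified]
  note T = base_itw_closed[OF \<pi> \<rho>]
  case (munit a b c)
  define P where "P k l = \<pi> (em (munit m k l))" for k l
  define R where "R k l = \<rho> (em (munit m k l))" for k l
  have Pc: "P k l \<in> carrier_mat N N" and Rc: "R k l \<in> carrier_mat N N" for k l
    using rep_carrier[OF \<pi> em_carrier[OF munit_carrier]] rep_carrier[OF \<rho> em_carrier[OF munit_carrier]] by (auto simp: P_def R_def)
  have PP: "P k l * P l' e = (if l = l' then P k e else 0\<^sub>m N N)" if "l < m" for k l l' e
    unfolding P_def by (rule munit_rep[OF \<pi> that])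
  have RR: "R k l * R l' e = (if l = l' then R k e else 0\<^sub>m N N)" if "l < m" for k l l' e
    unfolding R_def by (rule munit_rep[OF \<rho> that])
  have m0: "0 < m" using m1 by simp
  have Tf: "base_itw \<pi> \<rho> = finsum (Mat N) (\<lambda>k. P k 0 * R 0 k) {..<m}" by (simp add: base_itw_def P_def R_def)
  have fc: "(\<lambda>k. P k 0 * R 0 k) \<in> {..<m} \<rightarrow> carrier (Mat N)" using mult_carrier_mat[OF Pc Rc] by auto
  have PRc: "P a 0 * R 0 k \<in> carrier_mat N N" for k using mult_carrier_mat[OF Pc Rc] .
  have PRc': "P k 0 * R 0 b \<in> carrier_mat N N" for k using mult_carrier_mat[OF Pc Rc] .
  have "P a b * base_itw \<pi> \<rho> = finsum (Mat N) (\<lambda>k. P a b * (P k 0 * R 0 k)) {..<m}"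
    using K.finsum_rdistr[of "{..<m}" "P a b" "\<lambda>k. P k 0 * R 0 k"] fc Pc Tf by simp
  also have "\<dots> = finsum (Mat N) (\<lambda>k. if b = k then P a 0 * R 0 k else \<zero>\<^bsub>Mat N\<^esub>) {..<m}"
  proof (rule K.finsum_cong')
    fix k assume "k \<in> {..<m}"
    have "P a b * (P k 0 * R 0 k) = (P a b * P k 0) * R 0 k" using assoc_mult_mat[OF Pc Pc Rc, of a b k 0 0 k] by simp
    then show "P a b * (P k 0 * R 0 k) = (if b = k then P a 0 * R 0 k else \<zero>\<^bsub>Mat N\<^esub>)"
      using PP[OF munit(2), of a k 0] left_mult_zero_mat[OF Rc] by simp
  qed (use PRc in auto)
  also have "\<dots> = P a 0 * R 0 b" by (rule K.add.finprod_singleton) (use munit PRc in auto)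
  finally have 1: "P a b * base_itw \<pi> \<rho> = P a 0 * R 0 b" .
  have "base_itw \<pi> \<rho> * R a b = finsum (Mat N) (\<lambda>k. (P k 0 * R 0 k) * R a b) {..<m}"
    using K.finsum_ldistr[of "{..<m}" "R a b" "\<lambda>k. P k 0 * R 0 k"] fc Rc Tf by simp
  also have "\<dots> = finsum (Mat N) (\<lambda>k. if a = k then P k 0 * R 0 b else \<zero>\<^bsub>Mat N\<^esub>) {..<m}"
  proof (rule K.finsum_cong')
    fix k assume k: "k \<in> {..<m}"
    have "(P k 0 * R 0 k) * R a b = P k 0 * (R 0 k * R a b)" using assoc_mult_mat[OF Pc Rc Rc] by simp
    then show "(P k 0 * R 0 k) * R a b = (if a = k then P k 0 * R 0 b else \<zero>\<^bsub>Mat N\<^esub>)"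
      using RR[of k 0 a b] k right_mult_zero_mat[OF Pc] by auto
  qed (use PRc' in auto)
  also have "\<dots> = P a 0 * R 0 b" by (rule K.add.finprod_singleton) (use munit PRc' in auto)
  finally have 2: "base_itw \<pi> \<rho> * R a b = P a 0 * R 0 b" .
  have "\<pi> (em (c \<cdot>\<^sub>m munit m a b)) = c \<cdot>\<^sub>m P a b" "\<rho> (em (c \<cdot>\<^sub>m munit m a b)) = c \<cdot>\<^sub>m R a b"
    using hp(5)[OF munit_carrier] hr(5)[OF munit_carrier] by (simp_all add: P_def R_def)
  then show ?case using 1 2 mult_smult_assoc_mat[OF Pc T, of c a b] mult_smult_distrib[OF T Rc, of c a b] by simp
next
  note hp = star_homD[OF rep_em[OF \<pi>], simplified] and hr = star_homD[OF rep_em[OF \<rho>], simplified]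
  note T = base_itw_closed[OF \<pi> \<rho>]
  case (add x y)
  show ?case unfolding hp(3)[OF add(1,2)] hr(3)[OF add(1,2)]
    using add_mult_distrib_mat[OF hp(1)[OF add(1)] hp(1)[OF add(2)] T] mult_add_distrib_mat[OF T hr(1)[OF add(1)] hr(1)[OF add(2)]] add(3,4) by simp
qed

lemma base_itw_diag: assumes \<pi>: "\<pi> \<in> Rep" shows "base_itw \<pi> \<pi> = 1\<^sub>m N"
proof -
  interpret K: star_alg "Mat N" by (rule star_alg_matrix)
  note h = star_homD[OF rep_em[OF \<pi>], simplified]
  have m0: "0 < m" using m1 by simp
  define Q where "Q k = mat m m (\<lambda>(i, j). if i = j \<and> i < k then 1 else (0::complex))" for k
  have Qc: "Q k \<in> carrier_mat m m" for k by (simp add: Q_def)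
  have z: "\<pi> (em (0\<^sub>m m m)) = 0\<^sub>m N N" using star_hom_zero[OF star_alg_matrix star_alg_matrix rep_em[OF \<pi>]] by simp
  have ec: "\<pi> (em (munit m k k)) \<in> carrier_mat N N" for k by (rule rep_carrier[OF \<pi> em_carrier[OF munit_carrier]])
  have "finsum (Mat N) (\<lambda>k. \<pi> (em (munit m k k))) {..<k} = \<pi> (em (Q k))" for k
  proof (induction k)
    case 0
    have "Q 0 = 0\<^sub>m m m" unfolding Q_def by (intro eq_matI) auto
    then show ?case using z by simp
  next
    case (Suc k)
    have "Q (Suc k) = munit m k k + Q k" unfolding Q_def munit_def by (intro eq_matI) auto
    then have "\<pi> (em (Q (Suc k))) = \<pi> (em (munit m k k)) + \<pi> (em (Q k))" using h(3)[OF munit_carrier Qc] by simp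
    then show ?case using Suc K.finsum_insert[of "{..<k}" k "\<lambda>k. \<pi> (em (munit m k k))"] ec by (simp add: lessThan_Suc)
  qed
  moreover have "Q m = 1\<^sub>m m" unfolding Q_def by (intro eq_matI) auto
  moreover have "base_itw \<pi> \<pi> = finsum (Mat N) (\<lambda>k. \<pi> (em (munit m k k))) {..<m}"
    unfolding base_itw_def using munit_rep[OF \<pi> m0] by simp
  ultimately show ?thesis using h(4) by simp
qed

lemma full_itw_closed: "\<pi> \<in> Rep ==> \<rho> \<in> Rep ==> full_itw \<pi> \<rho> \<in> carrier_mat N N"
  unfolding full_itw_def
  using star_alg.itw_closed[OF star_alg_matrix rep_tuple rep_tuple, of \<pi> N \<rho> "base_itw \<pi> \<rho>" d n] base_itw_closed d1 by simp

lemma full_itw_diag: "\<pi> \<in> Rep ==> full_itw \<pi> \<pi> = (of_nat d ^ n) \<cdot>\<^sub>m 1\<^sub>m N"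
  unfolding full_itw_def using star_alg.itw_diag[OF star_alg_matrix rep_tuple, of \<pi> N n d] base_itw_diag by simp

lemma full_itw_intertwines:
  assumes \<pi>: "\<pi> \<in> Rep" and \<rho>: "\<rho> \<in> Rep" and c: "\<And>j. j < n ==> \<pi> (zpow B (ug j) (int d)) = \<rho> (zpow B (ug j) (int d))"
    and b: "b \<in> carrier B"
  shows "\<pi> b * full_itw \<pi> \<rho> = full_itw \<pi> \<rho> * \<rho> b"
proof -
  interpret B: star_alg B by (rule star_alg_B)
  interpret K: star_alg "Mat N" by (rule star_alg_matrix)
  note tp = rep_tuple[OF \<pi>] and tr = rep_tuple[OF \<rho>]
  have T: "base_itw \<pi> \<rho> \<in> carrier (Mat N)" using base_itw_closed[OF \<pi> \<rho>] by simp
  have per: "zpow (Mat N) (\<pi> (ug j)) (int d) \<otimes>\<^bsub>Mat N\<^esub> X \<otimes>\<^bsub>Mat N\<^esub>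
      star (Mat N) (zpow (Mat N) (\<rho> (ug j)) (int d)) = X"
    if j: "j < n" and X: "X \<in> carrier (Mat N)" for j X
  proof -
    have uj: "ug j \<in> unitaries B" by (rule B.torus_tuple_unitary[OF ug_tuple j])
    obtain x where x: "\<pi> (zpow B (ug j) (int d)) = x \<cdot>\<^sub>m 1\<^sub>m N" "x * cnj x = 1"
      using central_power(2)[OF j \<pi>] by blast
    have z: "zpow (Mat N) (\<pi> (ug j)) (int d) = x \<odot>\<^bsub>Mat N\<^esub> \<one>\<^bsub>Mat N\<^esub>"
      "zpow (Mat N) (\<rho> (ug j)) (int d) = x \<odot>\<^bsub>Mat N\<^esub> \<one>\<^bsub>Mat N\<^esub>"
      using zpow_hom(2)[OF star_alg_B star_alg_matrix \<pi> uj, of "int d"] zpow_hom(2)[OF star_alg_B star_alg_matrix \<rho> uj, of "int d"] c[OF j] x(1) by simp_all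
    show ?thesis unfolding z K.star_smult[OF K.one_closed] K.star_one K.smult_mult_l[OF K.one_closed X] K.l_one[OF X]
        K.smult_mult_r[OF K.smult_closed[OF X] K.one_closed] K.r_one[OF K.smult_closed[OF X]] K.smult_smult[OF X]
      using x(2) K.smult_one[OF X] by (simp only: mult.commute)
  qed
  show ?thesis
  proof (rule rep_intertwiner[OF \<pi> \<rho> full_itw_closed[OF \<pi> \<rho>] _ _ b])
    fix j assume "j < n"
    then show "\<pi> (ug j) * full_itw \<pi> \<rho> = full_itw \<pi> \<rho> * \<rho> (ug j)"
      unfolding full_itw_def using K.itw_intertwine_gen[OF tp tr T d1 per order_refl] by simp
  next
    fix x :: "complex mat" assume x: "x \<in> carrier_mat m m"
    have "\<pi> (em x) \<otimes>\<^bsub>Mat N\<^esub> K.itw d (\<lambda>j. \<pi> (ug j)) (\<lambda>j. \<rho> (ug j)) (base_itw \<pi> \<rho>) n =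
        K.itw d (\<lambda>j. \<pi> (ug j)) (\<lambda>j. \<rho> (ug j)) (base_itw \<pi> \<rho>) n \<otimes>\<^bsub>Mat N\<^esub> \<rho> (em x)"
    proof (rule K.itw_intertwine_commuting[OF tp tr T d1 _ _ _ _ _ order_refl])
      show "\<pi> (em x) \<otimes>\<^bsub>Mat N\<^esub> base_itw \<pi> \<rho> = base_itw \<pi> \<rho> \<otimes>\<^bsub>Mat N\<^esub> \<rho> (em x)"
        using base_itw_intertwines[OF \<pi> \<rho> x] by simp
      show "\<pi> (em x) \<in> carrier (Mat N)" "\<rho> (em x) \<in> carrier (Mat N)"
        using rep_carrier[OF \<pi> em_carrier[OF x]] rep_carrier[OF \<rho> em_carrier[OF x]] by simp_all
    next
      fix j assume j: "j < n"
      show "\<pi> (em x) \<otimes>\<^bsub>Mat N\<^esub> \<pi> (ug j) = \<pi> (ug j) \<otimes>\<^bsub>Mat N\<^esub> \<pi> (em x)"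
        "\<rho> (em x) \<otimes>\<^bsub>Mat N\<^esub> \<rho> (ug j) = \<rho> (ug j) \<otimes>\<^bsub>Mat N\<^esub> \<rho> (em x)"
        using rep_comm[OF \<pi> j x] rep_comm[OF \<rho> j x] by simp_all
    qed
    then show "\<pi> (em x) * full_itw \<pi> \<rho> = full_itw \<pi> \<rho> * \<rho> (em x)" by (simp add: full_itw_def)
  qed
qed

lemma full_itw_continuous:
  assumes p: "family X p"
  shows "cont_mat (X \<times> X) N N (\<lambda>st. full_itw (p (fst st)) (p (snd st)))"
proof -
  have c: "cont_mat (X \<times> X) N N (\<lambda>st. p (fst st) b)" "cont_mat (X \<times> X) N N (\<lambda>st. p (snd st) b)" if "b \<in> carrier B" for b
    by (rule cont_mat_compose[OF familyD(2)[OF p that]]; auto intro!: continuous_intros)+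
  have T: "cont_mat (X \<times> X) N N (\<lambda>st. base_itw (p (fst st)) (p (snd st)))"
    unfolding base_itw_def
    by (rule cont_mat_finsum) (auto intro!: cont_mat_mult[where l = N] c em_carrier)
  show ?thesis unfolding full_itw_def
  proof (rule cont_mat_itw[where \<theta> = \<theta>, OF _ _ _ _ T order_refl])
    fix st assume "st \<in> X \<times> X"
    then have r: "p (fst st) \<in> Rep" "p (snd st) \<in> Rep" using familyD(1)[OF p] by auto
    show "torus_tuple (Mat N) n \<theta> (\<lambda>j. p (fst st) (ug j))" by (rule rep_tuple[OF r(1)])
    show "torus_tuple (Mat N) n \<theta> (\<lambda>j. p (snd st) (ug j))" by (rule rep_tuple[OF r(2)])
  qed (rule c[OF ug_carrier], assumption)+
qed

text \<open>A family with constant determinants is conjugate to a constant one, by a continuous family of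
  invertible matrices.  The averaged intertwiner between nearby members is invertible because it is close
  to a multiple of the identity; composing along the segment from \<open>0\<close> to \<open>t\<close> gives the global one.\<close>

lemma family_trivial:
  fixes X :: "'t::real_normed_vector set"
  assumes X: "compact X" "convex X" "0 \<in> X" and p: "family X p"
    and det: "\<And>t j. t \<in> X ==> j < n ==> det (p t (ug j)) = det (p 0 (ug j))"
  obtains W where "cont_mat X N N W" "\<And>t. t \<in> X ==> det (W t) = 1"
    "\<And>t b. t \<in> X ==> b \<in> carrier B ==> p t b * W t = W t * p 0 b"
proof -
  have conn: "connected X" using X(2) by (rule convex_connected)
  have N0: "0 < N" using N1 by simp
  have pw: "p s (zpow B (ug j) (int d)) = p t (zpow B (ug j) (int d))" if st: "s \<in> X" "t \<in> X" and j: "j < n" for s t j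
  proof -
    let ?w = "zpow B (ug j) (int d)"
    have ex: "\<exists>c. p t ?w = c \<cdot>\<^sub>m 1\<^sub>m N \<and> c ^ N = det (p 0 (ug j)) ^ d" if "t \<in> X" for t
      using central_power(2)[OF j familyD(1)[OF p that]] det[OF that j] by metis
    have f: "p t ?w = (p t ?w $$ (0, 0)) \<cdot>\<^sub>m 1\<^sub>m N" "(p t ?w $$ (0, 0)) ^ N = det (p 0 (ug j)) ^ d" if t: "t \<in> X" for t
    proof -
      obtain c where c: "p t ?w = c \<cdot>\<^sub>m 1\<^sub>m N" "c ^ N = det (p 0 (ug j)) ^ d" using ex[OF t] by blast
      have "p t ?w $$ (0, 0) = c" unfolding c(1) using N0 by simp
      then show "p t ?w = (p t ?w $$ (0, 0)) \<cdot>\<^sub>m 1\<^sub>m N" "(p t ?w $$ (0, 0)) ^ N = det (p 0 (ug j)) ^ d" using c by simp_all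
    qed
    have "p s ?w $$ (0, 0) = p t ?w $$ (0, 0)"
      by (rule constant_of_roots[OF conn cont_matD(2)[OF familyD(2)[OF p central_power(1)[OF j]] N0 N0] N0 f(2) st])
    then show ?thesis using f(1)[OF st(1)] f(1)[OF st(2)] by metis
  qed
  define I where "I s t = full_itw (p s) (p t)" for s t
  have Ic: "I s t \<in> carrier_mat N N" if "s \<in> X" "t \<in> X" for s t
    unfolding I_def by (rule full_itw_closed) (use that familyD(1)[OF p] in auto)
  have Ii: "p s b * I s t = I s t * p t b" if "s \<in> X" "t \<in> X" "b \<in> carrier B" for s t b
    unfolding I_def by (rule full_itw_intertwines[OF familyD(1)[OF p that(1)] familyD(1)[OF p that(2)] pw[OF that(1,2)] that(3)])
  have Icont: "cont_mat (X \<times> X) N N (\<lambda>st. I (fst st) (snd st))"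
    unfolding I_def by (rule full_itw_continuous[OF p])
  \<comment> \<open>The determinant of the averaged intertwiner from a representation to itself.\<close>
  define D0 where "D0 = (real d ^ n) ^ N"
  have D0: "D0 > 0" using d1 by (simp add: D0_def)
  have Id: "det (I t t) = complex_of_real D0" if "t \<in> X" for t
    unfolding I_def full_itw_diag[OF familyD(1)[OF p that]] det_smult_one D0_def by simp
  have "uniformly_continuous_on (X \<times> X) (\<lambda>st. det (I (fst st) (snd st)))"
    by (rule compact_uniformly_continuous[OF continuous_on_det[OF Icont] compact_Times[OF X(1) X(1)]])
  then obtain \<delta> where \<delta>: "\<delta> > 0" "\<And>x x'. x \<in> X \<times> X ==> x' \<in> X \<times> X ==> dist x' x < \<delta> ==>
      dist (det (I (fst x') (snd x'))) (det (I (fst x) (snd x))) < D0"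
    using D0 unfolding uniformly_continuous_on_def by metis
  have nz: "det (I s t) \<noteq> 0" if "s \<in> X" "t \<in> X" "dist s t < \<delta>" for s t
  proof -
    have "dist (det (I s t)) (det (I t t)) < D0"
      using \<delta>(2)[of "(t, t)" "(s, t)"] that by (simp add: dist_Pair_Pair)
    then show ?thesis using Id[OF that(2)] D0 by (auto simp: dist_norm)
  qed
  obtain r where r: "r > 0" "\<And>t. t \<in> X ==> norm t \<le> r"
    using compact_imp_bounded[OF X(1)] by (auto simp: bounded_pos)
  obtain K :: nat where K: "r / \<delta> < real K" using reals_Archimedean2 by blast
  have K0: "0 < real K" using K r \<delta> by (meson divide_pos_pos less_trans)
  define pt where "pt k t = (real k / real K) *\<^sub>R t" for k and t :: 't
  have ptX: "pt k t \<in> X" if "k \<le> K" "t \<in> X" for k t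
  proof -
    have "(1 - real k / real K) *\<^sub>R 0 + (real k / real K) *\<^sub>R t \<in> X"
      using that K0 X by (intro convexD) (auto simp: divide_simps)
    then show ?thesis by (simp add: pt_def)
  qed
  have ptd: "dist (pt (Suc k) t) (pt k t) < \<delta>" if "t \<in> X" for k t
  proof -
    have "dist (pt (Suc k) t) (pt k t) = norm t / real K"
      using K0 by (simp add: dist_norm pt_def add_divide_distrib flip: scaleR_left_diff_distrib)
    also have "\<dots> \<le> r / real K" using r that K0 by (intro divide_right_mono) auto
    also have "\<dots> < \<delta>" using K K0 \<delta> by (simp add: divide_simps mult.commute)
    finally show ?thesis .
  qed
  define W where "W = rec_nat (\<lambda>t. 1\<^sub>m N) (\<lambda>k w t. I (pt (Suc k) t) (pt k t) * w t)"
  have W0: "W 0 = (\<lambda>t. 1\<^sub>m N)" and WS: "W (Suc k) = (\<lambda>t. I (pt (Suc k) t) (pt k t) * W k t)" for k by (simp_all add: W_def)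
  have W: "k \<le> K ==> cont_mat X N N (W k) \<and> (\<forall>t\<in>X. det (W k t) \<noteq> 0 \<and> (\<forall>b\<in>carrier B. p (pt k t) b * W k t = W k t * p 0 b))" for k
  proof (induction k)
    case 0
    have "pt 0 t = 0" for t by (simp add: pt_def)
    have "p 0 b * 1\<^sub>m N = 1\<^sub>m N * p 0 b" if "b \<in> carrier B" for b
      using rep_carrier[OF familyD(1)[OF p X(3)] that] by (simp add: right_mult_one_mat left_mult_one_mat)
    then show ?case using \<open>\<And>t. pt 0 t = 0\<close> by (simp add: W0 cont_mat_const)
  next
    case (Suc k)
    then have IH: "cont_mat X N N (W k)" "\<And>t. t \<in> X ==> det (W k t) \<noteq> 0"
      "\<And>t b. t \<in> X ==> b \<in> carrier B ==> p (pt k t) b * W k t = W k t * p 0 b" by auto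
    have "cont_mat X N N (\<lambda>t. I (fst (pt (Suc k) t, pt k t)) (snd (pt (Suc k) t, pt k t)))"
    proof (rule cont_mat_compose[OF Icont])
      show "continuous_on X (\<lambda>t. (pt (Suc k) t, pt k t))" unfolding pt_def by (intro continuous_intros)
      show "(\<lambda>t. (pt (Suc k) t, pt k t)) ` X \<subseteq> X \<times> X" using ptX Suc.prems by auto
    qed
    then have "cont_mat X N N (W (Suc k))" unfolding WS using cont_mat_mult[OF _ IH(1)] by simp
    moreover have "det (W (Suc k) t) \<noteq> 0 \<and> (\<forall>b\<in>carrier B. p (pt (Suc k) t) b * W (Suc k) t = W (Suc k) t * p 0 b)" if t: "t \<in> X" for t
    proof -
      have x: "pt (Suc k) t \<in> X" "pt k t \<in> X" using ptX t Suc by auto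
      note c1 = Ic[OF x] and c2 = cont_matD(1)[OF IH(1) t]
      have "det (W (Suc k) t) = det (I (pt (Suc k) t) (pt k t)) * det (W k t)" unfolding WS by (rule det_mult[OF c1 c2])
      moreover have "p (pt (Suc k) t) b * W (Suc k) t = W (Suc k) t * p 0 b" if b: "b \<in> carrier B" for b
      proof -
        note pc = rep_carrier[OF familyD(1)[OF p x(1)] b] rep_carrier[OF familyD(1)[OF p x(2)] b] rep_carrier[OF familyD(1)[OF p X(3)] b]
        have "p (pt (Suc k) t) b * (I (pt (Suc k) t) (pt k t) * W k t) = (p (pt (Suc k) t) b * I (pt (Suc k) t) (pt k t)) * W k t"
          using assoc_mult_mat[OF pc(1) c1 c2] by simp
        also have "\<dots> = I (pt (Suc k) t) (pt k t) * (p (pt k t) b * W k t)"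
          unfolding Ii[OF x b] by (rule assoc_mult_mat[OF c1 pc(2) c2])
        also have "\<dots> = (I (pt (Suc k) t) (pt k t) * W k t) * p 0 b"
          unfolding IH(3)[OF t b] using assoc_mult_mat[OF c1 c2 pc(3)] by simp
        finally show ?thesis by (simp only: WS)
      qed
      ultimately show ?thesis using nz[OF x ptd[OF t]] IH(2)[OF t] by simp
    qed
    ultimately show ?case by blast
  qed
  have ptK: "pt K t = t" for t using K0 by (simp add: pt_def)
  have WK: "cont_mat X N N (W K)" "\<And>t. t \<in> X ==> det (W K t) \<noteq> 0"
    "\<And>t b. t \<in> X ==> b \<in> carrier B ==> p t b * W K t = W K t * p 0 b" using W[of K] by (auto simp: ptK)
  obtain g where g: "continuous_on X g" "\<And>t. t \<in> X ==> det (W K t) = exp (g t)"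
    using continuous_logarithm_on_contractible[OF continuous_on_det[OF WK(1)] convex_imp_contractible[OF X(2)]] WK(2) by metis
  \<comment> \<open>The determinant is normalised by a continuous \<open>N\<close>-th root, which exists because \<open>X\<close> is contractible.\<close>
  define V where "V t = exp (- g t / of_nat N) \<cdot>\<^sub>m W K t" for t
  show ?thesis
  proof (rule that[of V])
    show "cont_mat X N N V" unfolding V_def by (intro cont_mat_smult WK(1) continuous_intros g(1)) (use N0 in auto)
    fix t assume t: "t \<in> X"
    note Wc = cont_matD(1)[OF WK(1) t]
    have "exp (- g t / of_nat N) ^ N = exp (- g t)" using N0 by (simp flip: exp_of_nat_mult)
    then show "det (V t) = 1" unfolding V_def using Wc g(2)[OF t] by (simp add: det_smult exp_minus)
    fix b assume b: "b \<in> carrier B"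
    show "p t b * V t = V t * p 0 b"
      unfolding V_def mult_smult_distrib[OF rep_carrier[OF familyD(1)[OF p t] b] Wc]
        mult_smult_assoc_mat[OF Wc rep_carrier[OF familyD(1)[OF p X(3)] b]] WK(3)[OF t b] ..
  qed
qed

text \<open>Gauging back by the lift makes the determinants constant.\<close>

lemma family_equivalence:
  fixes X :: "'t::real_normed_vector set"
  assumes X: "compact X" "convex X" "0 \<in> X" and p: "family X p" and h: "is_lift X p h"
  obtains W where "cont_mat X N N W" "\<And>t. t \<in> X ==> det (W t) = 1"
    "\<And>t b. t \<in> X ==> b \<in> carrier B ==> p t b * W t = W t * gauge (p 0) (h t) b"
proof -
  define q where "q t = gauge (p t) (\<lambda>j. - h t j)" for t
  have qR: "q t \<in> Rep" if "t \<in> X" for t unfolding q_def by (rule gauge(1)[OF familyD(1)[OF p that]])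
  have q: "family X q" unfolding family_def
  proof (intro conjI ballI qR)
    fix b assume b: "b \<in> carrier B"
    show "cont_mat X N N (\<lambda>t. q t b)"
    proof (rule rep_continuous[OF qR _ _ b])
      fix j assume j: "j < n"
      have "continuous_on X (\<lambda>t. phase (- h t j))" unfolding phase_def by (intro continuous_intros is_liftD(1)[OF h j])
      from cont_mat_smult[OF this familyD(2)[OF p ug_carrier[OF j]]]
      show "cont_mat X N N (\<lambda>t. q t (ug j))"
        by (rule cont_mat_cong[rotated]) (simp add: q_def gauge(2)[OF familyD(1)[OF p] j])
    next
      fix x :: "complex mat" assume x: "x \<in> carrier_mat m m"
      show "cont_mat X N N (\<lambda>t. q t (em x))"
        by (rule cont_mat_cong[OF _ familyD(2)[OF p em_carrier[OF x]]]) (simp add: q_def gauge(3)[OF familyD(1)[OF p] x])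
    qed
  qed
  have q0: "q 0 b = p 0 b" if "b \<in> carrier B" for b
    unfolding q_def by (rule gauge_zero[OF familyD(1)[OF p X(3)] that]) (use is_liftD(2)[OF h] in simp)
  have qd: "det (q t (ug j)) = det (q 0 (ug j))" if "t \<in> X" "j < n" for t j
  proof -
    have "det (q t (ug j)) = phase (real N * - h t j) * (phase (real N * h t j) * det (p 0 (ug j)))"
      unfolding q_def det_gauge[OF familyD(1)[OF p that(1)] that(2)] is_liftD(3)[OF h that(2,1)] ..
    also have "\<dots> = det (p 0 (ug j))" using phase_add[of "real N * - h t j" "real N * h t j"] by simp
    finally show ?thesis using q0[OF ug_carrier[OF that(2)]] by simp
  qed
  obtain W where W: "cont_mat X N N W" "\<And>t. t \<in> X ==> det (W t) = 1"
    "\<And>t b. t \<in> X ==> b \<in> carrier B ==> q t b * W t = W t * q 0 b"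
    using family_trivial[OF X q qd] by metis
  show ?thesis
  proof (rule that[OF W(1,2)])
    fix t b assume t: "t \<in> X" and b: "b \<in> carrier B"
    note Wc = cont_matD(1)[OF W(1) t] and p0 = familyD(1)[OF p X(3)] and pt = familyD(1)[OF p t]
    show "p t b * W t = W t * gauge (p 0) (h t) b"
    proof (rule rep_intertwiner[OF pt gauge(1)[OF p0] Wc _ _ b])
      fix j assume j: "j < n"
      note uc = ug_carrier[OF j]
      have "q t (ug j) = phase (- h t j) \<cdot>\<^sub>m p t (ug j)" unfolding q_def by (rule gauge(2)[OF pt j])
      then have "p t (ug j) = phase (h t j) \<cdot>\<^sub>m q t (ug j)"
        by (auto intro!: eq_matI simp: phase_minus mult.assoc[symmetric] unimodular_mult_cnj)
      then have "p t (ug j) * W t = phase (h t j) \<cdot>\<^sub>m (q t (ug j) * W t)"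
        using mult_smult_assoc_mat[OF rep_carrier[OF qR[OF t] uc] Wc] by simp
      also have "\<dots> = W t * (phase (h t j) \<cdot>\<^sub>m p 0 (ug j))"
        unfolding W(3)[OF t uc] q0[OF uc] using mult_smult_distrib[OF Wc rep_carrier[OF p0 uc]] by simp
      finally show "p t (ug j) * W t = W t * gauge (p 0) (h t) (ug j)" unfolding gauge(2)[OF p0 j] .
    next
      fix x :: "complex mat" assume x: "x \<in> carrier_mat m m"
      have "q t (em x) = p t (em x)" unfolding q_def by (rule gauge(3)[OF pt x])
      then show "p t (em x) * W t = W t * gauge (p 0) (h t) (em x)"
        using W(3)[OF t em_carrier[OF x]] q0[OF em_carrier[OF x]] gauge(3)[OF p0 x] by simp
    qed
  qed
qed

end

section \<open>Duality of lattices\<close>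

lemma geometric_phase:
  assumes "real d * a \<in> \<int>" shows "(\<Sum>x<d. phase (real x * a)) = (if a \<in> \<int> then of_nat d else 0)"
proof (cases "a \<in> \<int>")
  case True
  then have "phase (real x * a) = 1" for x by (simp add: phase_eq_1_iff)
  then show ?thesis using True by simp
next
  case False
  then have "phase a \<noteq> 1" by (simp add: phase_eq_1_iff)
  moreover have "phase a ^ d = 1" using assms by (simp add: phase_power phase_eq_1_iff)
  ultimately have "(\<Sum>x<d. phase a ^ x) = 0" by (simp add: geometric_sum)
  then show ?thesis using False by (simp add: phase_power)
qed

text \<open>Orthogonality of the characters of \<open>(\<int>/d)\<^sup>n\<close>.\<close>

lemma character_sum:
  assumes "\<And>j. j < n ==> real d * a j \<in> \<int>"
  shows "(\<Sum>x\<in>PiE {..<n} (\<lambda>_. {..<d}). phase (\<Sum>j<n. real (x j) * a j)) =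
    (if \<forall>j<n. a j \<in> \<int> then of_nat d ^ n else 0)"
proof -
  have "(\<Sum>x\<in>PiE {..<n} (\<lambda>_. {..<d}). phase (\<Sum>j<n. real (x j) * a j)) =
      (\<Sum>x\<in>PiE {..<n} (\<lambda>_. {..<d}). \<Prod>j<n. phase (real (x j) * a j))"
    by (simp add: phase_sum)
  also have "\<dots> = (\<Prod>j<n. \<Sum>x<d. phase (real x * a j))" by (simp add: prod_sum_PiE)
  also have "\<dots> = (\<Prod>j<n. if a j \<in> \<int> then of_nat d else 0)"
    by (intro prod.cong refl geometric_phase) (use assms in auto)
  also have "\<dots> = (if \<forall>j<n. a j \<in> \<int> then of_nat d ^ n else 0)"
  proof (cases "\<forall>j<n. a j \<in> \<int>")
    case False
    then obtain j where "j < n" "a j \<notin> \<int>" by blast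
    then have "(\<Prod>j<n. if a j \<in> \<int> then of_nat d else (0::complex)) = 0" by (intro prod_zero) auto
    then show ?thesis using False by simp
  qed simp
  finally show ?thesis .
qed

text \<open>Membership of \<open>y\<close> in the lattice \<open>\<theta> \<int>\<^sup>n + \<int>\<^sup>n\<close>, with a witness \<open>z\<close>, which is the exponent of a monomial
  implementing the gauge transformation by \<open>y\<close>.\<close>

definition Lat :: "nat => real mat => (nat => int) => (nat => real) => bool" where
  "Lat n \<theta> z y \<longleftrightarrow> (\<forall>k<n. y k - (\<Sum>j<n. \<theta> $$ (k, j) * of_int (z j)) \<in> \<int>)"

text \<open>The dual of the lattice \<open>{x. \<theta> x \<in> \<int>\<^sup>n}\<close> is \<open>\<theta> \<int>\<^sup>n + \<int>\<^sup>n\<close>.  Modulo \<open>d\<close> this is a statement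
  about finite abelian groups: the sum over all \<open>x\<close> and \<open>z\<close> of the characters \<open>\<langle>x, y - \<theta> z\<rangle>\<close> counts, when
  summed over \<open>z\<close> first, the elements \<open>x\<close> of the lattice, so that it is nonzero.  Hence for some
  \<open>z\<close> the sum over \<open>x\<close> is nonzero, which makes the character trivial.\<close>

lemma lattice_duality:
  assumes rs: "rat_skew n d \<theta>"
    and y: "\<And>x :: nat => int. (\<And>k. k < n ==> (\<Sum>j<n. \<theta> $$ (k, j) * of_int (x j)) \<in> \<int>) ==> (\<Sum>j<n. of_int (x j) * y j) \<in> \<int>"
  obtains z where "Lat n \<theta> z y"
proof -
  define G where "G = PiE {..<n} (\<lambda>_. {..<d})"
  have finG: "finite G" unfolding G_def by (rule finite_PiE) auto
  have d: "1 \<le> d" using rs by (rule rat_skewD)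
  define a where "a z j = y j - (\<Sum>k<n. \<theta> $$ (j, k) * real (z k))" for z :: "nat => nat" and j
  define b where "b x k = (\<Sum>j<n. \<theta> $$ (k, j) * real (x j))" for x :: "nat => nat" and k
  have dth: "real d * (\<Sum>k<n. \<theta> $$ (j, k) * real (z k)) \<in> \<int>" if "j < n" for j and z :: "nat => nat"
  proof -
    have "real d * (\<Sum>k<n. \<theta> $$ (j, k) * real (z k)) = (\<Sum>k<n. (real d * \<theta> $$ (j, k)) * real (z k))"
      by (simp add: sum_distrib_left mult.assoc)
    also have "\<dots> \<in> \<int>" by (intro Ints_sum Ints_mult rat_skewD(2)[OF rs]) (use that in auto)
    finally show ?thesis .
  qed
  have dy: "real d * y j \<in> \<int>" if j: "j < n" for j
  proof -
    have "(\<Sum>i<n. of_int (if i = j then int d else 0) * y i) \<in> \<int>"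
    proof (rule y)
      fix k assume k: "k < n"
      have "(\<Sum>i<n. \<theta> $$ (k, i) * of_int (if i = j then int d else 0)) = (\<Sum>i<n. if i = j then real d * \<theta> $$ (k, i) else 0)"
        by (intro sum.cong) auto
      then show "(\<Sum>i<n. \<theta> $$ (k, i) * of_int (if i = j then int d else 0)) \<in> \<int>"
        using j k rat_skewD(2)[OF rs k j] by simp
    qed
    moreover have "(\<Sum>i<n. of_int (if i = j then int d else 0) * y i) = (\<Sum>i<n. if i = j then real d * y i else 0)"
      by (intro sum.cong) auto
    ultimately show ?thesis using j by simp
  qed
  have da: "real d * a z j \<in> \<int>" if "j < n" for z j
    unfolding a_def right_diff_distrib by (rule Ints_diff[OF dy[OF that] dth[OF that]])
  have db: "real d * b x k \<in> \<int>" if "k < n" for x k unfolding b_def by (rule dth[OF that])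
  have skew: "(\<Sum>j<n. real (x j) * a z j) = (\<Sum>j<n. real (x j) * y j) + (\<Sum>k<n. real (z k) * b x k)" for x z
  proof -
    have "(\<Sum>j<n. real (x j) * (\<Sum>k<n. \<theta> $$ (j, k) * real (z k))) = (\<Sum>k<n. \<Sum>j<n. real (x j) * (\<theta> $$ (j, k) * real (z k)))"
      unfolding sum_distrib_left by (rule sum.swap)
    also have "\<dots> = - (\<Sum>k<n. real (z k) * b x k)"
      unfolding b_def sum_distrib_left sum_negf[symmetric]
    proof (intro sum.cong refl)
      fix k j assume "k \<in> {..<n}" "j \<in> {..<n}"
      then show "real (x j) * (\<theta> $$ (j, k) * real (z k)) = - (real (z k) * (\<theta> $$ (k, j) * real (x j)))"
        using rat_skewD(3)[OF rs, of j k] by simp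
    qed
    finally show ?thesis by (simp add: a_def right_diff_distrib sum_subtractf)
  qed
  have "(\<Sum>z\<in>G. \<Sum>x\<in>G. phase (\<Sum>j<n. real (x j) * a z j)) =
      (\<Sum>x\<in>G. phase (\<Sum>j<n. real (x j) * y j) * (\<Sum>z\<in>G. phase (\<Sum>k<n. real (z k) * b x k)))"
    unfolding skew phase_add by (subst sum.swap) (simp add: sum_distrib_left)
  also have "\<dots> = (\<Sum>x\<in>G. if \<forall>k<n. b x k \<in> \<int> then of_nat d ^ n else 0)"
  proof (rule sum.cong[OF refl])
    fix x assume "x \<in> G"
    have y0: "(\<Sum>j<n. real (x j) * y j) \<in> \<int>" if "\<forall>k<n. b x k \<in> \<int>"
      using y[of "\<lambda>j. int (x j)"] that by (simp add: b_def)
    then show "phase (\<Sum>j<n. real (x j) * y j) * (\<Sum>z\<in>G. phase (\<Sum>k<n. real (z k) * b x k)) =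
        (if \<forall>k<n. b x k \<in> \<int> then of_nat d ^ n else 0)"
    proof (cases "\<forall>k<n. b x k \<in> \<int>")
      case True
      moreover have "(\<Sum>z\<in>G. phase (\<Sum>k<n. real (z k) * b x k)) = (if \<forall>k<n. b x k \<in> \<int> then of_nat d ^ n else 0)"
        unfolding G_def by (rule character_sum) (rule db)
      ultimately show ?thesis using y0 by (simp add: phase_eq_1_iff)
    next
      case False
      have sm: "(\<Sum>z\<in>G. phase (\<Sum>k<n. real (z k) * b x k)) = (if \<forall>k<n. b x k \<in> \<int> then of_nat d ^ n else 0)"
        unfolding G_def by (rule character_sum) (rule db)
      show ?thesis unfolding sm if_not_P[OF False] by simp
    qed
  qed
  also have "\<dots> = of_nat (\<Sum>x\<in>G. if \<forall>k<n. b x k \<in> \<int> then d ^ n else 0)"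
    unfolding of_nat_sum by (intro sum.cong) auto
  finally have tot: "(\<Sum>z\<in>G. \<Sum>x\<in>G. phase (\<Sum>j<n. real (x j) * a z j)) = of_nat (\<Sum>x\<in>G. if \<forall>k<n. b x k \<in> \<int> then d ^ n else 0)" .
  define x0 where "x0 = restrict (\<lambda>_. 0::nat) {..<n}"
  have x0: "x0 \<in> G" "b x0 k = 0" for k using d by (auto simp: x0_def G_def b_def)
  have "0 < (if \<forall>k<n. b x0 k \<in> \<int> then d ^ n else 0)" using x0 d by simp
  also have "\<dots> \<le> (\<Sum>x\<in>G. if \<forall>k<n. b x k \<in> \<int> then d ^ n else 0)"
    by (rule member_le_sum[OF x0(1)]) (use finG in auto)
  finally have "(\<Sum>z\<in>G. \<Sum>x\<in>G. phase (\<Sum>j<n. real (x j) * a z j)) \<noteq> 0" unfolding tot of_nat_eq_0_iff by simp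
  then obtain z where "z \<in> G" "(\<Sum>x\<in>G. phase (\<Sum>j<n. real (x j) * a z j)) \<noteq> 0" by (meson sum.neutral)
  moreover have "(\<Sum>x\<in>G. phase (\<Sum>j<n. real (x j) * a z j)) = (if \<forall>j<n. a z j \<in> \<int> then of_nat d ^ n else 0)"
    unfolding G_def by (rule character_sum) (rule da)
  ultimately have "\<forall>j<n. a z j \<in> \<int>" by metis
  then have "Lat n \<theta> (\<lambda>j. int (z j)) y" by (simp add: Lat_def a_def)
  then show ?thesis by (rule that)
qed

section \<open>Inner gauge transformations\<close>

context torus_rep
begin

definition mono where "mono z = monomial B n ug z"

lemma mono_unitary: "mono z \<in> unitaries B"
  unfolding mono_def
  by (rule star_alg.monomial_unitary[OF star_alg_B star_alg.torus_tuple_unitary[OF star_alg_B ug_tuple]])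

lemma mono_carrier: "mono z \<in> carrier B"
  using star_alg.unitariesD(1)[OF star_alg_B mono_unitary] .

lemma rep_mono_unitary: "\<pi> \<in> Rep ==> \<pi> (mono z) \<in> unitaries (Mat N)"
  by (rule zpow_hom(1)[OF star_alg_B star_alg_matrix _ mono_unitary])

lemma rep_mono_em:
  assumes \<pi>: "\<pi> \<in> Rep" and x: "x \<in> carrier_mat m m" shows "\<pi> (em x) * \<pi> (mono z) = \<pi> (mono z) * \<pi> (em x)"
proof -
  interpret B: star_alg B by (rule star_alg_B)
  have "comm_phase B (em x) (mono z) (phase (\<Sum>j<n. of_int (z j) * 0))"
    unfolding mono_def
  proof (rule B.comm_phase_monomial[OF em_carrier[OF x] B.torus_tuple_unitary[OF ug_tuple]])
    fix j assume j: "j < n"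
    have "tgen n \<theta> j \<in> carrier A" using torus_tupleD(1)[OF torus_tuple_tgen j] .
    then have "em x \<otimes>\<^bsub>B\<^esub> ug j = ug j \<otimes>\<^bsub>B\<^esub> em x" using ts.in_commute[of "tgen n \<theta> j" x] x by (simp add: ug_def em_def)
    then show "comm_phase B (em x) (ug j) (phase 0)" unfolding comm_phase_def
      using B.m_closed[OF ug_carrier[OF j] em_carrier[OF x]] by simp
  qed
  then have "em x \<otimes>\<^bsub>B\<^esub> mono z = mono z \<otimes>\<^bsub>B\<^esub> em x"
    unfolding comm_phase_def using B.m_closed[OF mono_carrier em_carrier[OF x]] by simp
  then show ?thesis
    using star_homD(2)[OF \<pi> mono_carrier em_carrier[OF x], of z] star_homD(2)[OF \<pi> em_carrier[OF x] mono_carrier, of z] by simp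
qed

lemma rep_mono_ug:
  assumes \<pi>: "\<pi> \<in> Rep" and k: "k < n"
  shows "\<pi> (mono z) * \<pi> (ug k) = phase (\<Sum>j<n. \<theta> $$ (k, j) * of_int (z j)) \<cdot>\<^sub>m (\<pi> (ug k) * \<pi> (mono z))"
proof -
  interpret B: star_alg B by (rule star_alg_B)
  have "(\<Sum>j<n. \<theta> $$ (k, j) * of_int (z j)) = - (\<Sum>j<n. of_int (z j) * \<theta> $$ (j, k))"
    unfolding sum_negf[symmetric]
  proof (rule sum.cong[OF refl])
    fix j assume "j \<in> {..<n}"
    then show "\<theta> $$ (k, j) * of_int (z j) = - (of_int (z j) * \<theta> $$ (j, k))" using rat_skewD(3)[OF rs k, of j] by simp
  qed
  then have "mono z \<otimes>\<^bsub>B\<^esub> ug k = phase (\<Sum>j<n. \<theta> $$ (k, j) * of_int (z j)) \<odot>\<^bsub>B\<^esub> (ug k \<otimes>\<^bsub>B\<^esub> mono z)"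
    using B.monomial_gen_comm[OF ug_tuple k order_refl, of z] by (simp add: comm_phase_def mono_def)
  then show ?thesis
    using star_homD(2)[OF \<pi> mono_carrier ug_carrier[OF k], of z] star_homD(2)[OF \<pi> ug_carrier[OF k] mono_carrier, of z]
      star_homD(5)[OF \<pi> B.m_closed[OF ug_carrier[OF k] mono_carrier], of _ z] by simp
qed

text \<open>Conjugation by the monomial with exponent \<open>z\<close> multiplies \<open>u\<^sub>k\<close> by the phase of \<open>(\<theta> z)\<^sub>k\<close>.\<close>

lemma gauge_inner:
  assumes \<sigma>: "\<sigma> \<in> Rep" and L: "Lat n \<theta> z y" and h': "\<And>j. j < n ==> h' j = h j + y j" and b: "b \<in> carrier B"
  shows "gauge \<sigma> h' b * \<sigma> (mono z) = \<sigma> (mono z) * gauge \<sigma> h b"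
proof (rule rep_intertwiner[OF gauge(1)[OF \<sigma>] gauge(1)[OF \<sigma>] rep_carrier[OF \<sigma> mono_carrier] _ _ b])
  fix j assume j: "j < n"
  note uc = rep_carrier[OF \<sigma> ug_carrier[OF j]] and vc = rep_carrier[OF \<sigma> mono_carrier, of z]
  have "phase (y j) = phase (\<Sum>i<n. \<theta> $$ (j, i) * of_int (z i))"
    by (rule phase_cong_int) (use L j in "simp add: Lat_def")
  then have e: "\<sigma> (mono z) * \<sigma> (ug j) = phase (y j) \<cdot>\<^sub>m (\<sigma> (ug j) * \<sigma> (mono z))" using rep_mono_ug[OF \<sigma> j] by simp
  show "gauge \<sigma> h' (ug j) * \<sigma> (mono z) = \<sigma> (mono z) * gauge \<sigma> h (ug j)"
    unfolding gauge(2)[OF \<sigma> j] mult_smult_assoc_mat[OF uc vc] mult_smult_distrib[OF vc uc] e h'[OF j] phase_add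
    by (simp add: mat_smult_smult)
next
  fix x :: "complex mat" assume x: "x \<in> carrier_mat m m"
  show "gauge \<sigma> h' (em x) * \<sigma> (mono z) = \<sigma> (mono z) * gauge \<sigma> h (em x)"
    unfolding gauge(3)[OF \<sigma> x] by (rule rep_mono_em[OF \<sigma> x])
qed

text \<open>The commutation phase, written in terms of the lattice vector \<open>y'\<close> instead of its witness \<open>z'\<close>.\<close>

lemma mono_commutator:
  assumes \<pi>: "\<pi> \<in> Rep" and L: "Lat n \<theta> z' y'"
  shows "\<pi> (mono z) * \<pi> (mono z') = phase (- (\<Sum>j<n. of_int (z j) * y' j)) \<cdot>\<^sub>m (\<pi> (mono z') * \<pi> (mono z))"
proof -
  interpret B: star_alg B by (rule star_alg_B)
  have "(\<Sum>k<n. of_int (z' k) * - (\<Sum>j<n. of_int (z j) * \<theta> $$ (j, k))) = (\<Sum>k<n. \<Sum>j<n. of_int (z' k) * - (of_int (z j) * \<theta> $$ (j, k)))"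
    by (simp add: sum_distrib_left sum_negf)
  also have "\<dots> = (\<Sum>j<n. \<Sum>k<n. of_int (z' k) * - (of_int (z j) * \<theta> $$ (j, k)))" by (rule sum.swap)
  also have "\<dots> = - (\<Sum>j<n. of_int (z j) * (\<Sum>k<n. \<theta> $$ (j, k) * of_int (z' k)))"
    by (simp add: sum_distrib_left sum_negf mult_ac)
  finally have e: "(\<Sum>k<n. of_int (z' k) * - (\<Sum>j<n. of_int (z j) * \<theta> $$ (j, k))) =
    - (\<Sum>j<n. of_int (z j) * (\<Sum>k<n. \<theta> $$ (j, k) * of_int (z' k)))" .
  have "- (\<Sum>j<n. of_int (z j) * y' j) - - (\<Sum>j<n. of_int (z j) * (\<Sum>k<n. \<theta> $$ (j, k) * of_int (z' k))) =
      - (\<Sum>j<n. of_int (z j) * (y' j - (\<Sum>k<n. \<theta> $$ (j, k) * of_int (z' k))))"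
    by (simp add: right_diff_distrib sum_subtractf)
  also have "\<dots> \<in> \<int>" using L by (intro Ints_minus Ints_sum Ints_mult) (auto simp: Lat_def)
  finally have "phase (- (\<Sum>j<n. of_int (z j) * y' j)) = phase (\<Sum>k<n. of_int (z' k) * - (\<Sum>j<n. of_int (z j) * \<theta> $$ (j, k)))"
    unfolding e by (rule phase_cong_int)
  then have eq: "mono z \<otimes>\<^bsub>B\<^esub> mono z' = phase (- (\<Sum>j<n. of_int (z j) * y' j)) \<odot>\<^bsub>B\<^esub> (mono z' \<otimes>\<^bsub>B\<^esub> mono z)"
    using B.monomial_comm[OF ug_tuple, of z z'] by (simp add: comm_phase_def mono_def)
  show ?thesis
    using arg_cong[OF eq, of \<pi>] star_homD(2)[OF \<pi> mono_carrier mono_carrier, of z z'] star_homD(2)[OF \<pi> mono_carrier mono_carrier, of z' z]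
      star_homD(5)[OF \<pi> B.m_closed[OF mono_carrier mono_carrier], of _ z' z]
    by (simp only: matrix_star_algebra_simps)
qed

lemma mat_smult_cancel:
  assumes "c \<cdot>\<^sub>m X = c' \<cdot>\<^sub>m X" "X \<in> carrier_mat N N" "det X \<noteq> 0" shows "c = (c' :: complex)"
proof (rule ccontr)
  assume ne: "c \<noteq> c'"
  have "X $$ (i, j) = 0" if "i < N" "j < N" for i j
  proof -
    have "c * X $$ (i, j) = c' * X $$ (i, j)" using arg_cong[OF assms(1), of "\<lambda>Y. Y $$ (i, j)"] assms(2) that by simp
    then show ?thesis using ne by simp
  qed
  then have "X = 0 \<cdot>\<^sub>m 1\<^sub>m N" using assms(2) by (intro eq_matI) auto
  then have "det X = 0 ^ N" by (simp only: det_smult_one)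
  then show False using assms(3) N1 by simp
qed

text \<open>If \<open>\<theta> x\<close> is integral, the monomial with exponent \<open>x\<close> is central and acts as a scalar, which is an
  invariant of the equivalence class.  The gauge transformation multiplies it by the phase of
  \<open>\<langle>x, y\<rangle>\<close>, which is therefore \<open>1\<close>, and duality of lattices applies.\<close>

lemma gauge_conjugate_Lat:
  assumes \<sigma>: "\<sigma> \<in> Rep" and Z: "Z \<in> carrier_mat N N" "det Z \<noteq> 0"
    and c: "\<And>b. b \<in> carrier B ==> gauge \<sigma> y b * Z = Z * \<sigma> b"
  obtains z where "Lat n \<theta> z y"
proof (rule lattice_duality[OF rs])
  interpret K: star_alg "Mat N" by (rule star_alg_matrix)
  fix x :: "nat => int" assume x: "\<And>k. k < n ==> (\<Sum>j<n. \<theta> $$ (k, j) * of_int (x j)) \<in> \<int>"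
  note g = gauge(1)[OF \<sigma>, of y]
  have un: "ug j \<in> unitaries B" if "j < n" for j using star_alg.torus_tuple_unitary[OF star_alg_B ug_tuple that] .
  have vc: "\<sigma> (mono x) \<in> carrier_mat N N" by (rule rep_carrier[OF \<sigma> mono_carrier])
  have uk: "\<sigma> (ug k) * \<sigma> (mono x) = \<sigma> (mono x) * \<sigma> (ug k)" if "k < n" for k
  proof -
    have "phase (\<Sum>j<n. \<theta> $$ (k, j) * of_int (x j)) = 1" using x[OF that] by (simp add: phase_eq_1_iff)
    then have "\<sigma> (mono x) * \<sigma> (ug k) = 1 \<cdot>\<^sub>m (\<sigma> (ug k) * \<sigma> (mono x))" using rep_mono_ug[OF \<sigma> that, of x] by simp
    then show ?thesis by (auto intro!: eq_matI simp del: index_mult_mat(1))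
  qed
  obtain c where s: "\<sigma> (mono x) = c \<cdot>\<^sub>m 1\<^sub>m N"
    using rep_commutant[OF \<sigma> vc uk rep_mono_em[OF \<sigma>]] by metis
  have c0: "c \<noteq> 0"
  proof
    assume "c = 0"
    then have "det (\<sigma> (mono x)) = 0 ^ N" unfolding s by (simp only: det_smult_one)
    then have "det (\<sigma> (mono x)) = 0" using N1 by (simp add: power_0_left)
    then show False using cmod_det_unitary[OF rep_mono_unitary[OF \<sigma>, of x]] by simp
  qed
  have "gauge \<sigma> y (mono x) = monomial (Mat N) n (\<lambda>j. gauge \<sigma> y (ug j)) x"
    unfolding mono_def by (rule monomial_hom[OF star_alg_B star_alg_matrix g un])
  also have "\<dots> = monomial (Mat N) n (\<lambda>j. phase (y j) \<odot>\<^bsub>Mat N\<^esub> \<sigma> (ug j)) x"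
    by (rule monomial_cong_gen) (simp add: gauge(2)[OF \<sigma>])
  also have "\<dots> = phase (\<Sum>j<n. of_int (x j) * y j) \<odot>\<^bsub>Mat N\<^esub> monomial (Mat N) n (\<lambda>j. \<sigma> (ug j)) x"
    by (rule K.monomial_scale[OF rep_unitary[OF \<sigma>]])
  also have "monomial (Mat N) n (\<lambda>j. \<sigma> (ug j)) x = \<sigma> (mono x)"
    unfolding mono_def by (rule monomial_hom[OF star_alg_B star_alg_matrix \<sigma> un, symmetric])
  finally have gm: "gauge \<sigma> y (mono x) = (phase (\<Sum>j<n. of_int (x j) * y j) * c) \<cdot>\<^sub>m 1\<^sub>m N"
    unfolding s by (simp add: mat_smult_smult)
  have "gauge \<sigma> y (mono x) * Z = Z * \<sigma> (mono x)" by (rule c[OF mono_carrier])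
  then have "(phase (\<Sum>j<n. of_int (x j) * y j) * c) \<cdot>\<^sub>m Z = c \<cdot>\<^sub>m Z"
    unfolding gm s using Z mult_smult_assoc_mat[of "1\<^sub>m N" N N Z N] mult_smult_distrib[of Z N N "1\<^sub>m N" N] by simp
  then have "phase (\<Sum>j<n. of_int (x j) * y j) * c = c" by (rule mat_smult_cancel[OF _ Z])
  then show "(\<Sum>j<n. of_int (x j) * y j) \<in> \<int>" using c0 by (simp add: phase_eq_1_iff)
qed (rule that)

lemma rep_adjoint_intertwiner:
  assumes \<pi>: "\<pi> \<in> Rep" and \<rho>: "\<rho> \<in> Rep" and W: "W \<in> carrier_mat N N"
    and c: "\<And>b. b \<in> carrier B ==> \<pi> b * W = W * \<rho> b" and b: "b \<in> carrier B"
  shows "\<rho> b * mat_adjoint W = mat_adjoint W * \<pi> b"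
proof -
  have sb: "star B b \<in> carrier B" by (rule star_alg.star_closed[OF star_alg_B b])
  have "mat_adjoint (\<pi> (star B b) * W) = mat_adjoint (W * \<rho> (star B b))" using c[OF sb] by simp
  moreover have "mat_adjoint (\<pi> (star B b)) = \<pi> b" "mat_adjoint (\<rho> (star B b)) = \<rho> b"
    using star_homD(6)[OF \<pi> b] star_homD(6)[OF \<rho> b] mat_adjoint_adjoint[OF rep_carrier[OF \<pi> b]] mat_adjoint_adjoint[OF rep_carrier[OF \<rho> b]] by simp_all
  ultimately show ?thesis
    using mat_adjoint_mult[OF rep_carrier[OF \<pi> sb] W] mat_adjoint_mult[OF W rep_carrier[OF \<rho> sb]] by simp
qed

text \<open>The matrix \<open>V\<^sup>* Z\<close> commutes with the representation \<open>\<rho>\<close>.\<close>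

lemma intertwiner_scalar:
  assumes \<pi>: "\<pi> \<in> Rep" and \<rho>: "\<rho> \<in> Rep" and V: "V \<in> carrier_mat N N" and Z: "Z \<in> carrier_mat N N"
    and cV: "\<And>b. b \<in> carrier B ==> \<pi> b * V = V * \<rho> b" and cZ: "\<And>b. b \<in> carrier B ==> \<pi> b * Z = Z * \<rho> b"
  obtains c where "mat_adjoint V * Z = c \<cdot>\<^sub>m 1\<^sub>m N"
proof -
  have aV: "mat_adjoint V \<in> carrier_mat N N" using V by simp
  have c: "\<rho> b * (mat_adjoint V * Z) = mat_adjoint V * Z * \<rho> b" if b: "b \<in> carrier B" for b
  proof -
    note pc = rep_carrier[OF \<pi> b] and rc = rep_carrier[OF \<rho> b]
    have aeq: "\<rho> b * mat_adjoint V = mat_adjoint V * \<pi> b" by (rule rep_adjoint_intertwiner[OF \<pi> \<rho> V _ b]) (rule cV)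
    have "\<rho> b * (mat_adjoint V * Z) = (\<rho> b * mat_adjoint V) * Z" using assoc_mult_mat[OF rc aV Z] by simp
    also have "\<dots> = mat_adjoint V * (\<pi> b * Z)"
      unfolding aeq by (rule assoc_mult_mat[OF aV pc Z])
    also have "\<dots> = mat_adjoint V * Z * \<rho> b" unfolding cZ[OF b] using assoc_mult_mat[OF aV Z rc] by simp
    finally show ?thesis .
  qed
  show ?thesis
    by (rule rep_commutant[OF \<rho> mult_carrier_mat[OF aV Z] c[OF ug_carrier] c[OF em_carrier]]) (assumption+, rule that)
qed

text \<open>The matrix \<open>W\<^sup>* W\<close> is a nonnegative scalar of determinant \<open>1\<close>.\<close>

lemma intertwiner_unitary:
  assumes \<pi>: "\<pi> \<in> Rep" and \<rho>: "\<rho> \<in> Rep" and W: "W \<in> carrier_mat N N" "det W = 1"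
    and c: "\<And>b. b \<in> carrier B ==> \<pi> b * W = W * \<rho> b"
  shows "mat_adjoint W * W = 1\<^sub>m N" "W * mat_adjoint W = 1\<^sub>m N"
proof -
  have aW: "mat_adjoint W \<in> carrier_mat N N" using W by simp
  obtain a where a: "mat_adjoint W * W = a \<cdot>\<^sub>m 1\<^sub>m N" using intertwiner_scalar[OF \<pi> \<rho> W(1) W(1) c c] by metis
  have "a ^ N = det (mat_adjoint W * W)" unfolding a by (simp only: det_smult_one)
  then have aN: "a ^ N = 1" using det_mult[OF aW W(1)] det_mat_adjoint[OF W(1)] W(2) by simp
  have "a = (mat_adjoint W * W) $$ (0, 0)" unfolding a using N1 by simp
  also have "\<dots> = (\<Sum>l<N. mat_adjoint W $$ (0, l) * W $$ (l, 0))" by (rule mat_mult_index[OF aW W(1)]) (use N1 in auto)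
  also have "\<dots> = (\<Sum>l<N. complex_of_real ((cmod (W $$ (l, 0)))\<^sup>2))"
    by (intro sum.cong refl) (use W N1 in "simp add: cnj_mult_self del: of_real_power")
  also have "\<dots> = complex_of_real (\<Sum>l<N. (cmod (W $$ (l, 0)))\<^sup>2)" by simp
  finally have ar: "a = complex_of_real (\<Sum>l<N. (cmod (W $$ (l, 0)))\<^sup>2)" .
  define r where "r = (\<Sum>l<N. (cmod (W $$ (l, 0)))\<^sup>2)"
  have r: "a = complex_of_real r" "r \<ge> 0" unfolding r_def by (rule ar) (rule sum_nonneg, simp)
  have "complex_of_real (r ^ N) = 1" using aN r by simp
  then have "r ^ N = 1" by (simp only: of_real_eq_1_iff)
  then have "r = 1" using r(2) N1 power_eq_1_iff by (metis abs_of_nonneg not_one_le_zero real_norm_def)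
  then show 1: "mat_adjoint W * W = 1\<^sub>m N" unfolding a r(1) by (intro eq_matI) auto
  show "W * mat_adjoint W = 1\<^sub>m N" by (rule mat_mult_left_right_inverse[OF aW W(1) 1])
qed

text \<open>Along an edge of the square the comparison of the two sides with an inner gauge transformation
  is a scalar. The determinants force it to be a root of a fixed number, so that it is constant.\<close>

lemma edge_scalar:
  assumes \<sigma>: "\<sigma> \<in> Rep" and L: "Lat n \<theta> z y"
    and Wa: "cont_mat {0..1::real} N N Wa" "\<And>t. t \<in> {0..1} ==> det (Wa t) = 1"
    and Wb: "cont_mat {0..1::real} N N Wb" "\<And>t. t \<in> {0..1} ==> det (Wb t) = 1"
    and ab: "\<And>t. t \<in> {0..1} ==> a t \<in> Rep" "\<And>t. t \<in> {0..1} ==> b t \<in> Rep"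
    and ca: "\<And>t x. t \<in> {0..1} ==> x \<in> carrier B ==> a t x * Wa t = Wa t * gauge \<sigma> (ha t) x"
    and cb: "\<And>t x. t \<in> {0..1} ==> x \<in> carrier B ==> b t x * Wb t = Wb t * gauge \<sigma> (hb t) x"
    and V: "V \<in> unitaries (Mat N)" "\<And>t x. t \<in> {0..1} ==> x \<in> carrier B ==> b t x * V = V * a t x"
    and h: "\<And>t j. t \<in> {0..1} ==> j < n ==> hb t j = ha t j + y j"
  obtains c where "c \<noteq> 0" "\<And>t. t \<in> {0..1} ==> mat_adjoint (Wb t) * (V * Wa t) = c \<cdot>\<^sub>m \<sigma> (mono z)"
proof -
  have V1: "V \<in> carrier_mat N N" using V(1) by (simp add: unitaries_def)
  define U where "U = \<sigma> (mono z)"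
  have U: "U \<in> carrier_mat N N" unfolding U_def by (rule rep_carrier[OF \<sigma> mono_carrier])
  have aU: "mat_adjoint U \<in> carrier_mat N N" using U by simp
  have UU: "U * mat_adjoint U = 1\<^sub>m N" using rep_mono_unitary[OF \<sigma>, of z] by (simp add: unitaries_def U_def)
  define Z where "Z t = mat_adjoint (Wb t) * (V * Wa t)" for t
  have Zcont: "cont_mat {0..1} N N Z"
    unfolding Z_def by (intro cont_mat_mult[where l = N] cont_mat_adjoint Wa Wb cont_mat_const V1)
  have Zi: "gauge \<sigma> (hb t) x * Z t = Z t * gauge \<sigma> (ha t) x" if t: "t \<in> {0..1}" and x: "x \<in> carrier B" for t x
  proof -
    note wa = cont_matD(1)[OF Wa(1) t] and wb = cont_matD(1)[OF Wb(1) t]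
    have awb: "mat_adjoint (Wb t) \<in> carrier_mat N N" using wb by simp
    note g1 = rep_carrier[OF gauge(1)[OF \<sigma>] x] and ac = rep_carrier[OF ab(1)[OF t] x] and bc = rep_carrier[OF ab(2)[OF t] x]
    have aeq: "gauge \<sigma> (hb t) x * mat_adjoint (Wb t) = mat_adjoint (Wb t) * b t x"
      by (rule rep_adjoint_intertwiner[OF ab(2)[OF t] gauge(1)[OF \<sigma>] wb _ x]) (rule cb[OF t])
    have "gauge \<sigma> (hb t) x * Z t = (gauge \<sigma> (hb t) x * mat_adjoint (Wb t)) * (V * Wa t)"
      unfolding Z_def using assoc_mult_mat[OF g1 awb mult_carrier_mat[OF V1 wa]] by simp
    also have "\<dots> = mat_adjoint (Wb t) * (b t x * (V * Wa t))"
      unfolding aeq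
      by (rule assoc_mult_mat[OF awb bc mult_carrier_mat[OF V1 wa]])
    also have "b t x * (V * Wa t) = V * (a t x * Wa t)"
      using assoc_mult_mat[OF bc V1 wa] assoc_mult_mat[OF V1 ac wa] V(2)[OF t x] by simp
    also have "\<dots> = (V * Wa t) * gauge \<sigma> (ha t) x" unfolding ca[OF t x] using assoc_mult_mat[OF V1 wa g1] by simp
    also have "mat_adjoint (Wb t) * ((V * Wa t) * gauge \<sigma> (ha t) x) = Z t * gauge \<sigma> (ha t) x"
      unfolding Z_def using assoc_mult_mat[OF awb mult_carrier_mat[OF V1 wa] g1] by simp
    finally show ?thesis .
  qed
  have Ui: "gauge \<sigma> (hb t) x * U = U * gauge \<sigma> (ha t) x" if t: "t \<in> {0..1}" and x: "x \<in> carrier B" for t x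
    unfolding U_def by (rule gauge_inner[OF \<sigma> L h[OF t] x])
  define f where "f t = (mat_adjoint U * Z t) $$ (0, 0)" for t
  have UZ: "mat_adjoint U * Z t = f t \<cdot>\<^sub>m 1\<^sub>m N" if t: "t \<in> {0..1}" for t
  proof -
    obtain c where c: "mat_adjoint U * Z t = c \<cdot>\<^sub>m 1\<^sub>m N"
      using intertwiner_scalar[OF gauge(1)[OF \<sigma>] gauge(1)[OF \<sigma>] U cont_matD(1)[OF Zcont t] Ui[OF t] Zi[OF t]] by metis
    have "f t = c" unfolding f_def c using N1 by simp
    then show ?thesis using c by simp
  qed
  have fN: "f t ^ N = cnj (det U) * det V" if t: "t \<in> {0..1}" for t
  proof -
    note wa = cont_matD(1)[OF Wa(1) t] and wb = cont_matD(1)[OF Wb(1) t]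
    have awb: "mat_adjoint (Wb t) \<in> carrier_mat N N" using wb by simp
    have "f t ^ N = det (mat_adjoint U * Z t)" unfolding UZ[OF t] by (simp only: det_smult_one)
    also have "\<dots> = cnj (det U) * (cnj (det (Wb t)) * (det V * det (Wa t)))"
      unfolding Z_def det_mult[OF aU mult_carrier_mat[OF awb mult_carrier_mat[OF V1 wa]]] det_mult[OF awb mult_carrier_mat[OF V1 wa]] det_mult[OF V1 wa]
        det_mat_adjoint[OF U] det_mat_adjoint[OF wb] ..
    finally show ?thesis using Wa(2)[OF t] Wb(2)[OF t] by simp
  qed
  have N0: "0 < N" using N1 by simp
  have "cont_mat {0..1} N N (\<lambda>t. mat_adjoint U * Z t)" by (rule cont_mat_mult[OF cont_mat_const[OF aU] Zcont])
  then have fc: "continuous_on {0..1} f" unfolding f_def[abs_def] using N0 by (rule cont_matD(2)) (rule N0)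
  have const: "f t = f 0" if "t \<in> {0..1}" for t
    by (rule constant_of_roots[OF _ fc N0 fN that]) auto
  show ?thesis
  proof (rule that[of "f 0"])
    have "cmod (cnj (det U) * det V) = 1"
      using cmod_det_unitary[OF V(1)] cmod_det_unitary[OF rep_mono_unitary[OF \<sigma>, of z]] by (simp add: norm_mult U_def)
    then show "f 0 \<noteq> 0" using fN[of 0] N0 by (auto simp: power_0_left)
    fix t :: real assume t: "t \<in> {0..1}"
    have "Z t = (U * mat_adjoint U) * Z t" unfolding UU using cont_matD(1)[OF Zcont t] by simp
    also have "\<dots> = U * (f 0 \<cdot>\<^sub>m 1\<^sub>m N)"
      using assoc_mult_mat[OF U aU cont_matD(1)[OF Zcont t]] UZ[OF t] const[OF t] by simp
    also have "\<dots> = f 0 \<cdot>\<^sub>m U" using mult_smult_distrib[OF U one_carrier_mat, of "f 0"] U by simp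
    finally show "mat_adjoint (Wb t) * (V * Wa t) = f 0 \<cdot>\<^sub>m \<sigma> (mono z)" unfolding Z_def U_def .
  qed
qed

end

context torus_rep
begin

lemma gauge_cong:
  assumes \<sigma>: "\<sigma> \<in> Rep" and \<tau>: "\<tau> \<in> Rep" and e: "\<And>b. b \<in> carrier B ==> \<sigma> b = \<tau> b"
    and h: "\<And>j. j < n ==> h j = h' j" and b: "b \<in> carrier B"
  shows "gauge \<sigma> h b = gauge \<tau> h' b"
  by (rule rep_unique[OF gauge(1)[OF \<sigma>] gauge(1)[OF \<tau>] _ _ b])
     (simp_all add: gauge(2,3)[OF \<sigma>] gauge(2,3)[OF \<tau>] h e[OF ug_carrier] e[OF em_carrier])

text \<open>Along a curve, all continuous logarithms of the determinants differ from the lift by constants.\<close>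

lemma lift_along:
  fixes c :: "real => 't::real_normed_vector"
  assumes p: "family S p" and h: "is_lift S p h" and S: "0 \<in> S"
    and c: "continuous_on {0..1} c" "c ` {0..1} \<subseteq> S" and j: "j < n" and g: "continuous_on {0..1} g"
    and D: "\<And>t. t \<in> {0..1} ==> det (p (c t) (ug j)) = phase (real N * g t) * D" and t: "t \<in> {0..1}"
  shows "h (c t) j - h (c 0) j = g t - g 0"
proof -
  have cS: "c t \<in> S" if "t \<in> {0..1}" for t using c(2) that by blast
  have p': "family {0..1} (\<lambda>t. p (c t))" unfolding family_def
  proof (intro conjI ballI)
    fix t :: real assume "t \<in> {0..1}" then show "p (c t) \<in> Rep" by (intro familyD(1)[OF p] cS)
  next
    fix b assume b: "b \<in> carrier B"
    show "cont_mat {0..1} N N (\<lambda>t. p (c t) b)" by (rule cont_mat_compose[OF familyD(2)[OF p b] c])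
  qed
  have l: "det (p (c t) (ug j)) = phase (real N * h (c t) j) * det (p 0 (ug j))" if "t \<in> {0..1}" for t
    by (rule is_liftD(3)[OF h j cS[OF that]])
  have z: "(0::real) \<in> {0..1}" by simp
  have D0: "D = phase (real N * (h (c 0) j - g 0)) * det (p 0 (ug j))"
  proof -
    have "phase (real N * g 0) * D = phase (real N * h (c 0) j) * det (p 0 (ug j))" using D[OF z] l[OF z] by simp
    then have "phase (- (real N * g 0)) * (phase (real N * g 0) * D) = phase (- (real N * g 0)) * (phase (real N * h (c 0) j) * det (p 0 (ug j)))" by simp
    then show ?thesis unfolding mult.assoc[symmetric] phase_add[symmetric] by (simp add: right_diff_distrib)
  qed
  have "h (c 0) j - (g 0 + (h (c 0) j - g 0)) = h (c t) j - (g t + (h (c 0) j - g 0))"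
  proof (rule lift_unique_gen[OF _ p' j _ _ l _ z t])
    show "continuous_on {0..1} (\<lambda>t. h (c t) j)" by (rule continuous_on_compose2[OF is_liftD(1)[OF h j] c])
    show "continuous_on {0..1} (\<lambda>t. g t + (h (c 0) j - g 0))" by (intro continuous_intros g)
    fix t :: real assume t: "t \<in> {0..1}"
    show "det (p (c t) (ug j)) = phase (real N * (g t + (h (c 0) j - g 0))) * det (p 0 (ug j))"
      unfolding D[OF t] D0 distrib_left phase_add by simp
  qed simp
  then show ?thesis by simp
qed

end

section \<open>Transport along an isomorphism\<close>

text \<open>The base points \<open>\<sigma>\<close> and \<open>\<sigma>'\<close> of the two moduli spaces correspond to each other, which makes the
  situation symmetric in the two algebras.\<close>

locale rep_iso = X: torus_rep n \<theta> m d N + Y: torus_rep n' \<theta>' m' d' N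
  for n \<theta> m d N n' \<theta>' m' d' +
  fixes \<Phi> \<Psi> \<sigma> \<sigma>'
  assumes Phi: "\<Phi> \<in> star_hom X.B Y.B" and Psi: "\<Psi> \<in> star_hom Y.B X.B"
    and PsiPhi: "\<And>b. b \<in> carrier X.B ==> \<Psi> (\<Phi> b) = b" and PhiPsi: "\<And>b. b \<in> carrier Y.B ==> \<Phi> (\<Psi> b) = b"
    and sig: "\<sigma> \<in> X.Rep" and sig': "\<sigma>' \<in> Y.Rep" and sP: "\<And>b. b \<in> carrier X.B ==> \<sigma> b = \<sigma>' (\<Phi> b)"
begin

lemma Phi_carrier: "b \<in> carrier X.B ==> \<Phi> b \<in> carrier Y.B" by (rule star_homD(1)[OF Phi])

lemma Psi_carrier: "b \<in> carrier Y.B ==> \<Psi> b \<in> carrier X.B" by (rule star_homD(1)[OF Psi])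

lemma swap: "rep_iso n' \<theta>' m' d' N n \<theta> m d \<Psi> \<Phi> \<sigma>' \<sigma>"
proof unfold_locales
  show "\<sigma>' b = \<sigma> (\<Psi> b)" if "b \<in> carrier Y.B" for b using sP[OF Psi_carrier[OF that]] PhiPsi[OF that] by simp
qed (use Phi Psi PsiPhi PhiPsi sig sig' in auto)

text \<open>The gauge transforms of \<open>\<sigma>'\<close>, regarded as representations of the first algebra.\<close>

definition pull where "pull H = (\<lambda>b. Y.gauge \<sigma>' H (\<Phi> b))"

lemma pull_rep: "pull H \<in> X.Rep"
  unfolding pull_def by (rule star_hom_comp[OF Phi Y.gauge(1)[OF sig']])

lemma pull_cong: "(\<And>j. j < n' ==> H j = H' j) ==> b \<in> carrier X.B ==> pull H b = pull H' b"
  unfolding pull_def by (rule Y.gauge_cong[OF sig' sig']) (auto intro: Phi_carrier)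

lemma pull_zero: "(\<And>j. j < n' ==> H j = 0) ==> b \<in> carrier X.B ==> pull H b = \<sigma> b"
  unfolding pull_def using Y.gauge_zero[OF sig' Phi_carrier] sP by simp

lemma pull_family: "(\<And>j. j < n' ==> continuous_on S (\<lambda>s. H s j)) ==> X.family S (\<lambda>s. pull (H s))"
  unfolding X.family_def
proof (intro conjI ballI pull_rep)
  assume c: "\<And>j. j < n' ==> continuous_on S (\<lambda>s. H s j)"
  fix b assume "b \<in> carrier X.B"
  then show "cont_mat S N N (\<lambda>s. pull (H s) b)"
    unfolding pull_def by (intro Y.gauge_continuous[OF sig' c] Phi_carrier)
qed

lemma pull_inner:
  assumes "Lat n' \<theta>' z y" "\<And>j. j < n' ==> H' j = H j + y j" "b \<in> carrier X.B"
  shows "pull H' b * \<sigma>' (Y.mono z) = \<sigma>' (Y.mono z) * pull H b"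
  unfolding pull_def by (rule Y.gauge_inner[OF sig' assms(1,2) Phi_carrier[OF assms(3)]])

lemma pull_det:
  assumes "Lat n' \<theta>' z y" "\<And>j. j < n' ==> H' j = H j + y j" "b \<in> carrier X.B"
  shows "det (pull H' b) = det (pull H b)"
proof -
  note V = Y.rep_carrier[OF sig' Y.mono_carrier, of z] and c = X.rep_carrier[OF pull_rep assms(3)]
  have "det (\<sigma>' (Y.mono z)) \<noteq> 0" using cmod_det_unitary[OF Y.rep_mono_unitary[OF sig', of z]] by auto
  then show ?thesis using arg_cong[OF pull_inner[OF assms], of det] det_mult[OF c V] det_mult[OF V c] by simp
qed

lemma pull_equivalence:
  fixes S :: "'t::real_normed_vector set"
  assumes S: "compact S" "convex S" "0 \<in> S" and H: "\<And>j. j < n' ==> continuous_on S (\<lambda>s. H s j)" "\<And>j. j < n' ==> H 0 j = 0"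
    and h: "X.is_lift S (\<lambda>s. pull (H s)) h"
  obtains W where "cont_mat S N N W" "\<And>s. s \<in> S ==> det (W s) = 1"
    "\<And>s b. s \<in> S ==> b \<in> carrier X.B ==> pull (H s) b * W s = W s * X.gauge \<sigma> (h s) b"
proof -
  obtain W where W: "cont_mat S N N W" "\<And>s. s \<in> S ==> det (W s) = 1"
    "\<And>s b. s \<in> S ==> b \<in> carrier X.B ==> pull (H s) b * W s = W s * X.gauge (pull (H 0)) (h s) b"
    using X.family_equivalence[OF S pull_family[OF H(1)] h] by metis
  have "X.gauge (pull (H 0)) (h s) b = X.gauge \<sigma> (h s) b" if "b \<in> carrier X.B" for s b
    by (rule X.gauge_cong[OF pull_rep sig pull_zero[OF H(2)] refl that])
  then show ?thesis using that[OF W(1,2)] W(3) by simp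
qed

text \<open>Lifts are unique for indices below \<open>n\<close>, so that the choice of \<open>h\<close> does not matter there.\<close>

definition transport :: "(nat => real) => nat => real" where
  "transport y = (SOME h. X.is_lift {0..1::real} (\<lambda>t. pull (\<lambda>j. t * y j)) h) 1"

lemma transport_lift:
  obtains h where "X.is_lift {0..1::real} (\<lambda>t. pull (\<lambda>j. t * y j)) h" "h 1 = transport y"
proof -
  have "X.family {0..1::real} (\<lambda>t. pull (\<lambda>j. t * y j))" by (rule pull_family) (intro continuous_intros)
  then obtain h where "X.is_lift {0..1::real} (\<lambda>t. pull (\<lambda>j. t * y j)) h"
    using X.lift_exists[of "{0..1::real}"] by auto
  then have "X.is_lift {0..1::real} (\<lambda>t. pull (\<lambda>j. t * y j)) (SOME h. X.is_lift {0..1::real} (\<lambda>t. pull (\<lambda>j. t * y j)) h)"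
    by (rule someI[of "X.is_lift {0..1::real} (\<lambda>t. pull (\<lambda>j. t * y j))"])
  then show ?thesis by (rule that) (simp add: transport_def)
qed

text \<open>The segment from \<open>0\<close> to \<open>y\<close> may be traversed inside any larger family; the lift then starts at
  an arbitrary value.\<close>

lemma transport_curve:
  fixes c :: "real => 't::real_normed_vector"
  assumes S: "0 \<in> S" and H: "\<And>j. j < n' ==> continuous_on S (\<lambda>s. H s j)"
    and h: "X.is_lift S (\<lambda>s. pull (H s)) h" and c: "continuous_on {0..1} c" "c ` {0..1} \<subseteq> S"
    and Hc: "\<And>t j. t \<in> {0..1} ==> j < n' ==> H (c t) j = t * y j" and i: "i < n"
  shows "h (c 1) i - h (c 0) i = transport y i"
proof -
  obtain g where g: "X.is_lift {0..1::real} (\<lambda>t. pull (\<lambda>j. t * y j)) g" "g 1 = transport y" by (rule transport_lift)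
  have "h (c 1) i - h (c 0) i = g 1 i - g 0 i"
  proof (rule X.lift_along[OF pull_family[OF H] h S c i X.is_liftD(1)[OF g(1) i]])
    fix t :: real assume t: "t \<in> {0..1}"
    have "pull (H (c t)) (X.ug i) = pull (\<lambda>j. t * y j) (X.ug i)" by (rule pull_cong[OF Hc[OF t] X.ug_carrier[OF i]])
    then show "det (pull (H (c t)) (X.ug i)) = phase (real N * g t i) * det (pull (\<lambda>j. 0 * y j) (X.ug i))"
      using X.is_liftD(3)[OF g(1) i t] by simp
  qed simp_all
  then show ?thesis using g(2) X.is_liftD(2)[OF g(1) i] by simp
qed

lemma transport_cong: "(\<And>j. j < n' ==> y j = y' j) ==> i < n ==> transport y i = transport y' i"
proof -
  assume e: "\<And>j. j < n' ==> y j = y' j" and i: "i < n"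
  obtain g where g: "X.is_lift {0..1::real} (\<lambda>t. pull (\<lambda>j. t * y j)) g" "g 1 = transport y" by (rule transport_lift)
  have "g 1 i - g 0 i = transport y' i"
    by (rule transport_curve[OF _ _ g(1), where c = "\<lambda>t. t"]) (auto intro!: continuous_intros simp: e i)
  then show ?thesis using g(2) X.is_liftD(2)[OF g(1) i] by simp
qed

text \<open>At the end of the segment the pulled back representation is equivalent to \<open>\<sigma>\<close>, because the gauge
  transformation of the second algebra by \<open>y'\<close> is inner; on the other hand it is equivalent to the
  gauge transform of \<open>\<sigma>\<close> by the transported vector.\<close>

lemma transport_Lat:
  assumes L: "Lat n' \<theta>' z' y'" obtains z where "Lat n \<theta> z (transport y')"
proof -
  obtain h where h: "X.is_lift {0..1::real} (\<lambda>t. pull (\<lambda>j. t * y' j)) h" "h 1 = transport y'" by (rule transport_lift)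
  have z: "(0::real) \<in> {0..1}" and z': "0 * y' j = 0" and c: "continuous_on {0..1} (\<lambda>t. t * y' j)" for j
    by (auto intro: continuous_intros)
  obtain W where W: "cont_mat {0..1::real} N N W" "\<And>s. s \<in> {0..1} ==> det (W s) = 1"
    "\<And>s b. s \<in> {0..1} ==> b \<in> carrier X.B ==> pull (\<lambda>j. s * y' j) b * W s = W s * X.gauge \<sigma> (h s) b"
    using pull_equivalence[OF compact_Icc convex_real_interval(5) z c z' h(1)] by metis
  have o: "(1::real) \<in> {0..1}" by simp
  define V where "V = \<sigma>' (Y.mono z')"
  note w = cont_matD(1)[OF W(1) o]
  have V: "V \<in> carrier_mat N N" unfolding V_def by (rule Y.rep_carrier[OF sig' Y.mono_carrier])
  have aw: "mat_adjoint (W 1) \<in> carrier_mat N N" using w by simp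
  have dV: "det V \<noteq> 0" unfolding V_def using cmod_det_unitary[OF Y.rep_mono_unitary[OF sig', of z']] by auto
  show ?thesis
  proof (rule X.gauge_conjugate_Lat[OF sig])
    show "mat_adjoint (W 1) * V \<in> carrier_mat N N" by (rule mult_carrier_mat[OF aw V])
    show "det (mat_adjoint (W 1) * V) \<noteq> 0" using det_mult[OF aw V] det_mat_adjoint[OF w] W(2)[OF o] dV by simp
    fix b assume b: "b \<in> carrier X.B"
    let ?p = "pull (\<lambda>j. 1 * y' j)"
    note g1 = X.rep_carrier[OF X.gauge(1)[OF sig] b] and pc = X.rep_carrier[OF pull_rep b] and sc = X.rep_carrier[OF sig b]
    have i: "X.gauge \<sigma> (h 1) b * mat_adjoint (W 1) = mat_adjoint (W 1) * ?p b"
      by (rule X.rep_adjoint_intertwiner[OF pull_rep X.gauge(1)[OF sig] w W(3)[OF o] b])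
    have pV: "?p b * V = V * \<sigma> b"
      using pull_inner[OF L, of "\<lambda>j. 1 * y' j" "\<lambda>_. 0", OF _ b] pull_zero[of "\<lambda>_. 0", OF _ b] by (simp add: V_def)
    have "X.gauge \<sigma> (h 1) b * (mat_adjoint (W 1) * V) = (X.gauge \<sigma> (h 1) b * mat_adjoint (W 1)) * V"
      using assoc_mult_mat[OF g1 aw V] by simp
    also have "\<dots> = mat_adjoint (W 1) * (?p b * V)" unfolding i by (rule assoc_mult_mat[OF aw pc V])
    also have "\<dots> = (mat_adjoint (W 1) * V) * \<sigma> b" unfolding pV using assoc_mult_mat[OF aw V sc] by simp
    finally show "X.gauge \<sigma> (transport y') b * (mat_adjoint (W 1) * V) = (mat_adjoint (W 1) * V) * \<sigma> b" using h(2) by simp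
  qed (rule that)
qed

text \<open>The family of the gauge transformations by \<open>s y\<^sub>1 + t y\<^sub>2\<close>.  Its values on opposite edges of the square
  are equivalent, so they have the same determinants, and the lifts differ by constants.\<close>

lemma square:
  assumes L1: "Lat n' \<theta>' z1 y1" and L2: "Lat n' \<theta>' z2 y2"
  defines "H \<equiv> \<lambda>(s::real, t::real) j. s * y1 j + t * y2 j" and "S \<equiv> {0..1::real} \<times> {0..1::real}"
  obtains h W where "\<And>j. j < n ==> h (1, 1) j = transport (\<lambda>j. y1 j + y2 j) j"
    "\<And>t j. t \<in> {0..1} ==> j < n ==> h (1, t) j = h (0, t) j + transport y1 j"
    "\<And>t j. t \<in> {0..1} ==> j < n ==> h (t, 1) j = h (t, 0) j + transport y2 j"
    "h (0, 0) = h 0" "\<And>j. j < n ==> h 0 j = 0"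
    "cont_mat S N N W" "\<And>s. s \<in> S ==> det (W s) = 1"
    "\<And>s b. s \<in> S ==> b \<in> carrier X.B ==> pull (H s) b * W s = W s * X.gauge \<sigma> (h s) b"
proof -
  have S: "compact S" "convex S" "0 \<in> S"
    by (auto simp: S_def zero_prod_def intro!: compact_Times convex_Times)
  have Hc: "continuous_on S (\<lambda>s. H s j)" for j
    unfolding H_def case_prod_unfold by (intro continuous_intros)
  have f: "X.family S (\<lambda>s. pull (H s))" by (rule pull_family) (rule Hc)
  obtain h where h: "X.is_lift S (\<lambda>s. pull (H s)) h" using X.lift_exists[OF S(2,3) f] by metis
  obtain W where W: "cont_mat S N N W" "\<And>s. s \<in> S ==> det (W s) = 1"
    "\<And>s b. s \<in> S ==> b \<in> carrier X.B ==> pull (H s) b * W s = W s * X.gauge \<sigma> (h s) b"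
    using pull_equivalence[OF S Hc _ h] by (auto simp: H_def zero_prod_def)
  have h0: "h (0, 0) j = 0" if "j < n" for j using X.is_liftD(2)[OF h that] by (simp add: zero_prod_def)
  have e1: "h (1, 0) j = transport y1 j" and e2: "h (0, 1) j = transport y2 j" and e12: "h (1, 1) j = transport (\<lambda>j. y1 j + y2 j) j"
    if j: "j < n" for j
  proof -
    have "h (1, 0) j - h (0, 0) j = transport y1 j"
      by (rule transport_curve[OF S(3) Hc h, where c = "\<lambda>t. (t, 0)"]) (use j in "auto simp: S_def H_def distrib_left intro!: continuous_intros")
    then show "h (1, 0) j = transport y1 j" using h0[OF j] by simp
    have "h (0, 1) j - h (0, 0) j = transport y2 j"
      by (rule transport_curve[OF S(3) Hc h, where c = "\<lambda>t. (0, t)"]) (use j in "auto simp: S_def H_def distrib_left intro!: continuous_intros")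
    then show "h (0, 1) j = transport y2 j" using h0[OF j] by simp
    have "h (1, 1) j - h (0, 0) j = transport (\<lambda>j. y1 j + y2 j) j"
      by (rule transport_curve[OF S(3) Hc h, where c = "\<lambda>t. (t, t)"]) (use j in "auto simp: S_def H_def distrib_left intro!: continuous_intros")
    then show "h (1, 1) j = transport (\<lambda>j. y1 j + y2 j) j" using h0[OF j] by simp
  qed
  show ?thesis
  proof (rule that[of h W])
    fix t :: real and j assume t: "t \<in> {0..1}" and j: "j < n"
    have "h (1, t) j - h (1, 0) j = h (0, t) j - h (0, 0) j"
    proof (rule X.lift_along[OF f h S(3), of "\<lambda>t. (1, t)" j "\<lambda>t. h (0, t) j" _ t])
      show "continuous_on {0..1} (\<lambda>t. h (0, t) j)"
        by (rule continuous_on_compose2[OF X.is_liftD(1)[OF h j]]) (auto simp: S_def intro!: continuous_intros)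
      fix t :: real assume t: "t \<in> {0..1}"
      have "det (pull (H (1, t)) (X.ug j)) = det (pull (H (0, t)) (X.ug j))"
        by (rule pull_det[OF L1 _ X.ug_carrier[OF j]]) (simp add: H_def)
      then show "det (pull (H (1, t)) (X.ug j)) = phase (real N * h (0, t) j) * det (pull (H 0) (X.ug j))"
        using X.is_liftD(3)[OF h j, of "(0, t)"] t by (simp add: S_def)
    qed (use t j in "auto simp: S_def intro!: continuous_intros")
    then show "h (1, t) j = h (0, t) j + transport y1 j" using h0[OF j] e1[OF j] by simp
    have "h (t, 1) j - h (0, 1) j = h (t, 0) j - h (0, 0) j"
    proof (rule X.lift_along[OF f h S(3), of "\<lambda>t. (t, 1)" j "\<lambda>t. h (t, 0) j" _ t])
      show "continuous_on {0..1} (\<lambda>t. h (t, 0) j)"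
        by (rule continuous_on_compose2[OF X.is_liftD(1)[OF h j]]) (auto simp: S_def intro!: continuous_intros)
      fix t :: real assume t: "t \<in> {0..1}"
      have "det (pull (H (t, 1)) (X.ug j)) = det (pull (H (t, 0)) (X.ug j))"
        by (rule pull_det[OF L2 _ X.ug_carrier[OF j]]) (simp add: H_def)
      then show "det (pull (H (t, 1)) (X.ug j)) = phase (real N * h (t, 0) j) * det (pull (H 0) (X.ug j))"
        using X.is_liftD(3)[OF h j, of "(t, 0)"] t by (simp add: S_def)
    qed (use t j in "auto simp: S_def intro!: continuous_intros")
    then show "h (t, 1) j = h (t, 0) j + transport y2 j" using h0[OF j] e2[OF j] by simp
  qed (use e12 W X.is_liftD(2)[OF h] in "auto simp: zero_prod_def")
qed

lemma transport_add:
  assumes "Lat n' \<theta>' z1 y1" "Lat n' \<theta>' z2 y2" "j < n"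
  shows "transport (\<lambda>j. y1 j + y2 j) j = transport y1 j + transport y2 j"
proof (rule square[OF assms(1,2)], goal_cases)
  case (1 h W)
  from 1(1)[OF assms(3)] 1(2)[of 1 j] 1(3)[of 0 j] 1(4) 1(5)[of j] assms(3) show ?case by simp
qed

end

lemma mat_telescope:
  assumes c: "A \<in> carrier_mat N N" "V \<in> carrier_mat N N" "W \<in> carrier_mat N N" "W' \<in> carrier_mat N N" "V' \<in> carrier_mat N N" "C \<in> carrier_mat N N"
    and W: "W * W' = 1\<^sub>m N"
  shows "(A * (V * W)) * (W' * (V' * C)) = A * ((V * V') * (C :: complex mat))"
proof -
  note m = mult_carrier_mat
  have "(A * (V * W)) * (W' * (V' * C)) = A * ((V * W) * (W' * (V' * C)))"
    by (rule assoc_mult_mat[OF c(1) m[OF c(2,3)] m[OF c(4) m[OF c(5,6)]]])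
  also have "(V * W) * (W' * (V' * C)) = V * (W * (W' * (V' * C)))"
    by (rule assoc_mult_mat[OF c(2,3) m[OF c(4) m[OF c(5,6)]]])
  also have "W * (W' * (V' * C)) = (W * W') * (V' * C)"
    by (rule assoc_mult_mat[OF c(3,4) m[OF c(5,6)], symmetric])
  also have "\<dots> = V' * C" unfolding W by (rule left_mult_one_mat[OF m[OF c(5,6)]])
  also have "V * (V' * C) = (V * V') * C" by (rule assoc_mult_mat[OF c(2,5,6), symmetric])
  finally show ?thesis .
qed

section \<open>Invariance of the pairing\<close>

lemma Lat_cong: "(\<And>j. j < n ==> y j = y' j) ==> Lat n \<theta> z y \<longleftrightarrow> Lat n \<theta> z y'"
  by (simp add: Lat_def)

lemma Lat_int: "(\<And>k. k < n ==> y k \<in> \<int>) ==> Lat n \<theta> (\<lambda>_. 0) y"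
  by (simp add: Lat_def)

lemma Lat_scale:
  assumes "Lat n \<theta> z y" shows "Lat n \<theta> (\<lambda>j. c * z j) (\<lambda>j. of_int c * y j)"
  unfolding Lat_def
proof (intro allI impI)
  fix k assume "k < n"
  then have "of_int c * (y k - (\<Sum>j<n. \<theta> $$ (k, j) * of_int (z j))) \<in> \<int>" using assms by (auto simp: Lat_def)
  then show "of_int c * y k - (\<Sum>j<n. \<theta> $$ (k, j) * of_int (c * z j)) \<in> \<int>"
    by (simp add: right_diff_distrib sum_distrib_left mult_ac)
qed

lemma Lat_column: "i < n ==> Lat n \<theta> (\<lambda>j. if j = i then 1 else 0) (\<lambda>k. \<theta> $$ (k, i))"
proof -
  assume i: "i < n"
  have "(\<Sum>j<n. \<theta> $$ (k, j) * of_int (if j = i then 1 else 0)) = (\<Sum>j<n. if j = i then \<theta> $$ (k, j) else 0)" for k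
    by (intro sum.cong) auto
  then show ?thesis using i by (simp add: Lat_def)
qed

context rep_iso
begin

sublocale S: rep_iso n' \<theta>' m' d' N n \<theta> m d \<Psi> \<Phi> \<sigma>' \<sigma> by (rule swap)

text \<open>Let \<open>h\<close> be the lift of the segment from \<open>0\<close> to \<open>y'\<close>.  The straight homotopy from \<open>h\<close> to the segment from
  \<open>0\<close> to \<open>h 1\<close>, pulled back to the second algebra, fixes the end points.  Pulling back \<open>h\<close> itself
  gives representations with the determinants of the original segment.\<close>

lemma transport_inverse:
  assumes j: "j < n'" shows "S.transport (transport y') j = y' j"
proof -
  obtain h where h: "X.is_lift {0..1::real} (\<lambda>t. pull (\<lambda>j. t * y' j)) h" "h 1 = transport y'" by (rule transport_lift)
  have z: "(0::real) \<in> {0..1}" and z': "0 * y' j = 0" and c: "continuous_on {0..1} (\<lambda>t. t * y' j)" for j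
    by (auto intro: continuous_intros)
  obtain W where W: "cont_mat {0..1::real} N N W" "\<And>s. s \<in> {0..1} ==> det (W s) = 1"
    "\<And>s b. s \<in> {0..1} ==> b \<in> carrier X.B ==> pull (\<lambda>j. s * y' j) b * W s = W s * X.gauge \<sigma> (h s) b"
    using pull_equivalence[OF compact_Icc convex_real_interval(5) z c z' h(1)] by metis
  define K where "K = (\<lambda>(s::real, t::real) i. (1 - s) * h t i + s * t * transport y' i)"
  define S where "S = {0..1::real} \<times> {0..1::real}"
  have S: "compact S" "convex S" "0 \<in> S"
    by (auto simp: S_def zero_prod_def intro!: compact_Times convex_Times)
  have Kc: "continuous_on S (\<lambda>s. K s i)" if "i < n" for i
    unfolding K_def case_prod_unfold
    by (intro continuous_intros continuous_on_compose2[OF X.is_liftD(1)[OF h(1) that]]) (auto simp: S_def)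
  have f: "Y.family S (\<lambda>s. S.pull (K s))" by (rule S.pull_family) (rule Kc)
  obtain k where k: "Y.is_lift S (\<lambda>s. S.pull (K s)) k" using Y.lift_exists[OF S(2,3) f] by metis
  \<comment> \<open>The edges of the square, in the order \<open>s = 1\<close>, \<open>t = 0\<close>, \<open>t = 1\<close>, \<open>s = 0\<close>; the lift is constant along the middle two.\<close>
  have e1: "k (1, 1) j - k (1, 0) j = S.transport (transport y') j"
    by (rule S.transport_curve[OF S(3) Kc k, where c = "\<lambda>t. (1, t)"]) (use j in "auto simp: S_def K_def intro!: continuous_intros")
  have e2: "k (1, 0) j - k (0, 0) j = 0 - 0"
  proof (rule Y.lift_along[OF f k S(3), where c = "\<lambda>s. (s, 0)" and g = "\<lambda>_. 0"])
    fix s :: real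
    have "S.pull (K (s, 0)) (Y.ug j) = S.pull (\<lambda>_. 0) (Y.ug j)"
      by (rule S.pull_cong[OF _ Y.ug_carrier[OF j]]) (simp add: K_def X.is_liftD(2)[OF h(1)])
    then show "det (S.pull (K (s, 0)) (Y.ug j)) = phase (real N * 0) * det (S.pull (\<lambda>_. 0) (Y.ug j))" by simp
  qed (use j in "auto simp: S_def intro!: continuous_intros")
  have e3: "k (1, 1) j - k (0, 1) j = 0 - 0"
  proof (rule Y.lift_along[OF f k S(3), where c = "\<lambda>s. (s, 1)" and g = "\<lambda>_. 0"])
    fix s :: real
    have "S.pull (K (s, 1)) (Y.ug j) = S.pull (transport y') (Y.ug j)"
      by (rule S.pull_cong[OF _ Y.ug_carrier[OF j]]) (simp add: K_def h(2) algebra_simps)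
    then show "det (S.pull (K (s, 1)) (Y.ug j)) = phase (real N * 0) * det (S.pull (transport y') (Y.ug j))" by simp
  qed (use j in "auto simp: S_def intro!: continuous_intros")
  have e4: "k (0, 1) j - k (0, 0) j = 1 * y' j - 0 * y' j"
  proof (rule Y.lift_along[OF f k S(3), where c = "\<lambda>t. (0, t)" and g = "\<lambda>t. t * y' j"])
    fix t :: real assume t: "t \<in> {0..1}"
    let ?b = "\<Psi> (Y.ug j)"
    have b: "?b \<in> carrier X.B" by (rule Psi_carrier[OF Y.ug_carrier[OF j]])
    note Wc = cont_matD(1)[OF W(1) t]
    have "det (pull (\<lambda>j. t * y' j) ?b) = det (X.gauge \<sigma> (h t) ?b)"
      using arg_cong[OF W(3)[OF t b], of det] W(2)[OF t] det_mult[OF X.rep_carrier[OF pull_rep b] Wc]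
        det_mult[OF Wc X.rep_carrier[OF X.gauge(1)[OF sig] b]] by simp
    moreover have "S.pull (K (0, t)) (Y.ug j) = X.gauge \<sigma> (h t) ?b" by (simp add: S.pull_def K_def)
    moreover have "pull (\<lambda>j. t * y' j) ?b = Y.gauge \<sigma>' (\<lambda>j. t * y' j) (Y.ug j)"
      by (simp add: pull_def PhiPsi[OF Y.ug_carrier[OF j]])
    ultimately show "det (S.pull (K (0, t)) (Y.ug j)) = phase (real N * (t * y' j)) * det (\<sigma>' (Y.ug j))"
      using Y.det_gauge[OF sig' j, of "\<lambda>j. t * y' j"] by simp
  qed (use j in "auto simp: S_def intro!: continuous_intros")
  show ?thesis using e1 e2 e3 e4 by simp
qed

text \<open>Two ways lead along the edges of the square from the corner \<open>(0, 0)\<close> to the corner \<open>(1, 1)\<close>.  On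
  each edge, the equivalences at its end points turn the monomial of the second algebra into a scalar
  multiple of that of the first, and the scalar is the same on the opposite edge.  The scalars cancel in the comparison of the
  two ways, which is the commutator of the two monomials.\<close>

lemma pairing:
  assumes L1: "Lat n' \<theta>' z1' y1" and L2: "Lat n' \<theta>' z2' y2"
    and K1: "Lat n \<theta> z1 (transport y1)" and K2: "Lat n \<theta> z2 (transport y2)"
  shows "(\<Sum>j<n. of_int (z1 j) * transport y2 j) - (\<Sum>j<n'. of_int (z1' j) * y2 j) \<in> \<int>"
proof (rule square[OF L1 L2], goal_cases)
  case (1 h W)
  define P where "P s t = pull (\<lambda>j. s * y1 j + t * y2 j)" for s t
  define V1 where "V1 = \<sigma>' (Y.mono z1')"
  define V2 where "V2 = \<sigma>' (Y.mono z2')"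
  define Z1 where "Z1 = \<sigma> (X.mono z1)"
  define Z2 where "Z2 = \<sigma> (X.mono z2)"
  have S: "(s, t) \<in> {0..1} \<times> {0..1}" if "s \<in> {0..1}" "t \<in> {0..1}" for s t :: real using that by simp
  have z: "(0::real) \<in> {0..1}" and o: "(1::real) \<in> {0..1}" by auto
  have Wc: "W (s, t) \<in> carrier_mat N N" if "s \<in> {0..1}" "t \<in> {0..1}" for s t
    by (rule cont_matD(1)[OF 1(6) S[OF that]])
  have Wd: "det (W (s, t)) = 1" if "s \<in> {0..1}" "t \<in> {0..1}" for s t
    by (rule 1(7)[OF S[OF that]])
  have Wi: "P s t b * W (s, t) = W (s, t) * X.gauge \<sigma> (h (s, t)) b" if "s \<in> {0..1}" "t \<in> {0..1}" "b \<in> carrier X.B" for s t b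
    using 1(8)[OF S[OF that(1,2)] that(3)] by (simp add: P_def)
  have PR: "P s t \<in> X.Rep" for s t unfolding P_def by (rule pull_rep)
  have Wcont: "cont_mat {0..1} N N (\<lambda>t. W (s, t))" "cont_mat {0..1} N N (\<lambda>t. W (t, s))" if "s \<in> {0..1}" for s
    by (rule cont_mat_compose[OF 1(6)]; use that in "auto intro!: continuous_intros")+
  have V: "V1 \<in> unitaries (Mat N)" "V2 \<in> unitaries (Mat N)"
    unfolding V1_def V2_def by (rule Y.rep_mono_unitary[OF sig'])+
  have i1: "P 1 t b * V1 = V1 * P 0 t b" if "b \<in> carrier X.B" for t b
    unfolding P_def V1_def by (rule pull_inner[OF L1 _ that]) simp
  have i2: "P t 1 b * V2 = V2 * P t 0 b" if "b \<in> carrier X.B" for t b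
    unfolding P_def V2_def by (rule pull_inner[OF L2 _ that]) simp
  have "\<exists>c. c \<noteq> 0 \<and> (\<forall>t\<in>{0..1}. mat_adjoint (W (1, t)) * (V1 * W (0, t)) = c \<cdot>\<^sub>m Z1)"
    by (rule X.edge_scalar[OF sig K1 Wcont(1)[OF z] Wd[OF z] Wcont(1)[OF o] Wd[OF o] PR PR Wi[OF z] Wi[OF o] V(1) i1 1(2)])
       (auto simp: Z1_def)
  then obtain c1 where c1: "c1 \<noteq> 0" "\<And>t. t \<in> {0..1} ==> mat_adjoint (W (1, t)) * (V1 * W (0, t)) = c1 \<cdot>\<^sub>m Z1" by blast
  have "\<exists>c. c \<noteq> 0 \<and> (\<forall>t\<in>{0..1}. mat_adjoint (W (t, 1)) * (V2 * W (t, 0)) = c \<cdot>\<^sub>m Z2)"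
    by (rule X.edge_scalar[OF sig K2 Wcont(2)[OF z] Wd[OF _ z] Wcont(2)[OF o] Wd[OF _ o] PR PR Wi[OF _ z] Wi[OF _ o] V(2) i2 1(3)])
       (auto simp: Z2_def)
  then obtain c2 where c2: "c2 \<noteq> 0" "\<And>t. t \<in> {0..1} ==> mat_adjoint (W (t, 1)) * (V2 * W (t, 0)) = c2 \<cdot>\<^sub>m Z2" by blast
  have Vc: "V1 \<in> carrier_mat N N" "V2 \<in> carrier_mat N N" using V by (auto simp: unitaries_def)
  have Zc: "Z1 \<in> carrier_mat N N" "Z2 \<in> carrier_mat N N" unfolding Z1_def Z2_def by (rule X.rep_carrier[OF sig X.mono_carrier])+
  have Wu: "W (s, t) * mat_adjoint (W (s, t)) = 1\<^sub>m N" if "s \<in> {0..1}" "t \<in> {0..1}" for s t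
    by (rule X.intertwiner_unitary(2)[OF PR X.gauge(1)[OF sig] Wc[OF that] Wd[OF that] Wi[OF that]])
  have Wa: "mat_adjoint (W (s, t)) \<in> carrier_mat N N" if "s \<in> {0..1}" "t \<in> {0..1}" for s t using Wc[OF that] by simp
  let ?D = "mat_adjoint (W (1, 1))" and ?C = "W (0, 0)"
  have p1: "(c1 * c2) \<cdot>\<^sub>m (Z1 * Z2) = ?D * ((V1 * V2) * ?C)"
    using mat_telescope[OF Wa[OF o o] Vc(1) Wc[OF z o] Wa[OF z o] Vc(2) Wc[OF z z] Wu[OF z o]]
    unfolding c1(2)[OF o] c2(2)[OF z] mat_smult_mult_smult[OF Zc] .
  have p2: "(c2 * c1) \<cdot>\<^sub>m (Z2 * Z1) = ?D * ((V2 * V1) * ?C)"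
    using mat_telescope[OF Wa[OF o o] Vc(2) Wc[OF o z] Wa[OF o z] Vc(1) Wc[OF z z] Wu[OF o z]]
    unfolding c1(2)[OF z] c2(2)[OF o] mat_smult_mult_smult[OF Zc(2,1)] .
  let ?a = "- (\<Sum>j<n. of_int (z1 j) * transport y2 j)" and ?b = "- (\<Sum>j<n'. of_int (z1' j) * y2 j)"
  have q1: "Z1 * Z2 = phase ?a \<cdot>\<^sub>m (Z2 * Z1)" unfolding Z1_def Z2_def by (rule X.mono_commutator[OF sig K2])
  have q2: "V1 * V2 = phase ?b \<cdot>\<^sub>m (V2 * V1)" unfolding V1_def V2_def by (rule Y.mono_commutator[OF sig' L2])
  note VV = mult_carrier_mat[OF Vc(2,1)] and ZZ = mult_carrier_mat[OF Zc(2,1)]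
  have "?D * ((V1 * V2) * ?C) = phase ?b \<cdot>\<^sub>m (?D * ((V2 * V1) * ?C))"
    unfolding q2 mult_smult_assoc_mat[OF VV Wc[OF z z]] by (rule mult_smult_distrib[OF Wa[OF o o] mult_carrier_mat[OF VV Wc[OF z z]]])
  then have "(c1 * c2 * phase ?a) \<cdot>\<^sub>m (Z2 * Z1) = (c1 * c2 * phase ?b) \<cdot>\<^sub>m (Z2 * Z1)"
    unfolding p1[symmetric] p2[symmetric] q1 mat_smult_smult by (simp only: mult_ac)
  moreover have "det (Z2 * Z1) \<noteq> 0"
    using det_mult[OF Zc(2,1)] cmod_det_unitary[OF X.rep_mono_unitary[OF sig]] unfolding Z1_def Z2_def by (metis mult_eq_0_iff norm_zero zero_neq_one)
  ultimately have "c1 * c2 * phase ?a = c1 * c2 * phase ?b" using X.mat_smult_cancel[OF _ ZZ] by blast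
  then have "phase ?b = phase ?a" using c1(1) c2(1) by simp
  from phase_eq_diff[OF this] show ?case by simp
qed

lemma transport_scale:
  assumes L: "Lat n' \<theta>' z y" and i: "i < n" shows "transport (\<lambda>j. of_int c * y j) i = of_int c * transport y i"
proof -
  have zero: "transport (\<lambda>j. 0) i = 0" using transport_add[OF Lat_int Lat_int i, of "\<lambda>_. 0" "\<lambda>_. 0"] by simp
  have nat: "transport (\<lambda>j. of_int (int k) * y j) i = of_int (int k) * transport y i" for k
  proof (induction k)
    case (Suc k)
    show ?case using transport_add[OF Lat_scale[OF L, of "int k"] L i] Suc by (simp add: distrib_right add.commute)
  qed (simp add: zero)
  show ?thesis
  proof (cases "c \<ge> 0")
    case True then show ?thesis using nat[of "nat c"] by simp
  next
    case False
    have "transport (\<lambda>j. of_int c * y j + of_int (int (nat (- c))) * y j) i = transport (\<lambda>j. of_int c * y j) i + transport (\<lambda>j. of_int (int (nat (- c))) * y j) i"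
      by (rule transport_add[OF Lat_scale[OF L] Lat_scale[OF L] i])
    then show ?thesis using False zero nat[of "nat (- c)"] by simp
  qed
qed

definition transport_mat where "transport_mat i j = transport (\<lambda>k. if k = j then 1 else 0) i"

text \<open>The multiples by \<open>d'\<close> of vectors in the lattice are integral, and the transport is additive.\<close>

lemma transport_linear:
  assumes L: "Lat n' \<theta>' z y" and i: "i < n" shows "transport y i = (\<Sum>j<n'. transport_mat i j * y j)"
proof -
  have int: "transport (\<lambda>k. if k < l then of_int (c k) else 0) i = (\<Sum>j<l. transport_mat i j * of_int (c j))" for c l
  proof (induction l)
    case 0
    show ?case using transport_add[OF Lat_int Lat_int i, of "\<lambda>_. 0" "\<lambda>_. 0"] by simp
  next
    case (Suc l)
    have u: "Lat n' \<theta>' (\<lambda>_. 0) (\<lambda>k. if k = l then 1 else 0)" by (rule Lat_int) auto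
    have "transport (\<lambda>k. if k < Suc l then of_int (c k) else 0) i =
        transport (\<lambda>k. (if k < l then of_int (c k) else 0) + of_int (c l) * (if k = l then 1 else 0)) i"
      by (rule transport_cong[OF _ i]) (auto simp: less_Suc_eq)
    also have "\<dots> = transport (\<lambda>k. if k < l then of_int (c k) else 0) i + transport (\<lambda>k. of_int (c l) * (if k = l then 1 else 0)) i"
      by (rule transport_add[OF Lat_int Lat_scale[OF u] i]) auto
    also have "transport (\<lambda>k. of_int (c l) * (if k = l then 1 else 0)) i = of_int (c l) * transport_mat i l"
      unfolding transport_mat_def by (rule transport_scale[OF u i])
    finally show ?case using Suc by simp
  qed
  have dy: "real d' * y j \<in> \<int>" if j: "j < n'" for j
  proof -
    have "real d' * (y j - (\<Sum>k<n'. \<theta>' $$ (j, k) * of_int (z k))) + (\<Sum>k<n'. real d' * \<theta>' $$ (j, k) * of_int (z k)) \<in> \<int>"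
      by (intro Ints_add Ints_mult Ints_sum rat_skewD(2)[OF Y.rs]) (use L j in "auto simp: Lat_def")
    then show ?thesis by (simp add: right_diff_distrib sum_distrib_left mult.assoc)
  qed
  have d': "real d' \<noteq> 0" using Y.d1 by simp
  have "real d' * transport y i = transport (\<lambda>j. real d' * y j) i" using transport_scale[OF L i, of "int d'"] by simp
  also have "\<dots> = transport (\<lambda>k. if k < n' then of_int \<lfloor>real d' * y k\<rfloor> else 0) i"
    by (rule transport_cong[OF _ i]) (use dy in simp)
  also have "\<dots> = (\<Sum>j<n'. transport_mat i j * of_int \<lfloor>real d' * y j\<rfloor>)" by (rule int)
  also have "\<dots> = real d' * (\<Sum>j<n'. transport_mat i j * y j)"
    unfolding sum_distrib_left by (rule sum.cong[OF refl]) (use dy in simp)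
  finally show ?thesis using d' by simp
qed

lemma Lat_unit: "Lat k \<tau> (\<lambda>_. 0) (\<lambda>k. if k = j then 1 else 0)"
  by (rule Lat_int) auto

end

context rep_iso
begin

lemma transport_mat_inverse:
  assumes j: "j < n'" "k < n'" shows "(\<Sum>i<n. S.transport_mat j i * transport_mat i k) = (if j = k then 1 else 0)"
proof -
  obtain z where z: "Lat n \<theta> z (transport (\<lambda>l. if l = k then 1 else 0))" using transport_Lat[OF Lat_unit] by metis
  show ?thesis using S.transport_linear[OF z j(1)] transport_inverse[OF j(1), of "\<lambda>l. if l = k then 1 else 0"] by (simp add: transport_mat_def)
qed

end

context rep_iso
begin

text \<open>Compare the traces of the two products of the transport matrices.\<close>

lemma dims_equal: "n = n'"
proof -
  have "real n' = (\<Sum>j<n'. \<Sum>i<n. S.transport_mat j i * transport_mat i j)" using transport_mat_inverse by simp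
  also have "\<dots> = (\<Sum>i<n. \<Sum>j<n'. transport_mat i j * S.transport_mat j i)" by (subst sum.swap) (simp only: mult.commute)
  also have "\<dots> = real n" using S.transport_mat_inverse by simp
  finally show ?thesis by simp
qed

text \<open>The unit vector \<open>e\<^sub>j\<close> has the witness \<open>0\<close> and pairs trivially with the whole lattice.  So the witness
  \<open>z\<^sub>1\<close> of its transport pairs trivially with the columns of \<open>\<theta>\<close>; this means that \<open>\<theta> z\<^sub>1\<close> is integral, and
  hence that the transport of \<open>e\<^sub>j\<close> is.\<close>

lemma transport_mat_int:
  assumes i: "i < n" and j: "j < n'" shows "transport_mat i j \<in> \<int>"
proof -
  obtain z1 where z1: "Lat n \<theta> z1 (transport (\<lambda>l. if l = j then 1 else 0))" using transport_Lat[OF Lat_unit] by metis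
  let ?y = "\<lambda>k. \<theta> $$ (k, i)"
  note Ly = Lat_column[OF i, of \<theta>]
  obtain z' where z': "Lat n' \<theta>' z' (S.transport ?y)" using S.transport_Lat[OF Ly] by metis
  have inv: "transport (S.transport ?y) k = ?y k" if "k < n" for k by (rule S.transport_inverse[OF that])
  have K: "Lat n \<theta> (\<lambda>j. if j = i then 1 else 0) (transport (S.transport ?y))"
    by (rule iffD2[OF Lat_cong Ly]) (rule inv)
  have "(\<Sum>k<n. of_int (z1 k) * transport (S.transport ?y) k) - (\<Sum>k<n'. of_int 0 * S.transport ?y k) \<in> \<int>"
    by (rule pairing[OF Lat_unit z' z1 K])
  moreover have "(\<Sum>k<n. of_int (z1 k) * transport (S.transport ?y) k) = - (\<Sum>k<n. \<theta> $$ (i, k) * of_int (z1 k))"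
    unfolding sum_negf[symmetric]
  proof (rule sum.cong[OF refl])
    fix k assume k: "k \<in> {..<n}"
    then show "of_int (z1 k) * transport (S.transport ?y) k = - (\<theta> $$ (i, k) * of_int (z1 k))"
      using inv[of k] rat_skewD(3)[OF X.rs, of k i] i by simp
  qed
  ultimately have "(\<Sum>k<n. \<theta> $$ (i, k) * of_int (z1 k)) \<in> \<int>" using Ints_minus by fastforce
  moreover have "transport_mat i j - (\<Sum>k<n. \<theta> $$ (i, k) * of_int (z1 k)) \<in> \<int>" using z1 i by (simp add: Lat_def transport_mat_def)
  ultimately show ?thesis using Ints_add by fastforce
qed

text \<open>The \<open>i\<close>-th column of \<open>\<theta>\<close> has the witness \<open>e\<^sub>i\<close>.  Pairing it with the transports of the columns of \<open>\<theta>'\<close>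
  shows that it is transported back to \<open>\<theta>' P\<^sup>t e\<^sub>i\<close> up to integers, where \<open>P\<close> is the transport matrix.  Applying
  \<open>P\<close> gives the claim.\<close>

lemma congruence:
  assumes i: "i < n" and k: "k < n"
  shows "\<theta> $$ (k, i) - (\<Sum>l<n'. \<Sum>j<n'. transport_mat k l * \<theta>' $$ (l, j) * transport_mat i j) \<in> \<int>"
proof -
  let ?y = "\<lambda>k. \<theta> $$ (k, i)"
  note Ly = Lat_column[OF i, of \<theta>]
  obtain z' where z': "Lat n' \<theta>' z' (S.transport ?y)" using S.transport_Lat[OF Ly] by metis
  have inv: "transport (S.transport ?y) k = ?y k" if "k < n" for k by (rule S.transport_inverse[OF that])
  have K: "Lat n \<theta> (\<lambda>j. if j = i then 1 else 0) (transport (S.transport ?y))"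
    by (rule iffD2[OF Lat_cong Ly]) (rule inv)
  have A: "S.transport ?y l - (\<Sum>j<n'. \<theta>' $$ (l, j) * transport_mat i j) \<in> \<int>" if l: "l < n'" for l
  proof -
    note Lc = Lat_column[OF l, of \<theta>']
    obtain z2 where z2: "Lat n \<theta> z2 (transport (\<lambda>k. \<theta>' $$ (k, l)))" using transport_Lat[OF Lc] by metis
    have "(\<Sum>j<n. of_int (if j = i then 1 else 0) * transport (\<lambda>k. \<theta>' $$ (k, l)) j) = (\<Sum>j<n. if j = i then transport (\<lambda>k. \<theta>' $$ (k, l)) j else 0)"
      by (intro sum.cong) auto
    also have "\<dots> = (\<Sum>j<n'. transport_mat i j * \<theta>' $$ (j, l))" using i transport_linear[OF Lc i] by simp
    finally have "(\<Sum>j<n'. transport_mat i j * \<theta>' $$ (j, l)) - (\<Sum>j<n'. of_int (z' j) * \<theta>' $$ (j, l)) \<in> \<int>"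
      using pairing[OF z' Lc K z2] by simp
    moreover have "(\<Sum>j<n'. c j * \<theta>' $$ (j, l)) = - (\<Sum>j<n'. \<theta>' $$ (l, j) * c j)" for c
      unfolding sum_negf[symmetric]
    proof (rule sum.cong[OF refl])
      fix j assume "j \<in> {..<n'}"
      then show "c j * \<theta>' $$ (j, l) = - (\<theta>' $$ (l, j) * c j)" using rat_skewD(3)[OF Y.rs, of j l] l by simp
    qed
    ultimately have "(\<Sum>j<n'. \<theta>' $$ (l, j) * of_int (z' j)) - (\<Sum>j<n'. \<theta>' $$ (l, j) * transport_mat i j) \<in> \<int>" by simp
    moreover have "S.transport ?y l - (\<Sum>j<n'. \<theta>' $$ (l, j) * of_int (z' j)) \<in> \<int>" using z' l by (simp add: Lat_def)
    ultimately show ?thesis using Ints_add by fastforce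
  qed
  have "(\<Sum>l<n'. transport_mat k l * (S.transport ?y l - (\<Sum>j<n'. \<theta>' $$ (l, j) * transport_mat i j))) \<in> \<int>"
    by (intro Ints_sum Ints_mult A transport_mat_int k) auto
  moreover have "(\<Sum>l<n'. transport_mat k l * S.transport ?y l) = \<theta> $$ (k, i)" using transport_linear[OF z' k] inv[OF k] by simp
  ultimately show ?thesis by (simp add: right_diff_distrib sum_subtractf sum_distrib_left mult.assoc)
qed

end

section \<open>Isomorphic tensor products come from congruent matrices\<close>

lemma rational_skew:
  fixes \<theta> :: "rat mat"
  assumes \<theta>: "\<theta> \<in> carrier_mat n n" "skew_symmetric_mat \<theta>"
  obtains d where "rat_skew n d (real_mat_of_rat \<theta>)"
proof -
  have "\<exists>b::nat. 1 \<le> b \<and> real b * of_rat r \<in> \<int>" for r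
  proof -
    obtain p q where pq: "quotient_of r = (p, q)" by (cases "quotient_of r")
    have q: "q > 0" using pq by (rule quotient_of_denom_pos)
    have "r = of_int p / of_int q" using pq by (rule quotient_of_div)
    then have "real (nat q) * of_rat r = of_int p" using q by (simp add: of_rat_divide)
    then show ?thesis using q by (intro exI[of _ "nat q"]) auto
  qed
  then obtain b :: "rat => nat" where b: "\<And>r. 1 \<le> b r" "\<And>r. real (b r) * of_rat r \<in> \<int>" by metis
  define d where "d = (\<Prod>jk\<in>{..<n} \<times> {..<n}. b (\<theta> $$ jk))"
  show ?thesis
  proof (rule that[of d], unfold rat_skew_def, intro conjI allI impI)
    show "1 \<le> d" unfolding d_def by (rule prod_ge_1) (rule b(1))
    fix j k assume jk: "j < n" "k < n"
    have "d = b (\<theta> $$ (j, k)) * (\<Prod>jk\<in>{..<n} \<times> {..<n} - {(j, k)}. b (\<theta> $$ jk))"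
      unfolding d_def using jk by (subst prod.remove[of _ "(j, k)"]) auto
    then have "real d * of_rat (\<theta> $$ (j, k)) =
        of_nat (\<Prod>jk\<in>{..<n} \<times> {..<n} - {(j, k)}. b (\<theta> $$ jk)) * (real (b (\<theta> $$ (j, k))) * of_rat (\<theta> $$ (j, k)))"
      by (simp only: of_nat_mult mult_ac)
    also have "\<dots> \<in> \<int>" by (rule Ints_mult[OF Ints_of_nat b(2)])
    finally show "real d * real_mat_of_rat \<theta> $$ (j, k) \<in> \<int>" using \<theta>(1) jk by simp
    show "real_mat_of_rat \<theta> $$ (j, k) = - real_mat_of_rat \<theta> $$ (k, j)"
      using skew_symmetric_index[OF \<theta>(2,1) jk] \<theta>(1) jk by (simp add: of_rat_minus)
  qed
qed

lemma rat_integer: "of_rat r \<in> (\<int> :: real set) ==> \<exists>c. r = of_int c"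
  by (metis Ints_cases of_rat_eq_iff of_rat_of_int_eq)

lemma (in rep_iso) rational_congruence:
  assumes \<tau>: "\<tau> \<in> carrier_mat n n" "\<theta> = real_mat_of_rat \<tau>" and \<tau>': "\<tau>' \<in> carrier_mat n' n'" "\<theta>' = real_mat_of_rat \<tau>'"
  obtains T K where "T \<in> GL_int n" "K \<in> carrier_mat n n" "\<tau>' = rat_mat_of_int T * \<tau> * transpose_mat (rat_mat_of_int T) + rat_mat_of_int K"
proof -
  note nn = dims_equal
  define T where "T = mat n n (\<lambda>(i, j). \<lfloor>S.transport_mat i j\<rfloor>)"
  define U where "U = mat n n (\<lambda>(i, j). \<lfloor>transport_mat i j\<rfloor>)"
  have c: "T \<in> carrier_mat n n" "U \<in> carrier_mat n n" by (auto simp: T_def U_def)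
  have Ti: "S.transport_mat i j = of_int (T $$ (i, j))" if "i < n" "j < n" for i j
    using S.transport_mat_int[of i j] that nn by (simp add: T_def)
  have Ui: "transport_mat i j = of_int (U $$ (i, j))" if "i < n" "j < n" for i j
    using transport_mat_int[of i j] that nn by (simp add: U_def)
  have TU: "T * U = 1\<^sub>m n"
  proof (rule mat_eqI_index[of _ n n])
    fix i k assume ik: "i < n" "k < n"
    have "real_of_int ((T * U) $$ (i, k)) = (\<Sum>j<n. S.transport_mat i j * transport_mat j k)"
      unfolding mat_mult_index[OF c ik] using ik by (simp add: Ti Ui)
    also have "\<dots> = real_of_int (1\<^sub>m n $$ (i, k))" using transport_mat_inverse[of i k] ik nn by simp
    finally show "(T * U) $$ (i, k) = 1\<^sub>m n $$ (i, k)" by (simp only: of_int_eq_iff)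
  qed (use mult_carrier_mat[OF c] in auto)
  have UT: "U * T = 1\<^sub>m n"
  proof (rule mat_eqI_index[of _ n n])
    fix i k assume ik: "i < n" "k < n"
    have "real_of_int ((U * T) $$ (i, k)) = (\<Sum>j<n. transport_mat i j * S.transport_mat j k)"
      unfolding mat_mult_index[OF c(2,1) ik] using ik by (simp add: Ti Ui)
    also have "\<dots> = real_of_int (1\<^sub>m n $$ (i, k))" using S.transport_mat_inverse[of i k] ik nn by simp
    finally show "(U * T) $$ (i, k) = 1\<^sub>m n $$ (i, k)" by (simp only: of_int_eq_iff)
  qed (use mult_carrier_mat[OF c(2,1)] in auto)
  have T: "T \<in> GL_int n" unfolding GL_int_def invertible_mat_def inverts_mat_def
    using c TU UT by (auto simp: square_mat.simps intro!: exI[of _ U])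
  have "\<exists>x. \<tau>' $$ ki = (rat_mat_of_int T * \<tau> * transpose_mat (rat_mat_of_int T)) $$ ki + rat_of_int x" if ki: "ki \<in> {..<n} \<times> {..<n}" for ki
  proof -
    obtain k i where ki': "ki = (k, i)" "k < n" "i < n" using ki by auto
    have rc: "rat_mat_of_int T \<in> carrier_mat n n" using c by simp
    have p: "(rat_mat_of_int T * \<tau> * transpose_mat (rat_mat_of_int T)) $$ ki = (\<Sum>l<n. \<Sum>j<n. of_int (T $$ (k, l)) * \<tau> $$ (l, j) * of_int (T $$ (i, j)))"
      unfolding ki'(1) triple_product_index[OF rc \<tau>(1) ki'(2,3)] using c ki' by (intro sum.cong refl) auto
    have th: "\<theta> $$ (l, j) = of_rat (\<tau> $$ (l, j))" if "l < n" "j < n" for l j using \<tau> that by simp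
    have th': "\<theta>' $$ (k, i) = of_rat (\<tau>' $$ (k, i))" using \<tau>' ki' nn by simp
    have "of_rat (\<tau>' $$ ki - (\<Sum>l<n. \<Sum>j<n. of_int (T $$ (k, l)) * \<tau> $$ (l, j) * of_int (T $$ (i, j)))) =
        \<theta>' $$ (k, i) - (\<Sum>l<n. \<Sum>j<n. S.transport_mat k l * \<theta> $$ (l, j) * S.transport_mat i j)"
      unfolding of_rat_diff of_rat_sum of_rat_mult of_rat_of_int_eq th' ki'(1)
      by (intro arg_cong2[where f = "(-)"] sum.cong refl) (use ki' th in "simp_all add: Ti")
    also have "\<dots> \<in> \<int>" using S.congruence[of i k] ki' nn by simp
    finally obtain x where "\<tau>' $$ ki - (\<Sum>l<n. \<Sum>j<n. of_int (T $$ (k, l)) * \<tau> $$ (l, j) * of_int (T $$ (i, j))) = of_int x"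
      using rat_integer by blast
    then show ?thesis unfolding p by (intro exI[of _ x]) (simp add: algebra_simps)
  qed
  then obtain x where x: "\<And>ki. ki \<in> {..<n} \<times> {..<n} ==>
      \<tau>' $$ ki = (rat_mat_of_int T * \<tau> * transpose_mat (rat_mat_of_int T)) $$ ki + rat_of_int (x ki)" by metis
  show ?thesis
  proof (rule that[OF T])
    show "mat n n x \<in> carrier_mat n n" by simp
    show "\<tau>' = rat_mat_of_int T * \<tau> * transpose_mat (rat_mat_of_int T) + rat_mat_of_int (mat n n x)"
      by (rule eq_matI) (use x \<tau>' nn c in auto)
  qed
qed

text \<open>Isomorphic algebras have the same least dimension of representations, which provides base points for
  the transport.\<close>

lemma tensor_iso_congruence:
  fixes \<theta> \<theta>' :: "rat mat"
  assumes m: "m \<ge> 1" "m' \<ge> 1"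
    and \<theta>: "\<theta> \<in> carrier_mat n n" "skew_symmetric_mat \<theta>" and \<theta>': "\<theta>' \<in> carrier_mat n' n'" "skew_symmetric_mat \<theta>'"
    and iso: "nc_torus n (real_mat_of_rat \<theta>) \<otimes>\<^sub>* Mat m \<cong>\<^sub>* nc_torus n' (real_mat_of_rat \<theta>') \<otimes>\<^sub>* Mat m'"
  shows "n = n' \<and> m = m' \<and>
    (\<exists>T\<in>GL_int n. \<exists>K\<in>carrier_mat n n. \<theta>' = rat_mat_of_int T * \<theta> * transpose_mat (rat_mat_of_int T) + rat_mat_of_int K)"
proof -
  interpret X: torus_matrix n "real_mat_of_rat \<theta>" m .
  interpret Y: torus_matrix n' "real_mat_of_rat \<theta>'" m' .
  obtain d where d: "rat_skew n d (real_mat_of_rat \<theta>)" using rational_skew[OF \<theta>] by blast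
  obtain d' where d': "rat_skew n' d' (real_mat_of_rat \<theta>')" using rational_skew[OF \<theta>'] by blast
  obtain q N where q: "min_rep_dim X.A q" and N: "min_rep_dim X.B N" using X.min_dims_exist[OF m(1) d] by blast
  obtain q' N' where q': "min_rep_dim Y.A q'" and N': "min_rep_dim Y.B N'" using Y.min_dims_exist[OF m(2) d'] by blast
  have NN: "min_rep_dim Y.B N" by (rule min_rep_dim_iso[OF X.star_alg_B iso N])
  obtain \<Phi> where \<Phi>: "\<Phi> \<in> star_iso X.B Y.B" using iso unfolding cstar_isomorphic_def by blast
  obtain \<Psi> where \<Psi>: "\<Psi> \<in> star_iso Y.B X.B" "\<And>x. x \<in> carrier X.B ==> \<Psi> (\<Phi> x) = x" "\<And>y. y \<in> carrier Y.B ==> \<Phi> (\<Psi> y) = y"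
    using star_iso_inverse[OF X.star_alg_B \<Phi>] by blast
  have hom: "\<Phi> \<in> star_hom X.B Y.B" "\<Psi> \<in> star_hom Y.B X.B" using \<Phi> \<Psi>(1) by (auto simp: star_iso_iff)
  obtain \<sigma>' where \<sigma>': "\<sigma>' \<in> star_hom Y.B (Mat N)" using NN unfolding min_rep_dim_def by blast
  interpret rep_iso n "real_mat_of_rat \<theta>" m d N n' "real_mat_of_rat \<theta>'" m' d' \<Phi> \<Psi> "\<lambda>b. \<sigma>' (\<Phi> b)" \<sigma>'
    by unfold_locales (use d d' m N NN hom \<Psi> \<sigma>' star_hom_comp[OF hom(1) \<sigma>'] in auto)
  obtain T K where TK: "T \<in> GL_int n" "K \<in> carrier_mat n n" "\<theta>' = rat_mat_of_int T * \<theta> * transpose_mat (rat_mat_of_int T) + rat_mat_of_int K"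
    using rational_congruence[OF \<theta>(1) refl \<theta>'(1) refl] by metis
  have "X.A \<cong>\<^sub>* Y.A"
    using torus_iso_congruent[OF \<theta> _ \<theta>'(2) TK] \<theta>'(1) dims_equal by simp
  then have "q = q'" using min_rep_dim_unique[OF min_rep_dim_iso[OF star_alg_torus _ q] q'] by blast
  moreover have "m * q = m' * q'"
    using X.min_dim_product[OF m(1) q N] Y.min_dim_product[OF m(2) q' NN] by simp
  moreover have "q \<ge> 1" using q by (simp add: min_rep_dim_def)
  ultimately show ?thesis using dims_equal TK by auto
qed

theorem theorem0p2:
  fixes m m' n n' :: nat and \<theta> \<theta>' :: "rat mat"
  assumes "m \<ge> 1" "m' \<ge> 1" "n \<ge> 1" "n' \<ge> 1"
    and "\<theta> \<in> carrier_mat n n" "skew_symmetric_mat \<theta>"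
    and "\<theta>' \<in> carrier_mat n' n'" "skew_symmetric_mat \<theta>'"
  defines "a \<equiv> nc_torus n (real_mat_of_rat \<theta>) \<otimes>\<^sub>* matrix_star_algebra m
      \<cong>\<^sub>* nc_torus n' (real_mat_of_rat \<theta>') \<otimes>\<^sub>* matrix_star_algebra m'"
    and "b \<equiv> n = n' \<and> m = m' \<and>
      nc_torus n (real_mat_of_rat \<theta>) \<cong>\<^sub>* nc_torus n (real_mat_of_rat \<theta>')"
    and "c \<equiv> n = n' \<and> m = m' \<and>
      \<theta>' \<in> {rat_mat_of_int T * \<theta> * transpose_mat (rat_mat_of_int T) + rat_mat_of_int K |T K.
        T \<in> GL_int n \<and> K \<in> carrier_mat n n}"
  shows "(a \<longleftrightarrow> b) \<and> (b \<longleftrightarrow> c)"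
proof -
  have ac: c if a
    using tensor_iso_congruence[OF assms(1,2,5-8) that[unfolded a_def]] unfolding c_def by blast
  have cb: b if hc: c
  proof -
    have nm: "n = n'" "m = m'" using hc by (auto simp: c_def)
    obtain T K where TK: "T \<in> GL_int n" "K \<in> carrier_mat n n"
      "\<theta>' = rat_mat_of_int T * \<theta> * transpose_mat (rat_mat_of_int T) + rat_mat_of_int K"
      using hc unfolding c_def by blast
    show b unfolding b_def using nm torus_iso_congruent[OF assms(5,6) assms(7)[folded nm(1)] assms(8) TK] by blast
  qed
  have ba: a if b
    using that tensor_cong[OF star_alg_torus star_alg_torus star_alg_matrix] unfolding a_def b_def by auto
  show ?thesis using ac cb ba by blast
qed

end
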